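(* Assume that $\lambda_0\in\mathfrak h^*$ is $J$-regular. Then for any $f,g\in F[0]^{K_{\lambda_0}}$ we have $$\overrightarrow{J(\lambda)}(f\otimes g)\to\overrightarrow{J^{\mathrm{red}}(\lambda_0)}(f\otimes g)\quad\text{as }\lambda\to\lambda_0.$$
   Context: Let $\Bbbk$ be the field obtained from $\mathbb C(q)$ by adjoining all fractional powers $q^{1/n}$, $n\in\mathbb N=\{1,2,3,\dots\}$. Let $(a_{ij})$ be an $r\times r$ Cartan matrix of finite type with realization $(\mathfrak h,\Pi,\Pi^\vee)$ over $\mathbb Q$: $\Pi=\{\alpha_1,\dots,\alpha_r\}\subset\mathfrak h^*$ are the simple roots, $\Pi^\vee=\{\alpha_1^\vee,\dots,\alpha_r^\vee\}\subset\mathfrak h$ the simple coroots, $a_{ij}=\langle\alpha_j,\alpha_i^\vee\rangle$; $u_1,\dots,u_r\in\mathfrak h$ are the simple coweights, $\langle\alpha_i,u_j\rangle=\delta_{ij}$. $\mathbf R_+$ is the set of positive roots, $\rho$ their half sum. Let $(\cdot|\cdot)$ be the invariant scalar product on $\mathfrak h^*$ with $(\alpha|\alpha)=2$ for short roots, $d_i=(\alpha_i|\alpha_i)/2$ (so $d_ia_{ij}=d_ja_{ji}$), $[k]_i=\frac{q^{kd_i}-q^{-kd_i}}{q^{d_i}-q^{-d_i}}$, $[k]_i!=[1]_i\cdots[k]_i$. Let $Q_+=\sum_i\mathbb Z_{\ge0}\alpha_i$. $U=\check U_q\mathfrak g$ is the $\Bbbk$-algebra generated by $t_i^{\pm1},e_i,f_i$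 ($1\le i\le r$) with the $t_i$ commuting and: $t_ie_jt_i^{-1}=q^{d_i\delta_{ij}}e_j$, $t_if_jt_i^{-1}=q^{-d_i\delta_{ij}}f_j$, $e_if_j-f_je_i=\delta_{ij}\frac{k_i-k_i^{-1}}{q^{d_i}-q^{-d_i}}$ with $k_i=\prod_jt_j^{a_{ji}}$, and for $i\ne j$ the Serre relations $\sum_{m=0}^{1-a_{ij}}\frac{(-1)^m}{[m]_i!\,[1-a_{ij}-m]_i!}e_i^me_je_i^{1-a_{ij}-m}=0$ and the same with $f$ in place of $e$. It is a Hopf algebra: $\Delta(t_i)=t_i\otimes t_i$, $\Delta(e_i)=e_i\otimes1+k_i\otimes e_i$, $\Delta(f_i)=f_i\otimes k_i^{-1}+1\otimes f_i$; $\varepsilon(t_i)=1$, $\varepsilon(e_i)=\varepsilon(f_i)=0$; antipode $\sigma(t_i)=t_i^{-1}$, $\sigma(e_i)=-k_i^{-1}e_i$, $\sigma(f_i)=-f_ik_i$. $U^0,U^+,U^-$ are the subalgebras generated by the $t_i^{\pm1}$, the $e_i$, the $f_i$; $U=U^-U^0U^+$. $T$ is the group generated by the $t_i$. $\theta$ is the involutive algebra automorphism with $\theta(e_i)=-f_i$, $\theta(f_i)=-e_i$, $\theta(t_i)=t_i^{-1}$, and $\omega=\sigma\theta$. Each $\lambda\in\mathfrak h^*$ defines the character $q^\lambda:U^0\to\Bbbk$, $t_i\mapsto q^{d_i\langle\lambda,u_i\rangle}$. For a $U$-module $V$, $V[\mu]=\{v: tv=q^\mu(t)v\ \forall t\in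 T\}$; $U^-[-\beta]$ is the span of $y\in U^-$ with $tyt^{-1}=q^{-\beta}(t)y$. $M(\lambda)$ is the Verma module with highest weight vector $\mathbf 1_\lambda$, free over $U^-$ on $\mathbf 1_\lambda$. With $U^\pm_+=\ker\varepsilon|_{U^\pm}$, let $x\mapsto(x)_0$ be the projection $U\to U^0$ along $U^-_+U+UU^+_+$. Put $\pi_\lambda(x\otimes y)=q^\lambda((\sigma(x)y)_0)$ for $x\in U^+$, $y\in U^-$, and $\mathbb S_\lambda(x\otimes y)=q^\lambda((\omega(x)y)_0)$ for $x,y\in U^-$ (Shapovalov form). $K_\lambda=\{y\in U^-:\pi_\lambda(x\otimes y)=0\ \forall x\in U^+\}$ (the kernel of $\mathbb S_\lambda$), $\widetilde K_\lambda=\{x\in U^+:\pi_\lambda(x\otimes y)=0\ \forall y\in U^-\}=\theta(K_\lambda)$. $L(\lambda)=M(\lambda)/K_\lambda\mathbf 1_\lambda$ is the irreducible module of highest weight $\lambda$; $\overline{\mathbf 1}_\lambda$ is the image of $\mathbf 1_\lambda$. $\overline{\mathbb S}_\lambda$ is the nondegenerate form on $L(\lambda)$ induced by $\mathbb S_\lambda$, $\overline{\mathbb S}_\lambda^\beta$ its restriction to $L(\lambda)[\lambda-\beta]$. $F=\Bbbk[G]_q$ is the quantized algebra of regular functions on the connected simply connected group $G$ with Cartan matrix $(a_{ij})$: the Hopf subalgebra of the dual Hopf algebra of $U$ spanned by matrix elements of the finite-dimensional modules $L(\mu)$, $\mu$ dominant integral. Left regular action: $(\overrightarrow{a}f)(x)=f(xa)$.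 $F[0]$ is the zero weight space for it, and $F[0]^{K}$ is the set of $f\in F[0]$ with $\overrightarrow{a}f=0$ for all $a\in K$. For $J$ in a completion of $U^-\otimes U^+$, $\overrightarrow{J}$ denotes its action on $F\otimes F$ by the left regular action in each factor. Reduced fusion element: $J^{\mathrm{red}}(\lambda)=\sum_{\beta\in Q_+}\sum_{i,j}(\overline{\mathbb S}^\beta_\lambda)^{-1}_{ij}\,y_\beta^i\otimes\theta(y_\beta^j)$, where $y_\beta^i\in U^-[-\beta]$ are such that the $y_\beta^i\overline{\mathbf 1}_\lambda$ form a basis of $L(\lambda)[\lambda-\beta]$ and $(\overline{\mathbb S}_\lambda^\beta)_{ij}=\overline{\mathbb S}_\lambda(y^i_\beta\overline{\mathbf 1}_\lambda,y^j_\beta\overline{\mathbf 1}_\lambda)$; the choice is immaterial for the claim. $\lambda\in\mathfrak h^*$ is generic if $\langle\lambda+\rho,\beta^\vee\rangle\notin\mathbb N$ for all $\beta\in\mathbf R_+$; then $L(\lambda)=M(\lambda)$ and one sets $J(\lambda)=J^{\mathrm{red}}(\lambda)$, i.e. $J(\lambda)=\sum_{\beta}\sum_{i,j}(\mathbb S_\lambda^\beta)^{-1}_{ij}\,y_\beta^i\otimes\theta(y_\beta^j)$ for bases $y_\beta^i$ of $U^-[-\beta]$. The coefficients are the values at $q^\lambda$ of elements of $\operatorname{Frac}(U^0)$ (rational functions in the $t_i$). $\lambda_0\in\mathfrak h^*$ is $J$-regular if for every $U^-$-module $M$ the family of operators $J(\lambda)^M:M\otimes F[0]^{\widetilde K_{\lambda_0}}\to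 M\otimes F$, $m\otimes f\mapsto\sum_{\beta,i,j}(\mathbb S^\beta_\lambda)^{-1}_{ij}\,y_\beta^im\otimes\overrightarrow{\theta(y_\beta^j)}f$ (a finite sum for given $f$), is regular at $\lambda=\lambda_0$, i.e. each $J(\lambda)^M(m\otimes f)$, as a rational function of $q^\lambda$ with values in $M\otimes F$, has no pole at $q^{\lambda_0}$ (its coefficients can be taken in the localization of $U^0$ at $\ker q^{\lambda_0}$). Equivalently, for every $U^+$-module $N$ the family $J(\lambda)_N:F[0]^{K_{\lambda_0}}\otimes N\to F\otimes N$ defined analogously is regular at $\lambda_0$. A statement "$A(\lambda)\to B$ as $\lambda\to\lambda_0$" means that $A(\lambda)$ ($\lambda$ generic), as a rational function of $q^\lambda$, has no pole at $q^{\lambda_0}$ and its value there is $B$. *)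

theory Defs
  imports
    Complex_Main
    "HOL-Library.Poly_Mapping"
    "HOL-Library.Function_Algebras"
    "HOL-Library.Groups_Big_Fun"
    "HOL-Computational_Algebra.Fraction_Field"
    "Jordan_Normal_Form.Gauss_Jordan_Elimination"
begin

section \<open>The ground field\<close>

text \<open>\<open>rat \<Rightarrow>\<^sub>0 complex\<close> is the group algebra of the additive group of rationals, that is, the
  union over all \<open>n\<close> of the Laurent polynomial rings in \<open>q\<close> to the power \<open>1/n\<close>.  Its fraction
  field is obtained from the rational functions in \<open>q\<close> by adjoining all fractional powers of \<open>q\<close>;
  \<open>qpow a\<close> is \<open>q\<close> to the power \<open>a\<close>.\<close>

type_synonym qfield = "(rat \<Rightarrow>\<^sub>0 complex) fract"

definition qpow :: "rat \<Rightarrow> qfield"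
  where "qpow a = Fraction_Field.Fract (Poly_Mapping.single a 1) 1"


section \<open>Cartan matrices of finite type and root data\<close>

text \<open>A Cartan matrix of finite type is nonsingular, so the simple roots form a basis of the dual
  Cartan space and the simple coweights form the dual basis of the Cartan space.  Weights are
  written in coordinates with respect to simple roots (so coordinate \<open>i\<close> of \<open>\<nu>\<close> is its value
  on the \<open>i\<close>-th simple coweight), elements of the Cartan space in coordinates with respect to
  simple coweights.\<close>

definition simple_root :: "'i \<Rightarrow> 'i \<Rightarrow> rat"
  where "simple_root i = (\<lambda>j. of_bool (j = i))"

definition simple_coweight :: "'i \<Rightarrow> 'i \<Rightarrow> rat"
  where "simple_coweight i = (\<lambda>j. of_bool (j = i))"

definition pairing :: "('i \<Rightarrow> rat) \<Rightarrow> ('i \<Rightarrow> rat) \<Rightarrow> rat"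
  where "pairing \<nu> h = (\<Sum>i\<in>UNIV. \<nu> i * h i)"

text \<open>The coroot \<open>i\<close> is determined by its values \<open>A i j\<close> on the simple roots \<open>j\<close>.\<close>

definition simple_coroot :: "('i \<Rightarrow> 'i \<Rightarrow> int) \<Rightarrow> 'i \<Rightarrow> 'i \<Rightarrow> rat"
  where "simple_coroot A i = (\<lambda>j. of_int (A i j))"

definition reflection :: "('i \<Rightarrow> 'i \<Rightarrow> int) \<Rightarrow> 'i \<Rightarrow> ('i \<Rightarrow> rat) \<Rightarrow> 'i \<Rightarrow> rat"
  where "reflection A i \<nu> = (\<lambda>j. \<nu> j - pairing \<nu> (simple_coroot A i) * simple_root i j)"

inductive_set roots :: "('i \<Rightarrow> 'i \<Rightarrow> int) \<Rightarrow> ('i \<Rightarrow> rat) set" for A where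
  "simple_root i \<in> roots A"
| "\<beta> \<in> roots A \<Longrightarrow> reflection A i \<beta> \<in> roots A"

text \<open>The bilinear form with \<open>(\<alpha>\<^sub>i | \<alpha>\<^sub>j) = d i * A i j\<close>.  It is invariant under the Weyl group when
  \<open>d\<close> symmetrizes \<open>A\<close>, and then \<open>d i\<close> is half the square length of the \<open>i\<close>-th simple root.\<close>

definition root_form ::
    "('i \<Rightarrow> 'i \<Rightarrow> int) \<Rightarrow> ('i \<Rightarrow> rat) \<Rightarrow> ('i \<Rightarrow> rat) \<Rightarrow> ('i \<Rightarrow> rat) \<Rightarrow> rat"
  where "root_form A d \<nu> \<mu> = (\<Sum>i\<in>UNIV. \<Sum>j\<in>UNIV. \<nu> i * \<mu> j * (d i * of_int (A i j)))"

text \<open>The matrix may be decomposable; a root is short if it has minimal length in its irreducible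
  component, and components are the classes generated by non-orthogonality.\<close>

definition non_orthogonal :: "('i \<Rightarrow> 'i \<Rightarrow> int) \<Rightarrow> ('i \<Rightarrow> rat) \<Rightarrow> (('i \<Rightarrow> rat) \<times> ('i \<Rightarrow> rat)) set"
  where "non_orthogonal A d = {(\<alpha>, \<beta>). \<alpha> \<in> roots A \<and> \<beta> \<in> roots A \<and> root_form A d \<alpha> \<beta> \<noteq> 0}"

definition short_root :: "('i \<Rightarrow> 'i \<Rightarrow> int) \<Rightarrow> ('i \<Rightarrow> rat) \<Rightarrow> ('i \<Rightarrow> rat) \<Rightarrow> bool"
  where "short_root A d \<alpha> \<longleftrightarrow> \<alpha> \<in> roots A \<and>
    (\<forall>\<beta>. (\<alpha>, \<beta>) \<in> (non_orthogonal A d)\<^sup>* \<longrightarrow> root_form A d \<alpha> \<alpha> \<le> root_form A d \<beta> \<beta>)"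

text \<open>\<open>A\<close> is a Cartan matrix of finite type, and \<open>d\<close> is its (unique) symmetrizer for which the
  form takes the value 2 on short roots.\<close>

definition finite_cartan :: "('i \<Rightarrow> 'i \<Rightarrow> int) \<Rightarrow> ('i \<Rightarrow> rat) \<Rightarrow> bool"
  where "finite_cartan A d \<longleftrightarrow>
    (\<forall>i. A i i = 2) \<and>
    (\<forall>i j. i \<noteq> j \<longrightarrow> A i j \<le> 0) \<and>
    (\<forall>i j. A i j = 0 \<longleftrightarrow> A j i = 0) \<and>
    (\<forall>i j. d i * of_int (A i j) = d j * of_int (A j i)) \<and>
    (\<forall>\<nu>. \<nu> \<noteq> (\<lambda>i. 0) \<longrightarrow> root_form A d \<nu> \<nu> > 0) \<and>
    (\<forall>\<alpha>. short_root A d \<alpha> \<longrightarrow> root_form A d \<alpha> \<alpha> = 2)"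

text \<open>The Cartan matrix is attached to its index type, so that the quantized enveloping algebra
  can be a type depending on the index type.  The linear order plays the role of the numbering of
  the simple roots; it only fixes an order of factors in products of commuting elements.\<close>

class cartan_datum = finite + linorder +
  fixes cartan :: "'a \<Rightarrow> 'a \<Rightarrow> int" and symm :: "'a \<Rightarrow> rat"
  assumes finite_cartan: "finite_cartan cartan symm"

definition positive_roots :: "('i::cartan_datum \<Rightarrow> rat) set"
  where "positive_roots = {\<beta> \<in> roots cartan. \<forall>i. 0 \<le> \<beta> i}"

definition half_sum :: "'i::cartan_datum \<Rightarrow> rat"  (\<open>\<rho>\<close>)
  where "\<rho> = (\<lambda>i. (\<Sum>\<beta>\<in>positive_roots. \<beta> i) / 2)"

text \<open>The element \<open>2 \<beta> / (\<beta> | \<beta>)\<close> of the dual Cartan space, moved to the Cartan space by the form.\<close>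

definition coroot :: "('i::cartan_datum \<Rightarrow> rat) \<Rightarrow> 'i \<Rightarrow> rat"
  where "coroot \<beta> = (\<lambda>j. 2 * root_form cartan symm (simple_root j) \<beta> / root_form cartan symm \<beta> \<beta>)"

definition generic :: "('i::cartan_datum \<Rightarrow> rat) \<Rightarrow> bool"
  where "generic \<nu> \<longleftrightarrow> (\<forall>\<beta>\<in>positive_roots. \<forall>n::nat. n \<ge> 1 \<longrightarrow> pairing (\<nu> + \<rho>) (coroot \<beta>) \<noteq> of_nat n)"

definition dominant_integral :: "('i::cartan_datum \<Rightarrow> rat) \<Rightarrow> bool"
  where "dominant_integral \<mu> \<longleftrightarrow> (\<forall>i. pairing \<mu> (simple_coroot cartan i) \<in> \<nat>)"

definition Qplus :: "('i \<Rightarrow> rat) set"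
  where "Qplus = {\<beta>. \<forall>i. \<beta> i \<in> \<nat>}"

definition qint :: "'i::cartan_datum \<Rightarrow> nat \<Rightarrow> qfield"
  where "qint i k = (qpow (of_nat k * symm i) - qpow (- (of_nat k * symm i))) /
                    (qpow (symm i) - qpow (- symm i))"

definition qfactorial :: "'i::cartan_datum \<Rightarrow> nat \<Rightarrow> qfield"
  where "qfactorial i k = (\<Prod>m\<in>{1..k}. qint i m)"


section \<open>The quantized enveloping algebra\<close>

datatype 'i gen = GenT 'i | GenTinv 'i | GenE 'i | GenF 'i

datatype 'a monoword = Word (letters: "'a list")

instantiation monoword :: (type) monoid_add
begin

definition zero_monoword :: "'a monoword"
  where "zero_monoword = Word []"

definition plus_monoword :: "'a monoword \<Rightarrow> 'a monoword \<Rightarrow> 'a monoword"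
  where "plus_monoword v w = Word (letters v @ letters w)"

instance
  by standard (simp_all add: zero_monoword_def plus_monoword_def)

end

text \<open>Addition of words is concatenation, so this is the free associative algebra.\<close>

type_synonym 'i falg = "'i gen monoword \<Rightarrow>\<^sub>0 qfield"

definition fscalar :: "qfield \<Rightarrow> 'i falg"
  where "fscalar c = Poly_Mapping.single 0 c"

definition fgen :: "'i gen \<Rightarrow> 'i falg"
  where "fgen g = Poly_Mapping.single (Word [g]) 1"

text \<open>Integer power of \<open>x\<close>, with \<open>x'\<close> standing for the inverse of \<open>x\<close>.\<close>

definition ipow :: "'b::monoid_mult \<Rightarrow> 'b \<Rightarrow> int \<Rightarrow> 'b"
  where "ipow x x' n = (if 0 \<le> n then x ^ nat n else x' ^ nat (- n))"

text \<open>\<open>kpow t t' i s\<close> is the \<open>s\<close>-th power of the product over \<open>j\<close> of \<open>t j\<close> to the power \<open>a\<^sub>j\<^sub>i\<close>.\<close>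

definition kpow :: "('i::cartan_datum \<Rightarrow> 'b::monoid_mult) \<Rightarrow> ('i \<Rightarrow> 'b) \<Rightarrow> 'i \<Rightarrow> int \<Rightarrow> 'b"
  where "kpow t t' i s =
    prod_list (map (\<lambda>j. ipow (t j) (t' j) (s * cartan j i)) (sorted_list_of_set UNIV))"

definition serre :: "('i::cartan_datum \<Rightarrow> 'i falg) \<Rightarrow> 'i \<Rightarrow> 'i \<Rightarrow> 'i falg"
  where "serre x i j = (let N = nat (1 - cartan i j) in
    \<Sum>m\<in>{0..N}. fscalar ((- 1) ^ m / (qfactorial i m * qfactorial i (N - m))) *
                (x i ^ m * x j * x i ^ (N - m)))"

abbreviation fT :: "'i \<Rightarrow> 'i falg" where "fT i \<equiv> fgen (GenT i)"
abbreviation fTinv :: "'i \<Rightarrow> 'i falg" where "fTinv i \<equiv> fgen (GenTinv i)"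
abbreviation fE :: "'i \<Rightarrow> 'i falg" where "fE i \<equiv> fgen (GenE i)"
abbreviation fF :: "'i \<Rightarrow> 'i falg" where "fF i \<equiv> fgen (GenF i)"

inductive_set relators :: "'i::cartan_datum falg set" where
  "fT i * fTinv i - 1 \<in> relators"
| "fTinv i * fT i - 1 \<in> relators"
| "fT i * fT j - fT j * fT i \<in> relators"
| "fT i * fE j * fTinv i - fscalar (qpow (symm i * of_bool (i = j))) * fE j \<in> relators"
| "fT i * fF j * fTinv i - fscalar (qpow (- (symm i * of_bool (i = j)))) * fF j \<in> relators"
| "fE i * fF j - fF j * fE i -
     fscalar (of_bool (i = j) / (qpow (symm i) - qpow (- symm i))) *
       (kpow fT fTinv i 1 - kpow fT fTinv i (- 1)) \<in> relators"
| "i \<noteq> j \<Longrightarrow> serre fE i j \<in> relators"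
| "i \<noteq> j \<Longrightarrow> serre fF i j \<in> relators"

inductive_set relation_ideal :: "'i::cartan_datum falg set" where
  zero: "0 \<in> relation_ideal"
| relator: "p \<in> relators \<Longrightarrow> p \<in> relation_ideal"
| add: "p \<in> relation_ideal \<Longrightarrow> p' \<in> relation_ideal \<Longrightarrow> p + p' \<in> relation_ideal"
| mult_left: "p \<in> relation_ideal \<Longrightarrow> x * p \<in> relation_ideal"
| mult_right: "p \<in> relation_ideal \<Longrightarrow> p * x \<in> relation_ideal"

lemma relation_ideal_uminus: "p \<in> relation_ideal \<Longrightarrow> - p \<in> relation_ideal"
  using relation_ideal.mult_left[of p "- 1"] by simp

lemma relation_ideal_diff:
  "p \<in> relation_ideal \<Longrightarrow> p' \<in> relation_ideal \<Longrightarrow> p - p' \<in> relation_ideal"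
  using relation_ideal.add[OF _ relation_ideal_uminus] by fastforce

lemma fscalar_comm: "fscalar c * p = p * fscalar c"
proof (induction p rule: Poly_Mapping.update_induct)
  case const
  then show ?case by simp
next
  case (update f a b)
  have "Poly_Mapping.update a b f = f + Poly_Mapping.single a b"
    using update(1)
    by (intro poly_mapping_eqI)
      (simp add: Poly_Mapping.update.rep_eq lookup_add lookup_single when_def not_in_keys_iff_lookup_eq_zero)
  moreover have "fscalar c * Poly_Mapping.single a b = Poly_Mapping.single a b * fscalar c"
    by (simp add: fscalar_def mult_single mult.commute)
  ultimately show ?case
    using update(3) by (simp add: distrib_left distrib_right)
qed

quotient_type (overloaded) 'i uq = "'i::cartan_datum falg" / "\<lambda>p p'. p - p' \<in> relation_ideal"
  morphisms rep_uq abs_uq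
proof (rule equivpI)
  show "reflp (\<lambda>p p'. p - p' \<in> (relation_ideal :: 'i falg set))"
    by (simp add: reflp_def relation_ideal.zero)
  show "symp (\<lambda>p p'. p - p' \<in> (relation_ideal :: 'i falg set))"
    unfolding symp_def using relation_ideal_uminus by fastforce
  show "transp (\<lambda>p p'. p - p' \<in> (relation_ideal :: 'i falg set))"
    unfolding transp_def using relation_ideal.add by fastforce
qed

instantiation uq :: (cartan_datum) "{ring, monoid_mult}"
begin

lift_definition zero_uq :: "'a uq" is 0 .

lift_definition one_uq :: "'a uq" is 1 .

lift_definition plus_uq :: "'a uq \<Rightarrow> 'a uq \<Rightarrow> 'a uq" is "(+)"
  using relation_ideal.add by (fastforce simp: algebra_simps)

lift_definition uminus_uq :: "'a uq \<Rightarrow> 'a uq" is uminus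
  using relation_ideal_uminus by fastforce

lift_definition minus_uq :: "'a uq \<Rightarrow> 'a uq \<Rightarrow> 'a uq" is "(-)"
  using relation_ideal_diff by (fastforce simp: algebra_simps)

lift_definition times_uq :: "'a uq \<Rightarrow> 'a uq \<Rightarrow> 'a uq" is "(*)"
proof -
  fix p p' r r' :: "'a falg"
  assume "p - p' \<in> relation_ideal" "r - r' \<in> relation_ideal"
  then have "(p - p') * r + p' * (r - r') \<in> relation_ideal"
    by (intro relation_ideal.add relation_ideal.mult_left relation_ideal.mult_right)
  then show "p * r - p' * r' \<in> relation_ideal"
    by (simp add: algebra_simps)
qed

instance
proof
  fix a b c :: "'a uq"
  show "a + b + c = a + (b + c)"
    by transfer (simp add: algebra_simps relation_ideal.zero)
  show "a + b = b + a"
    by transfer (simp add: algebra_simps relation_ideal.zero)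
  show "0 + a = a"
    by transfer (simp add: relation_ideal.zero)
  show "- a + a = 0"
    by transfer (simp add: relation_ideal.zero)
  show "a - b = a + - b"
    by transfer (simp add: relation_ideal.zero)
  show "a * b * c = a * (b * c)"
    by transfer (simp add: mult.assoc relation_ideal.zero)
  show "1 * a = a"
    by transfer (simp add: relation_ideal.zero)
  show "a * 1 = a"
    by transfer (simp add: relation_ideal.zero)
  show "(a + b) * c = a * c + b * c"
    by transfer (simp add: algebra_simps relation_ideal.zero)
  show "a * (b + c) = a * b + a * c"
    by transfer (simp add: algebra_simps relation_ideal.zero)
qed

end

lift_definition uscale :: "qfield \<Rightarrow> 'i::cartan_datum uq \<Rightarrow> 'i uq" is "\<lambda>c p. fscalar c * p"
  using relation_ideal.mult_left by (fastforce simp: right_diff_distrib[symmetric])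

lemma vector_space_uscale: "vector_space (uscale :: qfield \<Rightarrow> 'i::cartan_datum uq \<Rightarrow> 'i uq)"
proof
  fix a b :: qfield and x y :: "'i uq"
  show "uscale a (x + y) = uscale a x + uscale a y"
    by transfer (simp add: algebra_simps relation_ideal.zero)
  show "uscale (a + b) x = uscale a x + uscale b x"
    by transfer (simp add: fscalar_def single_add algebra_simps relation_ideal.zero)
  show "uscale a (uscale b x) = uscale (a * b) x"
    by transfer (simp add: fscalar_def mult.assoc[symmetric] mult_single relation_ideal.zero)
  show "uscale 1 x = x"
    by transfer (simp add: fscalar_def relation_ideal.zero)
qed

lemma uscale_mult_left: "uscale c x * y = uscale c (x * y)"
  by transfer (simp add: mult.assoc relation_ideal.zero)

lemma uscale_mult_right: "x * uscale c y = uscale c (x * y)"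
proof transfer
  fix x y :: "'a falg" and c
  have "x * (fscalar c * y) = fscalar c * (x * y)"
    by (metis fscalar_comm mult.assoc)
  then show "x * (fscalar c * y) - fscalar c * (x * y) \<in> relation_ideal"
    by (simp add: relation_ideal.zero)
qed

lift_definition uT :: "'i::cartan_datum \<Rightarrow> 'i uq" is fT .
lift_definition uTinv :: "'i::cartan_datum \<Rightarrow> 'i uq" is fTinv .
lift_definition uE :: "'i::cartan_datum \<Rightarrow> 'i uq" is fE .
lift_definition uF :: "'i::cartan_datum \<Rightarrow> 'i uq" is fF .

definition uK :: "'i::cartan_datum \<Rightarrow> 'i uq" where "uK i = kpow uT uTinv i 1"
definition uKinv :: "'i::cartan_datum \<Rightarrow> 'i uq" where "uKinv i = kpow uT uTinv i (- 1)"

definition subalgebra :: "'i::cartan_datum uq set \<Rightarrow> bool"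
  where "subalgebra A \<longleftrightarrow> module.subspace uscale A \<and> 1 \<in> A \<and> (\<forall>x\<in>A. \<forall>y\<in>A. x * y \<in> A)"

definition Uzero :: "'i::cartan_datum uq set" where "Uzero = subalgebra hull (range uT \<union> range uTinv)"
definition Uplus :: "'i::cartan_datum uq set" where "Uplus = subalgebra hull (range uE)"
definition Uminus :: "'i::cartan_datum uq set" where "Uminus = subalgebra hull (range uF)"

inductive_set torus :: "'i::cartan_datum uq set" where
  "1 \<in> torus"
| "x \<in> torus \<Longrightarrow> uT i * x \<in> torus"
| "x \<in> torus \<Longrightarrow> uTinv i * x \<in> torus"

text \<open>Algebra maps are specified by their values on generators.\<close>

definition counit :: "'i::cartan_datum uq \<Rightarrow> qfield"
  where "counit = (THE \<phi>. (\<forall>x y. \<phi> (x + y) = \<phi> x + \<phi> y) \<and> (\<forall>c x. \<phi> (uscale c x) = c * \<phi> x) \<and>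
    \<phi> 1 = 1 \<and> (\<forall>x y. \<phi> (x * y) = \<phi> x * \<phi> y) \<and>
    (\<forall>i. \<phi> (uT i) = 1 \<and> \<phi> (uE i) = 0 \<and> \<phi> (uF i) = 0))"

definition antipode :: "'i::cartan_datum uq \<Rightarrow> 'i uq"
  where "antipode = (THE \<phi>. (\<forall>x y. \<phi> (x + y) = \<phi> x + \<phi> y) \<and> (\<forall>c x. \<phi> (uscale c x) = uscale c (\<phi> x)) \<and>
    \<phi> 1 = 1 \<and> (\<forall>x y. \<phi> (x * y) = \<phi> y * \<phi> x) \<and>
    (\<forall>i. \<phi> (uT i) = uTinv i \<and> \<phi> (uE i) = - (uKinv i * uE i) \<and> \<phi> (uF i) = - (uF i * uK i)))"

definition theta :: "'i::cartan_datum uq \<Rightarrow> 'i uq"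
  where "theta = (THE \<phi>. (\<forall>x y. \<phi> (x + y) = \<phi> x + \<phi> y) \<and> (\<forall>c x. \<phi> (uscale c x) = uscale c (\<phi> x)) \<and>
    \<phi> 1 = 1 \<and> (\<forall>x y. \<phi> (x * y) = \<phi> x * \<phi> y) \<and>
    (\<forall>i. \<phi> (uT i) = uTinv i \<and> \<phi> (uE i) = - uF i \<and> \<phi> (uF i) = - uE i))"

definition omega :: "'i::cartan_datum uq \<Rightarrow> 'i uq"
  where "omega = antipode \<circ> theta"

text \<open>The character \<open>q\<^sup>\<nu>\<close> of \<open>Uzero\<close>, extended by 0 to a function on the whole algebra.\<close>

definition qchar :: "('i::cartan_datum \<Rightarrow> rat) \<Rightarrow> 'i uq \<Rightarrow> qfield"
  where "qchar \<nu> = (THE \<chi>. (\<forall>x. x \<notin> Uzero \<longrightarrow> \<chi> x = 0) \<and>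
    (\<forall>x\<in>Uzero. \<forall>y\<in>Uzero. \<chi> (x + y) = \<chi> x + \<chi> y \<and> \<chi> (x * y) = \<chi> x * \<chi> y) \<and>
    (\<forall>c. \<forall>x\<in>Uzero. \<chi> (uscale c x) = c * \<chi> x) \<and> \<chi> 1 = 1 \<and>
    (\<forall>i. \<chi> (uT i) = qpow (symm i * pairing \<nu> (simple_coweight i))))"

text \<open>The weight space of \<open>Uminus\<close> of weight \<open>-\<beta>\<close>.\<close>

definition Uminus_weight :: "('i::cartan_datum \<Rightarrow> rat) \<Rightarrow> 'i uq set"
  where "Uminus_weight \<beta> = {y \<in> Uminus. \<forall>t\<in>torus. \<forall>t'\<in>torus. t * t' = 1 \<longrightarrow>
    t * y * t' = uscale (qchar (- \<beta>) t) y}"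

definition proj0 :: "'i::cartan_datum uq \<Rightarrow> 'i uq"
  where "proj0 x = (THE z. z \<in> Uzero \<and> x - z \<in> module.span uscale
    ({y * u | y u. y \<in> Uminus \<and> counit y = 0} \<union> {u * y | u y. y \<in> Uplus \<and> counit y = 0}))"

definition pi_pairing :: "('i::cartan_datum \<Rightarrow> rat) \<Rightarrow> 'i uq \<Rightarrow> 'i uq \<Rightarrow> qfield"
  where "pi_pairing \<nu> x y = qchar \<nu> (proj0 (antipode x * y))"

definition shapovalov :: "('i::cartan_datum \<Rightarrow> rat) \<Rightarrow> 'i uq \<Rightarrow> 'i uq \<Rightarrow> qfield"
  where "shapovalov \<nu> x y = qchar \<nu> (proj0 (omega x * y))"

definition Kminus :: "('i::cartan_datum \<Rightarrow> rat) \<Rightarrow> 'i uq set"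
  where "Kminus \<nu> = {y \<in> Uminus. \<forall>x\<in>Uplus. pi_pairing \<nu> x y = 0}"

definition Kplus :: "('i::cartan_datum \<Rightarrow> rat) \<Rightarrow> 'i uq set"
  where "Kplus \<nu> = {x \<in> Uplus. \<forall>y\<in>Uminus. pi_pairing \<nu> x y = 0}"


section \<open>Modules with explicit carrier\<close>

record ('u, 'v) umodule =
  mcarrier :: "'v set"
  madd :: "'v \<Rightarrow> 'v \<Rightarrow> 'v"
  mzero :: 'v
  mscale :: "qfield \<Rightarrow> 'v \<Rightarrow> 'v"
  mact :: "'u \<Rightarrow> 'v \<Rightarrow> 'v"

definition regular_module :: "('i::cartan_datum uq, 'i uq) umodule"
  where "regular_module =
    \<lparr>mcarrier = UNIV, madd = (+), mzero = 0, mscale = uscale, mact = (*)\<rparr>"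

definition mcoset :: "('u, 'v) umodule \<Rightarrow> 'v set \<Rightarrow> 'v \<Rightarrow> 'v set"
  where "mcoset V N v = {madd V v n | n. n \<in> N}"

definition quotient_module :: "('u, 'v) umodule \<Rightarrow> 'v set \<Rightarrow> ('u, 'v set) umodule"
  where "quotient_module V N =
    \<lparr>mcarrier = mcoset V N ` mcarrier V,
     madd = (\<lambda>X Y. {madd V x y | x y. x \<in> X \<and> y \<in> Y}),
     mzero = N,
     mscale = (\<lambda>c X. \<Union>x\<in>X. mcoset V N (mscale V c x)),
     mact = (\<lambda>a X. \<Union>x\<in>X. mcoset V N (mact V a x))\<rparr>"

definition weight_space ::
    "('i::cartan_datum uq, 'v) umodule \<Rightarrow> ('i \<Rightarrow> rat) \<Rightarrow> 'v set"
  where "weight_space V \<mu> = {v \<in> mcarrier V. \<forall>t\<in>torus. mact V t v = mscale V (qchar \<mu> t) v}"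

definition lincomb :: "('u, 'v) umodule \<Rightarrow> qfield list \<Rightarrow> 'v list \<Rightarrow> 'v"
  where "lincomb V cs vs = foldr (\<lambda>(c, v) s. madd V (mscale V c v) s) (zip cs vs) (mzero V)"

definition ordered_basis :: "('u, 'v) umodule \<Rightarrow> 'v set \<Rightarrow> 'v list \<Rightarrow> bool"
  where "ordered_basis V W vs \<longleftrightarrow> set vs \<subseteq> W \<and>
    (\<forall>w\<in>W. \<exists>!cs. length cs = length vs \<and> w = lincomb V cs vs)"

definition linear_functional :: "('u, 'v) umodule \<Rightarrow> ('v \<Rightarrow> qfield) \<Rightarrow> bool"
  where "linear_functional V \<xi> \<longleftrightarrow>
    (\<forall>v\<in>mcarrier V. \<forall>w\<in>mcarrier V. \<xi> (madd V v w) = \<xi> v + \<xi> w) \<and>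
    (\<forall>c. \<forall>v\<in>mcarrier V. \<xi> (mscale V c v) = c * \<xi> v)"

definition matrix_element :: "('u, 'v) umodule \<Rightarrow> ('v \<Rightarrow> qfield) \<Rightarrow> 'v \<Rightarrow> 'u \<Rightarrow> qfield"
  where "matrix_element V \<xi> v = (\<lambda>x. \<xi> (mact V x v))"

text \<open>The Verma module is induced from the character of the nonnegative part, that is, it is the
  quotient of the algebra by the following left ideal.\<close>

definition verma_ideal :: "('i::cartan_datum \<Rightarrow> rat) \<Rightarrow> 'i uq set"
  where "verma_ideal \<nu> = module.span uscale
    ({u * uE i | u i. True} \<union> {u * (uT i - uscale (qchar \<nu> (uT i)) 1) | u i. True})"

definition verma :: "('i::cartan_datum \<Rightarrow> rat) \<Rightarrow> ('i uq, 'i uq set) umodule"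
  where "verma \<nu> = quotient_module regular_module (verma_ideal \<nu>)"

definition verma_vec :: "('i::cartan_datum \<Rightarrow> rat) \<Rightarrow> 'i uq set"
  where "verma_vec \<nu> = mcoset regular_module (verma_ideal \<nu>) 1"

definition verma_kernel :: "('i::cartan_datum \<Rightarrow> rat) \<Rightarrow> 'i uq set set"
  where "verma_kernel \<nu> = (\<lambda>y. mact (verma \<nu>) y (verma_vec \<nu>)) ` Kminus \<nu>"

definition irr :: "('i::cartan_datum \<Rightarrow> rat) \<Rightarrow> ('i uq, 'i uq set set) umodule"
  where "irr \<nu> = quotient_module (verma \<nu>) (verma_kernel \<nu>)"

definition irr_vec :: "('i::cartan_datum \<Rightarrow> rat) \<Rightarrow> 'i uq set set"
  where "irr_vec \<nu> = mcoset (verma \<nu>) (verma_kernel \<nu>) (verma_vec \<nu>)"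

text \<open>The form on the irreducible module induced by the Shapovalov form.\<close>

definition shapovalov_bar ::
    "('i::cartan_datum \<Rightarrow> rat) \<Rightarrow> 'i uq set set \<Rightarrow> 'i uq set set \<Rightarrow> qfield"
  where "shapovalov_bar \<nu> v w = (THE c. \<exists>x\<in>Uminus. \<exists>y\<in>Uminus.
    v = mact (irr \<nu>) x (irr_vec \<nu>) \<and> w = mact (irr \<nu>) y (irr_vec \<nu>) \<and> c = shapovalov \<nu> x y)"


section \<open>Quantized regular functions\<close>

definition pscale :: "(qfield \<Rightarrow> 'b \<Rightarrow> 'b) \<Rightarrow> qfield \<Rightarrow> ('x \<Rightarrow> 'b) \<Rightarrow> 'x \<Rightarrow> 'b"
  where "pscale sc c \<phi> = (\<lambda>x. sc c (\<phi> x))"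

abbreviation fscale :: "qfield \<Rightarrow> ('x \<Rightarrow> qfield) \<Rightarrow> 'x \<Rightarrow> qfield"
  where "fscale \<equiv> pscale (*)"

definition Freg :: "('i::cartan_datum uq \<Rightarrow> qfield) set"
  where "Freg = module.span fscale {matrix_element (irr \<mu>) \<xi> v | \<mu> \<xi> v.
    dominant_integral \<mu> \<and> linear_functional (irr \<mu>) \<xi> \<and> v \<in> mcarrier (irr \<mu>)}"

definition left_reg :: "'i::cartan_datum uq \<Rightarrow> ('i uq \<Rightarrow> qfield) \<Rightarrow> 'i uq \<Rightarrow> qfield"
  where "left_reg a f = (\<lambda>x. f (x * a))"

definition Fmodule :: "('i::cartan_datum uq, 'i uq \<Rightarrow> qfield) umodule"
  where "Fmodule =
    \<lparr>mcarrier = Freg, madd = (+), mzero = 0, mscale = fscale, mact = left_reg\<rparr>"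

text \<open>\<open>F0 K\<close> is the set of \<open>K\<close>-invariants in the zero weight space.\<close>

definition F0 :: "'i::cartan_datum uq set \<Rightarrow> ('i uq \<Rightarrow> qfield) set"
  where "F0 K = {f \<in> weight_space Fmodule 0. \<forall>a\<in>K. left_reg a f = 0}"

text \<open>Since elements of \<open>Freg\<close> are functions, a tensor product of a vector space \<open>M\<close> with \<open>Freg\<close> is
  the space of functions to \<open>M\<close> spanned by the functions \<open>x \<mapsto> f x \<cdot> m\<close>, and the tensor square of
  \<open>Freg\<close> is spanned by the functions \<open>(x, y) \<mapsto> f x \<cdot> g y\<close>.\<close>

definition tensorM :: "(qfield \<Rightarrow> 'm \<Rightarrow> 'm) \<Rightarrow> 'm \<Rightarrow> ('x \<Rightarrow> qfield) \<Rightarrow> 'x \<Rightarrow> 'm"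
  where "tensorM sc m f = (\<lambda>x. sc (f x) m)"

definition M_tensor_F ::
    "(qfield \<Rightarrow> 'm \<Rightarrow> 'm) \<Rightarrow> 'm set \<Rightarrow> ('i::cartan_datum uq \<Rightarrow> 'm::ab_group_add) set"
  where "M_tensor_F sc W = module.span (pscale sc) {tensorM sc m f | m f. m \<in> W \<and> f \<in> Freg}"

definition tensorF :: "('x \<Rightarrow> qfield) \<Rightarrow> ('y \<Rightarrow> qfield) \<Rightarrow> 'x \<times> 'y \<Rightarrow> qfield"
  where "tensorF f g = (\<lambda>(x, y). f x * g y)"

definition F_tensor_F :: "('i::cartan_datum uq \<times> 'i uq \<Rightarrow> qfield) set"
  where "F_tensor_F = module.span fscale {tensorF f g | f g. f \<in> Freg \<and> g \<in> Freg}"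


section \<open>Fusion elements and regularity\<close>

text \<open>\<open>Y \<beta>\<close> lists the chosen elements of weight \<open>-\<beta>\<close>.\<close>

definition gram :: "('b \<Rightarrow> 'b \<Rightarrow> qfield) \<Rightarrow> 'b list \<Rightarrow> qfield mat"
  where "gram S ys = mat (length ys) (length ys) (\<lambda>(i, j). S (ys ! i) (ys ! j))"

text \<open>The infinite sum over \<open>\<beta>\<close>, \<open>i\<close>, \<open>j\<close> of the inverse Gram matrix entries times
  \<open>y\<^sub>i \<otimes> \<theta> y\<^sub>j\<close>, applied through a bilinear map \<open>B\<close> for which only finitely many \<open>\<beta>\<close> contribute.\<close>

definition fusion_apply ::
    "(qfield \<Rightarrow> 'w \<Rightarrow> 'w) \<Rightarrow> ('i::cartan_datum uq \<Rightarrow> 'i uq \<Rightarrow> qfield) \<Rightarrow>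
     (('i \<Rightarrow> rat) \<Rightarrow> 'i uq list) \<Rightarrow> ('i uq \<Rightarrow> 'i uq \<Rightarrow> 'w) \<Rightarrow> 'w::comm_monoid_add"
  where "fusion_apply sc S Y B = Sum_any (\<lambda>\<beta>. if \<beta> \<in> Qplus then
    (\<Sum>i<length (Y \<beta>). \<Sum>j<length (Y \<beta>).
      sc (the (mat_inverse (gram S (Y \<beta>))) $$ (i, j)) (B (Y \<beta> ! i) (theta (Y \<beta> ! j)))) else 0)"

definition basis_family :: "(('i::cartan_datum \<Rightarrow> rat) \<Rightarrow> 'i uq list) \<Rightarrow> bool"
  where "basis_family Y \<longleftrightarrow>
    (\<forall>\<beta>\<in>Qplus. ordered_basis regular_module (Uminus_weight \<beta>) (Y \<beta>))"

definition reduced_family ::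
    "('i::cartan_datum \<Rightarrow> rat) \<Rightarrow> (('i \<Rightarrow> rat) \<Rightarrow> 'i uq list) \<Rightarrow> bool"
  where "reduced_family \<nu> Y \<longleftrightarrow> (\<forall>\<beta>\<in>Qplus. set (Y \<beta>) \<subseteq> Uminus_weight \<beta> \<and>
    ordered_basis (irr \<nu>) (weight_space (irr \<nu>) (\<nu> - \<beta>))
      (map (\<lambda>y. mact (irr \<nu>) y (irr_vec \<nu>)) (Y \<beta>)))"

text \<open>The actions of \<open>J(\<nu>)\<close> (for generic \<open>\<nu>\<close>, computed from a basis family) and of the reduced
  fusion element (computed from a reduced family).\<close>

definition J_FF ::
    "(('i::cartan_datum \<Rightarrow> rat) \<Rightarrow> 'i uq list) \<Rightarrow> ('i \<Rightarrow> rat) \<Rightarrow>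
     ('i uq \<Rightarrow> qfield) \<Rightarrow> ('i uq \<Rightarrow> qfield) \<Rightarrow> 'i uq \<times> 'i uq \<Rightarrow> qfield"
  where "J_FF Y \<nu> f g = fusion_apply fscale (shapovalov \<nu>) Y
    (\<lambda>a b. tensorF (left_reg a f) (left_reg b g))"

definition Jred_FF ::
    "(('i::cartan_datum \<Rightarrow> rat) \<Rightarrow> 'i uq list) \<Rightarrow> ('i \<Rightarrow> rat) \<Rightarrow>
     ('i uq \<Rightarrow> qfield) \<Rightarrow> ('i uq \<Rightarrow> qfield) \<Rightarrow> 'i uq \<times> 'i uq \<Rightarrow> qfield"
  where "Jred_FF Y \<nu> f g = fusion_apply fscale
    (\<lambda>x y. shapovalov_bar \<nu> (mact (irr \<nu>) x (irr_vec \<nu>)) (mact (irr \<nu>) y (irr_vec \<nu>))) Y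
    (\<lambda>a b. tensorF (left_reg a f) (left_reg b g))"

definition J_M ::
    "(qfield \<Rightarrow> 'm \<Rightarrow> 'm) \<Rightarrow> ('i::cartan_datum uq \<Rightarrow> 'm \<Rightarrow> 'm) \<Rightarrow>
     (('i \<Rightarrow> rat) \<Rightarrow> 'i uq list) \<Rightarrow> ('i \<Rightarrow> rat) \<Rightarrow>
     'm \<Rightarrow> ('i uq \<Rightarrow> qfield) \<Rightarrow> 'i uq \<Rightarrow> 'm::ab_group_add"
  where "J_M sc ac Y \<nu> m f = fusion_apply (pscale sc) (shapovalov \<nu>) Y
    (\<lambda>a b. tensorM sc (ac a m) (left_reg b f))"

text \<open>\<open>A \<nu>\<close>, for generic \<open>\<nu>\<close>, is a rational function of \<open>q\<^sup>\<nu>\<close> with values in the vector space \<open>V\<close>,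
  namely the value at \<open>q\<^sup>\<nu>\<close> of the sum of the \<open>c k / D \<cdot> v k\<close>, whose common denominator \<open>D\<close> does
  not vanish at \<open>q\<close> to the power \<open>\<nu>0\<close>; its value there is \<open>B\<close>.  Denominators are cleared.\<close>

definition tends_to ::
    "(qfield \<Rightarrow> 'w \<Rightarrow> 'w) \<Rightarrow> 'w set \<Rightarrow> (('i::cartan_datum \<Rightarrow> rat) \<Rightarrow> 'w) \<Rightarrow> ('i \<Rightarrow> rat) \<Rightarrow>
     'w::ab_group_add \<Rightarrow> bool"
  where "tends_to sc V A \<nu>0 B \<longleftrightarrow>
    (\<exists>(n::nat) c v. \<exists>D\<in>Uzero. (\<forall>k<n. c k \<in> Uzero \<and> v k \<in> V) \<and> qchar \<nu>0 D \<noteq> 0 \<and>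
      (\<forall>\<nu>. generic \<nu> \<longrightarrow> sc (qchar \<nu> D) (A \<nu>) = (\<Sum>k<n. sc (qchar \<nu> (c k)) (v k))) \<and>
      sc (qchar \<nu>0 D) B = (\<Sum>k<n. sc (qchar \<nu>0 (c k)) (v k)))"

definition regular_at ::
    "(qfield \<Rightarrow> 'w \<Rightarrow> 'w) \<Rightarrow> 'w set \<Rightarrow> (('i::cartan_datum \<Rightarrow> rat) \<Rightarrow> 'w::ab_group_add) \<Rightarrow>
     ('i \<Rightarrow> rat) \<Rightarrow> bool"
  where "regular_at sc V A \<nu>0 \<longleftrightarrow> (\<exists>B. tends_to sc V A \<nu>0 B)"

definition Uminus_module ::
    "(qfield \<Rightarrow> 'm \<Rightarrow> 'm) \<Rightarrow> 'm::ab_group_add set \<Rightarrow> ('i::cartan_datum uq \<Rightarrow> 'm \<Rightarrow> 'm) \<Rightarrow> bool"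
  where "Uminus_module sc W ac \<longleftrightarrow> module.subspace sc W \<and>
    (\<forall>a\<in>Uminus. \<forall>m\<in>W. ac a m \<in> W) \<and>
    (\<forall>a\<in>Uminus. \<forall>m\<in>W. \<forall>m'\<in>W. ac a (m + m') = ac a m + ac a m') \<and>
    (\<forall>a\<in>Uminus. \<forall>b\<in>Uminus. \<forall>m\<in>W. ac (a + b) m = ac a m + ac b m \<and> ac (a * b) m = ac a (ac b m)) \<and>
    (\<forall>c. \<forall>a\<in>Uminus. \<forall>m\<in>W. ac (uscale c a) m = sc c (ac a m) \<and> ac a (sc c m) = sc c (ac a m)) \<and>
    (\<forall>m\<in>W. ac 1 m = m)"

text \<open>The modules range over all \<open>Uminus\<close>-module structures on subspaces of the space of functions
  from the algebra to the field.  Up to isomorphism these are all modules of dimension at most that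
  of the function space; in particular all cyclic modules (\<open>Uminus\<close> has countable dimension) occur,
  and regularity on \<open>m \<otimes> f\<close> only concerns the cyclic submodule generated by \<open>m\<close>.\<close>

definition J_regular ::
    "(('i::cartan_datum \<Rightarrow> rat) \<Rightarrow> 'i uq list) \<Rightarrow> ('i \<Rightarrow> rat) \<Rightarrow> bool"
  where "J_regular Y \<nu>0 \<longleftrightarrow>
    (\<forall>(W :: ('i uq \<Rightarrow> qfield) set) ac. Uminus_module fscale W ac \<longrightarrow>
      (\<forall>m\<in>W. \<forall>f\<in>F0 (Kplus \<nu>0).
        regular_at (pscale fscale) (M_tensor_F fscale W) (\<lambda>\<nu>. J_M fscale ac Y \<nu> m f) \<nu>0))"

end

theory Submission
  imports Defs "Jordan_Normal_Form.Determinant" "HOL-Computational_Algebra.Polynomial"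
begin

text \<open>For \<open>p\<close> in the negative part consider the Shapovalov equations
  \<open>S\<^sub>\<lambda>(p, M) = f(z p)\<close> in the unknown \<open>M\<close>.  Regularity, applied to the negative part as a module over
  itself, yields a solution \<open>M(\<lambda>)\<close> without pole along a line of weights through \<open>\<lambda>\<^sub>0\<close> that are
  generic near infinity, and \<open>J(\<lambda>)(f \<otimes> g)\<close> is obtained by evaluating \<open>g\<close> at \<open>\<theta>(M(\<lambda>))\<close>.  At
  \<open>\<lambda>\<^sub>0\<close> the equations determine \<open>M\<close> only up to the kernel \<open>K\<close> of the Shapovalov form, so the limit
  is given by the reduced fusion element as soon as \<open>g\<close> is also invariant under \<open>\<theta>(K)\<close>.

  This invariance is where the Jantzen filtration along the line enters.  If \<open>g\<close> were not
  \<open>\<theta>(K)\<close>-invariant, the Shapovalov equations twisted by \<open>\<theta>\<close> would only be solvable with a pole of some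
  order \<open>i > 0\<close>.  Multiplying a family in the \<open>j\<close>-th layer of the filtration by such a solution
  gives a family in layer \<open>i + j\<close>, nonzero at \<open>\<lambda>\<^sub>0\<close> because the negative part has no zero divisors;
  starting from \<open>1\<close> one reaches arbitrarily deep layers.  But a nonzero layer contains a singular vector,
  whose weight is one of finitely many, so the layers vanish from some point on.\<close>

section \<open>Powers of \<open>q\<close>\<close>

text \<open>Orders of poles are awkward for rational functions of several variables. On a line of
  weights with integral direction everything becomes a Laurent polynomial in \<open>q^s\<close>, and
  the order of vanishing at the base point is a number. Layers add because of the coproduct: a
  solution \<open>R\<close> of the twisted equations is a singular vector in the tensor product of a
  Verma module with F, so \<open>m \<mapsto> \<Delta>(m) R\<close> is a homomorphism from the Verma
  module. Its pairing with the highest weight vector is \<open>g(z m)\<close>, and regularity is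
  what makes this divisible when \<open>m\<close> is. Once \<open>g\<close> is invariant under both
  kernels, regularity for F as a module over the negative part yields
  \<open>J(\<lambda>)(f \<otimes> g)\<close> as a rational function without pole. Only its value at
  the base point is left, and for this one line suffices. The structure maps are given by definite
  descriptions, so Verma modules have to be built first. They live on a free algebra and are
  governed by skew derivations. Modulo the Serre relations these have no common kernel in non-zero
  weight, which gives the absence of zero divisors.\<close>

lemma qpow_0 [simp]: "qpow 0 = 1" by (simp add: qpow_def One_fract_def)

lemma qpow_add: "qpow (a + b) = qpow a * qpow b" by (simp add: qpow_def mult_single)

lemma qpow_mult_minus [simp]: "qpow a * qpow (- a) = 1" "qpow (- a) * qpow a = 1" by (simp_all flip: qpow_add)

lemma qpow_nonzero [simp]: "qpow a \<noteq> 0" using qpow_mult_minus(1)[of a] by (metis mult_zero_left zero_neq_one)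

lemma qpow_minus: "qpow (- a) = inverse (qpow a)" using qpow_mult_minus(1)[of a] by (metis inverse_unique)

lemma qpow_diff: "qpow (a - b) = qpow a / qpow b"
  using qpow_add[of a "- b"] by (simp add: qpow_minus divide_inverse)

lemma qpow_inj [simp]: "qpow a = qpow b \<longleftrightarrow> a = b"
proof
  assume "qpow a = qpow b"
  then have "Poly_Mapping.single a (1::complex) = Poly_Mapping.single b 1" by (simp add: qpow_def eq_fract)
  then have "Poly_Mapping.lookup (Poly_Mapping.single a (1::complex)) a = Poly_Mapping.lookup (Poly_Mapping.single b 1) a"
    by simp
  then show "a = b" by (simp add: lookup_single when_def split: if_splits)
qed simp

lemma qpow_eq_1 [simp]: "qpow a = 1 \<longleftrightarrow> a = 0" using qpow_inj[of a 0] by (simp del: qpow_inj)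

lemma qpow_power: "qpow a ^ n = qpow (of_nat n * a)" by (induction n) (simp_all add: qpow_add distrib_right)

lemma qpow_diff_minus_eq_0 [simp]: "qpow a - qpow (- a) = 0 \<longleftrightarrow> a = 0" by simp

text \<open>A form of positivity: the coefficients of an iterated q-Leibniz rule lie here, and
  non-empty sums of powers of \<open>q\<close> cannot vanish.\<close>

inductive_set qpos :: "qfield set" where
  qpow: "qpow a \<in> qpos"
| add: "x \<in> qpos ==> y \<in> qpos ==> x + y \<in> qpos"

lemma qpos_mult_qpow: "x \<in> qpos ==> qpow a * x \<in> qpos"
  by (induction rule: qpos.induct) (auto simp: distrib_left qpow_add[symmetric] intro: qpos.intros)

lemma qpos_nonzero: "x \<in> qpos ==> x \<noteq> 0"
proof -
  \<comment> \<open>\<open>tot\<close> is the augmentation \<open>q = 1\<close>: it sends every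
    power of \<open>q\<close> to 1, hence sums of such powers to positive numbers.\<close>
  define tot :: "(rat \<Rightarrow>\<^sub>0 complex) => complex" where "tot p = (\<Sum>a\<in>Poly_Mapping.keys p. Poly_Mapping.lookup p a)" for p
  have tot: "tot p = (\<Sum>a\<in>S. Poly_Mapping.lookup p a)" if "Poly_Mapping.keys p \<subseteq> S" "finite S" for p S
    unfolding tot_def using that by (intro sum.mono_neutral_left) (auto simp: in_keys_iff)
  have tot_add: "tot (p + r) = tot p + tot r" for p r
    by (simp add: keys_add tot[of _ "Poly_Mapping.keys p \<union> Poly_Mapping.keys r"] lookup_add sum.distrib)
  have "\<exists>p. x = Fraction_Field.Fract p 1 \<and> Re (tot p) > 0" if "x \<in> qpos" for x using that
  proof (induction rule: qpos.induct)
    case (qpow a)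
    have "tot (Poly_Mapping.single a 1) = 1" by (simp add: tot_def)
    then show ?case by (intro exI[of _ "Poly_Mapping.single a 1"]) (simp add: qpow_def)
  next
    case (add x y)
    then obtain p r where "x = Fraction_Field.Fract p 1" "Re (tot p) > 0"
      "y = Fraction_Field.Fract r 1" "Re (tot r) > 0" by blast
    then show ?case by (intro exI[of _ "p + r"]) (simp add: tot_add)
  qed
  moreover assume "x \<in> qpos"
  ultimately obtain p where p: "x = Fraction_Field.Fract p 1" "Re (tot p) > 0" by blast
  then have "p \<noteq> 0" by (auto simp: tot_def)
  then show "x \<noteq> 0" using p(1) by (simp add: Zero_fract_def eq_fract)
qed

section \<open>The invariant form\<close>

text \<open>The scalar product of \<open>l\<close> with the simple root \<open>i\<close>. The
  exponents of \<open>q\<close> in the relations are of this kind.\<close>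

definition rpair :: "'i::cartan_datum => ('i => rat) => rat"
  where "rpair i l = (\<Sum>j\<in>UNIV. symm i * of_int (cartan i j) * l j)"

abbreviation ip :: "('i::cartan_datum => rat) => ('i => rat) => rat"
  where "ip \<equiv> root_form cartan symm"

lemma symm_cartan: "symm i * of_int (cartan i j) = symm j * of_int (cartan j (i::'i::cartan_datum))"
  using finite_cartan unfolding finite_cartan_def by blast

lemma cartan_diag [simp]: "cartan i i = (2::int)" using finite_cartan unfolding finite_cartan_def by blast

lemma cartan_off: "i \<noteq> j ==> cartan i j \<le> 0" using finite_cartan unfolding finite_cartan_def by blast

lemma ip_pos: "l \<noteq> 0 ==> ip l l > 0" using finite_cartan unfolding finite_cartan_def zero_fun_def by blast

lemma rpair_add: "rpair i (l + m) = rpair i l + rpair i m" by (simp add: rpair_def distrib_left sum.distrib)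

lemma rpair_diff: "rpair i (l - m) = rpair i l - rpair i m"
  by (simp add: rpair_def right_diff_distrib sum_subtractf)

lemma rpair_0 [simp]: "rpair i 0 = 0" "rpair i (\<lambda>j. 0) = 0" by (simp_all add: rpair_def)

lemma rpair_minus: "rpair i (- l) = - rpair i l" by (simp add: rpair_def sum_negf)

lemma rpair_scale: "rpair i (\<lambda>j. c * l j) = c * rpair i l" by (simp add: rpair_def sum_distrib_left mult_ac)

lemma rpair_simple: "rpair i (simple_root j) = symm i * of_int (cartan i j)"
proof -
  have "rpair i (simple_root j) = (\<Sum>k\<in>UNIV. if k = j then symm i * of_int (cartan i k) else 0)"
    unfolding rpair_def simple_root_def by (intro sum.cong) auto
  then show ?thesis by simp
qed

lemma rpair_simple_commute: "rpair i (simple_root j) = rpair j (simple_root i)"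
  by (simp add: rpair_simple symm_cartan)

lemma ip_alt: "ip l m = (\<Sum>i\<in>UNIV. l i * rpair i m)" by (simp add: root_form_def rpair_def sum_distrib_left mult_ac)

lemma ip_commute: "ip l m = ip m l" unfolding root_form_def
  by (subst sum.swap, intro sum.cong refl) (metis mult.commute symm_cartan)

lemma ip_simple: "ip (simple_root i) m = rpair i m"
proof -
  have "ip (simple_root i) m = (\<Sum>k\<in>UNIV. if k = i then rpair k m else 0)"
    unfolding ip_alt simple_root_def by (intro sum.cong) auto
  then show ?thesis by simp
qed

lemma ip_add_right: "ip l (m + m') = ip l m + ip l m'" by (simp add: ip_alt rpair_add distrib_left sum.distrib)

lemma ip_diff_right: "ip l (m - m') = ip l m - ip l m'"
  by (simp add: ip_alt rpair_diff right_diff_distrib sum_subtractf)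

lemma ip_diff_left: "ip (l - l') m = ip l m - ip l' m" by (simp add: ip_alt left_diff_distrib sum_subtractf)

lemma ip_0 [simp]: "ip 0 m = 0" "ip m 0 = 0" by (simp_all add: ip_alt)

lemma symm_pos: "symm (i::'i::cartan_datum) > 0"
proof -
  have "simple_root i \<noteq> 0" by (auto simp: simple_root_def fun_eq_iff)
  then have "ip (simple_root i) (simple_root i) > 0" by (rule ip_pos)
  then show ?thesis by (simp add: ip_simple rpair_simple)
qed

lemma symm_nonzero [simp]: "symm (i::'i::cartan_datum) \<noteq> 0" using symm_pos[of i] by simp

definition qden :: "'i::cartan_datum => qfield"
  where "qden i = qpow (symm i) - qpow (- symm i)"

lemma qden_nonzero [simp]: "qden i \<noteq> 0"
  using qpow_diff_minus_eq_0[of "symm i"] by (auto simp: qden_def simp del: qpow_diff_minus_eq_0)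

text \<open>The scalar by which \<open>e_i f_i - f_i e_i\<close> acts where \<open>k_i\<close> acts
  by \<open>qpow x\<close>; it extends \<open>qint\<close> to rational arguments.\<close>

definition qbracket :: "'i::cartan_datum => rat => qfield"
  where "qbracket i x = (qpow x - qpow (- x)) / qden i"

lemma qint_eq: "qint i k = qbracket i (of_nat k * symm i)" by (simp add: qint_def qbracket_def qden_def)

lemma qint_nonzero: "k \<noteq> 0 ==> qint i k \<noteq> 0" by (simp add: qint_eq qbracket_def)

lemma qint_0 [simp]: "qint i 0 = 0" by (simp add: qint_eq qbracket_def)

lemma qfactorial_0 [simp]: "qfactorial i 0 = 1" by (simp add: qfactorial_def)

lemma qfactorial_Suc: "qfactorial i (Suc k) = qfactorial i k * qint i (Suc k)" by (simp add: qfactorial_def)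

lemma qfactorial_nonzero [simp]: "qfactorial i k \<noteq> 0" by (induction k) (simp_all add: qfactorial_Suc qint_nonzero)

section \<open>Free algebras and their actions\<close>

definition psc :: "qfield => ('a monoword \<Rightarrow>\<^sub>0 qfield) => 'a monoword \<Rightarrow>\<^sub>0 qfield"
  where "psc c p = Poly_Mapping.single 0 c * p"

abbreviation mono :: "'a list => 'a monoword \<Rightarrow>\<^sub>0 qfield"
  where "mono w \<equiv> Poly_Mapping.single (Word w) 1"

lemma psc_fscalar: "psc c p = fscalar c * p" by (simp add: psc_def fscalar_def)

lemma psc_single: "psc c (Poly_Mapping.single w d) = Poly_Mapping.single w (c * d)"
  by (simp add: psc_def mult_single)

lemma mono_Nil: "mono [] = 1" by (simp flip: zero_monoword_def)

lemma mono_append: "mono (v @ w) = mono v * mono w" by (simp add: mult_single plus_monoword_def)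

lemma mono_Cons: "mono (i # w) = mono [i] * mono w" using mono_append[of "[i]" w] by simp

lemma free_induct [case_names single add]:
  assumes "\<And>w c. P (psc c (mono w))" and "\<And>p r. P p ==> P r ==> P (p + r)"
  shows "P p"
proof (induction p rule: Poly_Mapping.update_induct)
  case const
  then show ?case using assms(1)[of 0 "[]"] by (simp add: psc_single)
next
  case (update f a b)
  have "Poly_Mapping.update a b f = f + psc b (mono (letters a))" using update(1) by (intro poly_mapping_eqI)
      (simp add: psc_single Poly_Mapping.update.rep_eq lookup_add lookup_single when_def
        not_in_keys_iff_lookup_eq_zero)
  moreover have "P (f + psc b (mono (letters a)))" using update(3) assms by blast
  ultimately show ?case by simp
qed

global_interpretation P: vector_space "psc :: qfield => ('a monoword \<Rightarrow>\<^sub>0 qfield) => _"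
  by standard (simp_all add: psc_def distrib_left single_add distrib_right mult_single flip: mult.assoc)

global_interpretation U: vector_space "uscale :: qfield => 'i::cartan_datum uq => _" by (rule vector_space_uscale)

global_interpretation K: vector_space "(*) :: qfield => qfield => qfield" by standard (simp_all add: algebra_simps)

lemma psc_mult_left: "psc c p * r = psc c (p * r)" by (simp add: psc_def mult.assoc)

lemma psc_mult_right: "p * psc c r = psc c (p * r)"
proof (induction p rule: free_induct)
  case (single w d)
  then show ?case by (simp add: psc_def mult_single flip: mult.assoc) (simp add: mult.commute)
qed (simp add: distrib_right P.scale_right_distrib)

text \<open>Linear extension of a function on words, the way in which most maps out of a free
  algebra are defined here.\<close>

definition lx :: "(qfield => 'b => 'b) => ('a list => 'b) => ('a monoword \<Rightarrow>\<^sub>0 qfield) => 'b::comm_monoid_add"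
  where "lx sc \<phi> p = (\<Sum>w\<in>Poly_Mapping.keys p. sc (Poly_Mapping.lookup p w) (\<phi> (letters w)))"

abbreviation lin :: "(qfield => 'a => 'a) => (qfield => 'b => 'b) => ('a::ab_group_add => 'b::ab_group_add) => bool"
  where "lin \<equiv> module_hom"

lemma linI:
  assumes "vector_space s1" "vector_space s2" "\<And>x y. f (x + y) = f x + f y" "\<And>c x. f (s1 c x) = s2 c (f x)"
  shows "lin s1 s2 f"
proof -
  interpret v1: vector_space s1 by fact
  interpret v2: vector_space s2 by fact
  show ?thesis by unfold_locales (simp_all add: assms)
qed

lemmas lin_add = module_hom.add
lemmas lin_scale = module_hom.scale
lemmas lin_0 = module_hom.zero
lemmas lin_diff = module_hom.diff
lemmas lin_neg = module_hom.neg
lemmas lin_sum = module_hom.sum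

lemma lin_comp: "lin s1 s2 f ==> lin s2 s3 g ==> lin s1 s3 (\<lambda>x. g (f x))"
  using module_hom_compose[of s1 s2 f s3 g] by (simp add: o_def)

locale qspace = vector_space scale for scale :: "qfield => 'x::ab_group_add => 'x"
begin

lemma lx_superset:
  assumes "finite S" "Poly_Mapping.keys p \<subseteq> S"
  shows "lx scale \<phi> p = (\<Sum>w\<in>S. scale (Poly_Mapping.lookup p w) (\<phi> (letters w)))"
  unfolding lx_def using assms by (intro sum.mono_neutral_left) (auto simp: in_keys_iff)

lemma lx_add: "lx scale \<phi> (p + r) = lx scale \<phi> p + lx scale \<phi> r"
  by (simp add: keys_add lx_superset[of "Poly_Mapping.keys p \<union> Poly_Mapping.keys r"] lookup_add scale_left_distrib sum.distrib)

lemma lx_psc_mono [simp]: "lx scale \<phi> (psc c (mono w)) = scale c (\<phi> w)" by (simp add: lx_def psc_single)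

lemma lx_mono [simp]: "lx scale \<phi> (mono w) = \<phi> w" using lx_psc_mono[of \<phi> 1 w] by simp

lemma lx_psc: "lx scale \<phi> (psc c p) = scale c (lx scale \<phi> p)"
  by (induction p rule: free_induct) (simp_all add: P.scale_right_distrib lx_add scale_right_distrib)

lemma lin_lx: "lin psc scale (lx scale \<phi>)" by (intro linI P.vector_space_axioms vector_space_axioms lx_add lx_psc)

end

lemma lin_free_eqI:
  assumes "lin psc sc f" "lin psc sc g" "\<And>w. f (mono w) = g (mono w)"
  shows "f p = g p"
  by (induction p rule: free_induct) (simp_all add: assms lin_add[OF assms(1)] lin_add[OF assms(2)]
      lin_scale[OF assms(1)] lin_scale[OF assms(2)])

definition act :: "(qfield => 'x => 'x) => ('g => 'x => 'x) => ('g monoword \<Rightarrow>\<^sub>0 qfield) => 'x => 'x::comm_monoid_add"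
  where "act sc op p x = lx sc (\<lambda>w. foldr op w x) p"

locale free_action = qspace scale
  for scale :: "qfield => 'x::ab_group_add => 'x" +
  fixes op :: "'g => 'x => 'x"
  assumes lin_op: "lin scale scale (op g)"
begin

abbreviation A where "A \<equiv> act scale op"

lemma lin_foldr: "lin scale scale (foldr op w)"
proof (induction w)
  case Nil
  show ?case by (intro linI vector_space_axioms) simp_all
next
  case (Cons g w)
  then show ?case using lin_comp[OF Cons lin_op[of g]] by (simp add: o_def)
qed

lemma act_add: "A (p + r) x = A p x + A r x" by (simp add: act_def lx_add)

lemma act_psc: "A (psc c p) x = scale c (A p x)" by (simp add: act_def lx_psc)

lemma lin_act_left: "lin psc scale (\<lambda>p. A p x)"
  by (intro linI P.vector_space_axioms vector_space_axioms act_add act_psc)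

lemma lin_act: "lin scale scale (A p)"
proof (induction p rule: free_induct)
  case (single w c)
  have "A (psc c (mono w)) = (\<lambda>x. scale c (foldr op w x))" by (simp add: act_def fun_eq_iff)
  then show ?case by (auto intro!: linI vector_space_axioms
        simp: lin_add[OF lin_foldr] lin_scale[OF lin_foldr] scale_right_distrib mult.commute)
next
  case (add p r)
  then show ?case by (auto intro!: linI vector_space_axioms simp: act_add scale_right_distrib
        lin_add[OF add(1)] lin_scale[OF add(1)] lin_add[OF add(2)] lin_scale[OF add(2)])
qed

lemmas act_diff = lin_diff[OF lin_act_left]
lemmas act_0 [simp] = lin_0[OF lin_act_left]
lemmas act_sum = lin_sum[OF lin_act_left]
lemma act_mono [simp]: "A (mono w) x = foldr op w x" by (simp add: act_def)

lemma act_1 [simp]: "A 1 x = x" by (simp flip: mono_Nil)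

lemma act_mult: "A (p * r) x = A p (A r x)"
proof (induction p rule: free_induct)
  case (single v c)
  have "A (mono v * r) x = foldr op v (A r x)"
  proof (rule lin_free_eqI)
    show "lin psc scale (\<lambda>r. A (mono v * r) x)" by (intro linI P.vector_space_axioms vector_space_axioms)
        (simp_all add: distrib_left act_add psc_mult_right act_psc)
    show "lin psc scale (\<lambda>r. foldr op v (A r x))" by (intro linI P.vector_space_axioms vector_space_axioms)
        (simp_all add: act_add act_psc lin_add[OF lin_foldr] lin_scale[OF lin_foldr])
    show "A (mono v * mono w) x = foldr op v (A (mono w) x)" for w by (simp flip: mono_append)
  qed
  then show ?case by (simp add: psc_mult_left act_psc)
qed (simp add: distrib_right act_add)

lemma act_power: "A (p ^ n) x = (A p ^^ n) x" by (induction n arbitrary: x) (simp_all add: act_mult)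

lemma act_stable:
  assumes "subspace N" "\<And>g x. x \<in> N ==> op g x \<in> N" "x \<in> N"
  shows "A p x \<in> N"
proof (induction p rule: free_induct)
  case (single w c)
  have "foldr op w x \<in> N" by (induction w) (simp_all add: assms)
  then show ?case using assms(1) by (simp add: act_psc subspace_scale)
qed (use assms(1) in \<open>simp add: act_add subspace_add\<close>)

end

section \<open>Skew derivations and the Serre elements\<close>

text \<open>Weights are functions. With the pointwise rules switched off, sums of weights stay
  elements of a group and are handled by \<open>algebra_simps\<close>.\<close>

declare plus_fun_apply [simp del] minus_apply [simp del] uminus_apply [simp del] zero_fun_apply [simp del]

lemma count_list_replicate_eq: "count_list (replicate n x) y = (if x = y then n else 0)" by (induction n) auto

section \<open>The free algebra on the simple roots and its grading by weights\<close>

type_synonym 'i tens = "'i monoword \<Rightarrow>\<^sub>0 qfield"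

definition wt :: "'i list => 'i => rat"
  where "wt w = (\<lambda>i. of_nat (count_list w i))"

lemma wt_Nil [simp]: "wt [] = 0" by (simp add: wt_def fun_eq_iff zero_fun_apply)

lemma wt_Cons: "wt (i # w) = simple_root i + wt w" by (auto simp: wt_def simple_root_def fun_eq_iff plus_fun_apply)

lemma wt_append: "wt (v @ w) = wt v + wt w" by (simp add: wt_def fun_eq_iff plus_fun_apply)

lemma wt_rev [simp]: "wt (rev w) = wt w" by (simp add: wt_def)

lemma wt_Qplus [simp]: "wt w \<in> Qplus" by (simp add: wt_def Qplus_def)

lemma rpair_wt_Cons: "rpair k (wt (i # w)) = rpair k (simple_root i) + rpair k (wt w)"
  by (simp add: wt_Cons rpair_add)

definition part :: "('i => rat) => 'i tens => 'i tens"
  where "part b = lx psc (\<lambda>w. if wt w = b then mono w else 0)"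

text \<open>Weight spaces of the free algebra whose letters are later sent to the \<open>uF\<close>
  or to the \<open>uE\<close>. Being fixed by the projection \<open>part b\<close> is a linear
  condition, so the closure properties are immediate.\<close>

definition Tw :: "('i => rat) => 'i tens set"
  where "Tw b = {p. part b p = p}"

global_interpretation PQ: qspace psc by unfold_locales

global_interpretation UQ: qspace uscale by unfold_locales

global_interpretation KQ: qspace "(*)" by unfold_locales

lemma linT: "(\<And>x y. f (x + y) = f x + f y) ==> (\<And>c x. f (psc c x) = psc c (f x)) ==> lin psc psc f"
  by (intro linI P.vector_space_axioms)

lemma linU: "(\<And>x y. f (x + y) = f x + f y) ==> (\<And>c x. f (uscale c x) = uscale c (f x)) ==> lin uscale uscale f"
  by (intro linI U.vector_space_axioms)

lemmas us_mult = uscale_mult_left uscale_mult_right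

lemmas linK = linI[OF U.vector_space_axioms K.vector_space_axioms]

lemma lin_left_mult: "lin uscale (*) f ==> lin uscale (*) (\<lambda>y. f (z * y))"
  by (rule linK) (simp_all add: distrib_left uscale_mult_right lin_add lin_scale)

lemma lin_part: "lin psc psc (part b)" unfolding part_def by (rule PQ.lin_lx)

lemmas part_simps [simp] = lin_add[OF lin_part] lin_scale[OF lin_part] lin_0[OF lin_part]
  lin_diff[OF lin_part] lin_neg[OF lin_part]

lemma part_mono: "part b (mono w) = (if wt w = b then mono w else 0)" by (simp add: part_def)

lemma part_part: "part b (part c p) = (if b = c then part b p else 0)"
  by (induction p rule: free_induct) (auto simp: part_mono)

lemma part_Tw [simp]: "part b p \<in> Tw b" by (simp add: Tw_def part_part)

lemma part_of_Tw: "p \<in> Tw c ==> part b p = (if b = c then p else 0)"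
  using part_part[of b c p] by (cases "b = c") (simp_all add: Tw_def)

lemma mono_Tw [simp]: "mono w \<in> Tw (wt w)" by (simp add: Tw_def part_mono)

lemma subspace_Tw: "P.subspace (Tw b)" by (auto simp: Tw_def P.subspace_def)

lemmas Tw_closed [simp] = P.subspace_0[OF subspace_Tw] P.subspace_add[OF subspace_Tw]
  P.subspace_scale[OF subspace_Tw] P.subspace_diff[OF subspace_Tw] P.subspace_neg[OF subspace_Tw]

lemma Tw_induct [consumes 1, case_names word add zero]:
  assumes "p \<in> Tw b" and "\<And>w c. wt w = b ==> Q (psc c (mono w))"
    and "\<And>p r. Q p ==> Q r ==> Q (p + r)" and "Q 0"
  shows "Q p"
proof -
  have "Q (part b r)" for r by (induction r rule: free_induct) (auto simp: part_mono assms)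
  from this[of p] show ?thesis using assms(1) by (simp add: Tw_def)
qed

lemma Tw_mult: "p \<in> Tw b ==> r \<in> Tw g ==> p * r \<in> Tw (b + g)"
proof (induction p rule: Tw_induct)
  case (word w c)
  from this(2) have "mono w * r \<in> Tw (b + g)"
  proof (induction r rule: Tw_induct)
    case (word v d)
    then show ?case using \<open>wt w = b\<close> mono_Tw[of "w @ v"] by (simp add: psc_mult_right wt_append mono_append)
  qed (simp_all add: distrib_left)
  then show ?case by (simp add: psc_mult_left)
qed (simp_all add: distrib_right)

lemma Tw_0: "p \<in> Tw b ==> b \<notin> Qplus ==> p = 0" by (induction p rule: Tw_induct; auto)

lemma finite_parts: "finite {b. part b p \<noteq> 0}"
proof (induction p rule: free_induct)
  case (single w c)
  have "{b. part b (psc c (mono w)) \<noteq> 0} \<subseteq> {wt w}" by (auto simp: part_mono)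
  then show ?case by (rule finite_subset) simp
next
  case (add p r)
  have "{b. part b (p + r) \<noteq> 0} \<subseteq> {b. part b p \<noteq> 0} \<union> {b. part b r \<noteq> 0}" by auto
  then show ?case using add by (meson finite_Un finite_subset)
qed

lemma sum_parts:
  assumes "finite S" "{b. part b p \<noteq> 0} \<subseteq> S"
  shows "(\<Sum>b\<in>S. part b p) = p"
proof -
  have "\<exists>S. finite S \<and> (\<forall>S'. finite S' \<longrightarrow> S \<subseteq> S' \<longrightarrow> (\<Sum>b\<in>S'. part b p) = p)"
  proof (induction p rule: free_induct)
    case (single w c)
    have "(\<Sum>b\<in>S'. part b (psc c (mono w))) = psc c (mono w)" if "finite S'" "{wt w} \<subseteq> S'" for S'
    proof -
      have "(\<Sum>b\<in>S'. part b (psc c (mono w))) = (\<Sum>b\<in>{wt w}. part b (psc c (mono w)))"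
        using that by (intro sum.mono_neutral_right) (auto simp: part_mono)
      then show ?thesis by (simp add: part_mono)
    qed
    then show ?case by (intro exI[of _ "{wt w}"]) simp
  next
    case (add p r)
    obtain S1 where S1: "finite S1" "\<forall>S'. finite S' \<longrightarrow> S1 \<subseteq> S' \<longrightarrow> (\<Sum>b\<in>S'. part b p) = p" using add(1) by blast
    obtain S2 where S2: "finite S2" "\<forall>S'. finite S' \<longrightarrow> S2 \<subseteq> S' \<longrightarrow> (\<Sum>b\<in>S'. part b r) = r" using add(2) by blast
    have "(\<Sum>b\<in>S'. part b (p + r)) = p + r" if "finite S'" "S1 \<union> S2 \<subseteq> S'" for S'
      using S1(2) S2(2) that by (simp add: sum.distrib)
    then show ?case using S1(1) S2(1) by (intro exI[of _ "S1 \<union> S2"]) simp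
  qed
  then obtain S0 where S0: "finite S0" "\<And>S'. finite S' ==> S0 \<subseteq> S' ==> (\<Sum>b\<in>S'. part b p) = p" by blast
  have "(\<Sum>b\<in>S. part b p) = (\<Sum>b\<in>S0 \<union> S. part b p)" using assms S0(1) by (intro sum.mono_neutral_left) auto
  also have "\<dots> = p" using assms(1) S0 by simp
  finally show ?thesis .
qed

section \<open>The two skew derivations\<close>

primrec lder_word :: "'i::cartan_datum => 'i list => 'i tens"
  where "lder_word i [] = 0"
  | "lder_word i (j # w) = (if j = i then mono w else 0) +
      psc (qpow (- rpair i (simple_root j))) (mono [j] * lder_word i w)"

text \<open>Lusztig's skew derivation: it removes a letter \<open>i\<close>, and every letter to the
  left of the removed one contributes a power of \<open>q\<close>.\<close>

definition lder :: "'i::cartan_datum => 'i tens => 'i tens"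
  where "lder i = lx psc (lder_word i)"

definition flip :: "'i tens => 'i tens"
  where "flip = lx psc (\<lambda>w. mono (rev w))"

text \<open>Conjugation with the reversal of words makes the letters to the right of the removed one
  contribute, so rules for \<open>rder\<close> follow from those for \<open>lder\<close> without a
  second induction.\<close>

definition rder :: "'i::cartan_datum => 'i tens => 'i tens"
  where "rder i p = flip (lder i (flip p))"

lemma lin_lder: "lin psc psc (lder i)" unfolding lder_def by (rule PQ.lin_lx)

lemmas lder_simps [simp] = lin_add[OF lin_lder] lin_scale[OF lin_lder] lin_0[OF lin_lder]
  lin_diff[OF lin_lder] lin_neg[OF lin_lder]

lemma lin_flip: "lin psc psc flip" unfolding flip_def by (rule PQ.lin_lx)

lemmas flip_simps [simp] = lin_add[OF lin_flip] lin_scale[OF lin_flip] lin_0[OF lin_flip]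
  lin_diff[OF lin_flip] lin_neg[OF lin_flip]

lemma lin_rder: "lin psc psc (rder i)" by (rule linT) (simp_all add: rder_def)

lemmas rder_simps [simp] = lin_add[OF lin_rder] lin_scale[OF lin_rder] lin_0[OF lin_rder]
  lin_diff[OF lin_rder] lin_neg[OF lin_rder]

lemma flip_mono: "flip (mono w) = mono (rev w)" by (simp add: flip_def)

lemma flip_mult: "flip (p * r) = flip r * flip p"
proof (induction p rule: free_induct)
  case (single v c)
  have "flip (mono v * r) = flip r * mono (rev v)" by (induction r rule: free_induct)
      (simp_all add: psc_mult_left psc_mult_right distrib_left distrib_right flip_mono flip: mono_append)
  then show ?case by (simp add: psc_mult_left psc_mult_right flip_mono)
qed (simp add: distrib_left distrib_right)

lemma flip_flip [simp]: "flip (flip p) = p" by (induction p rule: free_induct) (simp_all add: flip_mono)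

lemma flip_Tw: "p \<in> Tw b ==> flip p \<in> Tw b"
proof (induction p rule: Tw_induct)
  case (word w c)
  then show ?case using mono_Tw[of "rev w"] by (simp add: flip_mono)
qed simp_all

lemma lder_mono: "lder i (mono w) = lder_word i w" by (simp add: lder_def)

lemma lder_1 [simp]: "lder i 1 = 0" using lder_mono[of i "[]"] by (simp add: mono_Nil)

lemma flip_1 [simp]: "flip 1 = 1" using flip_mono[of "[]"] by (simp add: mono_Nil)

lemma rder_1 [simp]: "rder i 1 = 0" by (simp add: rder_def)

lemma lder_Cons: "lder i (mono [j] * p) = (if j = i then p else 0) +
    psc (qpow (- rpair i (simple_root j))) (mono [j] * lder i p)"
proof (rule lin_free_eqI[of psc _ _ p])
  show "lin psc psc (\<lambda>p. lder i (mono [j] * p))" by (rule linT) (simp_all add: distrib_left psc_mult_right)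
  show "lin psc psc (\<lambda>p. (if j = i then p else 0) + psc (qpow (- rpair i (simple_root j))) (mono [j] * lder i p))"
    by (rule linT) (simp_all add: distrib_left psc_mult_right P.scale_right_distrib mult.commute)
  show "lder i (mono [j] * mono w) = (if j = i then mono w else 0) +
      psc (qpow (- rpair i (simple_root j))) (mono [j] * lder i (mono w))" for w
    by (simp add: lder_mono flip: mono_Cons)
qed

lemma lder_mult:
  assumes "x \<in> Tw b"
  shows "lder i (x * y) = lder i x * y + psc (qpow (- rpair i b)) (x * lder i y)" using assms
proof (induction x rule: Tw_induct)
  case (word w c)
  have "lder i (mono w * y) = lder i (mono w) * y + psc (qpow (- rpair i (wt w))) (mono w * lder i y)"
  proof (induction w)
    case Nil
    then show ?case by (simp add: mono_Nil)
  next
    case (Cons j w)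
    have "lder i (mono (j # w) * y) = lder i (mono [j] * (mono w * y))"
      by (simp only: mono_Cons[of j w] mult.assoc)
    also have "\<dots> = (if j = i then mono w * y else 0) +
        psc (qpow (- rpair i (simple_root j))) (mono [j] * (lder i (mono w) * y +
          psc (qpow (- rpair i (wt w))) (mono w * lder i y)))" by (simp add: lder_Cons Cons)
    also have "\<dots> = ((if j = i then mono w else 0) + psc (qpow (- rpair i (simple_root j))) (mono [j] * lder i (mono w))) * y
        + psc (qpow (- rpair i (wt (j # w)))) (mono [j] * mono w * lder i y)"
      by (simp add: distrib_left distrib_right P.scale_right_distrib psc_mult_left psc_mult_right
          mult.assoc rpair_wt_Cons flip: qpow_add)
    finally show ?case by (simp add: lder_mono flip: mono_Cons)
  qed
  then show ?case using word by (simp add: psc_mult_left P.scale_right_distrib mult.commute)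
qed (simp_all add: distrib_right P.scale_right_distrib)

lemma rder_mult:
  assumes "y \<in> Tw c"
  shows "rder i (x * y) = x * rder i y + psc (qpow (- rpair i c)) (rder i x * y)"
  using lder_mult[OF flip_Tw[OF assms], of i "flip x"] by (simp add: rder_def flip_mult)

lemma lder_single [simp]: "lder i (mono [j]) = (if j = i then 1 else 0)"
  using lder_mono[of i "[j]"] by (simp add: mono_Nil)

lemma rder_single [simp]: "rder i (mono [j]) = (if j = i then 1 else 0)"
  using flip_mono[of "[j]"] by (simp add: rder_def)

lemma rder_Cons:
  assumes "p \<in> Tw b"
  shows "rder i (mono [j] * p) = mono [j] * rder i p + (if j = i then psc (qpow (- rpair i b)) p else 0)"
  using rder_mult[OF assms, of i "mono [j]"] by simp

lemma lder_Tw: "p \<in> Tw b ==> lder i p \<in> Tw (b - simple_root i)"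
proof (induction p rule: Tw_induct)
  case (word w c)
  have "lder i (mono w) \<in> Tw (wt w - simple_root i)"
  proof (induction w)
    case Nil
    then show ?case by (simp add: mono_Nil)
  next
    case (Cons j w)
    have "mono [j] * lder i (mono w) \<in> Tw (wt [j] + (wt w - simple_root i))" by (intro Tw_mult Cons mono_Tw)
    then have "mono [j] * lder i (mono w) \<in> Tw (wt (j # w) - simple_root i)" by (simp add: wt_Cons algebra_simps)
    moreover have "mono w \<in> Tw (wt (i # w) - simple_root i)" by (simp add: wt_Cons)
    ultimately show ?case by (auto simp: lder_mono)
  qed
  then show ?case using word by simp
qed simp_all

lemma rder_Tw: "p \<in> Tw b ==> rder i p \<in> Tw (b - simple_root i)" unfolding rder_def by (intro flip_Tw lder_Tw)

text \<open>Removing two letters, one counted from the left and one from the right, can be done in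
  either order; the powers of \<open>q\<close> agree because the form is symmetric.\<close>

lemma lder_rder_commute: "lder i (rder j p) = rder j (lder i p)"
proof (rule lin_free_eqI[of psc "\<lambda>p. lder i (rder j p)"])
  show "lin psc psc (\<lambda>p. lder i (rder j p))" "lin psc psc (\<lambda>p. rder j (lder i p))" by (rule linT; simp)+
  show "lder i (rder j (mono w)) = rder j (lder i (mono w))" for w
  proof (induction w)
    case Nil
    then show ?case by (simp add: mono_Nil)
  next
    case (Cons k w)
    have r: "rder j (mono [k] * lder i (mono w)) = mono [k] * rder j (lder i (mono w)) +
        (if k = j then psc (qpow (- rpair j (wt w - simple_root i))) (lder i (mono w)) else 0)"
      by (intro rder_Cons lder_Tw mono_Tw)
    show ?case using Cons by (simp add: mono_Cons[of k w] rder_Cons[OF mono_Tw] lder_Cons r distrib_left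
          P.scale_right_distrib rpair_diff rpair_simple_commute[of j i] flip: qpow_add)
  qed
qed

section \<open>Serre elements and their annihilation by the skew derivations\<close>

definition serre_elt :: "'i::cartan_datum => 'i => 'i tens"
  where "serre_elt i j = (let N = nat (1 - cartan i j) in
    \<Sum>m\<in>{0..N}. psc ((- 1) ^ m / (qfactorial i m * qfactorial i (N - m)))
      (mono (replicate m i @ j # replicate (N - m) i)))"

lemma serre_elt_Tw:
  "serre_elt i j \<in> Tw (wt (j # replicate (nat (1 - cartan i j)) i))" unfolding serre_elt_def Let_def
proof (intro P.subspace_sum[OF subspace_Tw] P.subspace_scale[OF subspace_Tw])
  fix m assume "m \<in> {0..nat (1 - cartan i j)}"
  then have "wt (replicate m i @ j # replicate (nat (1 - cartan i j) - m) i) = wt (j # replicate (nat (1 - cartan i j)) i)"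
    by (auto simp: wt_def fun_eq_iff count_list_replicate_eq simp flip: of_nat_add)
  then show "mono (replicate m i @ j # replicate (nat (1 - cartan i j) - m) i) \<in> Tw (wt (j # replicate (nat (1 - cartan i j)) i))"
    using mono_Tw by metis
qed

lemma flip_serre: "flip (serre_elt i j) = psc ((- 1) ^ nat (1 - cartan i j)) (serre_elt i j)"
proof -
  define N where "N = nat (1 - cartan i j)"
  have "flip (serre_elt i j) = (\<Sum>m\<in>{0..N}. psc ((- 1) ^ m / (qfactorial i m * qfactorial i (N - m)))
      (mono (replicate (N - m) i @ j # replicate m i)))"
    by (simp add: serre_elt_def Let_def lin_sum[OF lin_flip] flip_mono flip: N_def)
  also have "\<dots> = (\<Sum>m\<in>{0..N}. psc ((- 1) ^ (N - m) / (qfactorial i (N - m) * qfactorial i m))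
      (mono (replicate m i @ j # replicate (N - m) i)))"
    by (rule sum.reindex_bij_witness[of _ "\<lambda>m. N - m" "\<lambda>m. N - m"]) auto
  also have "\<dots> = (\<Sum>m\<in>{0..N}. psc ((- 1) ^ N) (psc ((- 1) ^ m / (qfactorial i m * qfactorial i (N - m)))
      (mono (replicate m i @ j # replicate (N - m) i))))"
    by (intro sum.cong refl; (simp add: minus_one_power_iff mult.commute))
  finally show ?thesis by (simp add: serre_elt_def Let_def P.scale_sum_right flip: N_def)
qed

lemma cartan_off_nat:
  assumes "i \<noteq> (j::'i::cartan_datum)"
  shows "rpair i (simple_root j) = symm i * (1 - of_nat (nat (1 - cartan i j)))"
  using cartan_off[OF assms] by (simp add: rpair_simple)

lemma rpair_self: "rpair i (simple_root i) = 2 * symm i" by (simp add: rpair_simple mult.commute)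

lemma rpair_wt_replicate: "rpair k (wt (replicate m i)) = of_nat m * rpair k (simple_root i)"
  by (induction m) (simp_all add: rpair_wt_Cons distrib_right)

lemma qint_split:
  assumes "m \<le> N"
  shows "qint i N = qpow (- (of_nat (N - m) * symm i)) * qint i m + qpow (of_nat m * symm i) * qint i (N - m)"
proof -
  define x y where "x = of_nat m * symm i" and "y = of_nat (N - m) * symm i"
  have xy: "of_nat N * symm i = x + y" using assms by (simp add: x_def y_def flip: distrib_right of_nat_add)
  have "qpow (x + y) - qpow (- (x + y)) = qpow (- y) * (qpow x - qpow (- x)) + qpow x * (qpow y - qpow (- y))"
    by (simp add: right_diff_distrib add.commute flip: qpow_add)
  then show ?thesis unfolding qint_def xy x_def[symmetric] y_def[symmetric] by (simp add: add_divide_distrib)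
qed

text \<open>A special value of the q-binomial theorem. After multiplication by
  \<open>qint i N\<close>, the rule \<open>qint_split\<close> writes each summand as a difference
  \<open>b (Suc m) - b m\<close>, and \<open>b\<close> is defined to vanish at both ends.\<close>

lemma serre_sum_zero:
  assumes "N > 0"
  shows "(\<Sum>m\<in>{0..N}. (- 1) ^ m / (qfactorial i m * qfactorial i (N - m)) *
    qpow (of_nat m * symm i * (of_nat N - 1))) = 0"
proof -
  define b where "b m = (if m = 0 \<or> m = Suc N then 0 else
    (- 1) ^ (m - 1) * qpow (of_nat (m - 1) * symm i * of_nat N) / (qfactorial i (m - 1) * qfactorial i (N - m)))" for m
  let ?t = "\<lambda>m. (- 1) ^ m / (qfactorial i m * qfactorial i (N - m)) *
    qpow (of_nat m * symm i * (of_nat N - 1))"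
  have "qint i N * ?t m = b (Suc m) - b m" if "m \<le> N" for m
  proof -
    have 1: "qpow (- (of_nat (N - m) * symm i)) * qint i m * ?t m = - b m"
    proof (cases m)
      case (Suc k)
      have e: "- (of_nat (N - m) * symm i) + of_nat m * symm i * (of_nat N - 1) = of_nat k * symm i * of_nat N"
        using that Suc by (simp add: of_nat_diff algebra_simps)
      have "qint i m * ((- 1) ^ m / (qfactorial i m * qfactorial i (N - m))) =
          - ((- 1) ^ k / (qfactorial i k * qfactorial i (N - m)))"
        using Suc by (simp add: qfactorial_Suc qint_nonzero)
      moreover have "qpow (- (of_nat (N - m) * symm i)) * qint i m * ?t m =
          qint i m * ((- 1) ^ m / (qfactorial i m * qfactorial i (N - m))) *
          (qpow (- (of_nat (N - m) * symm i)) * qpow (of_nat m * symm i * (of_nat N - 1)))" by (simp only: mult_ac)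
      ultimately have "qpow (- (of_nat (N - m) * symm i)) * qint i m * ?t m =
          - ((- 1) ^ k / (qfactorial i k * qfactorial i (N - m))) * qpow (of_nat k * symm i * of_nat N)"
        by (simp only: e flip: qpow_add)
      then show ?thesis using that Suc by (simp add: b_def)
    qed (simp add: b_def)
    have 2: "qpow (of_nat m * symm i) * qint i (N - m) * ?t m = b (Suc m)"
    proof (cases "N - m")
      case (Suc k)
      then have k: "N - Suc m = k" "m \<noteq> N" by auto
      have e: "of_nat m * symm i + of_nat m * symm i * (of_nat N - 1) = of_nat m * symm i * of_nat N"
        by (simp add: algebra_simps)
      have "qint i (N - m) * ((- 1) ^ m / (qfactorial i m * qfactorial i (N - m))) =
          (- 1) ^ m / (qfactorial i m * qfactorial i k)" using Suc by (simp add: qfactorial_Suc qint_nonzero)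
      moreover have "qpow (of_nat m * symm i) * qint i (N - m) * ?t m =
          qint i (N - m) * ((- 1) ^ m / (qfactorial i m * qfactorial i (N - m))) *
          (qpow (of_nat m * symm i) * qpow (of_nat m * symm i * (of_nat N - 1)))" by (simp only: mult_ac)
      ultimately have "qpow (of_nat m * symm i) * qint i (N - m) * ?t m =
          (- 1) ^ m / (qfactorial i m * qfactorial i k) * qpow (of_nat m * symm i * of_nat N)"
        by (simp only: e flip: qpow_add)
      then show ?thesis using k by (simp add: b_def)
    next
      case 0
      then show ?thesis using that by (simp add: b_def)
    qed
    show ?thesis unfolding qint_split[OF that] distrib_right 1 2 by simp
  qed
  then have "qint i N * (\<Sum>m\<in>{0..N}. ?t m) = (\<Sum>m<Suc N. b (Suc m) - b m)"
    by (simp add: sum_distrib_left atLeast0AtMost lessThan_Suc_atMost)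
  also have "\<dots> = 0" by (simp only: sum_lessThan_telescope) (simp add: b_def)
  finally show ?thesis using assms qint_nonzero[of N i] by simp
qed

lemma lder_replicate:
  "lder i (mono (replicate m i)) = psc (qpow (- ((of_nat m - 1) * symm i)) * qint i m) (mono (replicate (m - 1) i))"
proof (induction m)
  case 0
  then show ?case by (simp add: mono_Nil)
next
  case (Suc m)
  have g: "1 + qpow (- (2 * symm i)) * (qpow (- ((of_nat m - 1) * symm i)) * qint i m) =
      qpow (- (of_nat m * symm i)) * qint i (Suc m)"
  proof -
    have e: "- (2 * symm i) + - ((of_nat m - 1) * symm i) = - (of_nat m * symm i) + - symm i"
      by (simp add: algebra_simps)
    have "qint i 1 = 1" by (simp add: qint_def)
    then have "qint i (Suc m) = qpow (- symm i) * qint i m + qpow (of_nat m * symm i)"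
      using qint_split[of m "Suc m" i] by simp
    then show ?thesis
      unfolding mult.assoc[symmetric] qpow_add[symmetric] e by (simp add: distrib_left qpow_diff qpow_minus divide_inverse)
  qed
  have "lder i (mono (replicate (Suc m) i)) = mono (replicate m i) +
      psc (qpow (- (2 * symm i))) (mono [i] * psc (qpow (- ((of_nat m - 1) * symm i)) * qint i m) (mono (replicate (m - 1) i)))"
    using lder_Cons[of i i "mono (replicate m i)"] by (simp add: Suc rpair_self mono_Cons[of i "replicate m i"])
  also have "\<dots> = psc (1 + qpow (- (2 * symm i)) * (qpow (- ((of_nat m - 1) * symm i)) * qint i m)) (mono (replicate m i))"
  proof (cases m)
    case (Suc k)
    then show ?thesis by (simp add: psc_mult_right P.scale_left_distrib flip: mono_Cons)
  qed simp
  finally show ?case by (simp only: g diff_Suc_1 of_nat_Suc add_diff_cancel_left' add_diff_cancel_right')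
qed

lemma lder_replicate_other: "i \<noteq> k ==> lder k (mono (replicate m i)) = 0"
proof (induction m)
  case (Suc m)
  then show ?case using lder_Cons[of k i "mono (replicate m i)"] by (simp add: mono_Cons[of i "replicate m i"])
qed (simp add: mono_Nil)

lemma lder_serre_word:
  assumes "i \<noteq> j"
  shows "lder k (mono (replicate m i @ j # replicate n i)) =
    lder k (mono (replicate m i)) * mono (j # replicate n i) +
    psc (qpow (- (of_nat m * rpair k (simple_root i)))) (mono (replicate m i) *
      ((if j = k then mono (replicate n i) else 0) +
        psc (qpow (- rpair k (simple_root j))) (mono [j] * lder k (mono (replicate n i)))))"
  unfolding mono_append lder_mult[OF mono_Tw] rpair_wt_replicate by (subst (2) mono_Cons) (simp only: lder_Cons)

text \<open>This makes the Serre relations compatible with raising operators. For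
  \<open>k = j\<close> the coefficients add up to the vanishing q-binomial sum; for
  \<open>k = i\<close> every word with one letter \<open>i\<close> less arises twice, with opposite
  coefficients.\<close>

lemma lder_serre:
  assumes "i \<noteq> (j::'i::cartan_datum)"
  shows "lder k (serre_elt i j) = 0"
proof -
  define N where "N = nat (1 - cartan i j)"
  define c where "c m = (- 1) ^ m / (qfactorial i m * qfactorial i (N - m))" for m
  have N: "N > 0" using cartan_off[OF assms] by (simp add: N_def)
  have S: "lder k (serre_elt i j) = (\<Sum>m\<in>{0..N}. psc (c m) (lder k (mono (replicate m i @ j # replicate (N - m) i))))"
    by (simp add: serre_elt_def Let_def lin_sum[OF lin_lder] c_def N_def)
  consider "k \<noteq> i" "k \<noteq> j" | "k = j" | "k = i" by blast
  then show ?thesis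
  proof cases
    case 1
    then show ?thesis using assms by (simp add: S lder_serre_word lder_replicate_other)
  next
    case 2
    have "lder k (mono (replicate m i @ j # replicate (N - m) i)) =
        psc (qpow (of_nat m * symm i * (of_nat N - 1))) (mono (replicate N i))" if "m \<in> {0..N}" for m
    proof -
      have "replicate m i @ replicate (N - m) i = replicate N i" using that by (simp flip: replicate_add)
      moreover have "- (of_nat m * rpair j (simple_root i)) = of_nat m * symm i * (of_nat N - 1)"
        using cartan_off_nat[OF assms]
        by (simp add: rpair_simple_commute[of j i] right_diff_distrib mult_ac flip: N_def)
      ultimately show ?thesis using assms 2 by (simp add: lder_serre_word lder_replicate_other flip: mono_append)
    qed
    then have "lder k (serre_elt i j) = psc (\<Sum>m\<in>{0..N}. c m * qpow (of_nat m * symm i * (of_nat N - 1))) (mono (replicate N i))"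
      by (simp add: S P.scale_sum_left)
    then show ?thesis using serre_sum_zero[OF N, of i] by (simp add: c_def)
  next
    case 3
    define W where "W m = mono (replicate m i @ j # replicate (N - 1 - m) i)" for m
    define g where "g m = qpow (- ((of_nat m - 1) * symm i)) * qint i m" for m
    let ?h = "\<lambda>m. qpow (- (2 * of_nat m * symm i) - symm i * (1 - of_nat N)) * g (N - m)"
    have w: "lder k (mono (replicate m i @ j # replicate (N - m) i)) =
        psc (g m) (W (m - 1)) + psc (?h m) (W m)"
      if "m \<le> N" for m
    proof -
      have "psc (g m) (mono (replicate (m - 1) i)) * mono (j # replicate (N - m) i) = psc (g m) (W (m - 1))"
        by (cases m; (simp add: W_def psc_mult_left mono_append g_def))
      moreover have "mono [j] * mono (replicate (N - m - 1) i) = mono (j # replicate (N - m - 1) i)"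
        by (simp flip: mono_append)
      moreover have "- (2 * of_nat m * symm i) - symm i * (1 - of_nat N) =
          - (of_nat m * rpair i (simple_root i)) + (- rpair i (simple_root j))"
        using cartan_off_nat[OF assms] by (simp add: N_def rpair_self)
      moreover have "lder k (mono (replicate m i @ j # replicate (N - m) i)) =
          psc (g m) (mono (replicate (m - 1) i)) * mono (j # replicate (N - m) i) +
          psc (qpow (- (of_nat m * rpair i (simple_root i)))) (mono (replicate m i) *
            psc (qpow (- rpair i (simple_root j))) (mono [j] * psc (g (N - m)) (mono (replicate (N - m - 1) i))))"
        using assms 3 by (simp add: lder_serre_word lder_replicate g_def)
      moreover have "mono (replicate m i) * mono (j # replicate (N - m - 1) i) = W m"
        by (simp add: W_def diff_commute flip: mono_append)
      ultimately show ?thesis by (simp only: psc_mult_right P.scale_scale qpow_add mult.assoc)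
    qed
    have "lder k (serre_elt i j) = (\<Sum>m\<in>{0..N}. psc (c m * g m) (W (m - 1))) +
        (\<Sum>m\<in>{0..N}. psc (c m * ?h m) (W m))" unfolding S sum.distrib[symmetric]
      by (intro sum.cong refl) (simp add: w P.scale_right_distrib)
    \<comment> \<open>The shift brings both sums to the same range. The boundary terms
      \<open>m = 0\<close> here and \<open>m = N\<close> in the other sum drop out because
      \<open>g 0 = 0\<close>.\<close>
    also have "(\<Sum>m\<in>{0..N}. psc (c m * g m) (W (m - 1))) = (\<Sum>m\<in>{..<N}. psc (c (Suc m) * g (Suc m)) (W m))"
    proof -
      have "(\<Sum>m\<in>{..N}. psc (c m * g m) (W (m - 1))) = (\<Sum>m\<in>{..<Suc N}. psc (c m * g m) (W (m - 1)))"
        by (simp add: lessThan_Suc_atMost)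
      also have "\<dots> = (\<Sum>m\<in>{..<N}. psc (c (Suc m) * g (Suc m)) (W m))"
        by (subst sum.lessThan_Suc_shift) (simp add: g_def)
      finally show ?thesis by (simp add: atLeast0AtMost)
    qed
    also have "(\<Sum>m\<in>{0..N}. psc (c m * ?h m) (W m)) =
        (\<Sum>m\<in>{..<N}. psc (c m * ?h m) (W m))"
    proof -
      have "{0..N} = insert N {..<N}" by auto
      then show ?thesis by (simp add: g_def)
    qed
    also have "(\<Sum>m\<in>{..<N}. psc (c (Suc m) * g (Suc m)) (W m)) +
        (\<Sum>m\<in>{..<N}. psc (c m * ?h m) (W m)) = 0"
    proof (subst sum.distrib[symmetric], intro sum.neutral ballI)
      fix m assume "m \<in> {..<N}"
      then have m: "N - m = Suc (N - Suc m)" "m < N" by auto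
      have e: "qpow (- (2 * of_nat m * symm i) - symm i * (1 - of_nat N)) * qpow (- ((of_nat (N - m) - 1) * symm i)) =
          qpow (- (of_nat m * symm i))"
      proof -
        have "- (2 * of_nat m * symm i) - symm i * (1 - of_nat N) + - ((of_nat (N - m) - 1) * symm i) = - (of_nat m * symm i)"
          using m(2) by (simp add: of_nat_diff algebra_simps)
        then show ?thesis by (simp only: flip: qpow_add)
      qed
      have "c (Suc m) * g (Suc m) = - ((- 1) ^ m / (qfactorial i m * qfactorial i (N - Suc m)) * qpow (- (of_nat m * symm i)))"
        by (simp add: c_def g_def qfactorial_Suc qint_nonzero)
      moreover have "c m * (?h m) =
          (- 1) ^ m / (qfactorial i m * qfactorial i (N - Suc m)) * qpow (- (of_nat m * symm i))"
      proof -
        have cm: "c m * qint i (N - m) = (- 1) ^ m / (qfactorial i m * qfactorial i (N - Suc m))"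
          using m by (simp add: c_def m(1) qfactorial_Suc qint_nonzero)
        then show ?thesis unfolding g_def e[symmetric] by (simp only: mult_ac flip: cm)
      qed
      ultimately have "c (Suc m) * g (Suc m) + c m * (?h m) = 0" by (simp only: left_minus)
      then show "psc (c (Suc m) * g (Suc m)) (W m) +
          psc (c m * ?h m) (W m) = 0" by (simp only: P.scale_zero_left flip: P.scale_left_distrib)
    qed
    finally show ?thesis .
  qed
qed

lemma rder_serre: "i \<noteq> j ==> rder k (serre_elt i j) = 0" by (simp add: rder_def flip_serre lder_serre)

section \<open>Relations in the quantized enveloping algebra\<close>

text \<open>A multiplicative relation \<open>R\<close> between algebra elements and exponents passes
  from the torus generators to their monomials. Commutation rules, characters and invariance
  statements are all instances; the exponent \<open>symm j * l j\<close> is that of the character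
  \<open>q^l\<close> at \<open>t_j\<close>.\<close>

lemma torus_rule:
  assumes "R 1 0" and "\<And>a b x y. R a x ==> R b y ==> R (a * b) (x + y)"
    and "\<And>j. R (t j) (symm j * l j)" and "\<And>j. R (t' j) (- (symm j * l j))"
  shows "R (prod_list (map (\<lambda>j. ipow (t j) (t' j) (n j)) (sorted_list_of_set UNIV)))
    (\<Sum>j\<in>UNIV. of_int (n j) * (symm j * l (j :: 'i::cartan_datum)))"
proof -
  have pow: "R (a ^ n) (of_nat n * x)" if "R a x" for a n x
    by (induction n) (use assms(1) assms(2)[OF that] in \<open>simp_all add: distrib_right\<close>)
  have ipow: "R (ipow (t j) (t' j) n) (of_int n * (symm j * l j))" for j n
    using pow[OF assms(3)[of j], where n = "nat n"] pow[OF assms(4)[of j], where n = "nat (- n)"]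
    by (cases "0 \<le> n") (simp_all add: ipow_def)
  have "R (prod_list (map (\<lambda>j. ipow (t j) (t' j) (n j)) js)) (\<Sum>j\<leftarrow>js. of_int (n j) * (symm j * l j))" for js
    by (induction js) (simp_all add: assms(1,2) ipow)
  from this[of "sorted_list_of_set UNIV"] show ?thesis by (simp add: sum_list_distinct_conv_sum_set)
qed

text \<open>For \<open>k_i\<close> the exponent is \<open>rpair i l\<close>: the column of the
  Cartan matrix in \<open>kpow\<close> becomes a row by the symmetry of
  \<open>symm i * cartan i j\<close>.\<close>

lemma kpow_rule:
  assumes "R 1 0" and "\<And>a b x y. R a x ==> R b y ==> R (a * b) (x + y)"
    and "\<And>j. R (t j) (symm j * l j)" and "\<And>j. R (t' j) (- (symm j * l j))"
  shows "R (kpow t t' i s) (of_int s * rpair i (l :: 'i::cartan_datum => rat))"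
proof -
  have "(\<Sum>j\<in>UNIV. of_int (s * cartan j i) * (symm j * l j)) = of_int s * rpair i l"
    unfolding rpair_def sum_distrib_left by (intro sum.cong refl) (use symm_cartan[of i] in \<open>simp add: mult_ac\<close>)
  then show ?thesis using torus_rule[of R t l t' "\<lambda>j. s * cartan j i", OF assms] by (simp add: kpow_def)
qed

lemma abs_uq_eq_iff: "abs_uq p = abs_uq r \<longleftrightarrow> p - r \<in> relation_ideal" by (rule uq.abs_eq_iff)

lemma abs_uq_add: "abs_uq (p + r) = abs_uq p + abs_uq r" by (simp add: plus_uq.abs_eq)

lemma abs_uq_diff: "abs_uq (p - r) = abs_uq p - abs_uq r" by (simp add: minus_uq.abs_eq)

lemma abs_uq_mult: "abs_uq (p * r) = abs_uq p * abs_uq r" by (simp add: times_uq.abs_eq)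

lemma abs_uq_psc: "abs_uq (psc c p) = uscale c (abs_uq p)" by (simp add: uscale.abs_eq psc_fscalar)

lemma abs_uq_0: "abs_uq 0 = 0" by (simp add: zero_uq.abs_eq)

lemma abs_uq_1: "abs_uq 1 = 1" by (simp add: one_uq.abs_eq)

lemma abs_rep_uq [simp]: "abs_uq (rep_uq u) = u" by (rule Quotient_abs_rep[OF Quotient_uq])

lemma uq_cases: obtains p where "u = abs_uq p" using abs_rep_uq by metis

lemma abs_uq_power: "abs_uq (p ^ n) = abs_uq p ^ n" by (induction n) (simp_all add: abs_uq_1 abs_uq_mult)

lemma abs_uq_gen: "abs_uq (fT i) = uT i" "abs_uq (fTinv i) = uTinv i" "abs_uq (fE i) = uE i"
    "abs_uq (fF i) = uF i" by (simp_all add: uT.abs_eq uTinv.abs_eq uE.abs_eq uF.abs_eq)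

lemma abs_uq_kpow: "abs_uq (kpow fT fTinv i s) = kpow uT uTinv (i :: 'i::cartan_datum) s"
proof -
  have "abs_uq (ipow (fT j) (fTinv j) n) = ipow (uT j) (uTinv j) n" for j :: 'i and n
    by (simp add: ipow_def abs_uq_power abs_uq_gen)
  then have "abs_uq (prod_list (map (\<lambda>j. ipow (fT j) (fTinv j) (s * cartan j i)) js)) =
      prod_list (map (\<lambda>j. ipow (uT j) (uTinv j) (s * cartan j i)) js)" for js
    by (induction js) (simp_all add: abs_uq_1 abs_uq_mult del: of_int_mult)
  then show ?thesis by (simp add: kpow_def)
qed

lemma abs_uq_relator: "p \<in> relators ==> abs_uq p = 0"
  using abs_uq_eq_iff[of p 0] by (simp add: abs_uq_0 relation_ideal.relator)

lemma uT_inv [simp]: "uT i * uTinv i = 1" "uTinv i * uT i = 1"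
  using abs_uq_relator[OF relators.intros(1)[of i]] abs_uq_relator[OF relators.intros(2)[of i]]
  by (simp_all add: abs_uq_diff abs_uq_mult abs_uq_gen abs_uq_1)

lemma uT_inv_left [simp]: "uT i * (uTinv i * x) = x" "uTinv i * (uT i * x) = x" by (simp_all flip: mult.assoc)

lemma uT_comm: "uT i * uT j = uT j * uT i" using abs_uq_relator[OF relators.intros(3)[of i j]]
  by (simp add: abs_uq_diff abs_uq_mult abs_uq_gen)

text \<open>Commutation up to a power of \<open>q\<close>, in the form required by
  \<open>torus_rule\<close>.\<close>

definition qcomm :: "'i::cartan_datum uq => 'i uq => rat => bool"
  where "qcomm a b x \<longleftrightarrow> a * b = uscale (qpow x) (b * a)"

lemma qcomm_1: "qcomm 1 b 0" by (simp add: qcomm_def)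

lemma qcomm_mult: "qcomm a b x ==> qcomm a' b y ==> qcomm (a * a') b (x + y)"
proof -
  assume 1: "qcomm a b x" and 2: "qcomm a' b y"
  have "a * a' * b = uscale (qpow y) (a * b * a')" using 2 by (simp add: qcomm_def mult.assoc uscale_mult_right)
  also have "a * b * a' = uscale (qpow x) (b * a) * a'" using 1 by (simp only: qcomm_def)
  finally show ?thesis
    using 1 by (simp add: qcomm_def qpow_add uscale_mult_left mult.assoc mult.commute[of "qpow x"])
qed

lemma qcomm_inverse:
  assumes "qcomm a b x" "a * a' = 1" "a' * a = 1"
  shows "qcomm a' b (- x)"
proof -
  have "a' * b = a' * (b * a) * a'" using assms(2) by (simp add: mult.assoc)
  also have "b * a = uscale (qpow (- x)) (a * b)" using assms(1) by (simp add: qcomm_def)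
  also have "a' * uscale (qpow (- x)) (a * b) * a' = uscale (qpow (- x)) (a' * a * b * a')"
    by (simp add: us_mult mult.assoc)
  finally show ?thesis using assms(3) by (simp add: qcomm_def)
qed

lemma qcomm_mult_right: "qcomm a b x ==> qcomm a b' y ==> qcomm a (b * b') (x + y)"
proof -
  assume 1: "qcomm a b x" and 2: "qcomm a b' y"
  have "a * (b * b') = uscale (qpow x) (b * (a * b'))"
    using 1 by (simp add: qcomm_def uscale_mult_left flip: mult.assoc)
  then show ?thesis using 2 by (simp add: qcomm_def qpow_add uscale_mult_right mult.assoc)
qed

lemma qcomm_T_T: "qcomm (uT i) (uT j) 0" by (simp add: qcomm_def uT_comm)

lemma qcomm_T_E: "qcomm (uT i) (uE j) (symm i * of_bool (i = j))"
proof -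
  have "uT i * uE j * uTinv i = uscale (qpow (symm i * of_bool (i = j))) (uE j)"
    using abs_uq_relator[OF relators.intros(4)[of i j]]
    by (simp add: abs_uq_diff abs_uq_mult abs_uq_gen abs_uq_psc flip: psc_fscalar)
  then have "uT i * uE j * uTinv i * uT i = uscale (qpow (symm i * of_bool (i = j))) (uE j) * uT i" by simp
  then show ?thesis by (simp add: qcomm_def mult.assoc uscale_mult_left)
qed

lemma qcomm_T_F: "qcomm (uT i) (uF j) (- (symm i * of_bool (i = j)))"
proof -
  have "uT i * uF j * uTinv i = uscale (qpow (- (symm i * of_bool (i = j)))) (uF j)"
    using abs_uq_relator[OF relators.intros(5)[of i j]]
    by (simp add: abs_uq_diff abs_uq_mult abs_uq_gen abs_uq_psc flip: psc_fscalar)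
  then have "uT i * uF j * uTinv i * uT i = uscale (qpow (- (symm i * of_bool (i = j)))) (uF j) * uT i" by simp
  then show ?thesis by (simp add: qcomm_def mult.assoc uscale_mult_left)
qed

lemmas qcomm_Tinv_E = qcomm_inverse[OF qcomm_T_E uT_inv]
lemmas qcomm_Tinv_F = qcomm_inverse[OF qcomm_T_F uT_inv]
lemmas qcomm_Tinv_T = qcomm_inverse[OF qcomm_T_T uT_inv]

lemma kpow_E: "qcomm (kpow uT uTinv i s) (uE j) (of_int s * rpair i (simple_root j))"
proof (rule kpow_rule[of "\<lambda>a. qcomm a (uE j)"])
  show "qcomm (uT k) (uE j) (symm k * simple_root j k)" "qcomm (uTinv k) (uE j) (- (symm k * simple_root j k))" for k
    using qcomm_T_E[of k j] qcomm_Tinv_E[of k j] by (simp_all only: simple_root_def)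
qed (fact qcomm_1, fact qcomm_mult)

lemma kpow_F: "qcomm (kpow uT uTinv i s) (uF j) (- (of_int s * rpair i (simple_root j)))"
proof -
  have "qcomm (kpow uT uTinv i s) (uF j) (of_int s * rpair i (- simple_root j))"
  proof (rule kpow_rule[of "\<lambda>a. qcomm a (uF j)"])
    show "qcomm (uT k) (uF j) (symm k * (- simple_root j) k)" "qcomm (uTinv k) (uF j) (- (symm k * (- simple_root j) k))" for k
      using qcomm_T_F[of k j] qcomm_Tinv_F[of k j] by (simp_all only: simple_root_def uminus_apply mult_minus_right)
  qed (fact qcomm_1, fact qcomm_mult)
  then show ?thesis by (simp add: rpair_minus)
qed

lemma uTinv_comm: "uTinv i * uT j = uT j * uTinv i" "uTinv i * uTinv j = uTinv j * uTinv i"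
proof -
  show 1: "uTinv i * uT j = uT j * uTinv i" for i j :: 'a using qcomm_Tinv_T[of i j] by (simp add: qcomm_def)
  have "qcomm (uTinv j) (uTinv i) (- 0)" by (rule qcomm_inverse[OF _ uT_inv]) (simp add: qcomm_def 1)
  then show "uTinv i * uTinv j = uTinv j * uTinv i" by (simp add: qcomm_def)
qed

lemma subalgebra_hull: "subalgebra (subalgebra hull S)"
  by (rule hull_in) (simp add: subalgebra_def U.subspace_Inter)

lemma subalgebra_Uzero: "subalgebra Uzero" and subalgebra_Uplus: "subalgebra Uplus"
    and subalgebra_Uminus: "subalgebra Uminus" by (simp_all add: Uzero_def Uplus_def Uminus_def subalgebra_hull)

lemma subalgebraD:
  assumes "subalgebra A"
  shows "0 \<in> A" "1 \<in> A" "x \<in> A ==> y \<in> A ==> x + y \<in> A" "x \<in> A ==> y \<in> A ==> x * y \<in> A"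
    "x \<in> A ==> uscale c x \<in> A" "x \<in> A ==> y \<in> A ==> x - y \<in> A" "x \<in> A ==> - x \<in> A"
  using assms unfolding subalgebra_def
  by (auto simp: U.subspace_0 U.subspace_add U.subspace_scale U.subspace_diff U.subspace_neg)

lemma uT_Uzero [simp]: "uT i \<in> Uzero" and uTinv_Uzero [simp]: "uTinv i \<in> Uzero"
  unfolding Uzero_def by (rule hull_inc, simp)+

lemma Uzero_induct [consumes 1, case_names 1 T Tinv add scale mult]:
  assumes "x \<in> Uzero" "Q 1" "\<And>i. Q (uT i)" "\<And>i. Q (uTinv i)"
    and "\<And>x y. x \<in> Uzero ==> y \<in> Uzero ==> Q x ==> Q y ==> Q (x + y)"
    and "\<And>c x. x \<in> Uzero ==> Q x ==> Q (uscale c x)"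
    and "\<And>x y. x \<in> Uzero ==> y \<in> Uzero ==> Q x ==> Q y ==> Q (x * y)"
  shows "Q x"
proof -
  note Z = subalgebraD[OF subalgebra_Uzero]
  have "Q 0" using assms(6)[OF Z(2) assms(2), of 0] by simp
  then have "subalgebra {x \<in> Uzero. Q x}" unfolding subalgebra_def U.subspace_def using assms by (auto simp: Z)
  moreover have "range uT \<union> range uTinv \<subseteq> {x \<in> Uzero. Q x}" using assms by auto
  ultimately have "Uzero \<subseteq> {x \<in> Uzero. Q x}" unfolding Uzero_def by (rule hull_minimal[rotated])
  then show ?thesis using assms(1) by blast
qed

lemma Uzero_commute: "x \<in> Uzero ==> y \<in> Uzero ==> x * y = y * x"
proof (induction arbitrary: y rule: Uzero_induct)
  case (T i)
  show ?case
    using T by (induction rule: Uzero_induct) (simp_all add: uT_comm[of i] distrib_left distrib_right us_mult uTinv_comm, metis mult.assoc)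
next
  case (Tinv i)
  show ?case
    using Tinv by (induction rule: Uzero_induct) (simp_all add: uTinv_comm(1)[of i] uTinv_comm(2)[of i] distrib_left distrib_right us_mult, metis mult.assoc)
next
  case (mult a b)
  then show ?case by (metis mult.assoc)
qed (simp_all add: distrib_left distrib_right us_mult)

lemma ipow_add:
  assumes "x * y = (1 :: 'b::monoid_mult)" "y * x = 1"
  shows "ipow x y (m + n) = ipow x y m * ipow x y n"
proof -
  have s: "ipow x y (m + 1) = ipow x y m * x" for m
  proof (cases "0 \<le> m")
    case True
    then show ?thesis by (simp add: ipow_def nat_add_distrib power_commutes)
  next
    case False
    then have "nat (- m) = Suc (nat (- (m + 1)))" by simp
    then show ?thesis
      using False assms by (cases "m + 1 = 0") (auto simp: ipow_def power_Suc2 mult.assoc simp del: power_Suc)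
  qed
  have p: "ipow x y (m - 1) = ipow x y m * y" for m using s[of "m - 1"] assms by (simp add: mult.assoc)
  show ?thesis
  proof (induction n rule: int_induct[where k = 0])
    case base
    then show ?case by (simp add: ipow_def)
  next
    case (step1 n)
    then show ?case using s[of "m + n"] s[of n] by (simp add: add.assoc mult.assoc)
  next
    case (step2 n)
    then show ?case using p[of "m + n"] p[of n] by (simp add: add_diff_eq mult.assoc)
  qed
qed

section \<open>Monomials in the torus generators\<close>

definition tmon :: "('i::cartan_datum => int) => 'i uq"
  where "tmon n = prod_list (map (\<lambda>j. ipow (uT j) (uTinv j) (n j)) (sorted_list_of_set UNIV))"

lemma tmon_single: "tmon (\<lambda>j. if j = i then k else 0) = ipow (uT i) (uTinv i) k"
proof -
  have "prod_list (map (\<lambda>j. ipow (uT j) (uTinv j) (if j = i then k else 0)) js) = (if i \<in> set js then ipow (uT i) (uTinv i) k else 1)"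
    if "distinct js" for js using that by (induction js) (auto simp: ipow_def)
  from this[of "sorted_list_of_set UNIV"] show ?thesis by (simp add: tmon_def)
qed

lemma tmon_0: "tmon (\<lambda>_. 0) = 1" using tmon_single[of _ 0] by (simp add: ipow_def)

lemma tmon_rule:
  assumes "R 1 0" and "\<And>a b x y. R a x ==> R b y ==> R (a * b) (x + y)"
    and "\<And>j. R (uT j) (symm j * l j)" and "\<And>j. R (uTinv j) (- (symm j * l j))"
  shows "R (tmon n) (\<Sum>j\<in>UNIV. of_int (n j) * (symm j * l j))"
  using torus_rule[of R uT l uTinv n, OF assms] by (simp add: tmon_def)

lemma tmon_Uzero [simp]: "tmon n \<in> Uzero"
  by (rule tmon_rule[of "\<lambda>a _. a \<in> Uzero" "\<lambda>_. 0"]) (simp_all add: subalgebraD[OF subalgebra_Uzero])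

lemma tmon_add: "tmon (\<lambda>j. n j + m j) = tmon n * tmon m"
proof -
  let ?P = "\<lambda>n js. prod_list (map (\<lambda>j. ipow (uT j) (uTinv j) (n j)) js)"
  have I: "ipow (uT j) (uTinv j) k \<in> Uzero" for j :: 'a and k unfolding tmon_single[symmetric] by simp
  have Z: "?P n js \<in> Uzero" for n :: "'a => int" and js
    by (induction js) (simp_all add: subalgebraD[OF subalgebra_Uzero] I)
  have "?P (\<lambda>j. n j + m j) js = ?P n js * ?P m js" for js
  proof (induction js)
    case (Cons j js)
    have "?P (\<lambda>j. n j + m j) (j # js) = ipow (uT j) (uTinv j) (n j) * (ipow (uT j) (uTinv j) (m j) * ?P n js) * ?P m js"
      by (simp only: list.map prod_list.Cons Cons ipow_add[OF uT_inv, of j] mult.assoc)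
    also have "ipow (uT j) (uTinv j) (m j) * ?P n js = ?P n js * ipow (uT j) (uTinv j) (m j)"
      by (rule Uzero_commute[OF I Z])
    finally show ?case by (simp add: mult.assoc)
  qed simp
  then show ?thesis by (simp add: tmon_def)
qed

lemma kpow_tmon: "kpow uT uTinv i s = tmon (\<lambda>j. s * cartan j i)" by (simp add: kpow_def tmon_def)

lemma uK_Uzero [simp]: "uK i \<in> Uzero" and uKinv_Uzero [simp]: "uKinv i \<in> Uzero"
  by (simp_all add: uK_def uKinv_def kpow_tmon)

lemma tmon_E: "qcomm (tmon n) (uE i) (\<Sum>j\<in>UNIV. of_int (n j) * (symm j * simple_root i j))"
  using qcomm_T_E[of _ i] qcomm_Tinv_E[of _ i]
  by (intro tmon_rule[of "\<lambda>a. qcomm a (uE i)"] qcomm_1 qcomm_mult) (simp_all only: simple_root_def)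

lemma tmon_F: "qcomm (tmon n) (uF i) (\<Sum>j\<in>UNIV. of_int (n j) * (symm j * - simple_root i j))"
  using qcomm_T_F[of _ i] qcomm_Tinv_F[of _ i]
  by (intro tmon_rule[of "\<lambda>a. qcomm a (uF i)"] qcomm_1 qcomm_mult) (simp_all only: simple_root_def mult_minus_right)

lemma uK_inv [simp]: "uK i * uKinv i = 1" "uKinv i * uK i = 1"
  by (simp_all add: uK_def uKinv_def kpow_tmon tmon_0 flip: tmon_add)

lemma uK_inv_left [simp]: "uK i * (uKinv i * x) = x" "uKinv i * (uK i * x) = x" by (simp_all flip: mult.assoc)

lemma uE_uF: "uE i * uF j = uF j * uE i + uscale (of_bool (i = j) / qden i) (uK i - uKinv i)"
proof -
  have "uE i * uF j - uF j * uE i - uscale (of_bool (i = j) / qden i) (uK i - uKinv i) = 0"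
    using abs_uq_relator[OF relators.intros(6)[of i j]]
    by (simp only: abs_uq_diff abs_uq_mult abs_uq_gen abs_uq_kpow uK_def uKinv_def qden_def abs_uq_psc
        flip: psc_fscalar)
  then have "uE i * uF j - uF j * uE i = uscale (of_bool (i = j) / qden i) (uK i - uKinv i)" by simp
  then show ?thesis by (metis add.commute diff_eq_eq)
qed

lemma uK_E: "uK i * uE j = uscale (qpow (rpair i (simple_root j))) (uE j * uK i)"
  using kpow_E[of i 1 j] by (simp add: qcomm_def uK_def)

lemma uKinv_E: "uKinv i * uE j = uscale (qpow (- rpair i (simple_root j))) (uE j * uKinv i)"
  using kpow_E[of i "- 1" j] by (simp add: qcomm_def uKinv_def)

lemma uK_F: "uK i * uF j = uscale (qpow (- rpair i (simple_root j))) (uF j * uK i)"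
  using kpow_F[of i 1 j] by (simp add: qcomm_def uK_def)

lemma uKinv_F: "uKinv i * uF j = uscale (qpow (rpair i (simple_root j))) (uF j * uKinv i)"
  using kpow_F[of i "- 1" j] by (simp add: qcomm_def uKinv_def)

section \<open>Evaluation of free algebra elements in the quantized algebra\<close>

definition ev :: "('g => 'i::cartan_datum uq) => ('g monoword \<Rightarrow>\<^sub>0 qfield) => 'i uq"
  where "ev x p = act uscale (\<lambda>i. (*) (x i)) p 1"

global_interpretation ev: free_action uscale "\<lambda>i. (*) (x i :: 'i::cartan_datum uq)" for x
  by unfold_locales (simp_all add: distrib_left uscale_mult_right)

lemma ev_act: "act uscale (\<lambda>i. (*) (x i)) p u = ev x p * u"
proof -
  have "foldr (\<lambda>i. (*) (x i)) w u = foldr (\<lambda>i. (*) (x i)) w 1 * u" for w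
    by (induction w) (simp_all add: mult.assoc)
  then show ?thesis by (induction p rule: free_induct)
      (simp_all add: ev_def ev.act_add ev.act_psc distrib_right uscale_mult_left)
qed

lemma ev_mult: "ev x (p * r) = ev x p * ev x r" by (metis ev_def ev.act_mult ev_act)

lemma lin_ev: "lin psc uscale (ev x)" unfolding ev_def by (rule ev.lin_act_left)

lemmas ev_simps [simp] = lin_add[OF lin_ev] lin_scale[OF lin_ev] lin_0[OF lin_ev]
  lin_diff[OF lin_ev] lin_neg[OF lin_ev]
lemmas ev_sum = lin_sum[OF lin_ev]

lemma ev_1 [simp]: "ev x 1 = 1" by (simp add: ev_def)

lemma ev_Nil [simp]: "ev x (mono []) = 1" by (simp add: mono_Nil)

lemma ev_single [simp]: "ev x (mono [i]) = x i" by (simp add: ev_def)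

lemma ev_Cons: "ev x (mono (i # w)) = x i * ev x (mono w)" by (simp add: ev_def)

lemma act_fgen: "free_action sc op ==> act sc op (fgen g) x = op g x"
  using free_action.act_mono[of sc op "[g]" x] by (simp add: fgen_def)

text \<open>The map \<open>h\<close> selects the generators that serve as letters, so one statement
  covers the relations for \<open>e\<close> and for \<open>f\<close>, and also their images under
  structure maps.\<close>

lemma act_serre:
  assumes "free_action sc op"
  shows "act sc op (serre (\<lambda>i. fgen (h i)) i j) x = act sc (\<lambda>i. op (h i)) (serre_elt i j) x"
proof -
  interpret a: free_action sc op by fact
  interpret b: free_action sc "\<lambda>i. op (h i)"
    by (intro free_action.intro free_action_axioms.intro a.qspace_axioms a.lin_op)
  have *: "act sc op (fgen (h i) ^ m) x = ((op (h i)) ^^ m) x" for i m x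
    by (simp add: a.act_power act_fgen[OF assms, abs_def])
  have **: "foldr (\<lambda>i. op (h i)) (replicate m i) x = ((op (h i)) ^^ m) x" for i m x by (induction m) simp_all
  show ?thesis unfolding serre_def serre_elt_def Let_def a.act_sum b.act_sum psc_fscalar[symmetric]
    by (simp add: a.act_psc b.act_psc a.act_mult * ** act_fgen[OF assms])
qed

definition gen_uq :: "'i::cartan_datum gen => 'i uq"
  where "gen_uq g = (case g of GenT i => uT i | GenTinv i => uTinv i | GenE i => uE i | GenF i => uF i)"

lemma gen_uq_simps [simp]: "gen_uq (GenT i) = uT i" "gen_uq (GenTinv i) = uTinv i"
    "gen_uq (GenE i) = uE i" "gen_uq (GenF i) = uF i" by (simp_all add: gen_uq_def)

lemma abs_uq_ev: "abs_uq p = ev gen_uq p"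
proof (induction p rule: free_induct)
  case (single w c)
  have "abs_uq (mono w) = ev gen_uq (mono w)"
  proof (induction w)
    case Nil
    then show ?case by (simp add: mono_Nil abs_uq_1)
  next
    case (Cons g w)
    have "abs_uq (fgen g) = gen_uq g" by (cases g) (simp_all add: abs_uq_gen)
    then show ?case using Cons by (simp add: mono_Cons[of g w] abs_uq_mult ev_mult fgen_def)
  qed
  then show ?case by (simp add: abs_uq_psc)
qed (simp add: abs_uq_add)

lemma ev_serre:
  assumes "i \<noteq> j"
  shows "ev uE (serre_elt i j) = 0" "ev uF (serre_elt i j) = 0"
proof -
  have "ev gen_uq (serre fE i j) = ev uE (serre_elt i j)" "ev gen_uq (serre fF i j) = ev uF (serre_elt i j)"
    unfolding ev_def by (subst act_serre, rule ev.free_action_axioms, simp)+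
  then show "ev uE (serre_elt i j) = 0" "ev uF (serre_elt i j) = 0"
    using abs_uq_relator[OF relators.intros(7)[OF assms]] abs_uq_relator[OF relators.intros(8)[OF assms]]
    by (simp_all add: abs_uq_ev)
qed

section \<open>Verma modules\<close>

text \<open>The operator \<open>e_i\<close> is commuted through the word and kills the empty word at
  its end; each letter \<open>i\<close> that it meets contributes a bracket determined by the weight
  of the letters behind.\<close>

primrec eword :: "('i::cartan_datum => rat) => 'i => 'i list => 'i tens"
  where "eword l i [] = 0"
  | "eword l i (j # w) = mono [j] * eword l i w +
      (if i = j then psc (qbracket i (rpair i (l - wt w))) (mono w) else 0)"

text \<open>The operators on the free algebra that define a Verma module of the quantized enveloping
  algebra without Serre relations, with the empty word as highest weight vector.\<close>

definition vop :: "('i::cartan_datum => rat) => 'i gen => 'i tens => 'i tens"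
  where "vop l g p = (case g of
      GenT i => lx psc (\<lambda>w. psc (qpow (symm i * (l i - wt w i))) (mono w)) p
    | GenTinv i => lx psc (\<lambda>w. psc (qpow (- (symm i * (l i - wt w i)))) (mono w)) p
    | GenE i => lx psc (eword l i) p
    | GenF i => mono [i] * p)"

lemma vop_F [simp]: "vop l (GenF i) p = mono [i] * p" by (simp add: vop_def)

lemma vop_E_mono: "vop l (GenE i) (mono w) = eword l i w" by (simp add: vop_def)

lemma lin_vop: "lin psc psc (vop n g)"
proof -
  note l = lin_add[OF PQ.lin_lx] lin_scale[OF PQ.lin_lx]
  show ?thesis by (cases g) (rule linT; simp add: vop_def l distrib_left psc_mult_right)+
qed

lemmas vop_simps [simp] = lin_add[OF lin_vop] lin_scale[OF lin_vop] lin_0[OF lin_vop]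
  lin_diff[OF lin_vop] lin_neg[OF lin_vop]

global_interpretation vm: free_action psc "vop \<nu>" for \<nu>
  by (intro free_action.intro free_action_axioms.intro PQ.qspace_axioms lin_vop)

global_interpretation vme: free_action psc "\<lambda>i. vop \<nu> (GenE i)" for \<nu>
  by (intro free_action.intro free_action_axioms.intro PQ.qspace_axioms lin_vop)

lemma vop_T: "p \<in> Tw b ==> vop l (GenT i) p = psc (qpow (symm i * (l i - b i))) p"
  by (induction p rule: Tw_induct) (auto simp: vop_def mult.commute P.scale_right_distrib PQ.lx_add lin_0[OF PQ.lin_lx])

lemma vop_Tinv: "p \<in> Tw b ==> vop l (GenTinv i) p = psc (qpow (- (symm i * (l i - b i)))) p"
  by (induction p rule: Tw_induct) (auto simp: vop_def mult.commute P.scale_right_distrib PQ.lx_add lin_0[OF PQ.lin_lx])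

lemma vop_E_1 [simp]: "vop l (GenE i) 1 = 0" using vop_E_mono[of l i "[]"] by (simp add: mono_Nil)

lemma vop_E_Cons:
  assumes "p \<in> Tw b"
  shows "vop l (GenE i) (mono [j] * p) = mono [j] * vop l (GenE i) p +
    (if i = j then psc (qbracket i (rpair i (l - b))) p else 0)" using assms
proof (induction p rule: Tw_induct)
  case (word w c)
  have "vop l (GenE i) (mono [j] * mono w) = mono [j] * vop l (GenE i) (mono w) +
    (if i = j then psc (qbracket i (rpair i (l - b))) (mono w) else 0)"
    unfolding mono_Cons[of j w, symmetric] vop_E_mono using word by simp
  then show ?case by (simp add: psc_mult_right P.scale_right_distrib mult.commute)
qed (auto simp: distrib_left P.scale_right_distrib)

text \<open>The bridge between raising operators and skew derivations: the commutator of
  \<open>e_i\<close> with \<open>f_i\<close> contains \<open>k_i\<close> and its inverse, and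
  collecting the two kinds of contributions gives \<open>rder\<close> and
  \<open>lder\<close>.\<close>

lemma vop_E_der:
  assumes "p \<in> Tw b"
  shows "vop n (GenE i) p = psc (1 / qden i) (psc (qpow (rpair i n)) (rder i p) -
    psc (qpow (rpair i (b - n) - rpair i (simple_root i))) (lder i p))" using assms
proof (induction p rule: Tw_induct)
  case (word w c)
  have "vop n (GenE i) (mono w) = psc (1 / qden i) (psc (qpow (rpair i n)) (rder i (mono w)) -
    psc (qpow (rpair i (wt w - n) - rpair i (simple_root i))) (lder i (mono w)))"
  proof (induction w)
    case Nil
    then show ?case by (simp add: mono_Nil)
  next
    case (Cons j w)
    have r: "rder i (mono (j # w)) = mono [j] * rder i (mono w) + (if j = i then psc (qpow (- rpair i (wt w))) (mono w) else 0)"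
      unfolding mono_Cons[of j w] by (rule rder_Cons[OF mono_Tw])
    have l: "lder i (mono (j # w)) = (if j = i then mono w else 0) + psc (qpow (- rpair i (simple_root j))) (mono [j] * lder i (mono w))"
      unfolding mono_Cons[of j w] by (rule lder_Cons)
    have e: "vop n (GenE i) (mono (j # w)) = mono [j] * vop n (GenE i) (mono w) +
        (if i = j then psc (qbracket i (rpair i (n - wt w))) (mono w) else 0)"
      unfolding mono_Cons[of j w] by (rule vop_E_Cons[OF mono_Tw])
    have 1: "qpow (rpair i (wt (j # w) - n) - rpair i (simple_root i)) * qpow (- rpair i (simple_root j)) =
        qpow (rpair i (wt w - n) - rpair i (simple_root i))"
      "qpow (- rpair i (simple_root j)) * qpow (rpair i (wt (j # w) - n) - rpair i (simple_root i)) =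
        qpow (rpair i (wt w - n) - rpair i (simple_root i))"
      by (simp_all add: wt_Cons rpair_diff rpair_add flip: qpow_add)
    have 2: "psc (1 / qden i) (psc (qpow (rpair i n) * qpow (- rpair i (wt w))) (mono w) -
        psc (qpow (rpair i (wt (i # w) - n) - rpair i (simple_root i))) (mono w)) =
        psc (qbracket i (rpair i (n - wt w))) (mono w)" by (simp add: wt_Cons rpair_diff rpair_add qbracket_def
          flip: qpow_add P.scale_left_diff_distrib)
    show ?case
    proof (cases "j = i")
      case True
      show ?thesis unfolding e Cons r l 2[symmetric] using True
        by (simp add: P.scale_right_distrib P.scale_right_diff_distrib psc_mult_right right_diff_distrib
            1[unfolded True] algebra_simps)
    next
      case False
      then show ?thesis unfolding e Cons r l
        by (simp add: P.scale_right_distrib P.scale_right_diff_distrib psc_mult_right right_diff_distrib 1)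
    qed
  qed
  then show ?case using word by (simp add: P.scale_right_diff_distrib mult.commute mult.left_commute)
qed (simp_all add: P.scale_right_distrib P.scale_right_diff_distrib)

lemma vop_E_Tw: "p \<in> Tw b ==> vop l (GenE i) p \<in> Tw (b - simple_root i)"
  by (subst vop_E_der, assumption) (simp add: lder_Tw rder_Tw)

lemma vop_F_Tw: "p \<in> Tw b ==> mono [i] * p \<in> Tw (simple_root i + b)"
  using Tw_mult[OF mono_Tw[of "[i]"]] by (simp add: wt_Cons)

lemma vme_Tw: "a \<in> Tw \<alpha> ==> p \<in> Tw b ==> vme.A l a p \<in> Tw (b - \<alpha>)"
proof (induction a rule: Tw_induct)
  case (word w c)
  have "foldr (\<lambda>i. vop l (GenE i)) w p \<in> Tw (b - wt w)"
  proof (induction w)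
    case (Cons i w)
    then show ?case using vop_E_Tw[OF Cons, of l i] by (simp add: wt_Cons algebra_simps)
  qed (use word in simp)
  then show ?case using word by (simp add: vme.act_psc)
qed (simp_all add: vme.act_add)

lemma vm_kpow: "p \<in> Tw B ==> act psc (vop l) (kpow fT fTinv i s) p = psc (qpow (of_int s * rpair i (l - B))) p"
proof (rule kpow_rule[of "\<lambda>a x. act psc (vop l) a p = psc (qpow x) p"])
  assume p: "p \<in> Tw B"
  show "act psc (vop l) (fT j) p = psc (qpow (symm j * (l - B) j)) p"
    "act psc (vop l) (fTinv j) p = psc (qpow (- (symm j * (l - B) j))) p" for j
    by (simp_all only: act_fgen[OF vm.free_action_axioms] vop_T[OF p] vop_Tinv[OF p] minus_apply)
  show "act psc (vop l) (a * b) p = psc (qpow (x + y)) p"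
    if "act psc (vop l) a p = psc (qpow x) p" "act psc (vop l) b p = psc (qpow y) p" for a b x y
    using that by (simp add: vm.act_mult lin_scale[OF vm.lin_act] qpow_add mult.commute)
qed simp

text \<open>Counterpart of \<open>vop_E_der\<close> with the roles exchanged: a polynomial
  \<open>a\<close> in raising operators is moved past one letter \<open>k\<close>, and the error
  terms are the skew derivatives of \<open>a\<close>.\<close>

lemma vme_comm:
  assumes "a \<in> Tw \<alpha>" "y \<in> Tw g"
  shows "vme.A n a (mono [k] * y) = mono [k] * vme.A n a y +
    psc (1 / qden k) (psc (qpow (rpair k (n - g + \<alpha> - simple_root k))) (vme.A n (lder k a) y) -
      psc (qpow (- rpair k (n - g))) (vme.A n (rder k a) y))" using assms(1)
proof (induction a rule: Tw_induct)
  case (word w c)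
  have "vme.A n (mono w) (mono [k] * y) = mono [k] * vme.A n (mono w) y +
    psc (1 / qden k) (psc (qpow (rpair k (n - g + wt w - simple_root k))) (vme.A n (lder k (mono w)) y) -
      psc (qpow (- rpair k (n - g))) (vme.A n (rder k (mono w)) y))"
  proof (induction w)
    case Nil
    then show ?case by (simp add: mono_Nil)
  next
    case (Cons j w)
    let ?e = "vop n (GenE j)" and ?z = "vme.A n (mono w) y"
    have z: "?z \<in> Tw (g - wt w)" by (rule vme_Tw[OF mono_Tw assms(2)])
    have A: "vme.A n (mono [j] * a) x = ?e (vme.A n a x)" for a x by (simp add: vme.act_mult)
    have r: "rder k (mono (j # w)) = mono [j] * rder k (mono w) + (if j = k then psc (qpow (- rpair k (wt w))) (mono w) else 0)"
      unfolding mono_Cons[of j w] by (rule rder_Cons[OF mono_Tw])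
    have l: "lder k (mono (j # w)) = (if j = k then mono w else 0) + psc (qpow (- rpair k (simple_root j))) (mono [j] * lder k (mono w))"
      unfolding mono_Cons[of j w] by (rule lder_Cons)
    have 1: "vme.A n (mono (j # w)) (mono [k] * y) = mono [k] * ?e ?z +
        (if j = k then psc (qbracket k (rpair k (n - g + wt w))) ?z else 0) +
        psc (1 / qden k) (psc (qpow (rpair k (n - g + wt w - simple_root k))) (?e (vme.A n (lder k (mono w)) y)) -
          psc (qpow (- rpair k (n - g))) (?e (vme.A n (rder k (mono w)) y)))"
    proof -
      have "vme.A n (mono (j # w)) (mono [k] * y) = ?e (vme.A n (mono w) (mono [k] * y))" by simp
      also have "\<dots> = ?e (mono [k] * ?z) + ?e (psc (1 / qden k) (psc (qpow (rpair k (n - g + wt w - simple_root k))) (vme.A n (lder k (mono w)) y) -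
          psc (qpow (- rpair k (n - g))) (vme.A n (rder k (mono w)) y)))"
        unfolding Cons by (rule lin_add[OF lin_vop])
      also have "?e (mono [k] * ?z) = mono [k] * ?e ?z +
          (if j = k then psc (qbracket k (rpair k (n - g + wt w))) ?z else 0)"
        by (subst vop_E_Cons[OF z]) (simp add: algebra_simps)
      finally show ?thesis by simp
    qed
    have 2: "qpow (rpair k (n - g + wt (j # w) - simple_root k)) * qpow (- rpair k (simple_root j)) =
        qpow (rpair k (n - g + wt w - simple_root k))" by (simp add: wt_Cons rpair_diff rpair_add flip: qpow_add)
    have 3: "psc (qbracket k (rpair k (n - g + wt w))) ?z =
       psc (1 / qden k) (psc (qpow (rpair k (n - g + wt (k # w) - simple_root k))) ?z -
          psc (qpow (- rpair k (n - g))) (psc (qpow (- rpair k (wt w))) ?z))"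
      by (simp add: wt_Cons rpair_diff rpair_add qbracket_def
          flip: qpow_add P.scale_left_diff_distrib)
    have 4: "vme.A n (lder k (mono (j # w))) y = (if j = k then ?z else 0) +
        psc (qpow (- rpair k (simple_root j))) (?e (vme.A n (lder k (mono w)) y))"
      unfolding l by (simp only: vme.act_add vme.act_psc A) simp
    have 5: "vme.A n (rder k (mono (j # w))) y = ?e (vme.A n (rder k (mono w)) y) +
        (if j = k then psc (qpow (- rpair k (wt w))) ?z else 0)"
      unfolding r by (simp add: vme.act_add vme.act_psc A)
    have 6: "vme.A n (mono (j # w)) y = ?e ?z" by simp
    show ?case
    proof (cases "j = k")
      case True
      then show ?thesis unfolding 1 4 5 6 3
        by (simp only: if_True P.scale_right_distrib P.scale_right_diff_distrib P.scale_scale 2[unfolded True])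
          (simp add: algebra_simps)
    next
      case False
      then show ?thesis unfolding 1 4 5 6 by (simp add: 2)
    qed
  qed
  then show ?case
    using word by (simp add: vme.act_psc P.scale_right_diff_distrib P.scale_right_distrib mult.commute mult.left_commute psc_mult_right)
qed (simp_all add: vme.act_add P.scale_right_distrib P.scale_right_diff_distrib distrib_left)

lemma vme_word_1: "w \<noteq> [] ==> vme.A l (mono w) 1 = 0"
  by (induction w) (auto, metis foldr_Nil foldr.simps(1) id_apply lin_0 lin_vop vop_E_1)

text \<open>The raising Serre relations hold on the free algebra before any quotient is taken: by
  \<open>vme_comm\<close> the Serre elements commute with multiplication by letters, and they
  annihilate the highest weight vector.\<close>

lemma vme_serre:
  assumes "i \<noteq> j"
  shows "vme.A l (serre_elt i j) x = 0"
proof (induction x rule: free_induct)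
  case (single w c)
  have "vme.A l (serre_elt i j) (mono w) = 0"
  proof (induction w)
    case Nil
    show ?case unfolding serre_elt_def Let_def vme.act_sum mono_Nil
      by (intro sum.neutral ballI) (simp only: vme.act_psc vme_word_1 P.scale_zero_right, simp add: vme_word_1 del: vme.act_mono)
  next
    case (Cons k w)
    then show ?case
      unfolding mono_Cons[of k w] by (simp add: vme_comm[OF serre_elt_Tw mono_Tw] lder_serre[OF assms] rder_serre[OF assms])
  qed
  then show ?case by (simp add: lin_scale[OF vme.lin_act])
qed (simp add: lin_add[OF vme.lin_act])

section \<open>The two-sided ideal of Serre relations\<close>

definition serre_ideal :: "'i::cartan_datum tens set"
  where "serre_ideal = P.span {mono v * serre_elt i j * mono w | v i j w. i \<noteq> j}"

lemma subspace_serre_ideal: "P.subspace serre_ideal" by (simp add: serre_ideal_def)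

lemmas serre_ideal_closed [simp] = P.subspace_0[OF subspace_serre_ideal]
  P.subspace_add[OF subspace_serre_ideal] P.subspace_scale[OF subspace_serre_ideal]
  P.subspace_diff[OF subspace_serre_ideal] P.subspace_neg[OF subspace_serre_ideal]

lemma serre_ideal_linear:
  assumes "lin psc psc f" and "\<And>v i j w. i \<noteq> j ==> f (mono v * serre_elt i j * mono w) \<in> serre_ideal"
    and "p \<in> serre_ideal"
  shows "f p \<in> serre_ideal"
proof -
  have "p \<in> P.span {mono v * serre_elt i j * mono w | v i j w. i \<noteq> j}"
    using assms(3) by (simp only: serre_ideal_def)
  then show ?thesis
    by (induction p rule: P.span_induct_alt; (auto simp: lin_0[OF assms(1)] assms(2) lin_add[OF assms(1)] lin_scale[OF assms(1)]))
qed

lemma serre_ideal_base: "i \<noteq> j ==> mono v * serre_elt i j * mono w \<in> serre_ideal"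
  unfolding serre_ideal_def by (rule P.span_base) blast

lemma serre_ideal_mult_left: "p \<in> serre_ideal ==> r * p \<in> serre_ideal"
proof (induction r rule: free_induct)
  case (single u c)
  have "mono u * p \<in> serre_ideal"
  proof (rule serre_ideal_linear[OF _ _ single])
    show "lin psc psc ((*) (mono u))" by (rule linT) (simp_all add: distrib_left psc_mult_right)
    show "mono u * (mono v * serre_elt i j * mono w) \<in> serre_ideal" if "i \<noteq> j" for v i j w
      using serre_ideal_base[OF that, of "u @ v" w] by (simp add: mono_append mult.assoc)
  qed
  then show ?case by (simp add: psc_mult_left)
qed (simp add: distrib_right)

lemma serre_ideal_mult_right: "p \<in> serre_ideal ==> p * r \<in> serre_ideal"
proof (induction r rule: free_induct)
  case (single u c)
  have "p * mono u \<in> serre_ideal"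
  proof (rule serre_ideal_linear[OF _ _ single])
    show "lin psc psc (\<lambda>p. p * mono u)" by (rule linT) (simp_all add: distrib_right psc_mult_left)
    show "mono v * serre_elt i j * mono w * mono u \<in> serre_ideal" if "i \<noteq> j" for v i j w
      using serre_ideal_base[OF that, of v "w @ u"] by (simp add: mono_append mult.assoc)
  qed
  then show ?case by (simp add: psc_mult_right)
qed (simp add: distrib_left)

lemma serre_elt_ideal: "i \<noteq> j ==> serre_elt i j \<in> serre_ideal"
  using serre_ideal_base[of i j "[]" "[]"] by (simp add: mono_Nil)

lemma serre_gen_Tw: "\<exists>b. mono v * serre_elt i j * mono w \<in> Tw b \<and> b \<noteq> 0"
proof -
  let ?u = "j # replicate (nat (1 - cartan i j)) i"
  have "wt v + wt ?u + wt w \<noteq> 0"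
  proof
    assume "wt v + wt ?u + wt w = 0"
    then have "(wt v + wt ?u + wt w) j = 0" by (simp add: zero_fun_apply)
    moreover have "(wt v + wt ?u + wt w) j = of_nat (count_list v j + count_list ?u j + count_list w j)"
      by (simp add: plus_fun_apply wt_def)
    ultimately show False unfolding of_nat_eq_0_iff by simp
  qed
  then show ?thesis using Tw_mult[OF Tw_mult[OF mono_Tw serre_elt_Tw] mono_Tw] by blast
qed

lemma part_serre_ideal: "p \<in> serre_ideal ==> part b p \<in> serre_ideal"
proof (rule serre_ideal_linear[OF lin_part])
  show "part b (mono v * serre_elt i j * mono w) \<in> serre_ideal" if ij: "i \<noteq> j" for v i j w
  proof -
    obtain c where "mono v * serre_elt i j * mono w \<in> Tw c" using serre_gen_Tw by blast
    then show ?thesis using serre_ideal_base[OF ij, of v w] by (simp add: part_of_Tw)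
  qed
qed

lemma part_0_serre_ideal: "p \<in> serre_ideal ==> part 0 p = 0" unfolding serre_ideal_def
proof (induction p rule: P.span_induct_alt)
  case (step c x y)
  then obtain v i j w where x: "x = mono v * serre_elt i j * mono w" by blast
  obtain g where "x \<in> Tw g" "g \<noteq> 0" using serre_gen_Tw x by blast
  then show ?case using step by (simp add: part_of_Tw)
qed simp

lemma lder_serre_ideal: "p \<in> serre_ideal ==> lder k p \<in> serre_ideal"
proof (rule serre_ideal_linear[OF lin_lder])
  show "lder k (mono v * serre_elt i j * mono w) \<in> serre_ideal" if "i \<noteq> j" for v i j w
    by (simp add: mult.assoc lder_mult[OF mono_Tw] lder_mult[OF serre_elt_Tw] lder_serre[OF that]
        serre_ideal_mult_left serre_ideal_mult_right serre_elt_ideal[OF that])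
qed

lemma flip_serre_ideal: "p \<in> serre_ideal ==> flip p \<in> serre_ideal"
proof (rule serre_ideal_linear[OF lin_flip])
  show "flip (mono v * serre_elt i j * mono w) \<in> serre_ideal" if "i \<noteq> j" for v i j w
    by (simp add: mult.assoc flip_mult flip_serre serre_ideal_mult_left serre_ideal_mult_right serre_elt_ideal[OF that])
qed

lemma rder_serre_ideal: "p \<in> serre_ideal ==> rder k p \<in> serre_ideal"
  unfolding rder_def by (intro flip_serre_ideal lder_serre_ideal)

text \<open>A raising operator is a combination of the two skew derivations, which preserve the
  ideal because they kill its generators.\<close>

lemma vop_serre_ideal: "p \<in> serre_ideal ==> vop l g p \<in> serre_ideal"
proof (rule serre_ideal_linear[OF lin_vop])
  show "vop l g (mono v * serre_elt i j * mono w) \<in> serre_ideal" if ij: "i \<noteq> j" for v i j w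
  proof -
    let ?x = "mono v * serre_elt i j * mono w"
    obtain c where g: "?x \<in> Tw c" using serre_gen_Tw by blast
    have x: "?x \<in> serre_ideal" by (rule serre_ideal_base[OF ij])
    show ?thesis
    proof (cases g)
      case (GenE k)
      then show ?thesis using vop_E_der[OF g, of l k] lder_serre_ideal[OF x] rder_serre_ideal[OF x] by simp
    qed (use x g in \<open>simp_all add: vop_T[OF g] vop_Tinv[OF g] serre_ideal_mult_left\<close>)
  qed
qed

lemma vm_serre_ideal: "p \<in> serre_ideal ==> vm.A l a p \<in> serre_ideal"
  by (rule vm.act_stable[OF subspace_serre_ideal vop_serre_ideal])

lemma act_relation_ideal:
  assumes "free_action sc op" "module.subspace sc N" "\<And>g x. x \<in> N ==> op g x \<in> N"
    and "\<And>p x. p \<in> relators ==> act sc op p x \<in> N" and "p \<in> relation_ideal"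
  shows "act sc op p x \<in> N"
proof -
  interpret free_action sc op by fact
  show ?thesis using assms(5)
    by (induction arbitrary: x rule: relation_ideal.induct; (simp add: assms(2) subspace_0 act_add subspace_add act_stable[OF assms(2,3)] act_mult assms(4)))
qed

text \<open>Only the lowering Serre relations require passing to the quotient by
  \<open>serre_ideal\<close>; on words the other relators act as zero.\<close>

lemma vm_relators:
  assumes "p \<in> relators"
  shows "vm.A l p x \<in> serre_ideal"
proof (induction x rule: free_induct)
  case (single w c)
  note fg = act_fgen[OF vm.free_action_axioms]
  let ?x = "mono w"
  have w: "mono w \<in> Tw (wt w)" by simp
  have T: "vop l (GenT i) (psc d y) = psc (qpow (symm i * (l i - b i))) (psc d y)"
    "vop l (GenTinv i) (psc d y) = psc (qpow (- (symm i * (l i - b i)))) (psc d y)" if "y \<in> Tw b" for y b d i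
    using that by (simp_all add: vop_T[of _ b] vop_Tinv[of _ b])
  have "vm.A l p (mono w) \<in> serre_ideal" using assms
  proof cases
    case (1 i)
    then show ?thesis by (simp add: vm.act_diff vm.act_mult fg T[OF w] vop_T[OF w] vop_Tinv[OF w])
  next
    case (2 i)
    then show ?thesis by (simp add: vm.act_diff vm.act_mult fg T[OF w] vop_T[OF w] vop_Tinv[OF w])
  next
    case (3 i j)
    then show ?thesis by (simp add: vm.act_diff vm.act_mult fg T[OF w] vop_T[OF w] mult.commute)
  next
    case (4 i j)
    have e: "vop l (GenE j) (mono w) \<in> Tw (wt w - simple_root j)" by (rule vop_E_Tw[OF w])
    have "symm i * (l i - (wt w - simple_root j) i) + - (symm i * (l i - wt w i)) = symm i * of_bool (i = j)"
      by (simp add: minus_apply simple_root_def algebra_simps)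
    then show ?thesis
      using 4 by (simp add: vm.act_diff vm.act_mult fg vop_Tinv[OF w] T(1)[OF e] vop_T[OF e] vm.act_psc mult.commute
          flip: psc_fscalar qpow_add)
  next
    case (5 i j)
    have e: "mono [j] * mono w \<in> Tw (simple_root j + wt w)" by (rule vop_F_Tw[OF w])
    have "symm i * (l i - (simple_root j + wt w) i) + - (symm i * (l i - wt w i)) = - (symm i * of_bool (i = j))"
      by (simp add: plus_fun_apply simple_root_def algebra_simps)
    then show ?thesis
      using 5 by (simp add: vm.act_diff vm.act_mult fg vop_Tinv[OF w] T(1)[OF e] vop_T[OF e] vm.act_psc mult.commute
          psc_mult_right flip: psc_fscalar qpow_add)
  next
    case (6 i j)
    have "vm.A l (kpow fT fTinv i 1 - kpow fT fTinv i (- 1)) (mono w) = psc (qden i * qbracket i (rpair i (l - wt w))) (mono w)"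
      by (simp add: vm.act_diff vm_kpow[OF w] qbracket_def flip: P.scale_left_diff_distrib)
    then show ?thesis
      using 6 by (simp add: vm.act_diff vm.act_mult fg vop_E_Cons[OF w] vm.act_psc flip: psc_fscalar qden_def)
  next
    case (7 i j)
    then show ?thesis by (simp add: act_serre[OF vm.free_action_axioms] vme_serre)
  next
    case (8 i j)
    have "act psc (\<lambda>i. vop l (GenF i)) r y = r * y" for r y
    proof -
      interpret f: free_action psc "\<lambda>i. vop l (GenF i)"
        by (intro free_action.intro free_action_axioms.intro PQ.qspace_axioms lin_vop)
      have "foldr (\<lambda>i. vop l (GenF i)) v y = mono v * y" for v
      proof (induction v)
        case (Cons j v)
        then show ?case by (simp add: mono_Cons[of j v] mult.assoc)
      qed (simp add: mono_Nil)
      then show ?thesis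
        by (induction r rule: free_induct) (simp_all add: f.act_add f.act_psc distrib_right psc_mult_left)
    qed
    then show ?thesis
      using 8 by (simp add: act_serre[OF vm.free_action_axioms] serre_ideal_mult_right serre_elt_ideal)
  qed
  then show ?case by (simp add: lin_scale[OF vm.lin_act])
qed (simp add: lin_add[OF vm.lin_act])

lemma vm_relation_ideal: "p \<in> relation_ideal ==> vm.A l p x \<in> serre_ideal"
  by (rule act_relation_ideal[OF vm.free_action_axioms subspace_serre_ideal vop_serre_ideal vm_relators])

section \<open>Verma modules realized on the negative part\<close>

abbreviation cong_serre :: "'i::cartan_datum tens => 'i tens => bool"  (infix \<open>\<approx>\<close> 50)
  where "p \<approx> r \<equiv> p - r \<in> serre_ideal"

lemma cong_serre_sym: "p \<approx> r ==> r \<approx> p" using P.subspace_neg[OF subspace_serre_ideal] by fastforce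

lemma cong_serre_trans: "p \<approx> r ==> r \<approx> s ==> p \<approx> s"
  using P.subspace_add[OF subspace_serre_ideal, of "p - r" "r - s"] by simp

text \<open>A chosen representative of \<open>u\<close> acts on the free algebra. Different
  representatives agree only modulo the Serre ideal, hence congruences below in place of
  equations.\<close>

definition vrep :: "('i::cartan_datum => rat) => 'i uq => 'i tens => 'i tens"
  where "vrep l u p = vm.A l (rep_uq u) p"

lemma vrep_abs: "vrep l (abs_uq a) p \<approx> vm.A l a p"
proof -
  have "rep_uq (abs_uq a) - a \<in> relation_ideal" using abs_uq_eq_iff[of "rep_uq (abs_uq a)" a] by simp
  from vm_relation_ideal[OF this, of l p] show ?thesis by (simp add: vrep_def vm.act_diff)
qed

abbreviation evF :: "'i::cartan_datum tens => 'i uq" where "evF \<equiv> ev uF"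
abbreviation evE :: "'i::cartan_datum tens => 'i uq" where "evE \<equiv> ev uE"

lemma evF_serre_ideal: "p \<in> serre_ideal ==> evF p = 0" unfolding serre_ideal_def
  by (induction p rule: P.span_induct_alt) (auto simp: ev_mult ev_serre)

lemma evF_lift: "\<exists>a. abs_uq a = evF p \<and> (\<forall>l x. vm.A l a x = p * x)"
proof (induction p rule: free_induct)
  case (single w c)
  have "\<exists>a. abs_uq a = evF (mono w) \<and> (\<forall>l x. vm.A l a x = mono w * x)"
  proof (induction w)
    case Nil
    then show ?case by (intro exI[of _ 1]) (simp add: abs_uq_1 mono_Nil)
  next
    case (Cons i w)
    then obtain a where "abs_uq a = evF (mono w)" "\<And>l x. vm.A l a x = mono w * x" by blast
    then show ?case by (intro exI[of _ "fF i * a"]) (simp add: abs_uq_mult abs_uq_gen vm.act_mult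
          act_fgen[OF vm.free_action_axioms] mono_Cons[of i w] ev_mult mult.assoc)
  qed
  then obtain a where "abs_uq a = evF (mono w)" "\<And>l x. vm.A l a x = mono w * x" by blast
  then show ?case by (intro exI[of _ "psc c a"]) (simp add: abs_uq_psc vm.act_psc psc_mult_left)
next
  case (add p r)
  then obtain a b where "abs_uq a = evF p" "\<And>l x. vm.A l a x = p * x"
    "abs_uq b = evF r" "\<And>l x. vm.A l b x = r * x" by blast
  then show ?case by (intro exI[of _ "a + b"]) (simp add: abs_uq_add vm.act_add distrib_right)
qed

lemma vrep_evF: "vrep l (evF p) x \<approx> p * x" using evF_lift[of p] vrep_abs by metis

text \<open>The negative part is the free algebra modulo the Serre ideal: the action of
  \<open>evF p\<close> on the highest weight vector is \<open>p\<close> itself, so it can vanish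
  only if \<open>p\<close> lies in the ideal.\<close>

lemma evF_eq_0_iff: "evF p = 0 \<longleftrightarrow> p \<in> serre_ideal"
proof
  assume "evF p = 0"
  then have "vrep 0 (evF p) 1 \<approx> 0" using vrep_abs[of 0 0 1] by (simp add: abs_uq_0)
  then show "p \<in> serre_ideal" using cong_serre_trans[OF cong_serre_sym[OF vrep_evF[of 0 p 1]], of 0] by simp
qed (rule evF_serre_ideal)

lemma evF_eq_iff: "evF p = evF r \<longleftrightarrow> p \<approx> r" using evF_eq_0_iff[of "p - r"] by simp

text \<open>The action of the algebra on the highest weight vector of a Verma module, identified with
  the negative part, and the coefficient of the highest weight vector.\<close>

definition vproj :: "('i::cartan_datum => rat) => 'i uq => 'i uq"
  where "vproj l u = evF (vrep l u 1)"

definition const :: "'i tens => qfield"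
  where "const p = Poly_Mapping.lookup p 0"

definition vcoeff :: "('i::cartan_datum => rat) => 'i uq => qfield"
  where "vcoeff l u = const (vrep l u 1)"

lemma lin_const: "lin psc (*) const"
proof (intro linI P.vector_space_axioms K.vector_space_axioms)
  show add: "const (p + r) = const p + const r" for p r :: "'a tens" by (simp add: const_def lookup_add)
  show "const (psc c p) = c * const p" for c and p :: "'a tens"
  proof (induction p rule: free_induct)
    case (single w d)
    then show ?case by (simp add: const_def psc_single lookup_single when_def)
  qed (simp add: add P.scale_right_distrib distrib_left)
qed

lemmas const_simps [simp] = lin_add[OF lin_const] lin_scale[OF lin_const] lin_0[OF lin_const]
  lin_diff[OF lin_const] lin_neg[OF lin_const]

lemma const_mono: "const (mono w) = (if w = [] then 1 else 0)"
  by (simp add: const_def lookup_single when_def zero_monoword_def)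

lemma const_1 [simp]: "const 1 = 1" using const_mono[of "[]"] by (simp add: mono_Nil)

lemma wt_eq_0_iff [simp]: "wt w = 0 \<longleftrightarrow> w = []" by (cases w; (auto simp: Cons wt_def fun_eq_iff zero_fun_apply))

lemma part_0: "part 0 p = psc (const p) 1" by (induction p rule: free_induct)
    (auto simp: part_mono const_mono mono_Nil P.scale_left_distrib)

lemma const_serre_ideal: "p \<in> serre_ideal ==> const p = 0"
  using part_0_serre_ideal[of p] const_1 by (simp add: part_0)

lemma const_cong: "p \<approx> r ==> const p = const r" using const_serre_ideal[of "p - r"] by simp

lemma const_Cons [simp]: "const (mono [i] * p) = 0"
  by (induction p rule: free_induct) (simp_all add: psc_mult_right distrib_left const_mono flip: mono_Cons)

lemma uq_induct [case_names 1 gen add scale]: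
  assumes "Q 1" "\<And>g u. Q u ==> Q (gen_uq g * u)" "\<And>u v. Q u ==> Q v ==> Q (u + v)"
    "\<And>c u. Q u ==> Q (uscale c u)"
  shows "Q u"
proof -
  have "Q (ev gen_uq p)" for p
  proof (induction p rule: free_induct)
    case (single w c)
    have "Q (ev gen_uq (mono w))" by (induction w) (simp_all add: assms ev_Cons)
    then show ?case by (simp add: assms)
  qed (simp add: assms)
  from this[of "rep_uq u"] show ?thesis by (simp flip: abs_uq_ev)
qed

lemma evF_induct [case_names 1 F add scale]:
  assumes "Q 1" "\<And>i u. Q u ==> Q (uF i * u)" "\<And>u v. Q u ==> Q v ==> Q (u + v)"
    "\<And>c u. Q u ==> Q (uscale c u)"
  shows "Q (evF p)"
proof (induction p rule: free_induct)
  case (single w c)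
  have "Q (ev uF (mono w))" by (induction w) (simp_all add: assms ev_Cons)
  then show ?case by (simp add: assms)
qed (simp add: assms)

lemma vrep_eq: "abs_uq a = u ==> vrep l u x \<approx> vm.A l a x" using vrep_abs by blast

lemma vrep_cong: "x \<approx> y ==> vrep l u x \<approx> vrep l u y" using vm_serre_ideal[of "x - y" l "rep_uq u"]
  by (simp add: vrep_def lin_diff[OF vm.lin_act])

lemma vrep_mult: "vrep l (u * v) x \<approx> vrep l u (vrep l v x)" using vrep_eq[of "rep_uq u * rep_uq v" "u * v" l x]
  by (simp add: abs_uq_mult vm.act_mult vrep_def)

lemma vrep_add: "vrep l (u + v) x \<approx> vrep l u x + vrep l v x" using vrep_eq[of "rep_uq u + rep_uq v" "u + v" l x]
  by (simp add: abs_uq_add vm.act_add vrep_def)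

lemma vrep_scale: "vrep l (uscale c u) x \<approx> psc c (vrep l u x)"
  using vrep_eq[of "psc c (rep_uq u)" "uscale c u" l x] by (simp add: abs_uq_psc vm.act_psc vrep_def)

lemma vrep_gen: "vrep l (gen_uq g) x \<approx> vop l g x" using vrep_eq[of "fgen g" "gen_uq g" l x]
  by (simp add: abs_uq_ev act_fgen[OF vm.free_action_axioms] act_fgen[OF ev.free_action_axioms] ev_def)

lemma lin_vproj: "lin uscale uscale (vproj l)"
proof (rule linU)
  show "vproj l (u + v) = vproj l u + vproj l v" for u v
    using vrep_add[of l u v 1] by (simp only: vproj_def evF_eq_iff flip: ev_simps(1))
  show "vproj l (uscale c u) = uscale c (vproj l u)" for c u
    using vrep_scale[of l c u 1] by (simp only: vproj_def evF_eq_iff flip: ev_simps(2))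
qed

lemmas vproj_simps [simp] = lin_add[OF lin_vproj] lin_scale[OF lin_vproj] lin_0[OF lin_vproj]
  lin_diff[OF lin_vproj] lin_neg[OF lin_vproj]

lemma lin_vcoeff: "lin uscale (*) (vcoeff l)"
proof (intro linI U.vector_space_axioms K.vector_space_axioms)
  show "vcoeff l (u + v) = vcoeff l u + vcoeff l v" for u v
    using const_cong[OF vrep_add[of l u v 1]] by (simp add: vcoeff_def)
  show "vcoeff l (uscale c u) = c * vcoeff l u" for c u
    using const_cong[OF vrep_scale[of l c u 1]] by (simp add: vcoeff_def)
qed

lemmas vcoeff_simps [simp] = lin_add[OF lin_vcoeff] lin_scale[OF lin_vcoeff] lin_0[OF lin_vcoeff]
  lin_diff[OF lin_vcoeff] lin_neg[OF lin_vcoeff]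

lemma vproj_mult: "vproj l (u * v) = vproj l (u * vproj l v)"
proof -
  have "vrep l (vproj l v) 1 \<approx> vrep l v 1" using vrep_evF[of l "vrep l v 1" 1] by (simp add: vproj_def)
  then have "vrep l (u * vproj l v) 1 \<approx> vrep l u (vrep l v 1)"
    using cong_serre_trans[OF vrep_mult vrep_cong] by blast
  then have "vrep l (u * v) 1 \<approx> vrep l (u * vproj l v) 1"
    using cong_serre_trans[OF vrep_mult cong_serre_sym] by blast
  then show ?thesis by (simp add: vproj_def evF_eq_iff)
qed

lemma vproj_evF [simp]: "vproj l (evF p) = evF p" using vrep_evF[of l p 1] by (simp add: vproj_def evF_eq_iff)

lemma vproj_1 [simp]: "vproj l 1 = 1" using vproj_evF[of l 1] by simp

lemma vproj_evF_mult: "vproj l (evF p * u) = evF p * vproj l u"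
  by (metis (no_types, lifting) vproj_mult vproj_def vproj_evF ev_mult)

lemma vproj_F_mult [simp]: "vproj l (uF i * u) = uF i * vproj l u" using vproj_evF_mult[of l "mono [i]" u] by simp

lemma vproj_vproj [simp]: "vproj l (vproj m u) = vproj m u" unfolding vproj_def[of m] by simp

lemma vproj_gen: "vproj l (gen_uq g) = evF (vop l g 1)"
  using vrep_gen[of l g 1] by (simp add: vproj_def evF_eq_iff)

lemma vproj_gen_mult: "vproj l (gen_uq g * evF p) = evF (vop l g p)"
proof -
  have "vrep l (gen_uq g * evF p) 1 \<approx> vop l g (vrep l (evF p) 1)"
    using cong_serre_trans[OF vrep_mult vrep_gen] by blast
  moreover have "vop l g (vrep l (evF p) 1) \<approx> vop l g p"
    using vop_serre_ideal[of "vrep l (evF p) 1 - p" l g] vrep_evF[of l p 1] by simp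
  ultimately show ?thesis unfolding vproj_def evF_eq_iff by (rule cong_serre_trans)
qed

lemma one_Tw [simp]: "1 \<in> Tw 0" using mono_Tw[of "[]"] by (simp add: mono_Nil)

lemma vproj_mult_E [simp]: "vproj l (u * uE i) = 0"
  using vproj_mult[of l u "uE i"] vproj_gen[of l "GenE i"] by simp

lemma vproj_mult_T [simp]: "vproj l (u * uT i) = uscale (qpow (symm i * l i)) (vproj l u)"
  using vproj_mult[of l u "uT i"] vproj_gen[of l "GenT i"]
  by (simp add: vop_T[OF one_Tw] zero_fun_apply uscale_mult_right)

lemma vproj_mult_Tinv [simp]: "vproj l (u * uTinv i) = uscale (qpow (- (symm i * l i))) (vproj l u)"
  using vproj_mult[of l u "uTinv i"] vproj_gen[of l "GenTinv i"]
  by (simp add: vop_Tinv[OF one_Tw] zero_fun_apply uscale_mult_right)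

lemma vproj_kpow: "vproj l (u * kpow uT uTinv i s) = uscale (qpow (of_int s * rpair i l)) (vproj l u)"
proof -
  have "\<forall>u. vproj l (u * kpow uT uTinv i s) = uscale (qpow (of_int s * rpair i l)) (vproj l u)"
    by (rule kpow_rule[of "\<lambda>a x. \<forall>u. vproj l (u * a) = uscale (qpow x) (vproj l u)"])
      (simp_all add: qpow_add mult.commute flip: mult.assoc)
  then show ?thesis by simp
qed

lemma vproj_K [simp]: "vproj l (u * uK i) = uscale (qpow (rpair i l)) (vproj l u)"
    and vproj_Kinv [simp]: "vproj l (u * uKinv i) = uscale (qpow (- rpair i l)) (vproj l u)"
  using vproj_kpow[of l u i 1] vproj_kpow[of l u i "- 1"] by (simp_all add: uK_def uKinv_def)

lemma vcoeff_vproj [simp]: "vcoeff l (vproj l u) = vcoeff l u"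
  using const_cong[OF vrep_evF[of l "vrep l u 1" 1]] by (simp add: vcoeff_def vproj_def)

lemma vcoeff_cong: "vproj l u = vproj l v ==> vcoeff l u = vcoeff l v" using vcoeff_vproj by metis

lemma vcoeff_evF [simp]: "vcoeff l (evF p) = const p"
  using const_cong[OF vrep_evF[of l p 1]] by (simp add: vcoeff_def)

lemma vcoeff_1 [simp]: "vcoeff l 1 = 1" using vcoeff_evF[of l 1] by simp

lemma vcoeff_F_mult [simp]: "vcoeff l (uF i * u) = 0"
proof -
  have "vcoeff l (uF i * u) = vcoeff l (evF (mono [i] * vrep l u 1))"
    by (rule vcoeff_cong) (simp only: ev_mult ev_single vproj_F_mult vproj_evF, simp only: vproj_def)
  then show ?thesis by simp
qed

lemma vcoeff_mult_E [simp]: "vcoeff l (u * uE i) = 0" using vcoeff_cong[of l "u * uE i" 0] by simp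

lemma vcoeff_mult_T [simp]: "vcoeff l (u * uT i) = qpow (symm i * l i) * vcoeff l u"
  using vcoeff_cong[of l "u * uT i" "uscale (qpow (symm i * l i)) u"] by simp

lemma vcoeff_mult_Tinv [simp]: "vcoeff l (u * uTinv i) = qpow (- (symm i * l i)) * vcoeff l u"
  using vcoeff_cong[of l "u * uTinv i" "uscale (qpow (- (symm i * l i))) u"] by simp

section \<open>Triangular decomposition\<close>

lemma qcomm_evF:
  assumes "\<And>k. qcomm t (uF k) (h (simple_root k))" "\<And>b g. h (b + g) = h b + h g" "p \<in> Tw b"
  shows "t * evF p = uscale (qpow (h b)) (evF p * t)" using assms(3)
proof (induction rule: Tw_induct)
  case (word w c)
  have "h 0 = 0" using assms(2)[of 0 0] by simp
  then have "qcomm t (evF (mono w)) (h (wt w))"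
    by (induction w) (simp_all add: ev_Cons wt_Cons assms(1,2) qcomm_mult_right, simp add: qcomm_def)
  then show ?case by (simp add: word qcomm_def us_mult mult.commute)
qed (simp_all add: distrib_left distrib_right U.scale_right_distrib)

lemma tmon_evF:
  "p \<in> Tw b ==> tmon n * evF p = uscale (qpow (\<Sum>j\<in>UNIV. of_int (n j) * (symm j * - b j))) (evF p * tmon n)"
  by (rule qcomm_evF[where h = "\<lambda>b. \<Sum>j\<in>UNIV. of_int (n j) * (symm j * - b j)"], rule tmon_F)
    (simp_all only: plus_fun_apply minus_add_distrib distrib_left sum.distrib)

text \<open>The spanning half of the triangular decomposition. The span contains 1 and is stable
  under left multiplication by generators; the case of \<open>uE i\<close> goes by induction on the
  lowering word that it has to cross.\<close>

lemma uq_triangular: "(u :: 'i::cartan_datum uq) \<in> U.span {evF (mono v) * tmon n * evE (mono w) | v n w. True}"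
proof -
  define S :: "'i uq set" where "S = {evF (mono v) * tmon n * evE (mono w) | v n w. True}"
  let ?R = "U.span S"
  have base: "evF (mono v) * tmon n * evE (mono w) \<in> ?R" for v n w by (rule U.span_base) (auto simp: S_def)
  have lin: "a * x \<in> ?R" if "\<And>v n w. a * (evF (mono v) * tmon n * evE (mono w)) \<in> ?R" "x \<in> ?R" for a x :: "'i uq"
    using that(2)
  proof (induction x rule: U.span_induct_alt)
    case (step c x y)
    then show ?case using that(1) by (auto simp: S_def distrib_left uscale_mult_right U.span_add U.span_scale)
  qed (simp add: U.span_zero)
  have F: "uF i * x \<in> ?R" if "x \<in> ?R" for i and x :: "'i uq"
    by (rule lin[OF _ that]) (use base[of "i # _"] in \<open>simp add: ev_Cons mult.assoc\<close>)
  have T: "tmon m * x \<in> ?R" if "x \<in> ?R" for m and x :: "'i uq"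
  proof (rule lin[OF _ that])
    fix v w :: "'i list" and n
    obtain c where c: "tmon m * evF (mono v) = uscale c (evF (mono v) * tmon m)"
      using tmon_evF[OF mono_Tw] by blast
    have "tmon m * (evF (mono v) * tmon n * evE (mono w)) = uscale c (evF (mono v) * tmon (\<lambda>j. m j + n j) * evE (mono w))"
      using c by (simp add: tmon_add uscale_mult_left flip: mult.assoc)
    then show "tmon m * (evF (mono v) * tmon n * evE (mono w)) \<in> ?R" using base by (simp add: U.span_scale)
  qed
  have E: "uE i * x \<in> ?R" if "x \<in> ?R" for i and x :: "'i uq"
  proof (rule lin[OF _ that])
    fix v w :: "'i list" and n
    show "uE i * (evF (mono v) * tmon n * evE (mono w)) \<in> ?R"
    proof (induction v)
      case Nil
      have "uE i * tmon n = uscale (qpow (- (\<Sum>j\<in>UNIV. of_int (n j) * (symm j * simple_root i j)))) (tmon n * uE i)"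
        using tmon_E[of n i] by (simp add: qcomm_def)
      then show ?case
        using base[of "[]" n "i # w"] by (simp add: ev_Cons uscale_mult_left U.span_scale flip: mult.assoc)
    next
      case (Cons j v)
      let ?x = "evF (mono v) * tmon n * evE (mono w)"
      have "uE i * (evF (mono (j # v)) * tmon n * evE (mono w)) = uF j * (uE i * ?x) +
          uscale (of_bool (i = j) / qden i) (uK i * ?x - uKinv i * ?x)"
        by (simp add: ev_Cons uE_uF distrib_right left_diff_distrib uscale_mult_left flip: mult.assoc)
      then show ?case
        using F[OF Cons] T[OF base] by (simp add: U.span_add U.span_scale U.span_diff uK_def uKinv_def kpow_tmon)
    qed
  qed
  have "u \<in> ?R"
  proof (induction u rule: uq_induct)
    case 1
    show ?case using base[of "[]" "\<lambda>_. 0" "[]"] by (simp add: tmon_0)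
  next
    case (gen g u)
    have "uT i = tmon (\<lambda>j. if j = i then 1 else 0)" "uTinv i = tmon (\<lambda>j. if j = i then - 1 else 0)" for i :: 'i
      by (simp_all add: tmon_single ipow_def)
    then show ?case using gen T E F by (cases g) auto
  qed (simp_all add: U.span_add U.span_scale)
  then show ?thesis by (simp add: S_def)
qed

text \<open>The universal property of Verma modules in terms of left ideals: modulo a left ideal
  that contains the highest weight relations, \<open>u\<close> equals its projection. It will be
  applied to radicals, to Verma ideals and to kernels of functionals.\<close>

lemma vproj_decomp:
  assumes "U.subspace N" "\<And>u v. v \<in> N ==> u * v \<in> N"
    and "\<And>i. uE i \<in> N" "\<And>i. uT i - uscale (qpow (symm i * l i)) 1 \<in> N"
  shows "u - vproj l u \<in> N"
proof -
  have Tinv: "uTinv i - uscale (qpow (- (symm i * l i))) 1 \<in> N" for i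
  proof -
    have "uTinv i - uscale (qpow (- (symm i * l i))) 1 =
        - (uscale (qpow (- (symm i * l i))) (uTinv i * (uT i - uscale (qpow (symm i * l i)) 1)))"
      by (simp add: right_diff_distrib uscale_mult_right U.scale_right_diff_distrib)
    then show ?thesis using assms(1,2,4) by (simp add: U.subspace_neg U.subspace_scale)
  qed
  let ?T = "\<lambda>a x. \<forall>u. u * a - uscale (qpow x) u \<in> N \<and> vproj l (u * a) = uscale (qpow x) (vproj l u)"
  have T: "?T (tmon n) (\<Sum>j\<in>UNIV. of_int (n j) * (symm j * l j))" for n
  proof (rule tmon_rule[of ?T])
    fix a b x y assume ab: "?T a x" "?T b y"
    have e: "u * (a * b) - uscale (qpow (x + y)) u = (u * a * b - uscale (qpow y) (u * a)) + uscale (qpow y) (u * a - uscale (qpow x) u)" for u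
      by (simp add: U.scale_right_diff_distrib qpow_add mult.assoc mult.commute[of "qpow x"])
    have "vproj l (u * (a * b)) = uscale (qpow (x + y)) (vproj l u)" for u
      using ab by (simp add: qpow_add mult.commute flip: mult.assoc)
    then show "?T (a * b) (x + y)" unfolding e using ab assms(1) by (simp add: U.subspace_add U.subspace_scale)
  next
    show "?T (uT j) (symm j * l j)" "?T (uTinv j) (- (symm j * l j))" for j
      using assms(2)[OF assms(4)[of j]] assms(2)[OF Tinv[of j]]
      by (simp_all add: right_diff_distrib uscale_mult_right)
  qed (simp add: assms(1) U.subspace_0)
  show ?thesis using uq_triangular[of u]
  proof (induction u rule: U.span_induct_alt)
    case base
    then show ?case by (simp add: assms(1) U.subspace_0)
  next
    case (step c x y)
    then obtain v n w where x: "x = evF (mono v) * tmon n * evE (mono w)" by blast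
    have "x - vproj l x \<in> N"
    proof (cases w rule: rev_cases)
      case Nil
      then show ?thesis using T[of n] by (simp add: x)
    next
      case (snoc w' i)
      then have "x = evF (mono v) * tmon n * evE (mono w') * uE i" by (simp add: x mono_append ev_mult mult.assoc)
      then show ?thesis using assms(2,3) by simp
    qed
    moreover have e: "uscale c x + y - vproj l (uscale c x + y) = uscale c (x - vproj l x) + (y - vproj l y)"
      by (simp add: U.scale_right_diff_distrib)
    ultimately show ?case unfolding e using step.IH assms(1) by (simp add: U.subspace_add U.subspace_scale)
  qed
qed

section \<open>The structure maps\<close>

lemma subalgebra_image:
  assumes "\<And>p r. f (p + r) = f p + f r" "\<And>c p. f (psc c p) = uscale c (f p)"
    "\<And>p r. f (p * r) = f p * f r" "f 1 = 1"
  shows "subalgebra (range f)"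
proof -
  have "f 0 = 0" using assms(1)[of 0 0] by simp
  then show ?thesis unfolding subalgebra_def U.subspace_def
    by (auto simp: assms(3)[symmetric] assms(1,2)[symmetric]) (metis assms(4) rangeI)
qed

lemma Uminus_eq: "Uminus = range (evF :: 'i::cartan_datum tens => 'i uq)"
  and Uplus_eq: "Uplus = range (evE :: 'i tens => 'i uq)"
proof -
  have r: "subalgebra hull range x = range (ev x)" for x :: "'i => 'i uq"
  proof (rule antisym)
    have "subalgebra (range (ev x))" by (rule subalgebra_image) (simp_all add: ev_mult)
    moreover have "range x \<subseteq> range (ev x)" using ev_single[of x] by (metis image_subsetI rangeI)
    ultimately show "subalgebra hull range x \<subseteq> range (ev x)" by (simp add: hull_minimal)
  next
    let ?A = "subalgebra hull range x"
    note A = subalgebraD[OF subalgebra_hull[of "range x"]]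
    have "ev x p \<in> ?A" for p
    proof (induction p rule: free_induct)
      case (single w c)
      have "ev x (mono w) \<in> ?A"
      proof (induction w)
        case (Cons i w)
        then show ?case using A(4)[of "x i"] hull_inc[of "x i" "range x" subalgebra] by (simp add: ev_Cons)
      qed (simp add: A)
      then show ?case by (simp add: A)
    qed (simp add: A)
    then show "range (ev x) \<subseteq> ?A" by blast
  qed
  show "Uminus = range (evF :: 'i tens => 'i uq)" "Uplus = range (evE :: 'i tens => 'i uq)"
    by (simp_all add: Uminus_def Uplus_def r)
qed

lemma evF_Uminus [simp]: "evF p \<in> Uminus" and evE_Uplus [simp]: "evE p \<in> Uplus"
  by (simp_all add: Uminus_eq Uplus_eq)

lemma uF_Uminus [simp]: "uF i \<in> Uminus" and uE_Uplus [simp]: "uE i \<in> Uplus"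
  using evF_Uminus[of "mono [i]"] evE_Uplus[of "mono [i]"] by simp_all

lemma vproj_Uminus [simp]: "vproj l u \<in> Uminus" by (simp add: vproj_def)

lemma torus_Uzero: "t \<in> torus ==> t \<in> Uzero"
  by (induction rule: torus.induct) (simp_all add: subalgebraD[OF subalgebra_Uzero])

lemma vproj_Uzero: "x \<in> Uzero ==> vproj l (u * x) = uscale (vcoeff l x) (vproj l u)"
proof (induction arbitrary: u rule: Uzero_induct)
  case (T i)
  then show ?case using vcoeff_mult_T[of l 1] by simp
next
  case (Tinv i)
  then show ?case using vcoeff_mult_Tinv[of l 1] by simp
next
  case (mult x y)
  have "vproj l (x * y) = uscale (vcoeff l y * vcoeff l x) 1" using mult(4)[of x] mult(3)[of 1] by simp
  then have "vcoeff l (x * y) = vcoeff l y * vcoeff l x" using vcoeff_vproj[of l "x * y"] by simp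
  then show ?case using mult(3)[of u] mult(4)[of "u * x"] by (simp add: mult.assoc)
qed (simp_all add: distrib_left U.scale_left_distrib uscale_mult_right)

lemma vcoeff_Uzero: "x \<in> Uzero ==> vcoeff l (u * x) = vcoeff l x * vcoeff l u"
  using vcoeff_vproj[of l "u * x"] by (simp add: vproj_Uzero)

lemma vcoeff_uT [simp]: "vcoeff l (uT i) = qpow (symm i * l i)" using vcoeff_mult_T[of l 1] by simp

lemma vcoeff_uTinv [simp]: "vcoeff l (uTinv i) = qpow (- (symm i * l i))" using vcoeff_mult_Tinv[of l 1] by simp

lemma pairing_simple_coweight [simp]: "pairing l (simple_coweight i) = l (i :: 'i::finite)"
proof -
  have "pairing l (simple_coweight i) = (\<Sum>k\<in>UNIV. if k = i then l k else 0)"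
    unfolding pairing_def simple_coweight_def by (intro sum.cong) auto
  then show ?thesis by simp
qed

text \<open>Existence of the character is obtained from the Verma module: on \<open>Uzero\<close> it
  is the coefficient of the highest weight vector.\<close>

lemma qchar_eq: "qchar l = (\<lambda>x. if x \<in> Uzero then vcoeff l x else 0)" unfolding qchar_def
proof (rule the_equality)
  note Z = subalgebraD[OF subalgebra_Uzero]
  let ?h = "\<lambda>x. if x \<in> Uzero then vcoeff l x else 0"
  show "(\<forall>x. x \<notin> Uzero \<longrightarrow> ?h x = 0) \<and>
    (\<forall>x\<in>Uzero. \<forall>y\<in>Uzero. ?h (x + y) = ?h x + ?h y \<and> ?h (x * y) = ?h x * ?h y) \<and>
    (\<forall>c. \<forall>x\<in>Uzero. ?h (uscale c x) = c * ?h x) \<and> ?h 1 = 1 \<and>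
    (\<forall>i. ?h (uT i) = qpow (symm i * pairing l (simple_coweight i)))" by (auto simp: Z vcoeff_Uzero)
  fix h :: "'a uq => qfield"
  assume h: "(\<forall>x. x \<notin> Uzero \<longrightarrow> h x = 0) \<and>
    (\<forall>x\<in>Uzero. \<forall>y\<in>Uzero. h (x + y) = h x + h y \<and> h (x * y) = h x * h y) \<and>
    (\<forall>c. \<forall>x\<in>Uzero. h (uscale c x) = c * h x) \<and> h 1 = 1 \<and>
    (\<forall>i. h (uT i) = qpow (symm i * pairing l (simple_coweight i)))"
  have "h x = vcoeff l x" if "x \<in> Uzero" for x using that
  proof (induction rule: Uzero_induct)
    case (Tinv i)
    have "h (uTinv i * uT i) = h (uTinv i) * h (uT i)" using h uT_Uzero uTinv_Uzero by blast
    then have "qpow (- (symm i * l i)) = h (uTinv i) * (qpow (symm i * l i) * qpow (- (symm i * l i)))"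
      using h by (simp del: qpow_mult_minus flip: mult.assoc)
    then show ?case by simp
  qed (use h in \<open>simp_all add: vcoeff_Uzero\<close>)
  then show "h = ?h" using h by auto
qed

lemma qchar_Uzero: "x \<in> Uzero ==> qchar l x = vcoeff l x" by (simp add: qchar_eq)

lemma qchar_uT [simp]: "qchar l (uT i) = qpow (symm i * l i)" by (simp add: qchar_eq)

subsection \<open>Counit, antipode and the Chevalley involution\<close>

lemma kpow_hom:
  assumes "h 1 = 1" "\<And>a b. h (a * b) = h a * h b"
  shows "h (kpow t t' i s) = kpow (\<lambda>j. h (t j)) (\<lambda>j. h (t' j)) i s"
proof -
  have pow: "h (a ^ n) = h a ^ n" for a n by (induction n) (simp_all add: assms)
  then have "h (ipow a b n) = ipow (h a) (h b) n" for a b n by (simp add: ipow_def)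
  then have "h (prod_list (map (\<lambda>j. ipow (t j) (t' j) (s * cartan j i)) js)) =
      prod_list (map (\<lambda>j. ipow (h (t j)) (h (t' j)) (s * cartan j i)) js)" for js
    by (induction js) (simp_all add: assms)
  then show ?thesis by (simp add: kpow_def)
qed

lemma serre_ev: "ev \<phi> (serre (\<lambda>i. fgen (h i)) i j) = ev (\<lambda>i. \<phi> (h i)) (serre_elt i j)"
  unfolding ev_def by (rule act_serre[OF ev.free_action_axioms])

lemma ev_fgen [simp]: "ev \<phi> (fgen g) = \<phi> g" by (simp add: ev_def act_fgen[OF ev.free_action_axioms])

lemma hom_exists:
  assumes "\<And>p. p \<in> relators ==> ev \<phi> p = 0"
  shows "\<exists>h. (\<forall>x y. h (x + y) = h x + h y) \<and> (\<forall>c x. h (uscale c x) = uscale c (h x)) \<and>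
    h 1 = 1 \<and> (\<forall>x y. h (x * y) = h x * h y) \<and> (\<forall>g. h (gen_uq g) = \<phi> g)"
proof -
  have rel: "ev \<phi> p = 0" if "p \<in> relation_ideal" for p
    using that by (induction rule: relation_ideal.induct) (simp_all add: assms ev_mult)
  define h where "h u = ev \<phi> (rep_uq u)" for u
  have h: "h (abs_uq p) = ev \<phi> p" for p
    using rel[of "rep_uq (abs_uq p) - p"] abs_uq_eq_iff[of "rep_uq (abs_uq p)" p] by (simp add: h_def)
  have "h (x + y) = h x + h y" "h (x * y) = h x * h y" "h (uscale c x) = uscale c (h x)" for x y c
  proof -
    obtain p r where [simp]: "x = abs_uq p" "y = abs_uq r" using uq_cases by metis
    show "h (x + y) = h x + h y" "h (x * y) = h x * h y" "h (uscale c x) = uscale c (h x)"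
      by (simp_all add: h ev_mult flip: abs_uq_add abs_uq_mult abs_uq_psc)
  qed
  moreover have "h 1 = 1" using h[of 1] by (simp add: abs_uq_1)
  moreover have "h (gen_uq g) = \<phi> g" for g using h[of "fgen g"] by (simp add: abs_uq_ev)
  ultimately show ?thesis by (intro exI[of _ h]) simp
qed

lemma hom_unique:
  assumes "\<forall>x y. h (x + y) = h x + h y" "\<forall>c x. h (uscale c x) = sc c (h x)" "h 1 = (1 :: 'b::{ring,monoid_mult})"
    "\<forall>x y. h (x * y) = h x * h y"
    and "\<forall>x y. k (x + y) = k x + k y" "\<forall>c x. k (uscale c x) = sc c (k x)" "k 1 = 1" "\<forall>x y. k (x * y) = k x * k y"
    and "\<forall>i. h (uT i) = k (uT i)" "\<forall>i. h (uE i) = k (uE i)" "\<forall>i. h (uF i) = k (uF i)"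
  shows "h = k"
proof
  have Tinv: "h (uTinv i) = k (uTinv i)" for i
    by (metis assms(3,4) uT_inv assms(4) assms(7) assms(8) assms(9) mult_1_left mult.assoc)
  have gen: "h (gen_uq g) = k (gen_uq g)" for g using assms(9-11) Tinv by (cases g) simp_all
  show "h u = k u" for u by (induction u rule: uq_induct) (simp_all add: assms(1-8) gen)
qed

definition theta_gen :: "'i::cartan_datum gen => 'i uq"
  where "theta_gen g = (case g of GenT i => uTinv i | GenTinv i => uT i | GenE i => - uF i | GenF i => - uE i)"

text \<open>Negating all letters multiplies a word by a sign that depends on its length, and all
  words of a given weight have the same length.\<close>

lemma ev_scaled: "p \<in> Tw b ==> ev x p = 0 ==> ev (\<lambda>i. - x i) p = 0"
proof -
  have word: "ev (\<lambda>i. - x i) (mono w) = uscale ((- 1) ^ length w) (ev x (mono w))" for w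
    by (induction w) (simp_all add: ev_Cons uscale_mult_right)
  have len: "wt v = wt w ==> length v = length w" for v w :: "'a list"
  proof -
    assume "wt v = wt w"
    then have "count_list v = count_list w" by (auto simp: wt_def fun_eq_iff)
    then have "mset v = mset w" by (intro multiset_eqI) (simp add: count_mset)
    then show "length v = length w" by (rule mset_eq_length)
  qed
  assume p: "p \<in> Tw b" and 0: "ev x p = 0"
  show ?thesis
  proof (cases "\<exists>v. wt v = b")
    case True
    then obtain v where v: "wt v = b" by blast
    have "ev (\<lambda>i. - x i) p = uscale ((- 1) ^ length v) (ev x p)" using p
    proof (induction p rule: Tw_induct)
      case (word w c)
      then show ?case
        using len[of w v] v \<open>\<And>w. ev (\<lambda>i. - x i) (mono w) = uscale ((- 1) ^ length w) (ev x (mono w))\<close>[of w]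
        by (simp add: mult.commute)
    qed (simp_all add: U.scale_right_distrib)
    then show ?thesis using 0 by simp
  next
    case False
    have "p = 0" using p by (induction p rule: Tw_induct) (use False in auto)
    then show ?thesis by simp
  qed
qed

lemma theta_relators:
  assumes "p \<in> (relators :: 'i::cartan_datum falg set)"
  shows "ev theta_gen p = 0"
proof -
  have k: "ev theta_gen (kpow fT fTinv i s) = kpow uTinv uT i s" for i :: 'i and s
    by (subst kpow_hom) (simp_all add: ev_mult theta_gen_def)
  have k': "kpow uTinv uT i s = kpow uT uTinv i (- s)" for i :: 'i and s unfolding kpow_def ipow_def
    by (intro arg_cong[of _ _ prod_list] map_cong refl) auto
  show ?thesis using assms
  proof cases
    case (4 i j)
    have "uTinv i * uF j * uT i = uscale (qpow (symm i * of_bool (i = j))) (uF j)"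
      using qcomm_Tinv_F[of i j] by (simp add: qcomm_def uscale_mult_left mult.assoc)
    then show ?thesis by (simp add: 4 ev_mult theta_gen_def mult.assoc flip: psc_fscalar)
  next
    case (5 i j)
    have "uTinv i * uE j * uT i = uscale (qpow (- (symm i * of_bool (i = j)))) (uE j)"
      using qcomm_Tinv_E[of i j] by (simp add: qcomm_def uscale_mult_left mult.assoc)
    then show ?thesis by (simp add: 5 ev_mult theta_gen_def mult.assoc flip: psc_fscalar)
  next
    case (6 i j)
    have "uF i * uE j - uE j * uF i = uscale (of_bool (i = j) / qden i) (uKinv i - uK i)"
      using uE_uF[of j i] by (cases "i = j") (simp_all add: U.scale_right_diff_distrib)
    then show ?thesis using 6 by (simp add: ev_mult k k' uK_def uKinv_def qden_def theta_gen_def flip: psc_fscalar)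
  next
    case (7 i j)
    then show ?thesis using ev_scaled[OF serre_elt_Tw ev_serre(2), of i j] by (simp add: serre_ev theta_gen_def)
  next
    case (8 i j)
    then show ?thesis using ev_scaled[OF serre_elt_Tw ev_serre(1), of i j] by (simp add: serre_ev theta_gen_def)
  qed (simp_all add: ev_mult theta_gen_def uTinv_comm)
qed

lemma theta_spec: "(\<forall>x y :: 'i::cartan_datum uq. theta (x + y) = theta x + theta y) \<and>
    (\<forall>c. \<forall>x :: 'i uq. theta (uscale c x) = uscale c (theta x)) \<and>
    theta 1 = (1 :: 'i uq) \<and> (\<forall>x y :: 'i uq. theta (x * y) = theta x * theta y) \<and>
    (\<forall>i :: 'i. theta (uT i) = uTinv i \<and> theta (uE i) = - uF i \<and> theta (uF i) = - uE i)"
proof -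
  obtain h :: "'i uq => 'i uq" where h: "\<forall>x y. h (x + y) = h x + h y" "\<forall>c x. h (uscale c x) = uscale c (h x)"
    "h 1 = 1" "\<forall>x y. h (x * y) = h x * h y" "\<forall>g. h (gen_uq g) = theta_gen g"
    using hom_exists[of theta_gen] theta_relators by blast
  have "\<forall>i. h (uT i) = uTinv i \<and> h (uE i) = - uF i \<and> h (uF i) = - uE i"
    using h(5)[rule_format, of "GenT _"] h(5)[rule_format, of "GenE _"] h(5)[rule_format, of "GenF _"]
    by (simp add: theta_gen_def)
  then have "\<exists>!\<phi>. (\<forall>x y. \<phi> (x + y) = \<phi> x + \<phi> y) \<and> (\<forall>c x. \<phi> (uscale c x) = uscale c (\<phi> x)) \<and>
    \<phi> 1 = 1 \<and> (\<forall>x y. \<phi> (x * y) = \<phi> x * \<phi> y) \<and>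
    (\<forall>i. \<phi> (uT i) = uTinv i \<and> \<phi> (uE i) = - uF i \<and> \<phi> (uF i) = - uE (i :: 'i))"
    by (intro ex1I[of _ h] hom_unique[of _ uscale]) (use h in \<open>simp_all\<close>)
  from theI'[OF this] show ?thesis unfolding theta_def .
qed

lemma lin_theta: "lin uscale uscale theta" using theta_spec by (intro linU) blast+

lemmas theta_simps [simp] = lin_add[OF lin_theta] lin_scale[OF lin_theta] lin_0[OF lin_theta]
  lin_diff[OF lin_theta] lin_neg[OF lin_theta]

lemma theta_1 [simp]: "theta 1 = 1" using theta_spec by blast

lemma theta_mult [simp]: "theta (x * y) = theta x * theta y" using theta_spec by blast

lemma theta_T [simp]: "theta (uT i) = uTinv i" and theta_E [simp]: "theta (uE i) = - uF i"
    and theta_F [simp]: "theta (uF i) = - uE i" using theta_spec by blast+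

lemma theta_Tinv [simp]: "theta (uTinv i) = uT i"
proof -
  have "theta (uTinv i * uT i) = theta (uTinv i) * uTinv i" by (simp only: theta_mult theta_T)
  then have "theta (uTinv i) * uTinv i * uT i = uT i" by simp
  then show ?thesis by (simp add: mult.assoc)
qed

lemma theta_theta [simp]: "theta (theta u) = u"
proof (induction u rule: uq_induct)
  case (gen g u)
  then show ?case by (cases g) simp_all
qed simp_all

lemma kpow_swap: "kpow uTinv uT i s = kpow uT uTinv i (- s)"
  unfolding kpow_def ipow_def by (intro arg_cong[of _ _ prod_list] map_cong refl) auto

lemma theta_K [simp]: "theta (uK i) = uKinv i" and theta_Kinv [simp]: "theta (uKinv i) = uK i"
  by (simp_all add: uK_def uKinv_def kpow_hom[of theta] kpow_swap)

lemma counit_spec: "(\<forall>x y :: 'i::cartan_datum uq. counit (x + y) = counit x + counit y) \<and>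
    (\<forall>c. \<forall>x :: 'i uq. counit (uscale c x) = c * counit x) \<and>
    counit (1 :: 'i uq) = 1 \<and> (\<forall>x y :: 'i uq. counit (x * y) = counit x * counit y) \<and>
    (\<forall>i :: 'i. counit (uT i) = 1 \<and> counit (uE i) = 0 \<and> counit (uF i) = 0)"
proof -
  \<comment> \<open>\<open>hom_exists\<close> yields maps into the algebra itself. The counit is
    therefore built with values in the multiples of 1, and the scalar is read off with
    \<open>vcoeff 0\<close>.\<close>
  let ?\<phi> = "\<lambda>g :: 'i gen. case g of GenT i => 1 | GenTinv i => 1 | GenE i => 0 | GenF i => (0 :: 'i uq)"
  have k: "ev ?\<phi> (kpow fT fTinv i s) = 1" for i :: 'i and s
  proof -
    have "ipow 1 1 n = (1 :: 'i uq)" for n by (simp add: ipow_def)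
    then show ?thesis by (subst kpow_hom) (simp_all add: ev_mult kpow_def map_replicate_const)
  qed
  have 0: "ev (\<lambda>i. 0) p = uscale (const p) (1 :: 'i uq)" for p :: "'i tens"
  proof (induction p rule: free_induct)
    case (single w c)
    then show ?case by (cases w) (simp_all add: const_mono ev_Cons)
  qed (simp add: U.scale_left_distrib)
  have "ev ?\<phi> p = 0" if "p \<in> relators" for p using that
  proof cases
    case (7 i j)
    then show ?thesis using const_serre_ideal[OF serre_elt_ideal, of i j] by (simp add: serre_ev 0)
  next
    case (8 i j)
    then show ?thesis using const_serre_ideal[OF serre_elt_ideal, of i j] by (simp add: serre_ev 0)
  qed (simp_all add: ev_mult k flip: psc_fscalar)
  then obtain h :: "'i uq => 'i uq" where h: "\<forall>x y. h (x + y) = h x + h y" "\<forall>c x. h (uscale c x) = uscale c (h x)"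
    "h 1 = 1" "\<forall>x y. h (x * y) = h x * h y" "\<forall>g. h (gen_uq g) = ?\<phi> g" using hom_exists[of ?\<phi>] by blast
  have hg: "h (uT i) = 1" "h (uTinv i) = 1" "h (uE i) = 0" "h (uF i) = 0" for i
    using h(5)[rule_format, of "GenT i"] h(5)[rule_format, of "GenTinv i"] h(5)[rule_format, of "GenE i"] h(5)[rule_format, of "GenF i"] by simp_all
  define c where "c u = vcoeff 0 (h u)" for u
  have c: "\<forall>x y. c (x + y) = c x + c y" "\<forall>d x. c (uscale d x) = d * c x" "c 1 = 1"
    "\<forall>i. c (uT i) = 1 \<and> c (uE i) = 0 \<and> c (uF i) = 0" by (simp_all add: c_def h(1-3) hg)
  have hc: "h u = uscale (c u) 1" for u
  proof (induction u rule: uq_induct)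
    case (gen g u)
    have "\<exists>x. h (gen_uq g) = uscale x 1" by (cases g) (auto simp: hg intro: exI[of _ 1] exI[of _ 0])
    then obtain x where x: "h (gen_uq g) = uscale x 1" by blast
    have "h (gen_uq g * u) = uscale x (uscale (c u) 1)" using h(4) gen x by (simp add: uscale_mult_left)
    then show ?case by (simp add: c_def)
  next
    case (add u v)
    then show ?case using h(1) c(1) by (simp only: U.scale_left_distrib)
  next
    case (scale d u)
    then show ?case using h(2) c(2) by (simp only: U.scale_scale)
  qed (simp add: h(3) c(3))
  have cm: "\<forall>x y. c (x * y) = c x * c y"
    using h(4) by (simp add: c_def[of "_ * _"]) (simp add: hc uscale_mult_left)
  have "\<exists>!\<phi>. (\<forall>x y. \<phi> (x + y) = \<phi> x + \<phi> y) \<and> (\<forall>c x. \<phi> (uscale c x) = c * \<phi> x) \<and>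
    \<phi> 1 = 1 \<and> (\<forall>x y. \<phi> (x * y) = \<phi> x * \<phi> y) \<and>
    (\<forall>i :: 'i. \<phi> (uT i) = 1 \<and> \<phi> (uE i) = 0 \<and> \<phi> (uF i) = (0 :: qfield))"
    by (intro ex1I[of _ c] hom_unique[of _ "(*)"]) (use c cm in simp_all)
  from theI'[OF this] show ?thesis unfolding counit_def .
qed

text \<open>Twisting the generators by commuting elements that they normalize multiplies homogeneous
  elements by a scalar and a product of the twisting elements; both only depend on the weight.\<close>

lemma ev_twist_serre:
  fixes K y :: "'i::cartan_datum => 'i uq"
  assumes comm: "\<And>i j. K i * K j = K j * K i"
    and q: "\<And>i j. y i * K j = uscale (qpow (rpair j (simple_root i))) (K j * y i)"
    and 0: "ev y (serre_elt i j) = 0"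
  shows "ev (\<lambda>i. K i * y i) (serre_elt i j) = 0"
proof -
  define kp where "kp w = prod_list (map K w)" for w
  \<comment> \<open>Moving all twisting factors to the left costs one exponent for each pair of
    positions. Halving the symmetric sum counts every pair once and makes it visible that the order
    of the letters is immaterial.\<close>
  define b where "b w = (\<Sum>i\<leftarrow>w. rpair i (wt w - simple_root i)) / 2" for w :: "'i list"
  have kp_Cons: "kp (k # w) = K k * kp w" for k w by (simp add: kp_def)
  have rp: "(\<Sum>k\<leftarrow>w. rpair k (simple_root i)) = rpair i (wt w)" for w and i :: 'i
    by (induction w) (simp_all add: rpair_wt_Cons rpair_simple_commute[of _ i])
  have b_Cons: "b (i # w) = rpair i (wt w) + b w" for i w
    by (simp add: b_def wt_Cons rpair_add rpair_diff rp sum_list_addf sum_list_subtractf field_simps)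
  have yk: "y i * kp w = uscale (qpow (rpair i (wt w))) (kp w * y i)" for i w
  proof (induction w)
    case (Cons k w)
    have "y i * kp (k # w) = uscale (qpow (rpair k (simple_root i))) (K k * (y i * kp w))"
      by (simp add: kp_Cons q uscale_mult_left flip: mult.assoc)
    then show ?case
      by (simp add: Cons kp_Cons uscale_mult_right mult.assoc rpair_wt_Cons qpow_add rpair_simple_commute[of k])
  qed (simp add: kp_def)
  have word: "ev (\<lambda>i. K i * y i) (mono w) = uscale (qpow (b w)) (kp w * ev y (mono w))" for w
  proof (induction w)
    case (Cons k w)
    have "ev (\<lambda>i. K i * y i) (mono (k # w)) = uscale (qpow (b w)) (K k * (y k * kp w) * ev y (mono w))"
      by (simp add: ev_Cons Cons uscale_mult_right mult.assoc)
    also have "\<dots> = uscale (qpow (b (k # w))) (kp (k # w) * ev y (mono (k # w)))"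
      by (simp add: yk b_Cons qpow_add us_mult mult.assoc ev_Cons kp_Cons mult.commute)
    finally show ?case .
  qed (simp add: kp_def b_def)
  define N where "N = nat (1 - cartan i j)"
  define W where "W m = replicate m i @ j # replicate (N - m) i" for m
  have W: "kp (W m) = K i ^ N * K j" "b (W m) = b (W 0)" if "m \<in> {0..N}" for m
  proof -
    have kr: "kp (replicate n i) = K i ^ n" for n by (induction n) (simp_all add: kp_def)
    have "kp (W m) = K i ^ m * (K j * K i ^ (N - m))" unfolding W_def using kr by (simp add: kp_def)
    also have "K j * K i ^ (N - m) = K i ^ (N - m) * K j" by (rule power_commuting_commutes[OF comm, symmetric])
    finally show "kp (W m) = K i ^ N * K j" using that by (simp flip: mult.assoc power_add)
    have m: "mset (W m) = mset (W 0)" using that by (simp add: W_def multiset_eq_iff)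
    then have "wt (W m) = wt (W 0)" by (simp add: wt_def flip: count_mset)
    then show "b (W m) = b (W 0)" unfolding b_def sum_mset_sum_list[symmetric] mset_map m by simp
  qed
  have "ev (\<lambda>i. K i * y i) (serre_elt i j) = (\<Sum>m\<in>{0..N}. uscale ((- 1) ^ m / (qfactorial i m * qfactorial i (N - m)))
      (uscale (qpow (b (W 0))) (K i ^ N * K j * ev y (mono (W m)))))"
    unfolding serre_elt_def Let_def ev_sum N_def[symmetric]
  proof (intro sum.cong refl)
    fix m assume m: "m \<in> {0..N}"
    show "ev (\<lambda>i. K i * y i) (psc ((- 1) ^ m / (qfactorial i m * qfactorial i (N - m))) (mono (replicate m i @ j # replicate (N - m) i))) =
      uscale ((- 1) ^ m / (qfactorial i m * qfactorial i (N - m))) (uscale (qpow (b (W 0))) (K i ^ N * K j * ev y (mono (W m))))"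
      unfolding W_def[of m, symmetric] by (simp add: word W(1)[OF m] W(2)[OF m])
  qed
  also have "\<dots> = uscale (qpow (b (W 0))) (K i ^ N * K j * ev y (serre_elt i j))"
    by (simp add: serre_elt_def Let_def ev_sum N_def[symmetric] sum_distrib_left U.scale_sum_right
        uscale_mult_right mult.commute W_def)
  finally show ?thesis using 0 by simp
qed

definition antipode_gen :: "'i::cartan_datum gen => 'i uq"
  where "antipode_gen g = (case g of GenT i => uTinv i | GenTinv i => uT i
    | GenE i => - (uKinv i * uE i) | GenF i => - (uF i * uK i))"

lemma flip_fgen [simp]: "flip (fgen g) = fgen g" by (simp add: fgen_def flip_mono)

lemma uK_comm: "uK i * uK j = uK j * uK i" "uKinv i * uK j = uK j * uKinv i" "uKinv i * uKinv j = uKinv j * uKinv i"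
  by (rule Uzero_commute; simp)+

lemma uE_K: "uE i * uK j = uscale (qpow (- rpair j (simple_root i))) (uK j * uE i)"
  and uE_Kinv: "uE i * uKinv j = uscale (qpow (rpair j (simple_root i))) (uKinv j * uE i)"
  and uF_K: "uF i * uK j = uscale (qpow (rpair j (simple_root i))) (uK j * uF i)"
  and uF_Kinv: "uF i * uKinv j = uscale (qpow (- rpair j (simple_root i))) (uKinv j * uF i)"
  by (simp_all add: uK_E uKinv_E uK_F uKinv_F)

lemma qcomm_T_K: "qcomm (uT i) (uK j) 0" "qcomm (uT i) (uKinv j) 0"
  by (simp_all add: qcomm_def Uzero_commute[OF uT_Uzero])

lemma ev_flip_act: "ev \<phi> (flip p) = act uscale (\<lambda>g u. u * \<phi> g) p 1"
proof -
  interpret r: free_action uscale "\<lambda>g u. u * \<phi> g" by unfold_locales (simp_all add: distrib_right uscale_mult_left)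
  have "ev \<phi> (mono (rev w)) = foldr (\<lambda>g u. u * \<phi> g) w 1" for w by (induction w) (simp_all add: mono_append ev_mult)
  then show ?thesis by (induction p rule: free_induct) (simp_all add: r.act_add r.act_psc flip_mono)
qed

lemma ev_flip_serre: "ev \<phi> (flip (serre (\<lambda>i. fgen (h i)) i j)) = ev (\<lambda>i. \<phi> (h i)) (flip (serre_elt i j))"
proof -
  have r: "free_action uscale (\<lambda>g u. u * \<phi> g)" by unfold_locales (simp_all add: distrib_right uscale_mult_left)
  show ?thesis unfolding ev_flip_act by (rule act_serre[OF r])
qed

text \<open>The antipode reverses products, so its values on generators are evaluated on reversed
  words. The Serre relations then come down to \<open>ev_twist_serre\<close>.\<close>

lemma antipode_relators:
  assumes "p \<in> (relators :: 'i::cartan_datum falg set)"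
  shows "ev antipode_gen (flip p) = 0"
proof -
  have k: "ev antipode_gen (flip (kpow fT fTinv i s)) * kpow uT uTinv i s = 1" for i :: 'i and s
  proof -
    have "ev antipode_gen (flip (kpow fT fTinv i s)) * abs_uq (kpow fT fTinv i s) = 1"
    proof (rule kpow_rule[of "\<lambda>a x. ev antipode_gen (flip a) * abs_uq a = 1" _ 0])
      show "ev antipode_gen (flip (a * b)) * abs_uq (a * b) = 1"
        if "ev antipode_gen (flip a) * abs_uq a = 1" "ev antipode_gen (flip b) * abs_uq b = 1" for a b :: "'i falg"
      proof -
        have "ev antipode_gen (flip (a * b)) * abs_uq (a * b) =
            ev antipode_gen (flip b) * (ev antipode_gen (flip a) * abs_uq a) * abs_uq b"
          by (simp only: flip_mult ev_mult abs_uq_mult mult.assoc)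
        then show ?thesis using that by simp
      qed
    qed (simp_all add: abs_uq_1 abs_uq_gen antipode_gen_def)
    then show ?thesis by (simp add: abs_uq_kpow)
  qed
  have K: "ev antipode_gen (flip (kpow fT fTinv i 1)) = uKinv i" for i :: 'i
  proof -
    have "ev antipode_gen (flip (kpow fT fTinv i 1)) * uK i * uKinv i = uKinv i"
      using k[of i 1] by (simp add: uK_def)
    then show ?thesis by (simp add: mult.assoc)
  qed
  have Kinv: "ev antipode_gen (flip (kpow fT fTinv i (- 1))) = uK i" for i :: 'i
  proof -
    have "ev antipode_gen (flip (kpow fT fTinv i (- 1))) * uKinv i * uK i = uK i"
      using k[of i "- 1"] by (simp add: uKinv_def)
    then show ?thesis by (simp add: mult.assoc)
  qed
  show ?thesis using assms
  proof cases
    case (4 i j)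
    have "qcomm (uT i) (uKinv j * uE j) (0 + symm i * of_bool (i = j))"
      by (rule qcomm_mult_right[OF qcomm_T_K(2) qcomm_T_E])
    then have "uT i * (uKinv j * uE j) * uTinv i = uscale (qpow (symm i * of_bool (i = j))) (uKinv j * uE j)"
      by (simp add: qcomm_def uscale_mult_left mult.assoc)
    then show ?thesis by (simp add: 4 flip_mult ev_mult antipode_gen_def mult.assoc flip: psc_fscalar)
  next
    case (5 i j)
    have "qcomm (uT i) (uF j * uK j) (- (symm i * of_bool (i = j)) + 0)"
      by (rule qcomm_mult_right[OF qcomm_T_F qcomm_T_K(1)])
    then have "uT i * (uF j * uK j) * uTinv i = uscale (qpow (- (symm i * of_bool (i = j)))) (uF j * uK j)"
      by (simp add: qcomm_def uscale_mult_left mult.assoc)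
    then show ?thesis by (simp add: 5 flip_mult ev_mult antipode_gen_def mult.assoc flip: psc_fscalar)
  next
    case (6 i j)
    have a: "uKinv i * uE i * (uF j * uK j) = uKinv i * (uE i * uF j) * uK j" by (simp add: mult.assoc)
    have b: "uF j * uK j * (uKinv i * uE i) = uKinv i * (uF j * uE i) * uK j"
    proof -
      have "uF j * uK j * (uKinv i * uE i) = uF j * (uKinv i * uK j) * uE i" by (simp add: uK_comm mult.assoc)
      also have "\<dots> = uscale (qpow (- rpair i (simple_root j))) (uKinv i * (uF j * (uK j * uE i)))"
        by (simp add: uF_Kinv uscale_mult_left flip: mult.assoc)
      also have "\<dots> = uKinv i * (uF j * uE i) * uK j"
        by (simp add: uK_E uscale_mult_right mult.assoc rpair_simple_commute[of j i])
      finally show ?thesis .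
    qed
    have "ev antipode_gen (flip (fE i * fF j - fF j * fE i)) = uKinv i * (uF j * uE i - uE i * uF j) * uK j"
      using a b by (simp add: flip_mult ev_mult antipode_gen_def right_diff_distrib left_diff_distrib)
    also have "uF j * uE i - uE i * uF j = - uscale (of_bool (i = j) / qden i) (uK i - uKinv i)"
      using uE_uF[of i j] by simp
    also have "uKinv i * - uscale (of_bool (i = j) / qden i) (uK i - uKinv i) * uK j =
        uscale (of_bool (i = j) / qden i) (uKinv i - uK i)"
      by (cases "i = j") (simp_all add: us_mult right_diff_distrib left_diff_distrib
          uK_comm mult.assoc U.scale_right_diff_distrib)
    finally show ?thesis using 6 by (simp add: K Kinv qden_def flip: psc_fscalar)
  next
    case (7 i j)
    have "ev (\<lambda>i. - uKinv i * uE i) (serre_elt i j) = 0"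
      by (rule ev_twist_serre) (simp_all add: uK_comm uE_Kinv ev_serre[OF 7(2)])
    then show ?thesis using 7 by (simp add: ev_flip_serre flip_serre antipode_gen_def)
  next
    case (8 i j)
    \<comment> \<open>The scalar rewrites \<open>- (uF i * uK i)\<close> with its torus factor on
      the left.\<close>
    have "ev (\<lambda>i. uscale (- qpow (2 * symm i)) (uK i) * uF i) (serre_elt i j) = 0"
      by (rule ev_twist_serre) (simp_all add: uK_comm uF_K ev_serre[OF 8(2)] us_mult mult.commute)
    moreover have "(\<lambda>i. uscale (- qpow (2 * symm i)) (uK i) * uF i) = (\<lambda>i :: 'i. - (uF i * uK i))"
      by (simp add: fun_eq_iff uF_K rpair_self uscale_mult_left)
    ultimately show ?thesis using 8 by (simp add: ev_flip_serre flip_serre antipode_gen_def)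
  qed (simp_all add: flip_mult ev_mult antipode_gen_def uTinv_comm)
qed

lemma antipode_spec: "(\<forall>x y :: 'i::cartan_datum uq. antipode (x + y) = antipode x + antipode y) \<and>
    (\<forall>c. \<forall>x :: 'i uq. antipode (uscale c x) = uscale c (antipode x)) \<and>
    antipode 1 = (1 :: 'i uq) \<and> (\<forall>x y :: 'i uq. antipode (x * y) = antipode y * antipode x) \<and>
    (\<forall>i :: 'i. antipode (uT i) = uTinv i \<and> antipode (uE i) = - (uKinv i * uE i) \<and> antipode (uF i) = - (uF i * uK i))"
proof -
  have rel: "ev antipode_gen (flip p) = 0" if "p \<in> relation_ideal" for p :: "'i falg"
    using that by (induction rule: relation_ideal.induct) (simp_all add: antipode_relators ev_mult flip_mult)
  define h where "h u = ev antipode_gen (flip (rep_uq u))" for u :: "'i uq"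
  have ha: "h (abs_uq p) = ev antipode_gen (flip p)" for p
    using rel[of "rep_uq (abs_uq p) - p"] abs_uq_eq_iff[of "rep_uq (abs_uq p)" p] by (simp add: h_def)
  have h: "h (x + y) = h x + h y" "h (x * y) = h y * h x" "h (uscale c x) = uscale c (h x)" for x y c
  proof -
    obtain p r where [simp]: "x = abs_uq p" "y = abs_uq r" using uq_cases by metis
    show "h (x + y) = h x + h y" "h (x * y) = h y * h x" "h (uscale c x) = uscale c (h x)"
      by (simp_all add: ha ev_mult flip_mult flip: abs_uq_add abs_uq_mult abs_uq_psc)
  qed
  have h1: "h 1 = 1" using ha[of 1] by (simp add: abs_uq_1)
  have hg: "h (gen_uq g) = antipode_gen g" for g using ha[of "fgen g"] by (simp add: abs_uq_ev)
  have "\<exists>!\<phi>. (\<forall>x y. \<phi> (x + y) = \<phi> x + \<phi> y) \<and> (\<forall>c x. \<phi> (uscale c x) = uscale c (\<phi> x)) \<and>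
    \<phi> 1 = 1 \<and> (\<forall>x y. \<phi> (x * y) = \<phi> y * \<phi> x) \<and>
    (\<forall>i :: 'i. \<phi> (uT i) = uTinv i \<and> \<phi> (uE i) = - (uKinv i * uE i) \<and> \<phi> (uF i) = - (uF i * uK i))"
  proof (rule ex1I[of _ h])
    show "(\<forall>x y. h (x + y) = h x + h y) \<and> (\<forall>c x. h (uscale c x) = uscale c (h x)) \<and>
      h 1 = 1 \<and> (\<forall>x y. h (x * y) = h y * h x) \<and>
      (\<forall>i :: 'i. h (uT i) = uTinv i \<and> h (uE i) = - (uKinv i * uE i) \<and> h (uF i) = - (uF i * uK i))"
      using h h1 hg[of "GenT _"] hg[of "GenE _"] hg[of "GenF _"] by (simp add: antipode_gen_def)
    fix k :: "'i uq => 'i uq" assume k: "(\<forall>x y. k (x + y) = k x + k y) \<and> (\<forall>c x. k (uscale c x) = uscale c (k x)) \<and>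
      k 1 = 1 \<and> (\<forall>x y. k (x * y) = k y * k x) \<and>
      (\<forall>i :: 'i. k (uT i) = uTinv i \<and> k (uE i) = - (uKinv i * uE i) \<and> k (uF i) = - (uF i * uK i))"
    have kT: "k (uTinv i) = uT i" for i
    proof -
      have "k (uT i * uTinv i) = k (uTinv i) * k (uT i)" using k by blast
      then have "k (uTinv i) * uTinv i = 1" using k by simp
      then have "k (uTinv i) * uTinv i * uT i = uT i" by simp
      then show ?thesis by (simp add: mult.assoc)
    qed
    have kg: "k (gen_uq g) = antipode_gen g" for g using k kT by (cases g) (simp_all add: antipode_gen_def)
    show "k = h"
    proof
      show "k u = h u" for u
      proof (induction u rule: uq_induct)
        case (gen g u)
        have "k (gen_uq g * u) = k u * k (gen_uq g)" using k by blast
        then show ?case by (simp add: gen kg hg h)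
      qed (use k h h1 in simp_all)
    qed
  qed
  from theI'[OF this] show ?thesis unfolding antipode_def .
qed

lemma lin_antipode: "lin uscale uscale antipode" using antipode_spec by (intro linU) blast+

lemma antipode_mult: "antipode (x * y) = antipode y * antipode x" using antipode_spec by blast

lemma lin_omega: "lin uscale uscale omega" using lin_comp[OF lin_theta lin_antipode] by (simp add: omega_def o_def)

lemmas omega_simps [simp] = lin_add[OF lin_omega] lin_scale[OF lin_omega] lin_0[OF lin_omega]
  lin_diff[OF lin_omega] lin_neg[OF lin_omega]

lemma omega_mult [simp]: "omega (x * y) = omega y * omega x" by (simp add: omega_def antipode_mult)

lemma omega_1 [simp]: "omega 1 = 1" unfolding omega_def o_def theta_1 using antipode_spec by blast

lemma omega_T [simp]: "omega (uT i) = uT i" and omega_Tinv [simp]: "omega (uTinv i) = uTinv i"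
    and omega_E [simp]: "omega (uE i) = uF i * uK i" and omega_F [simp]: "omega (uF i) = uKinv i * uE i"
proof -
  have s: "antipode (uT i) = uTinv i" "antipode (uE i) = - (uKinv i * uE i)" "antipode (uF i) = - (uF i * uK i)"
    "antipode 1 = (1 :: 'a uq)" using antipode_spec by blast+
  show "omega (uTinv i) = uTinv i" "omega (uE i) = uF i * uK i" "omega (uF i) = uKinv i * uE i"
    by (simp_all add: omega_def s lin_neg[OF lin_antipode])
  moreover have "omega (uTinv i) * omega (uT i) = 1" by (simp only: omega_1 uT_inv flip: omega_mult)
  ultimately have "uT i * (uTinv i * omega (uT i)) = uT i" by (simp add: omega_def s)
  then show "omega (uT i) = uT i" by simp
qed

lemma omega_K [simp]: "omega (uK i) = uK i" and omega_Kinv [simp]: "omega (uKinv i) = uKinv i"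
proof -
  have o: "omega x = x" if "x \<in> Uzero" for x :: "'a uq"
    using that by (induction rule: Uzero_induct) (simp_all add: Uzero_commute)
  show "omega (uK i) = uK i" "omega (uKinv i) = uKinv i" by (simp_all add: o)
qed

lemma omega_omega [simp]: "omega (omega u) = u"
proof (induction u rule: uq_induct)
  case (gen g u)
  then show ?case by (cases g) (simp_all add: mult.assoc)
qed simp_all

section \<open>The Shapovalov form\<close>

text \<open>The elements \<open>v\<close> with \<open>g (u * v) = 0\<close> for all \<open>u\<close>
  form a left ideal containing the highest weight relations. By \<open>vproj_decomp\<close> it
  suffices to know \<open>g\<close> on the negative part, where it sees only the constant
  term.\<close>

lemma vcoeff_unique:
  assumes "lin uscale (*) g" "\<And>u i. g (u * uE i) = 0" "\<And>u i. g (uF i * u) = 0"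
    and "\<And>u i. g (u * uT i) = qpow (symm i * l i) * g u"
  shows "g u = g 1 * vcoeff l u"
proof -
  let ?N = "{v. \<forall>u. g (u * v) = 0}"
  have "u - vproj l u \<in> ?N"
  proof (rule vproj_decomp)
    show "U.subspace ?N"
      by (simp add: U.subspace_def distrib_left uscale_mult_right lin_add[OF assms(1)] lin_scale[OF assms(1)] lin_0[OF assms(1)])
    show "uT i - uscale (qpow (symm i * l i)) 1 \<in> ?N" for i
      by (simp add: right_diff_distrib uscale_mult_right lin_diff[OF assms(1)] lin_scale[OF assms(1)] assms(4))
  qed (simp_all add: assms(2) flip: mult.assoc)
  then have "g (1 * (u - vproj l u)) = 0" by blast
  then have "g u = g (vproj l u)" by (simp add: lin_diff[OF assms(1)])
  moreover have "g (evF p) = g 1 * const p" for p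
  proof (induction p rule: free_induct)
    case (single w c)
    then show ?case
      by (cases w) (simp_all add: ev_Cons lin_scale[OF assms(1)] lin_0[OF assms(1)] assms(3) const_mono)
  qed (simp add: lin_add[OF assms(1)] distrib_left)
  ultimately show ?thesis by (simp add: vproj_def vcoeff_def)
qed

lemma lin_vcoeff_comp: "lin uscale uscale f ==> lin uscale (*) (\<lambda>u. vcoeff l (f u))"
  by (rule lin_comp[OF _ lin_vcoeff])

text \<open>\<open>omega\<close> exchanges the two annihilation conditions and fixes the torus
  generators, so uniqueness applies. The symmetry of the Shapovalov form follows.\<close>

lemma vcoeff_omega [simp]: "vcoeff l (omega u) = vcoeff l u"
proof -
  have kt: "vcoeff l (uT i * u) = qpow (symm i * l i) * vcoeff l u" for u i
  proof -
    have "vcoeff l (uT i * u) = qpow (symm i * l i) * const p" if u: "vproj l u = evF p" for p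
    proof -
      have "const (vop l (GenT i) p) = qpow (symm i * l i) * const p" by (induction p rule: free_induct)
          (auto simp: vop_T[OF mono_Tw] const_mono distrib_left zero_fun_apply)
      moreover have "vcoeff l (uT i * u) = vcoeff l (uT i * vproj l u)" by (rule vcoeff_cong) (rule vproj_mult)
      moreover have "vproj l (uT i * evF p) = vproj l (evF (vop l (GenT i) p))"
        using vproj_gen_mult[of l "GenT i" p] by simp
      from vcoeff_cong[OF this] have "vcoeff l (uT i * evF p) = const (vop l (GenT i) p)" by simp
      ultimately show ?thesis by (simp add: u)
    qed
    from this[of "vrep l u 1"] show ?thesis by (simp add: vproj_def vcoeff_def)
  qed
  have "vcoeff l (omega u) = vcoeff l (omega 1) * vcoeff l u" by (rule vcoeff_unique[of "\<lambda>u. vcoeff l (omega u)"])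
      (simp_all add: lin_vcoeff_comp lin_omega kt mult.assoc, metis mult.assoc vcoeff_mult_E)
  then show ?thesis by simp
qed

text \<open>The Shapovalov form extended from the negative part to the whole algebra, which makes
  contravariance an identity without domain conditions.\<close>

definition shap :: "('i::cartan_datum => rat) => 'i uq => 'i uq => qfield"
  where "shap l x y = vcoeff l (omega x * y)"

lemma shap_commute: "shap l x y = shap l y x" using vcoeff_omega[of l "omega x * y"] by (simp add: shap_def)

lemma lin_shap: "lin uscale (*) (shap l x)" using lin_vcoeff_comp[of "\<lambda>y. omega x * y" l]
  by (simp add: linU distrib_left uscale_mult_right shap_def[abs_def])

lemmas shap_simps [simp] = lin_add[OF lin_shap] lin_scale[OF lin_shap] lin_0[OF lin_shap]
  lin_diff[OF lin_shap] lin_neg[OF lin_shap]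
lemmas shap_sum = lin_sum[OF lin_shap]

lemma lin_shap_left: "lin uscale (*) (\<lambda>x. shap l x y)" using lin_shap[of l y] by (simp add: shap_commute[of l _ y])

lemmas shap_left_simps [simp] = lin_add[OF lin_shap_left] lin_scale[OF lin_shap_left] lin_0[OF lin_shap_left]
  lin_diff[OF lin_shap_left] lin_neg[OF lin_shap_left]
lemmas shap_left_sum = lin_sum[OF lin_shap_left]

lemma shap_mult_right: "shap l x (a * y) = shap l (omega a * x) y" by (simp add: shap_def mult.assoc)

lemma shap_mult_left: "shap l (a * x) y = shap l x (omega a * y)" by (simp add: shap_def mult.assoc)

lemma shap_vproj_right [simp]: "shap l x (vproj l y) = shap l x y"
  unfolding shap_def by (rule vcoeff_cong) (rule vproj_mult[symmetric])

lemma shap_vproj_left [simp]: "shap l (vproj l x) y = shap l x y"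
  using shap_vproj_right[of l y x] by (simp add: shap_commute)

lemma shap_1 [simp]: "shap l 1 y = vcoeff l y" by (simp add: shap_def)

section \<open>The projection to the torus part\<close>

lemma Uminus_counit: "counit (evF p) = const p" and Uplus_counit: "counit (evE p) = const p"
proof -
  have c: "counit (x + y) = counit x + counit y" "counit (uscale d x) = d * counit x" "counit (1 :: 'a uq) = 1"
    "counit (x * y) = counit x * counit y" "counit (uE i) = 0" "counit (uF i) = 0" for x y :: "'a uq" and d i
    using counit_spec by blast+
  have "counit (ev x p) = const p" if "\<And>i. counit (x i) = 0" for x :: "'a => 'a uq" and p
  proof (induction p rule: free_induct)
    case (single w d)
    then show ?case by (cases w) (simp_all add: ev_Cons c(1-4) that const_mono)
  qed (simp add: c(1))
  then show "counit (evF p) = const p" "counit (evE p) = const p" for p :: "'a tens" by (simp_all add: c)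
qed

definition ker0 :: "'i::cartan_datum uq set"
  where "ker0 = U.span ({y * u | y u. y \<in> Uminus \<and> counit y = 0} \<union> {u * y | u y. y \<in> Uplus \<and> counit y = 0})"

lemma const_0_decomp_left:
  assumes "const p = 0"
  obtains a where "ev x p = (\<Sum>i\<in>UNIV. x i * ev x (a (i :: 'i::finite)))"
proof -
  have "\<exists>a. ev x p = uscale (const p) 1 + (\<Sum>i\<in>UNIV. x i * ev x (a i))" for p
  proof (induction p rule: free_induct)
    case (single w c)
    show ?case
    proof (cases w)
      case Nil
      then show ?thesis by (intro exI[of _ "\<lambda>_. 0"]) (simp add: const_mono)
    next
      case (Cons j v)
      have "(\<Sum>i\<in>UNIV. x i * ev x (if i = j then psc c (mono v) else 0)) = (\<Sum>i\<in>UNIV. if i = j then x j * ev x (psc c (mono v)) else 0)"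
        by (intro sum.cong) auto
      then show ?thesis
        by (intro exI[of _ "\<lambda>i. if i = j then psc c (mono v) else 0"]) (simp add: Cons ev_Cons uscale_mult_right const_mono)
    qed
  next
    case (add p r)
    then obtain a b where ab: "ev x p = uscale (const p) 1 + (\<Sum>i\<in>UNIV. x i * ev x (a i))"
      "ev x r = uscale (const r) 1 + (\<Sum>i\<in>UNIV. x i * ev x (b i))" by blast
    show ?case by (intro exI[of _ "\<lambda>i. a i + b i"])
        (simp only: ev_simps ab const_simps distrib_left sum.distrib U.scale_left_distrib add_ac)
  qed
  from this[of p] show ?thesis using that assms by auto
qed

lemma const_0_decomp_right:
  assumes "const p = 0"
  obtains a where "ev x p = (\<Sum>i\<in>UNIV. ev x (a i) * x (i :: 'i::finite))"
proof -
  have "\<exists>a. ev x p = uscale (const p) 1 + (\<Sum>i\<in>UNIV. ev x (a i) * x i)" for p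
  proof (induction p rule: free_induct)
    case (single w c)
    show ?case
    proof (cases w rule: rev_cases)
      case Nil
      then show ?thesis by (intro exI[of _ "\<lambda>_. 0"]) (simp add: const_mono)
    next
      case (snoc v j)
      have "(\<Sum>i\<in>UNIV. ev x (if i = j then psc c (mono v) else 0) * x i) = (\<Sum>i\<in>UNIV. if i = j then ev x (psc c (mono v)) * x j else 0)"
        by (intro sum.cong) auto
      then show ?thesis by (intro exI[of _ "\<lambda>i. if i = j then psc c (mono v) else 0"])
          (simp add: snoc mono_append ev_mult uscale_mult_left const_mono[of "v @ [j]", unfolded mono_append])
    qed
  next
    case (add p r)
    then obtain a b where ab: "ev x p = uscale (const p) 1 + (\<Sum>i\<in>UNIV. ev x (a i) * x i)"
      "ev x r = uscale (const r) 1 + (\<Sum>i\<in>UNIV. ev x (b i) * x i)" by blast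
    show ?case by (intro exI[of _ "\<lambda>i. a i + b i"])
        (simp only: ev_simps ab const_simps distrib_right sum.distrib U.scale_left_distrib add_ac)
  qed
  from this[of p] show ?thesis using that assms by auto
qed

lemma vcoeff_ker0: "x \<in> ker0 ==> vcoeff l x = 0" unfolding ker0_def
proof (induction x rule: U.span_induct_alt)
  case (step c x z)
  have "vcoeff l x = 0"
  proof (cases "x \<in> {y * u | y u. y \<in> Uminus \<and> counit y = 0}")
    case True
    then obtain p u where p: "x = evF p * u" "const p = 0" by (auto simp: Uminus_eq Uminus_counit)
    obtain a where "evF p = (\<Sum>i\<in>UNIV. uF i * evF (a i))" by (rule const_0_decomp_left[OF p(2), of uF])
    then show ?thesis by (simp add: p(1) sum_distrib_right lin_sum[OF lin_vcoeff] mult.assoc)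
  next
    case False
    then obtain p u where p: "x = u * evE p" "const p = 0" using step by (auto simp: Uplus_eq Uplus_counit)
    obtain b where "evE p = (\<Sum>i\<in>UNIV. evE (b i) * uE i)" by (rule const_0_decomp_right[OF p(2), of uE])
    then show ?thesis by (simp add: p(1) sum_distrib_left lin_sum[OF lin_vcoeff] flip: mult.assoc)
  qed
  then show ?case using step by simp
qed simp

lemma ker0_subspace: "U.subspace ker0" by (simp add: ker0_def)

lemma ker0_F: "uF i * u \<in> ker0" unfolding ker0_def
  by (rule U.span_base) (use Uminus_counit[of "mono [i]"] const_mono[of "[i]"] uF_Uminus in auto)

lemma ker0_E: "u * uE i \<in> ker0" unfolding ker0_def
  by (rule U.span_base) (use Uplus_counit[of "mono [i]"] const_mono[of "[i]"] uE_Uplus in auto)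

lemma ker0_complement: "\<exists>z\<in>Uzero. (u :: 'i::cartan_datum uq) - z \<in> ker0"
proof -
  note Z = subalgebraD[OF subalgebra_Uzero]
  show ?thesis using uq_triangular[of u]
  proof (induction u rule: U.span_induct_alt)
    case base
    then show ?case by (intro bexI[of _ 0]) (simp_all add: Z U.subspace_0[OF ker0_subspace])
  next
    case (step c x y)
    then obtain v n w where x: "x = evF (mono v) * tmon n * evE (mono w)" by blast
    have "\<exists>z\<in>Uzero. x - z \<in> ker0"
    proof (cases "v = [] \<and> w = []")
      case True
      then show ?thesis using x by (intro bexI[of _ "tmon n"]) (simp_all add: U.subspace_0[OF ker0_subspace])
    next
      case False
      have "x \<in> ker0"
      proof (cases v)
        case (Cons i v')
        then show ?thesis
          using ker0_F[of i "evF (mono v') * tmon n * evE (mono w)"] by (simp add: x ev_Cons mult.assoc)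
      next
        case Nil
        then obtain w' i where "w = w' @ [i]" using False by (metis rev_exhaust)
        then show ?thesis
          using ker0_E[of "evF (mono v) * tmon n * evE (mono w')" i] by (simp add: x mono_append ev_mult mult.assoc)
      qed
      then show ?thesis by (intro bexI[of _ 0]) (simp_all add: Z)
    qed
    then obtain z z' where "z \<in> Uzero" "x - z \<in> ker0" "z' \<in> Uzero" "y - z' \<in> ker0" using step by blast
    moreover have h: "uscale c x + y - (uscale c z + z') = uscale c (x - z) + (y - z')"
      by (simp add: U.scale_right_diff_distrib)
    ultimately have "uscale c x + y - (uscale c z + z') \<in> ker0"
      unfolding h by (intro U.subspace_add[OF ker0_subspace] U.subspace_scale[OF ker0_subspace])
    then show ?case using \<open>z \<in> Uzero\<close> \<open>z' \<in> Uzero\<close> by (intro bexI[of _ "uscale c z + z'"]) (simp_all add: Z)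
  qed
qed

text \<open>Artin's argument: subtracting \<open>h m u\<close> times the relation from its translate
  by \<open>u\<close> removes the term \<open>m\<close> and leaves the term \<open>n\<close> with a
  non-zero factor.\<close>

lemma characters_independent:
  fixes h :: "'n => 'm::plus => 'k::field"
  assumes "finite S" "\<And>l. (\<Sum>n\<in>S. c n * h n l) = 0"
    and "\<And>n l u. h n (l + u) = h n l * h n u" "\<And>n l. h n l \<noteq> 0"
    and "\<And>n m. n \<in> S ==> m \<in> S ==> n \<noteq> m ==> \<exists>u. h n u \<noteq> h m u"
  shows "n \<in> S ==> c n = 0" using assms(1,2,5)
proof (induction S arbitrary: c n rule: finite_induct)
  case (insert m S)
  have 0: "c n = 0" if "n \<in> S" for n
  proof -
    obtain u where u: "h n u \<noteq> h m u" using insert.prems(3)[of n m] insert.hyps \<open>n \<in> S\<close> by blast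
    have "(\<Sum>k\<in>S. c k * (h k u - h m u) * h k l) = 0" for l
    proof -
      have "(\<Sum>k\<in>insert m S. c k * h k (l + u)) - h m u * (\<Sum>k\<in>insert m S. c k * h k l) = 0"
        using insert.prems(2) by simp
      then have "(\<Sum>k\<in>insert m S. c k * h k (l + u) - h m u * (c k * h k l)) = 0"
        by (simp only: sum_distrib_left sum_subtractf)
      then show ?thesis using insert.hyps by (simp add: assms(3) algebra_simps)
    qed
    from insert.IH[OF \<open>n \<in> S\<close> this] show "c n = 0" using u insert.prems(3) by simp
  qed
  have "c m * h m l = 0" for l using insert.prems(2)[of l] insert.hyps 0 by simp
  then have "c m = 0" using assms(4) by simp
  then show ?case using 0 insert.prems(1) by blast
qed simp

lemma vcoeff_tmon: "vcoeff l (tmon n) = qpow (\<Sum>j\<in>UNIV. of_int (n j) * (symm j * l j))"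
proof -
  have "tmon n \<in> Uzero \<and> vcoeff l (tmon n) = qpow (\<Sum>j\<in>UNIV. of_int (n j) * (symm j * l j))"
    by (rule tmon_rule) (auto simp: subalgebraD[OF subalgebra_Uzero] vcoeff_Uzero qpow_add)
  then show ?thesis ..
qed

lemma Uzero_tmon:
  assumes "z \<in> Uzero"
  obtains S c where "finite S" "z = (\<Sum>n\<in>S. uscale (c n) (tmon n))"
proof -
  have "z \<in> U.span (range tmon)" using assms
  proof (induction rule: Uzero_induct)
    case 1
    show ?case using U.span_base[OF rangeI, of tmon "\<lambda>_. 0"] by (simp add: tmon_0)
  next
    case (T i)
    have "ipow (uT i) (uTinv i) 1 = uT i" by (simp add: ipow_def)
    then show ?case using U.span_base[OF rangeI, of tmon "\<lambda>j. if j = i then 1 else 0"] by (simp add: tmon_single)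
  next
    case (Tinv i)
    have "ipow (uT i) (uTinv i) (- 1) = uTinv i" by (simp add: ipow_def)
    then show ?case using U.span_base[OF rangeI, of tmon "\<lambda>j. if j = i then - 1 else 0"] by (simp add: tmon_single)
  next
    case (mult x y)
    have a: "a * y \<in> U.span (range tmon)" if "a \<in> range tmon" for a using mult(4)
    proof (induction y rule: U.span_induct_alt)
      case (step c u v)
      then have "a * u \<in> range tmon" using that by (auto simp flip: tmon_add)
      then show ?case using step by (simp add: distrib_left uscale_mult_right U.span_add U.span_scale U.span_base)
    qed (simp add: U.span_zero)
    show ?case using mult(3) by (induction x rule: U.span_induct_alt)
        (simp_all add: a distrib_right uscale_mult_left U.span_add U.span_scale U.span_zero)
  qed (simp_all add: U.span_add U.span_scale)
  then show ?thesis unfolding U.span_explicit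
  proof clarify
    fix S r assume S: "finite S" "S \<subseteq> range tmon" "z = (\<Sum>a\<in>S. uscale (r a) a)"
    then obtain S' where S': "S = tmon ` S'" "inj_on tmon S'" unfolding subset_image_inj by blast
    have "finite S'" using S(1) S' by (simp add: finite_image_iff)
    show thesis by (rule that[of S' "\<lambda>n. r (tmon n)"]) (simp_all add: S(3) S' \<open>finite S'\<close> sum.reindex)
  qed
qed

text \<open>Distinct torus monomials have distinct characters as functions of the weight. Hence the
  values at all weights determine an element of \<open>Uzero\<close>, and \<open>proj0\<close> is
  well defined.\<close>

lemma Uzero_eq_0:
  assumes "z \<in> Uzero" "\<And>L. vcoeff L z = 0"
  shows "z = 0"
proof -
  obtain S c where S: "finite S" "z = (\<Sum>n\<in>S. uscale (c n) (tmon n))" using Uzero_tmon[OF assms(1)] .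
  define \<chi> where "\<chi> n L = qpow (\<Sum>j\<in>UNIV. of_int (n j) * (symm j * L j))" for n :: "'a => int" and L
  have "c n = 0" if "n \<in> S" for n
  proof (rule characters_independent[of S c \<chi>])
    show "(\<Sum>n\<in>S. c n * \<chi> n L) = 0" for L
      using assms(2)[of L] by (simp add: S lin_sum[OF lin_vcoeff] vcoeff_tmon \<chi>_def)
    show "\<chi> n (L + u) = \<chi> n L * \<chi> n u" for n L u
      by (simp add: \<chi>_def plus_fun_apply distrib_left sum.distrib qpow_add)
    fix n m assume "n \<in> S" "m \<in> S" "n \<noteq> m"
    then obtain j where j: "n j \<noteq> m j" by blast
    have "(\<Sum>k\<in>UNIV. of_int (l k) * (symm k * simple_root j k)) = of_int (l j) * symm j" for l :: "'a => int"
    proof -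
      have "(\<Sum>k\<in>UNIV. of_int (l k) * (symm k * simple_root j k)) = (\<Sum>k\<in>UNIV. if k = j then of_int (l j) * symm j else 0)"
        by (intro sum.cong) (auto simp: simple_root_def)
      then show ?thesis by simp
    qed
    then show "\<exists>u. \<chi> n u \<noteq> \<chi> m u" using j by (intro exI[of _ "simple_root j"]) (simp add: \<chi>_def)
  qed (use S that in \<open>simp_all add: \<chi>_def\<close>)
  then show ?thesis by (simp add: S)
qed

lemma vcoeff_eq_proj0: "qchar l (proj0 u) = vcoeff l u"
proof -
  have unique: "z = z'" if "z \<in> Uzero" "u - z \<in> ker0" "z' \<in> Uzero" "u - z' \<in> ker0" for z z'
  proof -
    have "vcoeff m (z - z') = 0" for m using vcoeff_ker0[OF that(2), of m] vcoeff_ker0[OF that(4), of m] by simp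
    then have "z - z' = 0" by (intro Uzero_eq_0) (simp_all add: subalgebraD[OF subalgebra_Uzero] that)
    then show ?thesis by simp
  qed
  have "proj0 u = (THE z. z \<in> Uzero \<and> u - z \<in> ker0)" by (simp add: proj0_def ker0_def)
  moreover have "\<exists>!z. z \<in> Uzero \<and> u - z \<in> ker0" using ker0_complement[of u] unique by blast
  ultimately have "proj0 u \<in> Uzero \<and> u - proj0 u \<in> ker0" using theI'[of "\<lambda>z. z \<in> Uzero \<and> u - z \<in> ker0"] by simp
  then show ?thesis using vcoeff_ker0[of "u - proj0 u" l] by (simp add: qchar_Uzero)
qed

lemma shapovalov_eq: "shapovalov l x y = shap l x y" by (simp add: shapovalov_def shap_def vcoeff_eq_proj0)

lemma pi_pairing_theta: "pi_pairing l (theta x) y = shap l x y"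
  by (simp add: pi_pairing_def shap_def vcoeff_eq_proj0 omega_def)

lemma Uplus_theta: "Uplus = theta ` Uminus"
proof -
  have E: "theta (evE p) \<in> Uminus" for p :: "'a tens"
  proof (induction p rule: free_induct)
    case (single w c)
    have "theta (evE (mono w)) \<in> Uminus" by (induction w) (simp_all add: ev_Cons subalgebraD[OF subalgebra_Uminus])
    then show ?case by (simp add: subalgebraD[OF subalgebra_Uminus])
  qed (simp add: subalgebraD[OF subalgebra_Uminus])
  have F: "theta (evF p) \<in> Uplus" for p :: "'a tens"
  proof (induction p rule: free_induct)
    case (single w c)
    have "theta (evF (mono w)) \<in> Uplus" by (induction w) (simp_all add: ev_Cons subalgebraD[OF subalgebra_Uplus])
    then show ?case by (simp add: subalgebraD[OF subalgebra_Uplus])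
  qed (simp add: subalgebraD[OF subalgebra_Uplus])
  show ?thesis
  proof
    show "Uplus \<subseteq> theta ` (Uminus :: 'a uq set)"
    proof
      fix x :: "'a uq" assume "x \<in> Uplus"
      then have "theta x \<in> Uminus" using E by (auto simp: Uplus_eq)
      then show "x \<in> theta ` Uminus" by (rule rev_image_eqI) simp
    qed
    show "theta ` Uminus \<subseteq> (Uplus :: 'a uq set)" using F by (auto simp: Uminus_eq)
  qed
qed

lemma Kminus_eq: "Kminus l = {y \<in> Uminus. \<forall>x\<in>Uminus. shap l x y = 0}"
  unfolding Kminus_def Uplus_theta ball_simps pi_pairing_theta ..

lemma Kplus_eq: "Kplus l = theta ` Kminus l"
proof -
  have "Kplus l = theta ` {x \<in> Uminus. \<forall>y\<in>Uminus. pi_pairing l (theta x) y = 0}"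
    unfolding Kplus_def Uplus_theta by blast
  also have "{x \<in> Uminus. \<forall>y\<in>Uminus. pi_pairing l (theta x) y = 0} = Kminus l"
    unfolding Kminus_eq pi_pairing_theta by (subst shap_commute) (rule refl)
  finally show ?thesis .
qed

section \<open>Integrability\<close>

text \<open>Solvability for a positive definite form, with one more prescribed coordinate at a time:
  \<open>v\<close> is the new basis vector made orthogonal to the earlier ones, and
  \<open>rpair s v = ip v v\<close> is positive.\<close>

lemma rpair_solvable: "\<exists>\<mu>. \<forall>k. rpair k \<mu> = x (k :: 'i::cartan_datum)"
proof -
  have "\<exists>\<mu>. (\<forall>k. k \<notin> S \<longrightarrow> \<mu> k = 0) \<and> (\<forall>k\<in>S. rpair k \<mu> = x k)" for S :: "'i set" and x using finite[of S]
  proof (induction S arbitrary: x rule: finite_induct)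
    case empty
    show ?case by (intro exI[of _ 0]) (simp add: zero_fun_apply)
  next
    case (insert s S)
    obtain \<mu>0 where \<mu>0: "\<And>k. k \<notin> S ==> \<mu>0 k = 0" "\<And>k. k \<in> S ==> rpair k \<mu>0 = x k" using insert.IH by blast
    obtain \<omega> where \<omega>: "\<And>k. k \<notin> S ==> \<omega> k = 0" "\<And>k. k \<in> S ==> rpair k \<omega> = - rpair k (simple_root s)"
      using insert.IH[of "\<lambda>k. - rpair k (simple_root s)"] by blast
    define v where "v = simple_root s + \<omega>"
    have v: "rpair k v = 0" if "k \<in> S" for k using \<omega>(2)[OF that] by (simp add: v_def rpair_add)
    have vs: "v s = 1" using \<omega>(1)[OF insert.hyps(2)] by (simp add: v_def plus_fun_apply simple_root_def)
    have "ip v v = (\<Sum>i\<in>UNIV. if i = s then rpair s v else 0)" unfolding ip_alt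
    proof (intro sum.cong refl)
      fix i :: 'i
      show "v i * rpair i v = (if i = s then rpair s v else 0)"
        using v[of i] vs \<omega>(1)[of i] by (cases "i \<in> S") (auto simp: v_def plus_fun_apply simple_root_def insert.hyps(2))
    qed
    moreover have "v \<noteq> 0" using vs by (auto simp: zero_fun_apply)
    ultimately have p: "rpair s v \<noteq> 0" using ip_pos[of v] by simp
    define t where "t = (x s - rpair s \<mu>0) / rpair s v"
    define \<mu> where "\<mu> = \<mu>0 + (\<lambda>j. t * v j)"
    have r: "rpair k \<mu> = rpair k \<mu>0 + t * rpair k v" for k by (simp only: \<mu>_def rpair_add rpair_scale)
    have "t * rpair s v = x s - rpair s \<mu>0" using p by (simp add: t_def)
    then have "\<forall>k\<in>insert s S. rpair k \<mu> = x k" using \<mu>0(2) v by (auto simp: r)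
    moreover have "\<forall>k. k \<notin> insert s S \<longrightarrow> \<mu> k = 0"
      using \<mu>0(1) \<omega>(1) by (simp add: \<mu>_def plus_fun_apply v_def simple_root_def)
    ultimately show ?case by blast
  qed
  from this[of UNIV x] show ?thesis by auto
qed

text \<open>Cyclic modules are treated as quotients of the algebra by a left ideal \<open>N\<close>;
  a vector vanishes in the module when its representative lies in \<open>N\<close>.\<close>

definition left_ideal :: "'i::cartan_datum uq set => bool"
  where "left_ideal N \<longleftrightarrow> U.subspace N \<and> (\<forall>u. \<forall>v\<in>N. u * v \<in> N)"

lemma left_idealD:
  assumes "left_ideal N"
  shows "0 \<in> N" "x \<in> N ==> y \<in> N ==> x + y \<in> N" "x \<in> N ==> u * x \<in> N"
    "x \<in> N ==> uscale c x \<in> N" "x \<in> N ==> y \<in> N ==> x - y \<in> N" "x \<in> N ==> - x \<in> N"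
    "x - y \<in> N ==> x \<in> N \<longleftrightarrow> y \<in> N"
proof -
  show *: "0 \<in> N" "x \<in> N ==> y \<in> N ==> x + y \<in> N" "x \<in> N ==> u * x \<in> N"
    "x \<in> N ==> uscale c x \<in> N" "x \<in> N ==> y \<in> N ==> x - y \<in> N" "x \<in> N ==> - x \<in> N" for x y
    using assms unfolding left_ideal_def
    by (auto simp: U.subspace_0 U.subspace_add U.subspace_scale U.subspace_diff U.subspace_neg)
  show "x - y \<in> N ==> x \<in> N \<longleftrightarrow> y \<in> N" using *(2)[of "x - y" y] *(5)[of x "x - y"] by auto
qed

section \<open>The Casimir element of a rank one subalgebra\<close>

definition casimir :: "'i::cartan_datum => 'i uq"
  where "casimir i = uF i * uE i +
    uscale (1 / qden i ^ 2) (uscale (qpow (symm i)) (uK i) + uscale (qpow (- symm i)) (uKinv i))"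

text \<open>The eigenvalue on a vector killed by \<open>uE i\<close> on which \<open>k_i\<close>
  acts by \<open>qpow (r * symm i)\<close>. It is unchanged under the shifted reflection of
  \<open>r\<close> to \<open>- 2 - r\<close>.\<close>

definition casimir_val :: "'i::cartan_datum => rat => qfield"
  where "casimir_val i r = (qpow ((r + 1) * symm i) + qpow (- ((r + 1) * symm i))) / qden i ^ 2"

lemma casimir_val_eq: "casimir_val i r = casimir_val i s \<longleftrightarrow> r = s \<or> r + s = - 2"
proof -
  let ?a = "(r + 1) * symm i" and ?b = "(s + 1) * symm i"
  have "(qpow ?a - qpow ?b) * (1 - qpow (- ?a - ?b)) = (qpow ?a + qpow (- ?a)) - (qpow ?b + qpow (- ?b))"
    by (simp add: right_diff_distrib left_diff_distrib flip: qpow_add)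
  moreover have "casimir_val i r = casimir_val i s \<longleftrightarrow> (qpow ?a + qpow (- ?a)) - (qpow ?b + qpow (- ?b)) = 0"
    by (simp add: casimir_val_def)
  ultimately have "casimir_val i r = casimir_val i s \<longleftrightarrow> ?a = ?b \<or> - ?a - ?b = 0"
    by (metis mult_eq_0_iff qpow_eq_1 qpow_inj right_minus_eq)
  moreover have "- ?a - ?b = - ((r + s + 2) * symm i)" by (simp add: algebra_simps)
  moreover have "(r + s + 2) * symm i = 0 \<longleftrightarrow> r + s = - 2" "?a = ?b \<longleftrightarrow> r = s" using symm_nonzero[of i] by auto
  ultimately show ?thesis by (simp only: neg_equal_0_iff_equal)
qed

lemma qden_identities: "1 / qden i + qpow (- symm i) / qden i ^ 2 = qpow (symm i) / qden i ^ 2"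
    "qpow (symm i) / qden i ^ 2 - 1 / qden i = qpow (- symm i) / qden i ^ 2"
proof -
  have "1 / qden i = (qpow (symm i) - qpow (- symm i)) / qden i ^ 2"
    by (simp add: power2_eq_square qden_def[symmetric])
  then show "1 / qden i + qpow (- symm i) / qden i ^ 2 = qpow (symm i) / qden i ^ 2"
    "qpow (symm i) / qden i ^ 2 - 1 / qden i = qpow (- symm i) / qden i ^ 2" by (simp_all add: diff_divide_distrib)
qed

lemma casimir_alt: "casimir i = uE i * uF i +
    uscale (1 / qden i ^ 2) (uscale (qpow (- symm i)) (uK i) + uscale (qpow (symm i)) (uKinv i))"
proof -
  let ?d = "qden i"
  have "uE i * uF i + uscale (1 / ?d ^ 2) (uscale (qpow (- symm i)) (uK i) + uscale (qpow (symm i)) (uKinv i)) =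
      uF i * uE i + (uscale (1 / ?d + qpow (- symm i) / ?d ^ 2) (uK i) + uscale (qpow (symm i) / ?d ^ 2 - 1 / ?d) (uKinv i))"
    by (simp add: uE_uF[of i i] U.scale_right_distrib U.scale_right_diff_distrib U.scale_left_distrib U.scale_left_diff_distrib algebra_simps)
  then show ?thesis by (simp only: qden_identities) (simp add: casimir_def U.scale_right_distrib)
qed

lemma casimir_E: "casimir i * uE i = uE i * casimir i"
proof -
  have "uK i * uE i = uscale (qpow (2 * symm i)) (uE i * uK i)" "uKinv i * uE i = uscale (qpow (- (2 * symm i))) (uE i * uKinv i)"
    by (simp_all add: uK_E uKinv_E rpair_self)
  then have "casimir i * uE i = uE i * uF i * uE i +
      uscale (1 / qden i ^ 2) (uscale (qpow (- symm i) * qpow (2 * symm i)) (uE i * uK i) + uscale (qpow (symm i) * qpow (- (2 * symm i))) (uE i * uKinv i))"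
    by (simp add: casimir_alt distrib_right uscale_mult_left)
  also have "\<dots> = uE i * casimir i"
    by (simp add: casimir_def distrib_left uscale_mult_right mult.assoc flip: qpow_add)
  finally show ?thesis .
qed

lemma casimir_F: "casimir i * uF i = uF i * casimir i"
proof -
  have "uK i * uF i = uscale (qpow (- (2 * symm i))) (uF i * uK i)" "uKinv i * uF i = uscale (qpow (2 * symm i)) (uF i * uKinv i)"
    by (simp_all add: uK_F uKinv_F rpair_self)
  then have "casimir i * uF i = uF i * uE i * uF i +
      uscale (1 / qden i ^ 2) (uscale (qpow (symm i) * qpow (- (2 * symm i))) (uF i * uK i) + uscale (qpow (- symm i) * qpow (2 * symm i)) (uF i * uKinv i))"
    by (simp add: casimir_def distrib_right uscale_mult_left)
  also have "\<dots> = uF i * casimir i"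
    by (simp add: casimir_alt distrib_left uscale_mult_right mult.assoc flip: qpow_add)
  finally show ?thesis .
qed

context
  fixes N :: "'i::cartan_datum uq set" and i :: 'i
  assumes N: "left_ideal N"
begin

definition weightN :: "rat => 'i uq => bool"
  where "weightN x v \<longleftrightarrow> uK i * v - uscale (qpow (x * symm i)) v \<in> N"

private lemma weightN_Kinv: "weightN x v ==> uKinv i * v - uscale (qpow (- (x * symm i))) v \<in> N"
proof -
  assume "weightN x v"
  then have "uscale (- qpow (- (x * symm i))) (uKinv i * (uK i * v - uscale (qpow (x * symm i)) v)) \<in> N"
    by (simp add: weightN_def left_idealD(1-6)[OF N])
  then show ?thesis by (simp add: right_diff_distrib uscale_mult_right U.scale_right_diff_distrib)
qed

lemma weightN_E: "weightN x v ==> weightN (x + 2) (uE i * v)"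
proof -
  assume "weightN x v"
  then have "uscale (qpow (2 * symm i)) (uE i * (uK i * v - uscale (qpow (x * symm i)) v)) \<in> N"
    by (simp add: weightN_def left_idealD(1-6)[OF N])
  moreover have "uK i * (uE i * v) = uscale (qpow (2 * symm i)) (uE i * (uK i * v))"
    by (simp add: uK_E rpair_self uscale_mult_left flip: mult.assoc)
  ultimately show ?thesis
    by (simp add: weightN_def right_diff_distrib uscale_mult_right U.scale_right_diff_distrib distrib_right add.commute flip: qpow_add)
qed

lemma weightN_F: "weightN x v ==> weightN (x - 2) (uF i * v)"
proof -
  assume "weightN x v"
  then have "uscale (qpow (- (2 * symm i))) (uF i * (uK i * v - uscale (qpow (x * symm i)) v)) \<in> N"
    by (simp add: weightN_def left_idealD(1-6)[OF N])
  moreover have "uK i * (uF i * v) = uscale (qpow (- (2 * symm i))) (uF i * (uK i * v))"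
    by (simp add: uK_F rpair_self uscale_mult_left flip: mult.assoc)
  moreover have "- (2 * symm i) + x * symm i = (x - 2) * symm i" by (simp add: algebra_simps)
  ultimately show ?thesis
    by (simp add: weightN_def right_diff_distrib uscale_mult_right U.scale_right_diff_distrib flip: qpow_add)
qed

definition casN :: "qfield => 'i uq"
  where "casN c = casimir i - uscale c 1"

private lemma casN_commI: "casimir i * u = u * casimir i ==> casN c * u = u * casN c"
  by (simp only: casN_def left_diff_distrib right_diff_distrib us_mult mult_1_left mult_1_right)

private lemma casN_comm: "casN c * uE i = uE i * casN c" "casN c * uF i = uF i * casN c" "casN c * casN d = casN d * casN c"
proof -
  show "casN c * uE i = uE i * casN c" "casN c * uF i = uF i * casN c"
    by (rule casN_commI, rule casimir_E, rule casN_commI, rule casimir_F)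
  have "casimir i * casN d = casN d * casimir i"
    by (simp only: casN_def left_diff_distrib right_diff_distrib us_mult mult_1_left mult_1_right)
  then show "casN c * casN d = casN d * casN c" by (rule casN_commI)
qed

private lemma K_part:
  assumes w: "weightN x v"
  shows "uscale d (uscale a (uK i * v) + uscale b (uKinv i * v)) -
    uscale (d * (a * qpow (x * symm i)) + d * (b * qpow (- (x * symm i)))) v \<in> N"
proof -
  have "uscale d (uscale a (uK i * v - uscale (qpow (x * symm i)) v) +
      uscale b (uKinv i * v - uscale (qpow (- (x * symm i))) v)) \<in> N"
    using w weightN_Kinv[OF w] unfolding weightN_def by (intro left_idealD(2,4)[OF N])
  then show ?thesis
    by (simp add: U.scale_right_diff_distrib U.scale_right_distrib U.scale_left_distrib add_diff_add)
qed

private lemma FE: "weightN x v ==> uF i * (uE i * v) - casN (casimir_val i x) * v \<in> N"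
proof -
  assume w: "weightN x v"
  have c: "casimir_val i x = 1 / qden i ^ 2 * (qpow (symm i) * qpow (x * symm i)) + 1 / qden i ^ 2 * (qpow (- symm i) * qpow (- (x * symm i)))"
    by (simp add: casimir_val_def add_divide_distrib distrib_right add.commute flip: qpow_add)
  have g: "a - (a + x - y) = - (x - y)" for a x y :: "'i uq" by simp
  have "casN (casimir_val i x) * v = uF i * (uE i * v) +
      uscale (1 / qden i ^ 2) (uscale (qpow (symm i)) (uK i * v) + uscale (qpow (- symm i)) (uKinv i * v)) - uscale (casimir_val i x) v"
    by (simp add: casN_def casimir_def left_diff_distrib distrib_right uscale_mult_left mult.assoc)
  then show ?thesis
    using left_idealD(6)[OF N K_part[OF w, of "1 / qden i ^ 2" "qpow (symm i)" "qpow (- symm i)"]] by (simp only: g c)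
qed

private lemma EF: "weightN x v ==> uE i * (uF i * v) - casN (casimir_val i (x - 2)) * v \<in> N"
proof -
  assume w: "weightN x v"
  have "(x - 2 + 1) * symm i = - symm i + x * symm i" by (simp add: algebra_simps)
  then have c: "casimir_val i (x - 2) = 1 / qden i ^ 2 * (qpow (- symm i) * qpow (x * symm i)) + 1 / qden i ^ 2 * (qpow (symm i) * qpow (- (x * symm i)))"
    by (simp add: casimir_val_def add_divide_distrib flip: qpow_add)
  have g: "a - (a + x - y) = - (x - y)" for a x y :: "'i uq" by simp
  have "casN (casimir_val i (x - 2)) * v = uE i * (uF i * v) +
      uscale (1 / qden i ^ 2) (uscale (qpow (- symm i)) (uK i * v) + uscale (qpow (symm i)) (uKinv i * v)) - uscale (casimir_val i (x - 2)) v"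
    by (simp add: casN_def casimir_alt left_diff_distrib distrib_right uscale_mult_left mult.assoc)
  then show ?thesis
    using left_idealD(6)[OF N K_part[OF w, of "1 / qden i ^ 2" "qpow (- symm i)" "qpow (symm i)"]] by (simp only: g c)
qed

private primrec casP :: "qfield list => 'i uq" where
  "casP [] = 1"
| "casP (c # cs) = casN c * casP cs"

private lemma casP_comm: "casP cs * casN c = casN c * casP cs"
proof (induction cs)
  case (Cons d cs)
  then show ?case by (simp add: mult.assoc) (simp add: casN_comm(3)[of d c] flip: mult.assoc)
qed simp

private lemma casP_append: "casP (cs @ [c]) = casN c * casP cs"
proof (induction cs)
  case (Cons d cs)
  have "casP ((d # cs) @ [c]) = casN d * casN c * casP cs" by (simp add: Cons mult.assoc)
  then show ?case by (simp only: casN_comm(3)[of d c] casP.simps mult.assoc)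
qed simp

text \<open>The Casimir element commutes with \<open>a\<close>, so
  \<open>a ^ n * (b ^ n * v)\<close> becomes a product of commuting factors \<open>casN c\<close>
  applied to \<open>v\<close>, one for each intermediate weight.\<close>

private lemma power_casP:
  assumes a: "\<And>c. casN c * a = a * casN c"
    and w: "weightN x v" "\<And>x v. weightN x v ==> weightN (x + z) (b * v)"
    and ab: "\<And>x v. weightN x v ==> a * (b * v) - casN (c x) * v \<in> N"
  shows "a ^ n * (b ^ n * v) - casP (map (\<lambda>j. c (x + of_nat j * z)) [0..<n]) * v \<in> N"
proof (induction n)
  case 0
  show ?case by (simp add: left_idealD(1-6)[OF N])
next
  case (Suc n)
  let ?c = "c (x + of_nat n * z)" and ?P = "casP (map (\<lambda>j. c (x + of_nat j * z)) [0..<n])"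
  have "weightN (x + of_nat n * z) (b ^ n * v)" for n
  proof (induction n)
    case (Suc n)
    have "x + of_nat (Suc n) * z = x + of_nat n * z + z" by (simp add: algebra_simps)
    then show ?case using w(2)[OF Suc] by (simp only: power_Suc mult.assoc)
  qed (simp add: w(1))
  from left_idealD(3)[OF N ab[OF this]] have 1: "a ^ n * (a * (b * (b ^ n * v)) - casN ?c * (b ^ n * v)) \<in> N" .
  have 2: "casN ?c * (a ^ n * (b ^ n * v) - ?P * v) \<in> N" using Suc by (rule left_idealD(3)[OF N])
  have "a ^ n * casN ?c = casN ?c * a ^ n" by (rule power_commuting_commutes) (rule a[symmetric])
  then have "a ^ n * (casN ?c * z) = casN ?c * (a ^ n * z)" for z by (simp only: mult.assoc[symmetric])
  moreover have "a ^ Suc n = a ^ n * a" "b ^ Suc n * v = b * (b ^ n * v)"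
    by (rule power_Suc2) (simp only: power_Suc mult.assoc)
  ultimately have "a ^ Suc n * (b ^ Suc n * v) - casN ?c * ?P * v =
      a ^ n * (a * (b * (b ^ n * v)) - casN ?c * (b ^ n * v)) + casN ?c * (a ^ n * (b ^ n * v) - ?P * v)"
    by (simp only: right_diff_distrib mult.assoc diff_add_eq_diff_diff_swap[symmetric] add_diff_eq diff_add_cancel)
  then show ?case using left_idealD(2)[OF N 1 2] by (simp add: casP_append)
qed

private lemma power_FE: "weightN x v ==>
    uF i ^ n * (uE i ^ n * v) - casP (map (\<lambda>j. casimir_val i (x + of_nat j * 2)) [0..<n]) * v \<in> N"
  by (rule power_casP[OF casN_comm(2)]) (assumption | erule weightN_E FE)+

private lemma power_EF: "weightN x v ==>
    uE i ^ n * (uF i ^ n * v) - casP (map (\<lambda>j. casimir_val i (x + of_nat j * (- 2) - 2)) [0..<n]) * v \<in> N"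
  by (rule power_casP[where c = "\<lambda>x. casimir_val i (x - 2)", OF casN_comm(1)])
    (assumption | erule weightN_F[unfolded diff_conv_add_uminus] EF)+

text \<open>Bezout for products of commuting linear factors: on a vector annihilated by
  \<open>casN a\<close> the second product acts by the product of the differences
  \<open>a - b\<close>, which is not zero.\<close>

private lemma casP_coprime:
  "casP as * v \<in> N ==> casP bs * v \<in> N ==> set as \<inter> set bs = {} ==> v \<in> N"
proof (induction as arbitrary: v)
  case (Cons a as)
  have 1: "casP as * (casN a * v) \<in> N" using Cons.prems(1) by (simp add: casP_comm flip: mult.assoc)
  have "casP bs * (casN a * v) = casN a * (casP bs * v)" by (simp add: casP_comm flip: mult.assoc)
  then have 2: "casP bs * (casN a * v) \<in> N" using Cons.prems(2) left_idealD(3)[OF N] by simp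
  have av: "casN a * v \<in> N" using Cons.IH[OF 1 2] Cons.prems(3) by auto
  have "casP bs * v - uscale (prod_list (map (\<lambda>b. a - b) bs)) v \<in> N"
  proof (induction bs)
    case (Cons b bs)
    let ?p = "prod_list (map (\<lambda>b. a - b) bs)"
    have "casP (b # bs) * v - uscale (prod_list (map (\<lambda>b. a - b) (b # bs))) v =
        casN b * (casP bs * v - uscale ?p v) + uscale ?p (casN a * v)"
      by (simp add: casN_def left_diff_distrib right_diff_distrib us_mult mult.assoc
          U.scale_right_diff_distrib U.scale_left_diff_distrib mult.commute)
    then show ?case using left_idealD(3)[OF N Cons] av left_idealD(1-6)[OF N] by simp
  qed (simp add: left_idealD(1-6)[OF N])
  then have "uscale (prod_list (map (\<lambda>b. a - b) bs)) v \<in> N" using Cons.prems(2) left_idealD(7)[OF N] by blast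
  then have "uscale (inverse (prod_list (map (\<lambda>b. a - b) bs))) (uscale (prod_list (map (\<lambda>b. a - b) bs)) v) \<in> N"
    by (rule left_idealD(4)[OF N])
  moreover have "prod_list (map (\<lambda>b. a - b) bs) \<noteq> 0" using Cons.prems(3) by (auto simp: prod_list_zero_iff)
  ultimately show ?case by simp
qed simp

text \<open>The two nilpotency conditions give two polynomials in the Casimir element that
  annihilate \<open>v\<close>. One involves the weights from \<open>-p\<close> up to
  \<open>p - 2\<close>, the other those from \<open>-p - 2\<close> downwards, and no eigenvalue
  occurs in both.\<close>

lemma sl2_E_inj:
  assumes "weightN (- of_nat p) v" "uE i ^ p * v \<in> N" "uF i ^ M * v \<in> N"
  shows "v \<in> N"
proof (rule casP_coprime)
  show "casP (map (\<lambda>j. casimir_val i (- of_nat p + of_nat j * 2)) [0..<p]) * v \<in> N"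
    using power_FE[OF assms(1), where n = p] left_idealD(3)[OF N assms(2), of "uF i ^ p"] left_idealD(7)[OF N] by blast
  show "casP (map (\<lambda>j. casimir_val i (- of_nat p + of_nat j * (- 2) - 2)) [0..<M]) * v \<in> N"
    using power_EF[OF assms(1), where n = M] left_idealD(3)[OF N assms(3), of "uE i ^ M"] left_idealD(7)[OF N] by blast
  have "casimir_val i (- of_nat p + of_nat j * 2) \<noteq> casimir_val i (- of_nat p + of_nat l * (- 2) - 2)" if "j < p" for j l
    using of_nat_less_iff[of j p, where 'a = rat] that of_nat_0_le_iff[of l, where 'a = rat] of_nat_0_le_iff[of j, where 'a = rat]
    unfolding casimir_val_eq by linarith
  then show "set (map (\<lambda>j. casimir_val i (- of_nat p + of_nat j * 2)) [0..<p]) \<inter>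
      set (map (\<lambda>j. casimir_val i (- of_nat p + of_nat j * (- 2) - 2)) [0..<M]) = {}" by auto
qed

lemma sl2_F_inj:
  assumes "weightN (of_nat p) v" "uF i ^ p * v \<in> N" "uE i ^ M * v \<in> N"
  shows "v \<in> N"
proof (rule casP_coprime)
  show "casP (map (\<lambda>j. casimir_val i (of_nat p + of_nat j * 2)) [0..<M]) * v \<in> N"
    using power_FE[OF assms(1), where n = M] left_idealD(3)[OF N assms(3), of "uF i ^ M"] left_idealD(7)[OF N] by blast
  show "casP (map (\<lambda>j. casimir_val i (of_nat p + of_nat j * (- 2) - 2)) [0..<p]) * v \<in> N"
    using power_EF[OF assms(1), where n = p] left_idealD(3)[OF N assms(2), of "uE i ^ p"] left_idealD(7)[OF N] by blast
  have "casimir_val i (of_nat p + of_nat j * 2) \<noteq> casimir_val i (of_nat p + of_nat l * (- 2) - 2)" if "l < p" for j l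
    using of_nat_less_iff[of l p, where 'a = rat] that of_nat_0_le_iff[of l, where 'a = rat] of_nat_0_le_iff[of j, where 'a = rat]
    unfolding casimir_val_eq by linarith
  then show "set (map (\<lambda>j. casimir_val i (of_nat p + of_nat j * 2)) [0..<M]) \<inter>
      set (map (\<lambda>j. casimir_val i (of_nat p + of_nat j * (- 2) - 2)) [0..<p]) = {}" by auto
qed

text \<open>By the Serre relation a power of \<open>uF i\<close> times \<open>uF j\<close> is a
  combination of products in which fewer than \<open>n\<close> factors \<open>uF i\<close> stand on
  the left. If the power is large, at least \<open>M\<close> of them reach \<open>v\<close>.\<close>

lemma F_nilpotent_F:
  assumes "i \<noteq> j" "uF i ^ M * v \<in> N"
  shows "\<exists>M. uF i ^ M * (uF j * v) \<in> N"
proof -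
  define n where "n = nat (1 - cartan i j)"
  define c where "c m = (- 1) ^ m / (qfactorial i m * qfactorial i (n - m))" for m
  have wd: "evF (mono (replicate m i @ j # replicate l i)) = uF i ^ m * uF j * uF i ^ l" for m l
  proof -
    have r: "evF (mono (replicate l i)) = uF i ^ l" for l by (induction l) (simp_all add: ev_Cons)
    show ?thesis by (simp add: mono_append ev_mult r ev_Cons mult.assoc)
  qed
  have S: "(\<Sum>m\<in>{0..n}. uscale (c m) (uF i ^ m * uF j * uF i ^ (n - m))) = 0"
    using ev_serre(2)[OF assms(1)] by (simp add: serre_elt_def Let_def ev_sum wd c_def n_def)
  have fn: "uF i ^ n * uF j = (\<Sum>m<n. uscale (- c m / c n) (uF i ^ m * uF j * uF i ^ (n - m)))"
  proof -
    have "(\<Sum>m\<in>{0..n}. uscale (c m) (uF i ^ m * uF j * uF i ^ (n - m))) =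
        uscale (c n) (uF i ^ n * uF j) + (\<Sum>m<n. uscale (c m) (uF i ^ m * uF j * uF i ^ (n - m)))"
      by (simp add: atLeast0AtMost atMost_Suc_eq_insert_0 flip: lessThan_Suc_atMost)
    then have "uscale (c n) (uF i ^ n * uF j) = - (\<Sum>m<n. uscale (c m) (uF i ^ m * uF j * uF i ^ (n - m)))"
      using S by (simp add: eq_neg_iff_add_eq_0)
    then have "uscale (1 / c n) (uscale (c n) (uF i ^ n * uF j)) = (\<Sum>m<n. uscale (- c m / c n) (uF i ^ m * uF j * uF i ^ (n - m)))"
      by (simp add: U.scale_sum_right sum_negf)
    moreover have "c n \<noteq> 0" by (simp add: c_def)
    ultimately show ?thesis by simp
  qed
  define X where "X m = U.span {uF i ^ k * uF j * uF i ^ l | k l. k < n \<and> k + l = m}" for m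
  have XI: "uF i ^ k * uF j * uF i ^ l \<in> X m" if "k < n" "k + l = m" for k l m
    unfolding X_def by (rule U.span_base) (use that in blast)
  have XR: "x * uF i ^ r \<in> X (m + r)" if "x \<in> X m" for x m r using that unfolding X_def[of m]
  proof (induction x rule: U.span_induct_alt)
    case base
    show ?case by (simp add: X_def U.span_zero)
  next
    case (step d x y)
    then obtain k l where x: "x = uF i ^ k * uF j * uF i ^ l" "k < n" "k + l = m" by blast
    have "x * uF i ^ r = uF i ^ k * uF j * uF i ^ (l + r)" by (simp only: x(1) mult.assoc power_add)
    then have "x * uF i ^ r \<in> X (m + r)" using x XI[of k "l + r" "m + r"] by simp
    then show ?case
      using step.IH unfolding X_def by (simp add: distrib_right uscale_mult_left U.span_add U.span_scale)
  qed
  have sp: "uF i ^ m * uF j \<in> X m" if "n > 0" for m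
  proof (induction m rule: less_induct)
    case (less m)
    show ?case
    proof (cases "m < n")
      case True
      then show ?thesis using XI[of m 0 m] by simp
    next
      case False
      have "uF i ^ m * uF j = uF i ^ (m - n) * (uF i ^ n * uF j)"
        using False by (simp add: power_add[symmetric] flip: mult.assoc)
      also have "\<dots> = (\<Sum>k<n. uscale (- c k / c n) (uF i ^ (m - n + k) * uF j * uF i ^ (n - k)))"
        by (simp only: fn sum_distrib_left uscale_mult_right power_add mult.assoc)
      also have "\<dots> \<in> X m" unfolding X_def
      proof (intro U.span_sum U.span_scale, fold X_def)
        fix k assume k: "k \<in> {..<n}"
        then have "m - n + k < m" "m - n + k + (n - k) = m" using False by auto
        then show "uF i ^ (m - n + k) * uF j * uF i ^ (n - k) \<in> X m"
          using XR[OF less, of "m - n + k" "n - k"] by simp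
      qed
      finally show ?thesis .
    qed
  qed
  have n: "n > 0" using cartan_off[OF assms(1)] by (simp add: n_def)
  have "x * v \<in> N" if "x \<in> X (M + n)" for x using that unfolding X_def
  proof (induction x rule: U.span_induct_alt)
    case base
    show ?case by (simp add: left_idealD(1-6)[OF N])
  next
    case (step d x y)
    then obtain k l where x: "x = uF i ^ k * uF j * uF i ^ l" "k < n" "k + l = M + n" by blast
    have "uF i ^ l = uF i ^ (l - M) * uF i ^ M" using x by (simp flip: power_add)
    then have "uF i ^ l * v = uF i ^ (l - M) * (uF i ^ M * v)" by (simp add: mult.assoc)
    then have "x * v = uF i ^ k * uF j * (uF i ^ (l - M) * (uF i ^ M * v))" by (simp add: x(1) mult.assoc)
    also have "\<dots> \<in> N" by (intro left_idealD(3)[OF N] assms(2))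
    finally show ?case using step by (simp add: distrib_right uscale_mult_left left_idealD(1-6)[OF N])
  qed
  from this[OF sp[OF n]] show ?thesis by (auto simp: mult.assoc)
qed

lemma F_nilpotent:
  assumes "uF i ^ M * v \<in> N"
  shows "\<exists>M. uF i ^ M * (evF p * v) \<in> N"
proof (induction p rule: evF_induct[where Q = "\<lambda>u. \<exists>M. uF i ^ M * (u * v) \<in> N"])
  case 1
  then show ?case using assms by auto
next
  case (F j u)
  then obtain M where M: "uF i ^ M * (u * v) \<in> N" by blast
  show ?case
  proof (cases "j = i")
    case True
    have "uF i ^ M * (uF i * (u * v)) = uF i * (uF i ^ M * (u * v))" by (simp add: power_commutes flip: mult.assoc)
    then show ?thesis using True left_idealD(3)[OF N M, of "uF i"] by (intro exI[of _ M]) (simp add: mult.assoc)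
  next
    case False
    then show ?thesis using F_nilpotent_F[OF _ M, of j] by (simp add: mult.assoc)
  qed
next
  case (add x y)
  then obtain M M' where M: "uF i ^ M * (x * v) \<in> N" "uF i ^ M' * (y * v) \<in> N" by blast
  have "uF i ^ (M' + M) * ((x + y) * v) = uF i ^ M' * (uF i ^ M * (x * v)) + uF i ^ M * (uF i ^ M' * (y * v))"
    by (simp add: distrib_left distrib_right power_add mult.assoc) (simp add: add.commute[of M] flip: mult.assoc power_add)
  then show ?case using left_idealD(2)[OF N left_idealD(3)[OF N M(1)] left_idealD(3)[OF N M(2)]] by metis
next
  case (scale c x)
  then show ?case using left_idealD(4)[OF N] by (auto simp: us_mult)
qed

end

section \<open>Nondegeneracy of the skew derivations\<close>

lemma evF_word_K: "p \<in> Tw b ==> uK i * evF p = uscale (qpow (- rpair i b)) (evF p * uK i)"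
  by (rule qcomm_evF[where h = "\<lambda>b. - rpair i b"]) (simp_all add: qcomm_def uK_F rpair_add)

lemma evF_word_Kinv: "p \<in> Tw b ==> uKinv i * evF p = uscale (qpow (rpair i b)) (evF p * uKinv i)"
  by (rule qcomm_evF[where h = "\<lambda>b. rpair i b"]) (simp_all add: qcomm_def uKinv_F rpair_add)

text \<open>The identity behind \<open>vop_E_der\<close>, now in the algebra itself: an element
  whose skew derivatives for \<open>i\<close> lie in the Serre ideal commutes with
  \<open>uE i\<close>.\<close>

lemma uE_evF: "uE i * evF p = evF p * uE i +
    uscale (1 / qden i) (evF (rder i p) * uK i - uKinv i * evF (lder i p))"
proof (induction p rule: free_induct)
  case (single w c)
  have "uE i * evF (mono w) = evF (mono w) * uE i +
      uscale (1 / qden i) (evF (rder i (mono w)) * uK i - uKinv i * evF (lder i (mono w)))"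
  proof (induction w)
    case Nil
    show ?case by (simp only: mono_Nil ev_1 rder_1 lder_1) simp
  next
    case (Cons j w)
    let ?x = "evF (mono w)" and ?r = "evF (rder i (mono w))" and ?l = "evF (lder i (mono w))"
    let ?d = "if j = i then 1 else (0::qfield)" and ?q = "rpair i (simple_root j)"
    have F: "evF (mono [j] * mono w) = uF j * ?x" by (simp add: ev_mult)
    have R: "evF (rder i (mono [j] * mono w)) = uF j * ?r + uscale (?d * qpow (- rpair i (wt w))) ?x"
      by (simp add: rder_Cons[OF mono_Tw] ev_mult)
    have L: "evF (lder i (mono [j] * mono w)) = uscale ?d ?x + uscale (qpow (- ?q)) (uF j * ?l)"
      by (simp add: lder_Cons ev_mult)
    have K': "uKinv i * uF j = uscale (qpow ?q) (uF j * uKinv i)" by (rule uKinv_F)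
    have KL: "uKinv i * evF (lder i (mono [j] * mono w)) = uscale ?d (uKinv i * ?x) + uF j * (uKinv i * ?l)"
      by (simp only: L distrib_left uscale_mult_right mult.assoc[symmetric] K' uscale_mult_left U.scale_scale qpow_mult_minus U.scale_one)
    have RK: "evF (rder i (mono [j] * mono w)) * uK i = uF j * (?r * uK i) + uscale ?d (uK i * ?x)"
      by (simp only: R distrib_right mult.assoc uscale_mult_left evF_word_K[OF mono_Tw] U.scale_scale)
    have E: "uE i * (uF j * ?x) = uF j * (uE i * ?x) + uscale (?d / qden i) (uK i * ?x - uKinv i * ?x)"
      by (simp add: uE_uF[of i j] distrib_right uscale_mult_left left_diff_distrib flip: mult.assoc)
    show ?case unfolding mono_Cons[of j w] F RK KL E Cons
      by (simp add: distrib_left right_diff_distrib uscale_mult_right mult.assoc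
          U.scale_right_distrib U.scale_right_diff_distrib)
  qed
  then show ?case by (simp add: us_mult U.scale_right_distrib U.scale_right_diff_distrib U.scale_left_commute)
next
  case (add p r)
  have "evF (p + r) * uE i + uscale (1 / qden i) (evF (rder i (p + r)) * uK i - uKinv i * evF (lder i (p + r)))
    = (evF p * uE i + uscale (1 / qden i) (evF (rder i p) * uK i - uKinv i * evF (lder i p))) +
      (evF r * uE i + uscale (1 / qden i) (evF (rder i r) * uK i - uKinv i * evF (lder i r)))"
    by (simp add: distrib_left distrib_right U.scale_right_distrib U.scale_right_diff_distrib)
  then show ?case by (simp only: add[symmetric] ev_simps distrib_left)
qed

lemma vproj_power_E:
  assumes "p \<in> Tw c"
  shows "\<exists>r\<in>Tw (c - wt (replicate m i)). vproj l (uE i ^ m * evF p) = evF r"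
proof (induction m)
  case 0
  then show ?case using assms by auto
next
  case (Suc m)
  then obtain r where r: "r \<in> Tw (c - wt (replicate m i))" "vproj l (uE i ^ m * evF p) = evF r" by blast
  have "vproj l (uE i ^ Suc m * evF p) = vproj l (uE i * (uE i ^ m * evF p))" by (simp only: power_Suc mult.assoc)
  also have "\<dots> = evF (vop l (GenE i) r)" using vproj_gen_mult[of l "GenE i" r] by (subst vproj_mult) (simp add: r)
  finally have "vproj l (uE i ^ Suc m * evF p) = evF (vop l (GenE i) r)" .
  moreover have "c - wt (replicate m i) - simple_root i = c - wt (replicate (Suc m) i)"
    by (simp add: wt_Cons algebra_simps)
  ultimately show ?case using vop_E_Tw[OF r(1), of l i] by (metis (no_types))
qed

lemma Tw_neg: "p \<in> Tw c ==> c i < 0 ==> p = 0"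
  by (rule Tw_0) (force simp: Qplus_def Nats_altdef2 dest: spec[of _ i])+

lemma Tw_zero_scalar: "p \<in> Tw 0 ==> p = psc (const p) 1" using part_0[of p] by (simp add: part_of_Tw)

lemma rder_replicate: "rder i (mono (replicate m i)) = lder i (mono (replicate m i))"
  by (simp add: rder_def flip_mono lder_replicate)

text \<open>This power of \<open>f_k\<close> is a singular vector: its left and right derivatives
  coincide, and for this \<open>m\<close> so do their coefficients in
  \<open>vop_E_der\<close>.\<close>

lemma vop_E_replicate:
  assumes "rpair k m = of_nat n * symm k"
  shows "vop m (GenE i) (mono (replicate (Suc n) k)) = 0"
proof (cases "i = k")
  case True
  have "rpair k (wt (replicate (Suc n) k) - m) - rpair k (simple_root k) = rpair k m"
    by (simp only: rpair_diff rpair_wt_replicate assms rpair_self) (simp add: algebra_simps)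
  then show ?thesis unfolding vop_E_der[OF mono_Tw] True rder_replicate by simp
next
  case False
  have "rder i (mono (replicate (Suc n) k)) = 0"
    by (simp only: rder_def flip_mono rev_replicate lder_replicate_other[OF False[symmetric]] flip_simps)
  then show ?thesis unfolding vop_E_der[OF mono_Tw] lder_replicate_other[OF False[symmetric]] by simp
qed

lemma serre_ideal_scale_iff:
  assumes "c \<noteq> 0"
  shows "psc c p \<in> serre_ideal \<longleftrightarrow> p \<in> serre_ideal"
proof
  assume "psc c p \<in> serre_ideal"
  then have "psc (inverse c) (psc c p) \<in> serre_ideal" by (rule serre_ideal_closed)
  then show "p \<in> serre_ideal" using assms by (simp only: P.scale_scale left_inverse[OF assms] P.scale_one)
qed simp

lemma replicate_not_serre: "mono (replicate m i) \<notin> serre_ideal"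
proof (induction m)
  case 0
  then show ?case using const_serre_ideal[of "mono []"] by (auto simp: const_mono)
next
  case (Suc m)
  show ?case
  proof
    assume "mono (replicate (Suc m) i) \<in> serre_ideal"
    then have "lder i (mono (replicate (Suc m) i)) \<in> serre_ideal" by (rule lder_serre_ideal)
    then have "psc (qpow (- (of_nat m * symm i)) * qint i (Suc m)) (mono (replicate m i)) \<in> serre_ideal"
      using lder_replicate[of i "Suc m"] by (simp del: replicate.simps)
    then show False using Suc by (simp add: serre_ideal_scale_iff qint_nonzero)
  qed
qed

lemma evF_replicate: "evF (mono (replicate m i)) = uF i ^ m" by (induction m) (simp_all add: ev_Cons)

section \<open>The integrable quotient of a Verma module\<close>

definition intT :: "('i::cartan_datum => nat) => 'i tens set"
  where "intT n = P.span {mono v * mono (replicate (Suc (n k)) k) | v k. True}"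

text \<open>The annihilator of the highest weight vector in the Verma module modulo the powers
  \<open>f_k ^ (n_k + 1)\<close>. For dominant \<open>m\<close> with labels \<open>n\<close> these
  powers are singular, so the left ideal \<open>intT\<close> is already stable under
  raising.\<close>

definition intN :: "('i::cartan_datum => rat) => ('i => nat) => 'i uq set"
  where "intN m n = {u. vproj m u \<in> evF ` intT n}"

lemma Nats_sum: "(\<And>i. i \<in> A ==> f i \<in> \<nat>) ==> sum f A \<in> (\<nat> :: 'a::semiring_1 set)"
  by (induction A rule: infinite_finite_induct) (simp_all add: Nats_add)

lemma Qplus_nonneg: "b \<in> Qplus ==> 0 \<le> b i" by (auto simp: Qplus_def elim: Nats_cases dest!: spec[of _ i])

definition height :: "('i::finite => rat) => rat"
  where "height b = (\<Sum>i\<in>UNIV. b i)"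

lemma height_nat: "b \<in> Qplus ==> height b \<in> \<nat>" unfolding height_def by (intro Nats_sum) (auto simp: Qplus_def)

lemma height_diff_simple: "height (b - simple_root i) = height b - 1"
  by (simp add: height_def minus_apply sum_subtractf simple_root_def)

lemma wt_simple: "wt w = simple_root i ==> w = [i]"
proof (cases w)
  case (Cons j v)
  assume "wt w = simple_root i"
  then have "simple_root j + wt v = simple_root i" using Cons by (simp add: wt_Cons)
  then have *: "simple_root j k + wt v k = simple_root i k" for k by (metis plus_fun_apply)
  have "j = i"
    using *[of j] of_nat_0_le_iff[of "count_list v j", where 'a = rat] by (cases "j = i") (simp_all add: simple_root_def wt_def)
  have "wt v = 0" by (rule ext) (use * \<open>j = i\<close> in \<open>simp add: zero_fun_apply\<close>)
  then show ?thesis using Cons \<open>j = i\<close> by simp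
qed (auto simp: simple_root_def fun_eq_iff zero_fun_apply)

lemma lder_eq_rder: "p \<in> Tw (simple_root i) ==> lder i p = rder i p"
proof (induction rule: Tw_induct)
  case (word w c)
  then have "w = [i]" by (simp add: wt_simple)
  then show ?case by simp
qed simp_all

lemma intT_linear:
  assumes "lin psc psc f" and "\<And>v k. f (mono v * mono (replicate (Suc (n k)) k)) \<in> intT n" and "p \<in> intT n"
  shows "f p \<in> intT n" using assms(3) unfolding intT_def
proof (induction p rule: P.span_induct_alt)
  case base
  show ?case by (simp add: lin_0[OF assms(1)] P.span_zero)
next
  case (step c x y)
  then show ?case
    using assms(2) unfolding intT_def by (auto simp: lin_add[OF assms(1)] lin_scale[OF assms(1)] intro!: P.span_add P.span_scale)
qed

lemma subspace_intT: "P.subspace (intT n)" by (simp add: intT_def)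

lemma intT_base: "mono v * mono (replicate (Suc (n k)) k) \<in> intT n" unfolding intT_def by (rule P.span_base) blast

lemma intT_F: "p \<in> intT n ==> mono [j] * p \<in> intT n"
proof (rule intT_linear[where f = "\<lambda>p. mono [j] * p"])
  fix v k
  have "mono [j] * (mono v * mono (replicate (Suc (n k)) k)) = mono (j # v) * mono (replicate (Suc (n k)) k)"
    by (simp only: mono_Cons[of j v] mult.assoc)
  then show "mono [j] * (mono v * mono (replicate (Suc (n k)) k)) \<in> intT n" by (simp only: intT_base)
qed (auto intro: linT simp: distrib_left psc_mult_right)

lemma intT_vop:
  assumes "\<And>k. rpair k m = of_nat (n k) * symm k"
  shows "p \<in> intT n ==> vop m g p \<in> intT n"
proof (rule intT_linear[OF lin_vop])
  fix v k
  let ?b = "mono (replicate (Suc (n k)) k)"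
  have T: "mono v * ?b \<in> Tw (wt (v @ replicate (Suc (n k)) k))" for v
    unfolding mono_append[symmetric] by (rule mono_Tw)
  show "vop m g (mono v * ?b) \<in> intT n"
  proof (cases g)
    case (GenT i)
    show ?thesis unfolding GenT vop_T[OF T] by (intro P.subspace_scale[OF subspace_intT] intT_base)
  next
    case (GenTinv i)
    show ?thesis unfolding GenTinv vop_Tinv[OF T] by (intro P.subspace_scale[OF subspace_intT] intT_base)
  next
    case (GenF i)
    show ?thesis unfolding GenF vop_F by (intro intT_F intT_base)
  next
    case (GenE i)
    show ?thesis unfolding GenE
    proof (induction v)
      case Nil
      show ?case by (simp only: mono_Nil mult_1_left vop_E_replicate[OF assms] P.subspace_0[OF subspace_intT])
    next
      case (Cons j v)
      have "mono (j # v) * ?b = mono [j] * (mono v * ?b)" by (simp only: mono_Cons[of j v] mult.assoc)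
      moreover have "vop m (GenE i) (mono [j] * (mono v * ?b)) \<in> intT n" unfolding vop_E_Cons[OF T]
        by (intro P.subspace_add[OF subspace_intT] intT_F Cons)
           (auto intro: P.subspace_scale[OF subspace_intT] intT_base P.subspace_0[OF subspace_intT] simp del: replicate.simps)
      ultimately show ?case by simp
    qed
  qed
qed

context
  fixes \<mu> :: "'i::cartan_datum => rat" and n :: "'i => nat"
  assumes \<mu>: "rpair k \<mu> = of_nat (n k) * symm k"
begin

lemma intN_left_ideal: "left_ideal (intN \<mu> n)"
proof -
  have sub: "U.subspace (evF ` intT n)"
    using subspace_intT[of n] lin_ev[of uF] by (rule module_hom.subspace_image[rotated])
  have "vproj \<mu> (u * x) \<in> evF ` intT n" if "x \<in> evF ` intT n" for u x using that
  proof (induction u arbitrary: x rule: uq_induct)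
    case 1
    then show ?case by auto
  next
    case (gen g u)
    then obtain p where p: "p \<in> intT n" "vproj \<mu> (u * x) = evF p" by blast
    have "vproj \<mu> (gen_uq g * u * x) = evF (vop \<mu> g p)"
      by (simp only: mult.assoc vproj_mult[of \<mu> "gen_uq g"] p vproj_gen_mult)
    then show ?case using intT_vop[of \<mu> n p g] \<mu> p by simp
  next
    case (add u v)
    then show ?case using U.subspace_add[OF sub] by (simp add: distrib_right)
  next
    case (scale c u)
    then show ?case using U.subspace_scale[OF sub] by (simp add: uscale_mult_left)
  qed
  then have "u * x \<in> intN \<mu> n" if "x \<in> intN \<mu> n" for u x
    using that unfolding intN_def mem_Collect_eq by (subst vproj_mult)
  moreover have "U.subspace (intN \<mu> n)" unfolding intN_def
    by (rule U.subspaceI) (simp_all only: mem_Collect_eq vproj_simps U.subspace_0[OF sub] U.subspace_add[OF sub] U.subspace_scale[OF sub])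
  ultimately show ?thesis by (simp add: left_ideal_def)
qed

lemma intN_E: "uE i \<in> intN \<mu> n"
  using vproj_mult_E[of \<mu> 1 i] P.subspace_0[OF subspace_intT, of n] by (force simp: intN_def)

lemma intN_T: "uT i - uscale (qpow (symm i * \<mu> i)) 1 \<in> intN \<mu> n"
  using vproj_mult_T[of \<mu> 1 i] P.subspace_0[OF subspace_intT, of n] by (force simp: intN_def)

lemma intN_F: "uF i ^ Suc (n i) \<in> intN \<mu> n"
proof -
  have "uF i ^ Suc (n i) = evF (mono [] * mono (replicate (Suc (n i)) i))"
    by (simp only: mono_Nil mult_1_left evF_replicate)
  then show ?thesis using intT_base[of "[]" n i] unfolding intN_def by (auto simp del: replicate.simps)
qed

text \<open>Up to the weight \<open>n\<close> the quotient is as large as the Verma module, since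
  every generator of \<open>intT\<close> contains some letter \<open>k\<close> more than
  \<open>n k\<close> times.\<close>

lemma intN_evF:
  assumes "p \<in> Tw g" "evF p \<in> intN \<mu> n" "\<And>k. g k \<le> of_nat (n k)"
  shows "p \<in> serre_ideal"
proof -
  obtain r where r: "r \<in> intT n" "evF p = evF r" using assms(2) by (auto simp: intN_def)
  have "part g r = 0" using r(1) unfolding intT_def
  proof (induction r rule: P.span_induct_alt)
    case (step c x y)
    then obtain v k where x: "x = mono v * mono (replicate (Suc (n k)) k)" by blast
    have "wt (v @ replicate (Suc (n k)) k) k \<noteq> g k"
      using assms(3)[of k] by (simp add: wt_def count_list_replicate_eq)
    then have "part g (mono (v @ replicate (Suc (n k)) k)) = 0" by (auto simp: part_mono simp del: replicate.simps)
    then have "part g x = 0" by (simp only: x mono_append)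
    then show ?case using step by simp
  qed simp
  moreover have "part g (p - r) \<in> serre_ideal" using r(2) by (intro part_serre_ideal) (simp flip: evF_eq_iff)
  ultimately show ?thesis using assms(1) by (simp add: part_of_Tw)
qed

lemma intN_weight:
  assumes "p \<in> Tw c" "rpair i (\<mu> - c) = x * symm i"
  shows "weightN (intN \<mu> n) i x (evF p)"
proof -
  have "vproj \<mu> (uK i * evF p - uscale (qpow (x * symm i)) (evF p)) = 0"
    unfolding evF_word_K[OF assms(1)] using vproj_K[of \<mu> "evF p" i] assms(2)
    by (simp add: rpair_diff flip: qpow_add)
  then show ?thesis
    unfolding weightN_def[OF intN_left_ideal] using P.subspace_0[OF subspace_intT, of n] by (force simp: intN_def)
qed

lemma intN_decomp: "u - vproj \<mu> u \<in> intN \<mu> n"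
  using intN_left_ideal unfolding left_ideal_def by (intro vproj_decomp intN_E intN_T) auto

end

text \<open>By induction on the height the left derivatives of \<open>y\<close> lie in the Serre
  ideal too, so \<open>evF y\<close> commutes with all \<open>e_i\<close>. In a suitable integrable
  quotient, rank one theory then forces \<open>evF y\<close> to kill the highest weight vector, and
  the quotient is faithful in the weight \<open>b\<close>.\<close>

lemma rder_nondegenerate:
  assumes "y \<in> Tw b" "b \<noteq> 0" "\<And>i. rder i y \<in> serre_ideal"
  shows "y \<in> serre_ideal"
proof -
  have "y \<in> serre_ideal" if "y \<in> Tw b" "b \<noteq> 0" "\<And>i. rder i y \<in> serre_ideal" "(\<Sum>i\<in>UNIV. b i) = of_nat h" for h y b
    using that
  proof (induction h arbitrary: y b rule: less_induct)
    case (less h)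
    show ?case
    proof (cases "b \<in> Qplus")
      case False
      then show ?thesis using Tw_0[OF less.prems(1)] by simp
    next
      case Q: True
      have l: "lder i y \<in> serre_ideal" for i
      \<comment> \<open>Here the left derivative has weight zero, which the induction hypothesis
        excludes; but then it coincides with the right one.\<close>
      proof (cases "b = simple_root i")
        case True
        then have "rder i y = lder i y" using less.prems(1) lder_eq_rder by metis
        then show ?thesis using less.prems(3)[of i] by simp
      next
        case False
        show ?thesis
        proof (cases "b - simple_root i \<in> Qplus")
          case True
          have s: "(\<Sum>k\<in>UNIV. (b - simple_root i) k) = of_nat h - 1"
            using less.prems(4) by (simp add: minus_apply sum_subtractf simple_root_def)
          have "(\<Sum>k\<in>UNIV. (b - simple_root i) k) \<ge> 0" using True by (intro sum_nonneg Qplus_nonneg)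
          then have "h \<ge> 1" using s by (cases h) auto
          show ?thesis
          proof (rule less.IH)
            show "h - 1 < h" using \<open>h \<ge> 1\<close> by simp
            show "lder i y \<in> Tw (b - simple_root i)" by (rule lder_Tw) (rule less.prems)
            show "b - simple_root i \<noteq> 0" using False by simp
            show "rder k (lder i y) \<in> serre_ideal" for k
              unfolding lder_rder_commute[symmetric] by (intro lder_serre_ideal less.prems)
            show "(\<Sum>k\<in>UNIV. (b - simple_root i) k) = of_nat (h - 1)" using s \<open>h \<ge> 1\<close> by (simp add: of_nat_diff)
          qed
        next
          case False
          then show ?thesis using Tw_0[OF lder_Tw[OF less.prems(1)]] by simp
        qed
      qed
      have comm: "uE i * evF y = evF y * uE i" for i
        using l[of i] less.prems(3)[of i] by (simp add: uE_evF evF_serre_ideal)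
      then have commp: "uE i ^ m * evF y = evF y * uE i ^ m" for i m by (intro power_commuting_commutes)
      have "\<exists>m. b k = of_nat m" for k using Q by (auto simp: Qplus_def Nats_def)
      then obtain n where n: "\<And>k. b k = of_nat (n k)" by metis
      \<comment> \<open>The labels of the highest weight are the coordinates of \<open>b\<close>, so
        that \<open>intN_evF\<close> applies in the weight \<open>b\<close>.\<close>
      obtain \<mu> where \<mu>: "\<And>k. rpair k \<mu> = of_nat (n k) * symm k"
        using rpair_solvable[of "\<lambda>k. of_nat (n k) * symm k"] by blast
      note N = intN_left_ideal[of \<mu> n, OF \<mu>]
      have "\<exists>i. rpair i b > 0"
      proof (rule ccontr)
        assume "\<not> ?thesis"
        then have "ip b b \<le> 0" unfolding ip_alt by (intro sum_nonpos) (auto simp: n mult_nonneg_nonpos not_less)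
        then show False using ip_pos[OF less.prems(2)] by simp
      qed
      then obtain i where i: "rpair i b > 0" by blast
      have rp: "rpair i b = symm i * of_int (\<Sum>k\<in>UNIV. cartan i k * int (n k))"
        by (simp add: rpair_def n sum_distrib_left mult.assoc)
      define m where "m = nat (\<Sum>k\<in>UNIV. cartan i k * int (n k))"
      have "(\<Sum>k\<in>UNIV. cartan i k * int (n k)) > 0"
        using i symm_pos[of i] unfolding rp by (simp add: zero_less_mult_iff del: of_int_sum of_int_mult)
      then have m: "rpair i b = of_nat m * symm i" "m > 0" unfolding rp m_def by simp_all
      let ?w = "mono (replicate (n i) i)"
      have Tw: "?w \<in> Tw (wt (replicate (n i) i))" by (rule mono_Tw)
      have evw: "evF ?w = uF i ^ n i" by (rule evF_replicate)
      have rw: "rpair i (wt (replicate (n i) i)) = 2 * of_nat (n i) * symm i"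
        by (simp add: rpair_wt_replicate rpair_self)
      have nil: "\<exists>M. uF i ^ M * (evF p * 1) \<in> intN \<mu> n" for p
        using F_nilpotent[OF N, of i "Suc (n i)" 1 p] intN_F[of \<mu> n i, OF \<mu>] by simp
      have dec: "u - vproj \<mu> u \<in> intN \<mu> n" for u by (rule intN_decomp) (rule \<mu>)
      note iff = left_idealD(7)[OF N]
      \<comment> \<open>The vector \<open>y f_i^(n_i)\<close> has weight \<open>-(n_i + m)\<close>
        for \<open>k_i\<close>. The power \<open>e_i^(n_i + m)\<close> passes through
        \<open>y\<close> and kills \<open>f_i^(n_i)\<close>, because \<open>m > 0\<close>.\<close>
      have yw: "evF (y * ?w) \<in> intN \<mu> n"
      proof -
        obtain M where M: "uF i ^ M * evF (y * ?w) \<in> intN \<mu> n" using nil[of "y * ?w"] by auto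
        show ?thesis
        proof (rule sl2_E_inj[OF N _ _ M])
          show "weightN (intN \<mu> n) i (- of_nat (n i + m)) (evF (y * ?w))"
          proof (rule intN_weight[OF \<mu> Tw_mult[OF less.prems(1) Tw]])
            show "rpair i (\<mu> - (b + wt (replicate (n i) i))) = - of_nat (n i + m) * symm i"
              by (simp add: rpair_diff rpair_add rw m \<mu> algebra_simps)
          qed
          obtain r where r: "r \<in> Tw (wt (replicate (n i) i) - wt (replicate (n i + m) i))"
            "vproj \<mu> (uE i ^ (n i + m) * evF ?w) = evF r" using vproj_power_E[OF Tw] by blast
          have "r = 0"
            using r(1) m(2) by (intro Tw_neg[OF r(1), of i]) (simp add: minus_apply wt_def count_list_replicate_eq)
          then have "uE i ^ (n i + m) * evF ?w \<in> intN \<mu> n" using dec[of "uE i ^ (n i + m) * evF ?w"] r(2) by simp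
          then have "evF y * (uE i ^ (n i + m) * evF ?w) \<in> intN \<mu> n" by (rule left_idealD(3)[OF N])
          then show "uE i ^ (n i + m) * evF (y * ?w) \<in> intN \<mu> n"
            by (simp only: ev_mult mult.assoc[symmetric] commp)
        qed
      qed
      obtain r where r: "r \<in> Tw (wt (replicate (n i) i) - wt (replicate (n i) i))"
        "vproj \<mu> (uE i ^ n i * evF ?w) = evF r" using vproj_power_E[OF Tw] by blast
      have rc: "evF r = uscale (const r) 1" using Tw_zero_scalar[of r] r(1) by (metis ev_1 ev_simps(2) diff_self)
      \<comment> \<open>This is the scalar of \<open>e_i^(n_i) f_i^(n_i)\<close> on the highest
        weight vector. If it vanished, \<open>f_i^(n_i)\<close> would itself be zero in the
        quotient.\<close>
      have "const r \<noteq> 0"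
      proof
        assume "const r = 0"
        then have *: "uE i ^ n i * evF ?w \<in> intN \<mu> n" using dec[of "uE i ^ n i * evF ?w"] r(2) rc by simp
        obtain M where M: "uF i ^ M * evF ?w \<in> intN \<mu> n" using nil[of ?w] by auto
        have "evF ?w \<in> intN \<mu> n"
        proof (rule sl2_E_inj[OF N _ * M])
          show "weightN (intN \<mu> n) i (- of_nat (n i)) (evF ?w)"
            by (rule intN_weight[OF \<mu> Tw]) (simp add: rpair_diff rw \<mu> algebra_simps)
        qed
        then have "?w \<in> serre_ideal" by (rule intN_evF[OF \<mu> Tw]) (auto simp: wt_def count_list_replicate_eq)
        then show False by (simp add: replicate_not_serre)
      qed
      have "uE i ^ n i * evF (y * ?w) \<in> intN \<mu> n" by (rule left_idealD(3)[OF N yw])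
      then have 1: "evF y * (uE i ^ n i * evF ?w) \<in> intN \<mu> n" by (simp only: ev_mult mult.assoc[symmetric] commp)
      have "evF y * (uE i ^ n i * evF ?w - uscale (const r) 1) \<in> intN \<mu> n"
        using dec[of "uE i ^ n i * evF ?w"] r(2) rc by (intro left_idealD(3)[OF N]) simp
      then have "uscale (const r) (evF y) \<in> intN \<mu> n"
        using 1 iff by (simp add: right_diff_distrib uscale_mult_right)
      then have "uscale (inverse (const r)) (uscale (const r) (evF y)) \<in> intN \<mu> n" by (rule left_idealD(4)[OF N])
      then have "evF y \<in> intN \<mu> n" using \<open>const r \<noteq> 0\<close> by simp
      then show ?thesis by (rule intN_evF[OF \<mu> less.prems(1)]) (simp add: n)
    qed
  qed
  moreover have "\<exists>h. (\<Sum>i\<in>UNIV. b i) = of_nat h" if "b \<in> Qplus"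
    using height_nat[OF that] by (auto simp: height_def Nats_def)
  ultimately show ?thesis using assms Tw_0[OF assms(1)] by (cases "b \<in> Qplus") auto
qed

section \<open>Singular vectors\<close>

lemma Tw_Qplus: "p \<in> Tw b ==> p \<notin> serre_ideal ==> b \<in> Qplus" using Tw_0 serre_ideal_closed(1) by metis

lemma Tw_height_induct [consumes 2, case_names step]:
  assumes "p \<in> Tw b" "p \<notin> serre_ideal"
    and "\<And>p b. p \<in> Tw b ==> p \<notin> serre_ideal ==>
      (\<And>i r. r \<in> Tw (b - simple_root i) ==> r \<notin> serre_ideal ==> Q r (b - simple_root i)) ==> Q p b"
  shows "Q p (b :: 'i::cartan_datum => rat)"
proof -
  have "Q p b" if "p \<in> Tw b" "p \<notin> serre_ideal" "height b = of_nat h" for h p b using that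
  proof (induction h arbitrary: p b rule: less_induct)
    case (less h)
    show ?case
    proof (rule assms(3)[OF less.prems(1,2)])
      fix i r assume r: "r \<in> Tw (b - simple_root i)" "r \<notin> serre_ideal"
      obtain k where k: "height (b - simple_root i) = of_nat k"
        using height_nat[OF Tw_Qplus[OF r]] by (auto simp: Nats_def)
      then have "of_nat h = (of_nat (Suc k) :: rat)" using less.prems(3) by (simp add: height_diff_simple)
      then have "k < h" by (simp only: of_nat_eq_iff)
      from less.IH[OF this r k] show "Q r (b - simple_root i)" .
    qed
  qed
  moreover obtain h where "height b = of_nat h"
    using height_nat[OF Tw_Qplus[OF assms(1,2)]] by (auto simp: Nats_def)
  ultimately show ?thesis using assms by blast
qed

text \<open>In non-zero weight a non-zero class has a non-zero right derivative; iteration leads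
  down to the constants.\<close>

lemma not_serre_word:
  assumes "y \<in> Tw c" "y \<notin> serre_ideal"
  shows "\<exists>w. wt w = c \<and> const (foldr rder w y) \<noteq> 0" using assms
proof (induction rule: Tw_height_induct)
  case (step y c)
  show ?case
  proof (cases "c = 0")
    case True
    then have "y = psc (const y) 1" using step(1) Tw_zero_scalar by blast
    then have "const y \<noteq> 0" using step(2) by (metis P.scale_zero_left serre_ideal_closed(1))
    then show ?thesis using True by (intro exI[of _ "[]"]) simp
  next
    case False
    then obtain i where i: "rder i y \<notin> serre_ideal" using rder_nondegenerate[OF step(1)] step(2) by blast
    obtain w where w: "wt w = c - simple_root i" "const (foldr rder w (rder i y)) \<noteq> 0"
      using step(3)[OF rder_Tw[OF step(1)] i] by blast
    have "wt (w @ [i]) = c" by (simp add: wt_append wt_Cons w)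
    then show ?thesis using w by (intro exI[of _ "w @ [i]"]) simp
  qed
qed

section \<open>Absence of zero divisors in the negative part\<close>

lemma rder_power_Tw: "p \<in> Tw b ==> (rder i ^^ m) p \<in> Tw (b - (\<lambda>k. of_nat m * simple_root i k))"
proof (induction m)
  case 0
  have "b - (\<lambda>k. of_nat 0 * simple_root i k) = b" by (simp add: fun_eq_iff minus_apply)
  then show ?case using 0 by simp
next
  case (Suc m)
  have "b - (\<lambda>k. of_nat m * simple_root i k) - simple_root i = b - (\<lambda>k. of_nat (Suc m) * simple_root i k)"
    by (rule ext) (simp add: minus_apply plus_fun_apply algebra_simps)
  then show ?case using rder_Tw[OF Suc.IH[OF Suc.prems], of i] by (metis comp_apply funpow.simps(2))
qed

lemma rder_power_simps: "(rder i ^^ m) 0 = 0" by (induction m) simp_all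

lemma rder_power_serre: "p \<in> serre_ideal ==> (rder i ^^ m) p \<in> serre_ideal"
  by (induction m) (simp_all add: rder_serre_ideal)

text \<open>The coefficients are twisted q-binomials. It is only recorded that they lie in
  \<open>qpos\<close>, which prevents them from vanishing.\<close>

lemma rder_power_leibniz:
  assumes "y \<in> Tw g"
  shows "\<exists>c. (\<forall>k\<le>n. c k \<in> qpos) \<and>
    (rder i ^^ n) (x * y) = (\<Sum>k\<le>n. psc (c k) ((rder i ^^ k) x * (rder i ^^ (n - k)) y))"
proof (induction n)
  case 0
  show ?case using qpos.qpow[of 0] by (intro exI[of _ "\<lambda>_. 1"]) simp
next
  case (Suc n)
  then obtain c where c: "\<And>k. k \<le> n ==> c k \<in> qpos"
    "(rder i ^^ n) (x * y) = (\<Sum>k\<le>n. psc (c k) ((rder i ^^ k) x * (rder i ^^ (n - k)) y))" by blast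
  define e where "e k = - rpair i (g - (\<lambda>j. of_nat (n - k) * simple_root i j))" for k
  define t where "t k = (rder i ^^ k) x * (rder i ^^ (Suc n - k)) y" for k
  have s: "rder i ((rder i ^^ k) x * (rder i ^^ (n - k)) y) = t k + psc (qpow (e k)) (t (Suc k))" if "k \<le> n" for k
  proof -
    have "rder i ((rder i ^^ (n - k)) y) = (rder i ^^ (Suc n - k)) y" using that by (simp add: Suc_diff_le)
    then show ?thesis unfolding rder_mult[OF rder_power_Tw[OF assms]] by (simp add: t_def e_def)
  qed
  define c' where "c' k = (if k \<le> n then c k else 0) + (case k of 0 => 0 | Suc l => qpow (e l) * c l)" for k
  have "(rder i ^^ Suc n) (x * y) = (\<Sum>k\<le>n. psc (c k) (rder i ((rder i ^^ k) x * (rder i ^^ (n - k)) y)))"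
    by (simp add: c(2) lin_sum[OF lin_rder])
  also have "\<dots> = (\<Sum>k\<le>n. psc (c k) (t k)) + (\<Sum>k\<le>n. psc (qpow (e k) * c k) (t (Suc k)))"
    by (simp add: s P.scale_right_distrib sum.distrib mult.commute)
  also have "(\<Sum>k\<le>n. psc (c k) (t k)) = (\<Sum>k\<le>Suc n. psc (if k \<le> n then c k else 0) (t k))" by simp
  also have "(\<Sum>k\<le>n. psc (qpow (e k) * c k) (t (Suc k))) = (\<Sum>k\<le>Suc n. psc (case k of 0 => 0 | Suc l => qpow (e l) * c l) (t k))"
    by (subst sum.atMost_Suc_shift) simp
  also have "(\<Sum>k\<le>Suc n. psc (if k \<le> n then c k else 0) (t k)) + \<dots> = (\<Sum>k\<le>Suc n. psc (c' k) (t k))"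
    unfolding c'_def P.scale_left_distrib sum.distrib ..
  finally have "(rder i ^^ Suc n) (x * y) = (\<Sum>k\<le>Suc n. psc (c' k) ((rder i ^^ k) x * (rder i ^^ (Suc n - k)) y))"
    unfolding t_def .
  moreover have "c' k \<in> qpos" if "k \<le> Suc n" for k
  proof (cases k)
    case (Suc l)
    then show ?thesis using that c(1) qpos_mult_qpow[OF c(1)] by (auto simp: c'_def intro!: qpos.add)
  qed (simp add: c'_def c(1))
  ultimately show ?case by blast
qed

lemma rder_power_max:
  fixes i :: "'i::cartan_datum"
  assumes "y \<in> Tw c" "y \<notin> serre_ideal"
  obtains b where "(rder i ^^ b) y \<notin> serre_ideal" "\<And>k. k > b ==> (rder i ^^ k) y \<in> serre_ideal"
proof -
  obtain m where m: "c i < of_nat m" using reals_Archimedean2 by blast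
  have "(rder i ^^ m) y = 0"
    using m by (intro Tw_neg[OF rder_power_Tw[OF assms(1)], where i = i]) (simp add: minus_apply simple_root_def)
  then have z: "(rder i ^^ k) y \<in> serre_ideal" if "k \<ge> m" for k
  proof -
    have "(rder i ^^ k) y = (rder i ^^ (k - m)) ((rder i ^^ m) y)"
      using that by (simp flip: funpow_add comp_apply[of "rder i ^^ (k - m)" "rder i ^^ m"])
    then show ?thesis using \<open>(rder i ^^ m) y = 0\<close> by (simp add: rder_power_simps)
  qed
  define B where "B = {k. (rder i ^^ k) y \<notin> serre_ideal}"
  have "B \<subseteq> {..<m}" using z by (auto simp: B_def simp flip: not_le)
  then have "finite B" by (rule finite_subset) simp
  moreover have "0 \<in> B" using assms(2) by (simp add: B_def)
  then have "B \<noteq> {}" by (simp only: ex_in_conv[symmetric]) (rule exI)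
  ultimately have "Max B \<in> B" by (rule Max_in)
  moreover have "k \<notin> B" if "k > Max B" for k using Max_ge[OF \<open>finite B\<close>, of k] that not_le by blast
  ultimately show ?thesis using that unfolding B_def by blast
qed

text \<open>Take \<open>i\<close> with a non-zero derivative of \<open>x\<close>, and the largest
  powers \<open>a\<close> and \<open>b\<close> of \<open>rder i\<close> that do not annihilate
  \<open>x\<close> and \<open>y\<close>. In the Leibniz expansion of the power \<open>a + b\<close>
  only one term survives, a product whose first factor has smaller height.\<close>

lemma serre_ideal_domain:
  assumes "x \<in> Tw B" "x \<notin> serre_ideal" "y \<in> Tw g" "y \<notin> serre_ideal"
  shows "x * y \<notin> serre_ideal"
proof -
  have "x * y \<notin> serre_ideal"
    if "x \<in> Tw B" "x \<notin> serre_ideal" "y \<in> Tw g" "y \<notin> serre_ideal" "height B = of_nat h" for h x y B g using that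
  proof (induction h arbitrary: x y B g rule: less_induct)
    case (less h)
    show ?case
    proof (cases "B = 0")
      case True
      then have x: "x = psc (const x) 1" using less.prems(1) Tw_zero_scalar by blast
      then have "const x \<noteq> 0" using less.prems(2) by (metis P.scale_zero_left serre_ideal_closed(1))
      moreover have "x * y = psc (const x) y" by (subst x) (simp add: psc_mult_left)
      ultimately show ?thesis using less.prems(4) by (simp add: serre_ideal_scale_iff)
    next
      case False
      then obtain i where i: "rder i x \<notin> serre_ideal"
        using rder_nondegenerate[OF less.prems(1)] less.prems(2) by blast
      obtain a where a: "(rder i ^^ a) x \<notin> serre_ideal" "\<And>k. k > a ==> (rder i ^^ k) x \<in> serre_ideal"
        using rder_power_max[OF less.prems(1,2)] by blast
      obtain b where b: "(rder i ^^ b) y \<notin> serre_ideal" "\<And>k. k > b ==> (rder i ^^ k) y \<in> serre_ideal"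
        using rder_power_max[OF less.prems(3,4)] by blast
      have "a \<noteq> 0" using a(2)[of 1] i by auto
      obtain c where c: "\<And>k. k \<le> a + b ==> c k \<in> qpos"
        "(rder i ^^ (a + b)) (x * y) = (\<Sum>k\<le>a + b. psc (c k) ((rder i ^^ k) x * (rder i ^^ (a + b - k)) y))"
        using rder_power_leibniz[OF less.prems(3)] by blast
      let ?t = "\<lambda>k. psc (c k) ((rder i ^^ k) x * (rder i ^^ (a + b - k)) y)"
      let ?p = "(rder i ^^ a) x * (rder i ^^ b) y"
      have "?p \<notin> serre_ideal"
      proof -
        let ?B = "B - (\<lambda>k. of_nat a * simple_root i k)"
        have T: "(rder i ^^ a) x \<in> Tw ?B" by (rule rder_power_Tw[OF less.prems(1)])
        obtain k where k: "height ?B = of_nat k" using height_nat[OF Tw_Qplus[OF T a(1)]] by (auto simp: Nats_def)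
        have "height ?B = height B - of_nat a" by (simp add: height_def minus_apply sum_subtractf simple_root_def)
        then have "of_nat h = (of_nat (k + a) :: rat)" using k less.prems(5) by simp
        then have "k < h" using \<open>a \<noteq> 0\<close> unfolding of_nat_eq_iff by simp
        then show ?thesis by (rule less.IH[OF _ T a(1) rder_power_Tw[OF less.prems(3)] b(1) k])
      qed
      moreover have "(rder i ^^ (a + b)) (x * y) \<approx> psc (c a) ?p"
      proof -
        have "(\<Sum>k\<le>a + b. ?t k) = ?t a + (\<Sum>k\<in>{..a + b} - {a}. ?t k)" by (rule sum.remove) auto
        then have "(rder i ^^ (a + b)) (x * y) - psc (c a) ?p = (\<Sum>k\<in>{..a + b} - {a}. ?t k)" unfolding c(2) by simp
        also have "\<dots> \<in> serre_ideal"
        proof (rule P.subspace_sum[OF subspace_serre_ideal])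
          fix k assume "k \<in> {..a + b} - {a}"
          then consider "k > a" | "a + b - k > b" by fastforce
          then show "?t k \<in> serre_ideal" using a(2)[of k] b(2)[of "a + b - k"]
            by cases (simp_all add: serre_ideal_mult_left serre_ideal_mult_right)
        qed
        finally show ?thesis .
      qed
      moreover have "c a \<noteq> 0" using c(1)[of a] qpos_nonzero by simp
      ultimately have "(rder i ^^ (a + b)) (x * y) \<notin> serre_ideal"
        using serre_ideal_closed(4)[of "(rder i ^^ (a + b)) (x * y)" "(rder i ^^ (a + b)) (x * y) - psc (c a) ?p"]
        by (auto simp: serre_ideal_scale_iff)
      then show ?thesis using rder_power_serre by blast
    qed
  qed
  moreover obtain h where "height B = of_nat h"
    using height_nat[OF Tw_Qplus[OF assms(1,2)]] by (auto simp: Nats_def)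
  ultimately show ?thesis using assms by blast
qed

section \<open>Singular vectors and their weights\<close>

definition singular :: "('i::cartan_datum => rat) => 'i tens => bool"
  where "singular l y \<longleftrightarrow> y \<notin> serre_ideal \<and> (\<forall>i. vop l (GenE i) y \<in> serre_ideal)"

lemma foldr_rder_lder: "lder i (foldr rder w y) = foldr rder w (lder i y)"
  by (induction w) (simp_all add: lder_rder_commute)

lemma foldr_rder_Tw: "y \<in> Tw c ==> foldr rder w y \<in> Tw (c - wt w)"
proof (induction w)
  case (Cons i w)
  have "c - wt w - simple_root i = c - wt (i # w)" by (simp add: wt_Cons algebra_simps)
  then show ?case using rder_Tw[OF Cons.IH[OF Cons.prems], of i] by (metis comp_apply foldr.simps(2))
qed simp

lemma foldr_rder_simps: "foldr rder w (psc c p) = psc c (foldr rder w p)"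
    "foldr rder w (p - r) = foldr rder w p - foldr rder w r" by (induction w) simp_all

lemma foldr_rder_serre: "p \<in> serre_ideal ==> foldr rder w p \<in> serre_ideal"
  by (induction w) (simp_all add: rder_serre_ideal)

text \<open>The condition \<open>2 (n + \<rho> | g) = (g | g)\<close> is obtained without a quantum
  Casimir element. For a singular vector each left derivative is \<open>qpow (c i)\<close> times the
  right one, so rotating a word of derivatives by one letter costs this factor. A full rotation
  returns to the start, and the exponents add up to zero.\<close>

lemma singular_weight:
  assumes "y \<in> Tw g" "singular n y"
  shows "2 * ip n g + (\<Sum>i\<in>UNIV. 2 * symm i * g i) = ip g g"
proof -
  define c where "c i = 2 * rpair i n - rpair i g + 2 * symm i" for i
  have l: "lder i y \<approx> psc (qpow (c i)) (rder i y)" for i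
  proof -
    define a where "a = rpair i n"
    define b where "b = rpair i (g - n) - rpair i (simple_root i)"
    have "psc (1 / qden i) (psc (qpow a) (rder i y) - psc (qpow b) (lder i y)) \<in> serre_ideal"
      using assms(2) unfolding singular_def a_def b_def vop_E_der[OF assms(1), symmetric] by blast
    then have "psc (qpow a) (rder i y) - psc (qpow b) (lder i y) \<in> serre_ideal"
      by (subst (asm) serre_ideal_scale_iff) simp_all
    then have "psc (- qpow (- b)) (psc (qpow a) (rder i y) - psc (qpow b) (lder i y)) \<in> serre_ideal"
      by (rule serre_ideal_closed)
    moreover have "- b + a = c i" by (simp add: a_def b_def c_def rpair_diff rpair_self)
    then have "psc (- qpow (- b)) (psc (qpow a) (rder i y) - psc (qpow b) (lder i y)) = lder i y - psc (qpow (c i)) (rder i y)"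
      by (simp add: P.scale_right_diff_distrib flip: qpow_add)
    ultimately show ?thesis by simp
  qed
  \<comment> \<open>The derivatives along \<open>w\<close> leave the weight of one simple root,
    where left and right derivatives agree. The left one commutes with all \<open>rder\<close> and
    can be moved to the inside.\<close>
  have rot: "const (foldr rder (i # w) y) = qpow (c i) * const (foldr rder (w @ [i]) y)" if "wt (i # w) = g" for i w
  proof -
    have "g - wt w = simple_root i" unfolding that[symmetric] by (simp add: wt_Cons)
    then have "foldr rder (i # w) y = foldr rder w (lder i y)"
      using lder_eq_rder[of "foldr rder w y" i] foldr_rder_Tw[OF assms(1), of w] by (simp add: foldr_rder_lder)
    moreover have "foldr rder w (lder i y - psc (qpow (c i)) (rder i y)) \<in> serre_ideal"
      by (rule foldr_rder_serre) (rule l)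
    ultimately have "foldr rder (i # w) y \<approx> psc (qpow (c i)) (foldr rder (w @ [i]) y)"
      by (simp add: foldr_rder_simps)
    from const_cong[OF this] show ?thesis by simp
  qed
  have rots: "const (foldr rder (u @ w) y) = qpow (sum_list (map c u)) * const (foldr rder (w @ u) y)" if "wt (u @ w) = g" for u w
    using that
  proof (induction u arbitrary: w)
    case (Cons i u)
    have "wt (u @ (w @ [i])) = g" using Cons.prems by (simp add: wt_append wt_Cons algebra_simps)
    from Cons.IH[OF this] rot[of i "u @ w"] Cons.prems show ?case by (simp add: qpow_add)
  qed simp
  obtain w where w: "wt w = g" "const (foldr rder w y) \<noteq> 0"
    using not_serre_word[OF assms(1)] assms(2) by (auto simp: singular_def)
  have "qpow (sum_list (map c w)) = 1" using rots[of w "[]"] w by simp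
  then have "sum_list (map c w) = 0" by simp
  moreover have "sum_list (map c w) = (\<Sum>i\<in>UNIV. wt w i * c i)" for w
  proof (induction w)
    case (Cons j w)
    have "(\<Sum>i\<in>UNIV. simple_root j i * c i) = (\<Sum>i\<in>UNIV. if i = j then c i else 0)"
      by (intro sum.cong) (auto simp: simple_root_def)
    then show ?case by (simp add: Cons wt_Cons plus_fun_apply distrib_right sum.distrib)
  qed (simp add: zero_fun_apply)
  ultimately have "(\<Sum>i\<in>UNIV. g i * c i) = 0" using w by simp
  then have "2 * (\<Sum>i\<in>UNIV. g i * rpair i n) - (\<Sum>i\<in>UNIV. g i * rpair i g) + (\<Sum>i\<in>UNIV. 2 * symm i * g i) = 0"
    by (simp add: c_def sum.distrib sum_subtractf sum_distrib_left algebra_simps)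
  then show ?thesis by (simp add: ip_commute[of n]) (simp add: ip_alt)
qed

text \<open>\<open>omega\<close> fixes \<open>uT i\<close>, so eigenvectors for different
  eigenvalues are orthogonal.\<close>

lemma shap_weights:
  assumes "p \<in> Tw b" "r \<in> Tw c" "b \<noteq> c"
  shows "shap l (evF p) (evF r) = 0"
proof -
  obtain i where i: "b i \<noteq> c i" using assms(3) by auto
  have T: "vproj l (uT i * evF p) = uscale (qpow (symm i * (l i - d i))) (evF p)" if "p \<in> Tw d" for p d
    using vproj_gen_mult[of l "GenT i" p] vop_T[OF that, of l i] by simp
  have "shap l (uT i * evF p) (evF r) = shap l (evF p) (uT i * evF r)" by (simp add: shap_mult_left)
  then have "shap l (vproj l (uT i * evF p)) (evF r) = shap l (evF p) (vproj l (uT i * evF r))"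
    by (simp only: shap_vproj_left shap_vproj_right)
  then have "(qpow (symm i * (l i - b i)) - qpow (symm i * (l i - c i))) * shap l (evF p) (evF r) = 0"
    by (simp add: T[OF assms(1)] T[OF assms(2)] left_diff_distrib)
  then show ?thesis using i by simp
qed

text \<open>The radical is stable under raising, which lowers the height. The process ends at a
  singular vector, and not in weight 0, where pairing with 1 detects constants.\<close>

lemma radical_singular:
  assumes "y \<in> Tw c" "y \<notin> serre_ideal" "\<And>p. shap l (evF p) (evF y) = 0"
  shows "\<exists>d z. z \<in> Tw d \<and> d \<noteq> 0 \<and> d \<in> Qplus \<and> c - d \<in> Qplus \<and> singular l z" using assms
proof (induction rule: Tw_height_induct)
  case (step y c)
  show ?case
  proof (cases "singular l y")
    case True
    have "c \<noteq> 0"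
    proof
      assume "c = 0"
      then have "y = psc (const y) 1" using step(1) Tw_zero_scalar by blast
      moreover have "const y = 0" using step(4)[of 1] by simp
      ultimately show False using step(2) by (metis P.scale_zero_left serre_ideal_closed(1))
    qed
    moreover have "c - c \<in> Qplus" by (simp add: Qplus_def zero_fun_apply)
    ultimately show ?thesis using True step(1) Tw_Qplus[OF step(1,2)] by blast
  next
    case False
    then obtain i where i: "vop l (GenE i) y \<notin> serre_ideal" using step(2) by (auto simp: singular_def)
    have T: "vop l (GenE i) y \<in> Tw (c - simple_root i)" by (rule vop_E_Tw) (rule step(1))
    have "shap l (evF p) (evF (vop l (GenE i) y)) = 0" for p
    proof -
      have "evF (vop l (GenE i) y) = vproj l (uE i * evF y)" using vproj_gen_mult[of l "GenE i" y] by simp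
      then have "shap l (evF p) (evF (vop l (GenE i) y)) = shap l (omega (uE i) * evF p) (evF y)"
        by (simp only: shap_vproj_right shap_mult_right)
      also have "\<dots> = shap l (vproj l (omega (uE i) * evF p)) (evF y)" by (simp only: shap_vproj_left)
      also have "\<dots> = 0" unfolding vproj_def by (rule step(4))
      finally show ?thesis .
    qed
    from step(3)[OF T i this] obtain d z where z: "z \<in> Tw d" "d \<noteq> 0" "d \<in> Qplus" "c - simple_root i - d \<in> Qplus" "singular l z"
      by blast
    have "c - d \<in> Qplus" unfolding Qplus_def mem_Collect_eq
    proof
      fix k
      have "(c - simple_root i - d) k + simple_root i k \<in> \<nat>"
        using z(4) by (intro Nats_add) (auto simp: Qplus_def simple_root_def simp del: minus_apply)
      then show "(c - d) k \<in> \<nat>" by (simp add: minus_apply)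
    qed
    then show ?thesis using z by blast
  qed
qed

text \<open>The numerical condition of \<open>singular_weight\<close>. The set may exceed the
  weights of actual singular vectors, but it is finite.\<close>

definition singular_weights :: "('i::cartan_datum => rat) => ('i => rat) set"
  where "singular_weights l = {c \<in> Qplus. c \<noteq> 0 \<and> 2 * ip l c + (\<Sum>i\<in>UNIV. 2 * symm i * c i) = ip c c}"

lemma shap_nondegenerate:
  assumes "y \<in> Tw c" "\<And>p. p \<in> Tw c ==> shap l (evF p) (evF y) = 0"
    and "\<And>d. d \<in> singular_weights l ==> c - d \<notin> Qplus"
  shows "y \<in> serre_ideal"
proof (rule ccontr)
  assume y: "y \<notin> serre_ideal"
  have 0: "shap l (evF p) (evF y) = 0" for p
  proof -
    let ?S = "{b. part b p \<noteq> 0}"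
    have "shap l (evF (part b p)) (evF y) = 0" for b
      using assms(2)[of "part b p"] shap_weights[OF part_Tw assms(1)] by (cases "b = c") auto
    then have "shap l (evF (\<Sum>b\<in>?S. part b p)) (evF y) = 0" by (simp add: ev_sum shap_left_sum)
    then show ?thesis using sum_parts[OF finite_parts, of p] by simp
  qed
  then obtain d z where z: "z \<in> Tw d" "d \<noteq> 0" "d \<in> Qplus" "c - d \<in> Qplus" "singular l z"
    using radical_singular[OF assms(1) y, of l] by blast
  then show False using singular_weight[OF z(1,5)] assms(3)[of d] by (auto simp: singular_weights_def)
qed

section \<open>Finiteness of the candidate weights\<close>

lemma ip_scale_left: "ip (\<lambda>j. c * l j) m = c * ip l m" by (simp add: ip_alt sum_distrib_left mult.assoc)

lemma ip_nonneg: "ip l l \<ge> 0" using ip_pos[of l] by (cases "l = 0") auto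

lemma ip_cauchy_schwarz: "ip l m ^ 2 \<le> ip l l * ip m m"
proof (cases "m = 0")
  case False
  define t where "t = ip l m / ip m m"
  have p: "ip m m > 0" by (rule ip_pos) (rule False)
  have "0 \<le> ip (l - (\<lambda>j. t * m j)) (l - (\<lambda>j. t * m j))" by (rule ip_nonneg)
  also have "\<dots> = ip l l - 2 * t * ip l m + t * t * ip m m"
    by (simp add: ip_diff_left ip_diff_right ip_scale_left ip_commute[of _ "\<lambda>j. t * m j"] ip_commute[of m l] algebra_simps)
  also have "t * t * ip m m = t * ip l m" using p by (simp add: t_def)
  finally have "t * ip l m \<le> ip l l" by simp
  then show ?thesis using p by (simp add: t_def power2_eq_square pos_divide_le_eq)
qed simp

lemma finite_Qplus_bounded: "finite {g \<in> Qplus. \<forall>i. g i \<le> c (i :: 'i::finite)}"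
proof -
  have "\<exists>n. c i \<le> of_nat n" for i by (rule real_arch_simple)
  then obtain n where n: "\<And>i. c i \<le> of_nat (n i)" by metis
  have "{g \<in> Qplus. \<forall>i. g i \<le> c i} \<subseteq> (\<lambda>f i. of_nat (f i)) ` (PiE UNIV (\<lambda>i. {..n i}))"
  proof
    fix g assume g: "g \<in> {g \<in> Qplus. \<forall>i. g i \<le> c i}"
    have "\<exists>m. g i = of_nat m \<and> m \<le> n i" for i
    proof -
      have "g i \<in> \<nat>" "g i \<le> of_nat (n i)" using g order_trans[OF _ n[of i], of "g i"] by (simp_all add: Qplus_def)
      then show ?thesis by (metis Nats_cases of_nat_le_iff)
    qed
    then obtain f where "\<And>i. g i = of_nat (f i) \<and> f i \<le> n i" by metis
    then show "g \<in> (\<lambda>f i. of_nat (f i)) ` (PiE UNIV (\<lambda>i. {..n i}))"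
      by (intro image_eqI[of _ _ f]) (auto simp: PiE_def)
  qed
  then show ?thesis by (rule finite_subset) (intro finite_imageI finite_PiE; simp)
qed

text \<open>A coordinate of a weight is its scalar product with a dual vector
  \<open>\<omega>\<close>, so Cauchy-Schwarz bounds it.\<close>

lemma finite_Qplus_ball: "finite {c \<in> Qplus. ip (c - s) (c - s) \<le> C}" for s :: "'i::cartan_datum => rat"
proof -
  have "\<exists>n. \<forall>c. ip (c - s) (c - s) \<le> C \<longrightarrow> c i \<le> of_nat n" for i :: 'i
  proof -
    obtain \<omega> where \<omega>: "\<And>k. rpair k \<omega> = of_bool (k = i)" using rpair_solvable[of "\<lambda>k. of_bool (k = i)"] by blast
    have i: "ip c \<omega> = c i" for c by (simp add: ip_alt \<omega>)
    obtain n where n: "1 + C * ip \<omega> \<omega> + s i < of_nat n" using reals_Archimedean2 by blast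
    have "c i \<le> of_nat n" if "ip (c - s) (c - s) \<le> C" for c
    proof -
      have "(c i - s i) ^ 2 = ip (c - s) \<omega> ^ 2" by (simp add: i minus_apply)
      also have "\<dots> \<le> ip (c - s) (c - s) * ip \<omega> \<omega>" by (rule ip_cauchy_schwarz)
      also have "\<dots> \<le> C * ip \<omega> \<omega>" by (rule mult_right_mono[OF that ip_nonneg])
      finally have "(c i - s i) ^ 2 \<le> C * ip \<omega> \<omega>" .
      moreover have "x \<le> 1 + x ^ 2" for x :: rat
        using zero_le_power2[of "x - 1/2"] by (simp add: power2_eq_square algebra_simps)
      ultimately have "c i - s i \<le> 1 + C * ip \<omega> \<omega>" by (meson add_left_mono order_trans)
      then show ?thesis using n by linarith
    qed
    then show ?thesis by blast
  qed
  then obtain n where n: "\<And>i c. ip (c - s) (c - s) \<le> C ==> c i \<le> of_nat (n i)" by metis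
  show ?thesis by (rule finite_subset[OF _ finite_Qplus_bounded[of "\<lambda>i. of_nat (n i)"]]) (use n in blast)
qed

text \<open>Completing the square puts \<open>c\<close> on the sphere around \<open>\<sigma>\<close>
  through the origin. The vector \<open>\<rho>'\<close> is characterized by its products with the
  simple roots.\<close>

lemma finite_singular_weights: "finite (singular_weights (l :: 'i::cartan_datum => rat))"
proof -
  obtain \<rho>' :: "'i => rat" where \<rho>': "\<And>k. rpair k \<rho>' = symm k" using rpair_solvable[of symm] by blast
  define \<sigma> where "\<sigma> = l + \<rho>'"
  have "ip (c - \<sigma>) (c - \<sigma>) \<le> ip \<sigma> \<sigma>" if "c \<in> singular_weights l" for c
  proof -
    have "(\<Sum>i\<in>UNIV. 2 * symm i * c i) = 2 * ip c \<rho>'" by (simp add: ip_alt \<rho>' sum_distrib_left algebra_simps)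
    then have "2 * ip c \<sigma> = ip c c"
      using that by (simp add: singular_weights_def \<sigma>_def ip_add_right ip_commute[of l])
    then show ?thesis by (simp add: ip_diff_left ip_diff_right ip_commute[of \<sigma> c])
  qed
  then have "singular_weights l \<subseteq> {c \<in> Qplus. ip (c - \<sigma>) (c - \<sigma>) \<le> ip \<sigma> \<sigma>}" by (auto simp: singular_weights_def)
  then show ?thesis by (rule finite_subset) (rule finite_Qplus_ball)
qed

text \<open>For such \<open>l\<close> the product of \<open>c\<close> with
  \<open>2 (l + \<rho>)\<close> is at most 0 on \<open>Qplus\<close>, whereas \<open>ip c c\<close>
  is positive.\<close>

lemma singular_weights_antidominant:
  assumes "\<And>i. rpair i l + symm i \<le> 0"
  shows "singular_weights l = {}"
proof -
  have False if "c \<in> singular_weights l" for c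
  proof -
    have "c i \<ge> 0" for i using that by (simp add: singular_weights_def Qplus_nonneg)
    then have "(\<Sum>i\<in>UNIV. 2 * (c i * (rpair i l + symm i))) \<le> 0"
      using assms by (intro sum_nonpos) (simp add: mult_nonneg_nonpos)
    moreover have "(\<Sum>i\<in>UNIV. 2 * (c i * (rpair i l + symm i))) = 2 * ip l c + (\<Sum>i\<in>UNIV. 2 * symm i * c i)"
      by (subst ip_commute) (simp add: ip_alt sum_distrib_left sum.distrib algebra_simps)
    ultimately have "ip c c \<le> 0" using that by (simp add: singular_weights_def)
    then show False using that ip_pos[of c] by (simp add: singular_weights_def)
  qed
  then show ?thesis by blast
qed

section \<open>Irreducible modules\<close>

text \<open>The annihilator of the highest weight vector of \<open>L(l)\<close>, as a left ideal:
  \<open>u\<close> vanishes there when no \<open>x\<close> brings it back to the top weight.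
  \<open>L(l)\<close> is then the algebra modulo \<open>rad l\<close>.\<close>

definition rad :: "('i::cartan_datum => rat) => 'i uq set"
  where "rad l = {u. \<forall>x. vcoeff l (x * u) = 0}"

lemma rad_left_ideal: "left_ideal (rad l)" unfolding left_ideal_def
proof
  show "U.subspace (rad l)" by (rule U.subspaceI) (simp_all add: rad_def distrib_left uscale_mult_right)
  show "\<forall>u. \<forall>v\<in>rad l. u * v \<in> rad l" by (simp add: rad_def flip: mult.assoc)
qed

lemmas rad_closed = left_idealD(1-6)[OF rad_left_ideal]
lemmas rad_iff = left_idealD(7)[OF rad_left_ideal]

lemma rad_sum: "(\<And>k. k \<in> A ==> f k \<in> rad l) ==> sum f A \<in> rad l"
  by (induction A rule: infinite_finite_induct) (simp_all add: rad_closed)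

lemma rad_E: "uE i \<in> rad l" by (simp add: rad_def)

lemma rad_T: "uT i - uscale (qpow (symm i * l i)) 1 \<in> rad l"
  by (simp add: rad_def right_diff_distrib uscale_mult_right)

lemma rad_vproj: "u - vproj l u \<in> rad l"
  using rad_left_ideal unfolding left_ideal_def by (intro vproj_decomp rad_E rad_T) auto

lemma rad_vproj_0: "vproj l u = 0 ==> u \<in> rad l" using rad_vproj[of u l] by simp

lemma rad_vcoeff: "u \<in> rad l ==> vcoeff l u = 0"
  unfolding rad_def using mult_1_left[of u] by (metis (mono_tags) mem_Collect_eq)

lemma one_not_rad: "1 \<notin> rad l" using rad_vcoeff[of 1 l] by auto

lemma vproj_range: "\<exists>p. vproj l u = evF p" by (auto simp: vproj_def)

lemma rad_shap: "u \<in> rad l \<longleftrightarrow> (\<forall>p. shap l (evF p) u = 0)"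
proof
  assume "u \<in> rad l"
  then show "\<forall>p. shap l (evF p) u = 0" by (simp add: shap_def rad_def)
next
  assume *: "\<forall>p. shap l (evF p) u = 0"
  have "vcoeff l (x * u) = 0" for x
  proof -
    have "vcoeff l (x * u) = shap l (vproj l (omega x)) u" by (simp only: shap_vproj_left) (simp add: shap_def)
    then show ?thesis using vproj_range[of l "omega x"] * by (metis (no_types))
  qed
  then show "u \<in> rad l" by (simp add: rad_def)
qed

lemma Kminus_rad: "Kminus l = Uminus \<inter> rad l" unfolding Kminus_eq Uminus_eq by (auto simp: rad_shap)

lemma shap_part: "shap l (evF (part c p)) (evF r) = shap l (evF (part c p)) (evF (part c r))"
proof -
  let ?S = "insert c {b. part b r \<noteq> 0}"
  have S: "finite ?S" using finite_parts by simp
  have "shap l (evF (part c p)) (evF r) = shap l (evF (part c p)) (evF (\<Sum>b\<in>?S. part b r))"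
    by (subst sum_parts[OF S]) auto
  also have "\<dots> = (\<Sum>b\<in>?S. shap l (evF (part c p)) (evF (part b r)))" by (simp only: ev_sum shap_sum)
  also have "\<dots> = (\<Sum>b\<in>?S. if b = c then shap l (evF (part c p)) (evF (part c r)) else 0)"
    by (intro sum.cong refl) (auto intro: shap_weights[OF part_Tw part_Tw])
  finally show ?thesis using S by simp
qed

lemma shap_part': "shap l (evF p) (evF (part c r)) = shap l (evF (part c p)) (evF (part c r))"
  using shap_part[of l c r p] by (simp only: shap_commute[of l "evF p"] shap_commute[of l "evF (part c p)"])

lemma rad_part:
  assumes "evF r \<in> rad l"
  shows "evF (part c r) \<in> rad l"
proof -
  have "shap l (evF p) (evF (part c r)) = 0" for p
    using assms shap_part[of l c p r] shap_part'[of l p c r] by (simp add: rad_shap)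
  then show ?thesis by (simp add: rad_shap)
qed

lemma evF_parts: "evF p = (\<Sum>b\<in>{b. part b p \<noteq> 0}. evF (part b p))"
  by (simp only: sum_parts[OF finite_parts order_refl] flip: ev_sum)

lemma vproj_gen_Tw: "p \<in> Tw b ==> \<exists>r\<in>Tw (b - simple_root i). vproj l (uE i * evF p) = evF r"
  using vproj_gen_mult[of l "GenE i" p] vop_E_Tw[of p b l i] by auto

text \<open>Common induction for \<open>omega\<close> and \<open>theta\<close>, both of which turn
  lowering elements into raising ones.\<close>

lemma vproj_raise:
  assumes g: "\<And>x y. g (x + y) = g x + g y" "\<And>c x. g (uscale c x) = uscale c (g x)"
    and w: "\<And>w p b. p \<in> Tw b ==> \<exists>r\<in>Tw (b - wt w). vproj l (g (evF (mono w)) * evF p) = evF r"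
    and "y \<in> Tw d" "p \<in> Tw b"
  shows "\<exists>r\<in>Tw (b - d). vproj l (g (evF y) * evF p) = evF r" using assms(4)
proof (induction rule: Tw_induct)
  case (word v c)
  obtain r where "r \<in> Tw (b - d)" "vproj l (g (evF (mono v)) * evF p) = evF r"
    using w[OF assms(5), of v] word by auto
  then show ?case by (intro bexI[of _ "psc c r"]) (simp_all add: g uscale_mult_left)
next
  case (add x y)
  then obtain r s where "r \<in> Tw (b - d)" "vproj l (g (evF x) * evF p) = evF r"
    "s \<in> Tw (b - d)" "vproj l (g (evF y) * evF p) = evF s" by blast
  then show ?case by (intro bexI[of _ "r + s"]) (simp_all add: g distrib_right)
next
  case zero
  have "g 0 = 0" using g(2)[of 0 0] by simp
  then show ?case by (intro bexI[of _ 0]) simp_all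
qed

lemma vproj_omega_Tw:
  fixes y :: "'i::cartan_datum tens"
  assumes "y \<in> Tw g" "p \<in> Tw b"
  shows "\<exists>r\<in>Tw (b - g). vproj l (omega (evF y) * evF p) = evF r"
proof (rule vproj_raise[OF _ _ _ assms])
  fix w :: "'i list" and p :: "'i tens" and b assume "p \<in> Tw b"
  then show "\<exists>r\<in>Tw (b - wt w). vproj l (omega (evF (mono w)) * evF p) = evF r"
  proof (induction w arbitrary: p b)
    case Nil
    then show ?case by auto
  next
    case (Cons i w)
    obtain s where s: "s \<in> Tw (b - simple_root i)" "vproj l (uE i * evF p) = evF s"
      using vproj_gen_Tw[OF Cons.prems] by blast
    obtain c where c: "vproj l (uKinv i * evF s) = uscale c (evF s)"
    proof
      have "evF s * uKinv i = uKinv i * (uK i * evF s) * uKinv i" by simp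
      also have "\<dots> = uscale (qpow (- rpair i (b - simple_root i))) (uKinv i * evF s)"
        by (simp only: evF_word_K[OF s(1)] us_mult mult.assoc uK_inv mult_1_right)
      finally have "evF s * uKinv i = uscale (qpow (- rpair i (b - simple_root i))) (uKinv i * evF s)" .
      then have "uKinv i * evF s = uscale (qpow (rpair i (b - simple_root i))) (evF s * uKinv i)"
        by (simp only: U.scale_scale qpow_mult_minus U.scale_one)
      then show "vproj l (uKinv i * evF s) = uscale (qpow (rpair i (b - simple_root i)) * qpow (- rpair i l)) (evF s)"
        by simp
    qed
    have T: "psc c s \<in> Tw (b - simple_root i)" using s by simp
    have "omega (evF (mono (i # w))) * evF p = omega (evF (mono w)) * (uKinv i * (uE i * evF p))"
      by (simp add: ev_Cons mult.assoc)
    also have "vproj l \<dots> = vproj l (omega (evF (mono w)) * vproj l (uKinv i * vproj l (uE i * evF p)))"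
      by (subst vproj_mult, subst (2) vproj_mult) simp
    also have "\<dots> = vproj l (omega (evF (mono w)) * evF (psc c s))" by (simp only: s c ev_simps)
    finally obtain r where "r \<in> Tw (b - simple_root i - wt w)" "vproj l (omega (evF (mono (i # w))) * evF p) = evF r"
      using Cons.IH[OF T] by auto
    moreover have "b - simple_root i - wt w = b - wt (i # w)" by (simp add: wt_Cons algebra_simps)
    ultimately show ?case by metis
  qed
qed simp_all

lemma vproj_theta_Tw:
  fixes y :: "'i::cartan_datum tens"
  assumes "y \<in> Tw c" "p \<in> Tw b"
  shows "\<exists>r\<in>Tw (b - c). vproj l (theta (evF y) * evF p) = evF r"
proof (rule vproj_raise[OF _ _ _ assms])
  fix w :: "'i list" and p :: "'i tens" and b assume "p \<in> Tw b"
  then show "\<exists>r\<in>Tw (b - wt w). vproj l (theta (evF (mono w)) * evF p) = evF r"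
  proof (induction w arbitrary: p b)
    case Nil
    then show ?case by auto
  next
    case (Cons i w)
    obtain s where s: "s \<in> Tw (b - wt w)" "vproj l (theta (evF (mono w)) * evF p) = evF s" using Cons by blast
    obtain r where r: "r \<in> Tw (b - wt w - simple_root i)" "vproj l (uE i * evF s) = evF r"
      using vproj_gen_Tw[OF s(1)] by blast
    have "theta (evF (mono (i # w))) * evF p = - (uE i * (theta (evF (mono w)) * evF p))"
      by (simp add: ev_Cons mult.assoc)
    also have "vproj l \<dots> = - vproj l (uE i * vproj l (theta (evF (mono w)) * evF p))"
      by (simp only: vproj_simps) (subst vproj_mult, rule refl)
    also have "\<dots> = evF (- r)" by (simp only: s r ev_simps)
    finally have "vproj l (theta (evF (mono (i # w))) * evF p) = evF (- r)" .
    moreover have "b - wt w - simple_root i = b - wt (i # w)" by (simp add: wt_Cons algebra_simps)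
    ultimately show ?case using r by (metis Tw_closed(5))
  qed
qed simp_all

lemma height_diff: "height (\<alpha> - b) = height \<alpha> - height b" by (simp add: height_def minus_apply sum_subtractf)

lemma height_add: "height (\<alpha> + b) = height \<alpha> + height b" by (simp add: height_def plus_fun_apply sum.distrib)

lemma height_pos: "c \<in> Qplus ==> c \<noteq> 0 ==> height c > 0"
proof -
  assume c: "c \<in> Qplus" "c \<noteq> 0"
  then obtain i where "c i \<noteq> 0" by (auto simp: fun_eq_iff zero_fun_apply)
  then show ?thesis
    unfolding height_def using Qplus_nonneg[OF c(1)] by (intro sum_pos2[of _ i]) (auto simp: less_le)
qed

lemma finite_max_height:
  assumes "finite S" "S \<noteq> {}"
  shows "\<exists>b\<in>S. \<forall>d\<in>S. height d \<le> height b"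
proof -
  have "Max (height ` S) \<in> height ` S" using assms by (intro Max_in) auto
  then obtain b where "b \<in> S" "height b = Max (height ` S)" by auto
  then show ?thesis using Max_ge[of "height ` S"] assms(1) by (intro bexI[of _ b]) auto
qed

text \<open>Take a component of \<open>v\<close> outside the radical with maximal height, and
  \<open>x\<close> from an element pairing non-trivially with it. Any other component outside the
  radical is sent to a weight outside \<open>Qplus\<close>, so \<open>x * v\<close> is a non-zero
  multiple of 1 modulo \<open>rad l\<close>.\<close>

lemma irreducible:
  assumes "v \<notin> rad l"
  shows "\<exists>x. x * v - 1 \<in> rad l"
proof -
  obtain p where p: "vproj l v = evF p" using vproj_range by blast
  have vp: "v - evF p \<in> rad l" using rad_vproj[of v l] p by simp
  define S where "S = {b. evF (part b p) \<notin> rad l}"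
  have "S \<subseteq> {b. part b p \<noteq> 0}" unfolding S_def by (auto simp: rad_closed)
  then have S: "finite S" by (rule finite_subset) (rule finite_parts)
  have "S \<noteq> {}"
  proof
    assume "S = {}"
    then have "evF p \<in> rad l" by (subst evF_parts, intro rad_sum) (auto simp: S_def)
    then show False using vp rad_iff assms by blast
  qed
  then obtain b where b: "b \<in> S" "\<And>d. d \<in> S ==> height d \<le> height b" using finite_max_height[OF S] by blast
  then obtain y where "shap l (evF y) (evF (part b p)) \<noteq> 0" by (auto simp: S_def rad_shap)
  then have y: "shap l (evF (part b y)) (evF (part b p)) \<noteq> 0" by (subst (asm) shap_part')
  define x where "x = omega (evF (part b y))"
  have other: "x * evF (part d p) \<in> rad l" if "d \<noteq> b" for d
  proof (cases "d \<in> S")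
    case True
    obtain r where r: "r \<in> Tw (d - b)" "vproj l (x * evF (part d p)) = evF r"
      using vproj_omega_Tw[OF part_Tw part_Tw] unfolding x_def by blast
    have "d - b \<notin> Qplus" using height_pos[of "d - b"] b(2)[OF True] that by (auto simp: height_diff)
    then have "r = 0" using Tw_0[OF r(1)] by blast
    then show ?thesis using r(2) by (intro rad_vproj_0) simp
  qed (simp add: S_def rad_closed)
  obtain r where r: "r \<in> Tw (b - b)" "vproj l (x * evF (part b p)) = evF r"
    using vproj_omega_Tw[OF part_Tw part_Tw] unfolding x_def by blast
  have rc: "evF r = uscale (const r) 1" using Tw_zero_scalar[of r] r(1) by (metis ev_1 ev_simps(2) diff_self)
  have "const r = shap l (evF (part b y)) (evF (part b p))"
    using r(2) vcoeff_vproj[of l "x * evF (part b p)"] by (simp add: shap_def x_def)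
  then have c: "const r \<noteq> 0" using y by simp
  have "x * evF (part d p) - (if d = b then uscale (const r) 1 else 0) \<in> rad l" for d
    using other[of d] rad_vproj[of "x * evF (part b p)" l] by (auto simp: r rc)
  then have "(\<Sum>d\<in>{b. part b p \<noteq> 0}. x * evF (part d p) - (if d = b then uscale (const r) 1 else 0)) \<in> rad l"
    by (intro rad_sum)
  moreover have "part b p \<noteq> 0" using b(1) by (auto simp: S_def rad_closed)
  ultimately have "x * evF p - uscale (const r) 1 \<in> rad l"
    by (subst evF_parts) (simp add: sum_subtractf sum_distrib_left finite_parts)
  moreover have "x * (v - evF p) \<in> rad l" using vp by (rule rad_closed)
  ultimately have "x * (v - evF p) + (x * evF p - uscale (const r) 1) \<in> rad l" using rad_closed(2) by blast
  then have "x * v - uscale (const r) 1 \<in> rad l" by (simp add: right_diff_distrib)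
  then have "uscale (inverse (const r)) (x * v - uscale (const r) 1) \<in> rad l" by (rule rad_closed)
  then have "uscale (inverse (const r)) x * v - 1 \<in> rad l"
    using c by (simp add: U.scale_right_diff_distrib uscale_mult_left)
  then show ?thesis by blast
qed

section \<open>Weights of irreducible modules with dominant integral highest weight\<close>

definition weights :: "('i::cartan_datum => rat) => ('i => rat) set"
  where "weights l = {b. \<exists>p\<in>Tw b. evF p \<notin> rad l}"

lemma weights_Qplus: "b \<in> weights l ==> b \<in> Qplus"
  unfolding weights_def by (rule ccontr) (auto dest: Tw_0 simp: rad_closed(1))

lemma zero_weights: "0 \<in> weights l"
  unfolding weights_def using one_not_rad[of l] one_Tw by (auto intro!: bexI[of _ 1])

lemma dominant_integral_iff: "dominant_integral u \<longleftrightarrow> (\<exists>n. \<forall>k. rpair k u = of_nat (n k) * symm k)"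
proof -
  have "rpair k u = symm k * pairing u (simple_coroot cartan k)" for k
    by (simp add: rpair_def pairing_def simple_coroot_def sum_distrib_left algebra_simps)
  then have *: "rpair k u = of_nat m * symm k \<longleftrightarrow> pairing u (simple_coroot cartan k) = of_nat m" for k m by simp
  show ?thesis unfolding dominant_integral_def * Nats_def by (auto simp: image_iff intro: choice)
qed

lemma rpair_integral:
  assumes "b \<in> Qplus"
  shows "\<exists>m. rpair i b = of_int m * symm i"
proof -
  have "\<exists>n. b k = of_nat n" for k using assms by (auto simp: Qplus_def Nats_def)
  then obtain n where n: "\<And>k. b k = of_nat (n k)" by metis
  have "rpair i b = of_int (\<Sum>k\<in>UNIV. cartan i k * int (n k)) * symm i"
    by (simp add: rpair_def n sum_distrib_left sum_distrib_right algebra_simps)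
  then show ?thesis by blast
qed

context
  fixes \<mu> :: "'i::cartan_datum => rat" and n :: "'i => nat"
  assumes \<mu>: "\<And>k. rpair k \<mu> = of_nat (n k) * symm k"
begin

lemma intN_rad: "intN \<mu> n \<subseteq> rad \<mu>"
proof
  fix u assume u: "u \<in> intN \<mu> n"
  have c: "const p = 0" if "p \<in> intT n" for p using that unfolding intT_def
  proof (induction p rule: P.span_induct_alt)
    case (step c x y)
    then obtain v k where x: "x = mono (v @ replicate (Suc (n k)) k)"
      by (auto simp: mono_append simp del: replicate.simps)
    have "const x = 0" unfolding x by (simp add: const_mono)
    then show ?case using step by simp
  qed simp
  have "vcoeff \<mu> (x * u) = 0" for x
  proof -
    have "x * u \<in> intN \<mu> n" by (rule left_idealD(3)[OF intN_left_ideal[OF \<mu>] u])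
    then obtain p where p: "p \<in> intT n" "vproj \<mu> (x * u) = evF p" by (auto simp: intN_def)
    then show ?thesis using c[OF p(1)] by (metis vcoeff_evF vcoeff_vproj)
  qed
  then show "u \<in> rad \<mu>" by (simp add: rad_def)
qed

lemma rad_F_nilpotent: "\<exists>M. uF i ^ M * evF p \<in> rad \<mu>"
  using F_nilpotent[OF rad_left_ideal, of i "Suc (n i)" 1 \<mu> p] intN_F[of \<mu> n i, OF \<mu>] intN_rad by auto

lemma rad_E_nilpotent:
  assumes "p \<in> Tw b"
  shows "\<exists>M. uE i ^ M * evF p \<in> rad \<mu>"
proof -
  obtain M where M: "b i < of_nat M" using reals_Archimedean2 by blast
  obtain r where r: "r \<in> Tw (b - wt (replicate M i))" "vproj \<mu> (uE i ^ M * evF p) = evF r"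
    using vproj_power_E[OF assms] by blast
  have "r = 0"
    using M by (intro Tw_neg[OF r(1), where i = i]) (simp add: minus_apply wt_def count_list_replicate_eq)
  then show ?thesis using r(2) rad_vproj_0[of \<mu> "uE i ^ M * evF p"] by auto
qed

lemma rad_weight:
  assumes "p \<in> Tw c" "rpair i (\<mu> - c) = x * symm i"
  shows "weightN (rad \<mu>) i x (evF p)"
  using intN_weight[OF \<mu> assms] intN_rad unfolding weightN_def[OF rad_left_ideal] weightN_def[OF intN_left_ideal[OF \<mu>]] by blast

text \<open>The power of \<open>uF i\<close> or \<open>uE i\<close>, according to the sign of
  \<open>m\<close>, that joins a weight to its reflection does not kill vectors on which the
  opposite operator is nilpotent. Since \<open>b\<close> measures the depth below
  \<open>\<mu>\<close>, the reflection adds \<open>m\<close> simple roots.\<close>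

lemma weights_reflect:
  assumes "b \<in> weights \<mu>" "rpair i (\<mu> - b) = of_int m * symm i"
  shows "b + (\<lambda>k. of_int m * simple_root i k) \<in> weights \<mu>"
proof -
  obtain p where p: "p \<in> Tw b" "evF p \<notin> rad \<mu>" using assms(1) by (auto simp: weights_def)
  obtain M where M: "uF i ^ M * evF p \<in> rad \<mu>" using rad_F_nilpotent by blast
  obtain M' where M': "uE i ^ M' * evF p \<in> rad \<mu>" using rad_E_nilpotent[OF p(1)] by blast
  have w: "wt (replicate k i) = (\<lambda>j. of_nat k * simple_root i j)" for k
    by (simp add: wt_def count_list_replicate_eq simple_root_def fun_eq_iff)
  show ?thesis
  proof (cases "m \<ge> 0")
    case True
    then obtain k where k: "m = int k" using nonneg_int_cases by blast
    have "weightN (rad \<mu>) i (of_nat k) (evF p)" using assms(2) by (intro rad_weight[OF p(1)]) (simp add: k)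
    then have "uF i ^ k * evF p \<notin> rad \<mu>" using sl2_F_inj[OF rad_left_ideal _ _ M'] p(2) by blast
    then have "evF (mono (replicate k i) * p) \<notin> rad \<mu>" by (simp add: ev_mult evF_replicate)
    moreover have "mono (replicate k i) * p \<in> Tw (wt (replicate k i) + b)" by (intro Tw_mult mono_Tw p)
    ultimately have "wt (replicate k i) + b \<in> weights \<mu>" by (auto simp: weights_def)
    then show ?thesis by (simp add: w k add.commute)
  next
    case False
    then obtain k where k: "m = - int k" by (metis minus_minus nle_le nonneg_int_cases neg_0_le_iff_le)
    have "weightN (rad \<mu>) i (- of_nat k) (evF p)" using assms(2) by (intro rad_weight[OF p(1)]) (simp add: k)
    then have e: "uE i ^ k * evF p \<notin> rad \<mu>" using sl2_E_inj[OF rad_left_ideal _ _ M] p(2) by blast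
    obtain r where r: "r \<in> Tw (b - wt (replicate k i))" "vproj \<mu> (uE i ^ k * evF p) = evF r"
      using vproj_power_E[OF p(1)] by blast
    have "evF r \<notin> rad \<mu>" using e rad_vproj[of "uE i ^ k * evF p" \<mu>] rad_iff r(2) by metis
    then have "b - wt (replicate k i) \<in> weights \<mu>" using r(1) by (auto simp: weights_def)
    moreover have "b - wt (replicate k i) = b + (\<lambda>j. of_int m * simple_root i j)"
      by (rule ext) (simp add: w k minus_apply plus_fun_apply)
    ultimately show ?thesis by metis
  qed
qed

lemma weights_integral:
  assumes "b \<in> weights \<mu>"
  obtains m where "rpair i (\<mu> - b) = of_int m * symm i"
proof -
  obtain m where "rpair i b = of_int m * symm i" using rpair_integral[OF weights_Qplus[OF assms]] by blast
  then have "rpair i (\<mu> - b) = of_int (int (n i) - m) * symm i" by (simp add: rpair_diff \<mu> left_diff_distrib)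
  then show ?thesis by (rule that)
qed

text \<open>If some \<open>rpair i (\<mu> - b)\<close> is negative, the reflection preserves the
  norm and decreases the height of \<open>b\<close>. Otherwise
  \<open>ip b \<mu> + ip b (\<mu> - b)\<close> is non-negative, which rearranges to the
  claim.\<close>

lemma weights_norm: "b \<in> weights \<mu> ==> ip (b - \<mu>) (b - \<mu>) \<le> ip \<mu> \<mu>"
proof -
  have "ip (b - \<mu>) (b - \<mu>) \<le> ip \<mu> \<mu>" if "b \<in> weights \<mu>" "height b = of_nat h" for h b using that
  proof (induction h arbitrary: b rule: less_induct)
    case (less h)
    show ?case
    proof (cases "\<exists>i. rpair i (\<mu> - b) < 0")
      case True
      then obtain i where i: "rpair i (\<mu> - b) < 0" by blast
      obtain m where m: "rpair i (\<mu> - b) = of_int m * symm i" using weights_integral[OF less.prems(1)] by blast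
      let ?v = "\<lambda>k. of_int m * simple_root i k"
      have m0: "m < 0" using i symm_pos[of i] unfolding m by (simp add: mult_less_0_iff)
      have w: "b + ?v \<in> weights \<mu>" by (rule weights_reflect[OF less.prems(1) m])
      obtain k where k: "height (b + ?v) = of_nat k"
        using height_nat[OF weights_Qplus[OF w]] by (auto simp: Nats_def)
      have "height (b + ?v) = height b + of_int m"
        by (simp add: height_def plus_fun_apply sum.distrib simple_root_def)
      then have "(of_int (int k) :: rat) = of_int (int h + m)" using k less.prems(2) by simp
      then have "k < h" using m0 unfolding of_int_eq_iff by simp
      from less.IH[OF this w k] have "ip (b + ?v - \<mu>) (b + ?v - \<mu>) \<le> ip \<mu> \<mu>" .
      moreover have "ip (b + ?v - \<mu>) (b + ?v - \<mu>) = ip (b - \<mu>) (b - \<mu>)"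
      proof -
        have 1: "b + ?v - \<mu> = ?v - (\<mu> - b)" by simp
        have 2: "ip ?v ?v = 2 * of_int m * of_int m * symm i"
          using ip_simple[of i ?v] by (simp add: ip_scale_left rpair_scale rpair_self)
        have 3: "ip ?v (\<mu> - b) = of_int m * of_int m * symm i" by (simp add: ip_scale_left ip_simple m)
        have 4: "ip (x - y) (x - y) = ip x x - 2 * ip x y + ip y y" for x y :: "'i => rat"
          by (simp add: ip_diff_left ip_diff_right ip_commute[of y x])
        show ?thesis unfolding 1 4 2 3 by (simp add: ip_diff_left ip_diff_right) (rule ip_commute)
      qed
      ultimately show ?thesis by simp
    next
      case False
      have "0 \<le> (\<Sum>i\<in>UNIV. b i * (rpair i \<mu> + rpair i (\<mu> - b)))"
        using False Qplus_nonneg[OF weights_Qplus[OF less.prems(1)]] symm_pos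
        by (intro sum_nonneg mult_nonneg_nonneg add_nonneg_nonneg) (auto simp: \<mu> not_less intro!: mult_nonneg_nonneg less_imp_le[OF symm_pos])
      also have "\<dots> = ip b \<mu> + ip b (\<mu> - b)" by (simp add: ip_alt distrib_left sum.distrib)
      finally show ?thesis by (simp add: ip_diff_left ip_diff_right ip_commute[of \<mu> b])
    qed
  qed
  moreover assume "b \<in> weights \<mu>"
  ultimately show ?thesis using height_nat[OF weights_Qplus[of b \<mu>]] by (auto simp: Nats_def)
qed

lemma finite_weights: "finite (weights \<mu>)"
  by (rule finite_subset[OF _ finite_Qplus_ball[of \<mu> "ip \<mu> \<mu>"]]) (auto simp: weights_Qplus weights_norm)

text \<open>A weight of maximal depth cannot be lowered further, and its maximality against all
  reflections says that \<open>b - \<mu>\<close> is dominant.\<close>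

lemma lowest_weight_vector:
  obtains b p where "p \<in> Tw b" "evF p \<notin> rad \<mu>" "\<And>i. uF i * evF p \<in> rad \<mu>"
    "dominant_integral (b - \<mu>)"
proof -
  obtain b where b: "b \<in> weights \<mu>" "\<And>d. d \<in> weights \<mu> ==> height d \<le> height b"
    using finite_max_height[OF finite_weights] zero_weights[of \<mu>] by blast
  then obtain p where p: "p \<in> Tw b" "evF p \<notin> rad \<mu>" by (auto simp: weights_def)
  have "uF i * evF p \<in> rad \<mu>" for i
  proof (rule ccontr)
    assume "uF i * evF p \<notin> rad \<mu>"
    then have "simple_root i + b \<in> weights \<mu>"
      using vop_F_Tw[OF p(1), of i] by (auto simp: weights_def ev_mult intro!: bexI[of _ "mono [i] * p"])
    from b(2)[OF this] show False by (simp add: height_add) (simp add: height_def simple_root_def)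
  qed
  moreover have "\<exists>m. rpair k (b - \<mu>) = of_nat m * symm k" for k
  proof -
    obtain m where m: "rpair k (\<mu> - b) = of_int m * symm k" using weights_integral[OF b(1)] by blast
    have "height (\<lambda>j. of_int m * simple_root k j) \<le> 0"
      using b(2)[OF weights_reflect[OF b(1) m]] by (simp add: height_add)
    then have "m \<le> 0" by (simp add: height_def simple_root_def)
    have "rpair k (b - \<mu>) = - rpair k (\<mu> - b)" by (simp add: rpair_diff)
    also have "\<dots> = of_nat (nat (- m)) * symm k" using \<open>m \<le> 0\<close> by (simp add: m of_nat_nat)
    finally show ?thesis by blast
  qed
  then have "dominant_integral (b - \<mu>)" unfolding dominant_integral_iff by metis
  ultimately show ?thesis using that p by blast
qed

end

section \<open>Twisting irreducible modules by theta\<close>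

lemma rad_finite_theta: "finite {c. \<exists>p\<in>Tw c. theta (evF p) * u \<notin> rad l}"
proof -
  obtain r where r: "vproj l u = evF r" using vproj_range by blast
  let ?S = "{b. part b r \<noteq> 0}"
  have "{c. \<exists>p\<in>Tw c. theta (evF p) * u \<notin> rad l} \<subseteq> (\<Union>b\<in>?S. {c\<in>Qplus. \<forall>i. c i \<le> b i})"
  proof
    fix c assume "c \<in> {c. \<exists>p\<in>Tw c. theta (evF p) * u \<notin> rad l}"
    then obtain p where p: "p \<in> Tw c" "theta (evF p) * u \<notin> rad l" by blast
    have "theta (evF p) * (u - evF r) \<in> rad l" using rad_vproj[of u l] r by (intro rad_closed(3)) simp
    then have "theta (evF p) * evF r \<notin> rad l" using p(2) rad_iff by (metis right_diff_distrib)
    then have "\<exists>b\<in>?S. theta (evF p) * evF (part b r) \<notin> rad l"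
      using rad_sum[of ?S "\<lambda>b. theta (evF p) * evF (part b r)" l] by (auto simp: evF_parts[of r] sum_distrib_left)
    then obtain b where b: "b \<in> ?S" "theta (evF p) * evF (part b r) \<notin> rad l" by blast
    obtain s where s: "s \<in> Tw (b - c)" "vproj l (theta (evF p) * evF (part b r)) = evF s"
      using vproj_theta_Tw[OF p(1) part_Tw] by blast
    have "b - c \<in> Qplus" using Tw_0[OF s(1)] s(2) b(2) rad_vproj_0 by (metis ev_simps(3))
    moreover have "c \<in> Qplus"
      using Tw_0[OF p(1)] p(2) rad_closed(1) by (metis ev_simps(3) mult_zero_left theta_simps(3))
    ultimately show "c \<in> (\<Union>b\<in>?S. {c\<in>Qplus. \<forall>i. c i \<le> b i})"
      using b(1) Qplus_nonneg[of "b - c"] by (auto simp: minus_apply)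
  qed
  then show ?thesis by (rule finite_subset) (intro finite_UN_I finite_parts finite_Qplus_bounded)
qed

text \<open>Under the twist by \<open>theta\<close> the lowest weight vector of \<open>L(m)\<close>
  becomes a highest weight vector of weight \<open>b - m\<close>, so the twisted module is
  \<open>L(b - m)\<close>. If the claim failed, irreducibility would give \<open>w\<close> in
  \<open>rad (b - m)\<close> with \<open>theta w\<close> fixing the vector. Then \<open>w\<close>
  has constant term zero, and the components of weight \<open>b\<close> contradict each
  other.\<close>

lemma rad_theta_twist:
  assumes "p \<in> Tw b" "evF p \<notin> rad m" "\<And>i. uF i * evF p \<in> rad m" "z \<in> rad (b - m)"
  shows "theta z * evF p \<in> rad m"
proof -
  define J where "J = {z. theta z * evF p \<in> rad m}"
  have sub: "U.subspace J"
    unfolding J_def by (rule U.subspaceI) (simp_all add: distrib_right uscale_mult_left rad_closed)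
  have li: "u * z \<in> J" if "z \<in> J" for u z using that by (simp add: J_def mult.assoc rad_closed)
  have E: "uE i \<in> J" for i using rad_closed(6)[OF assms(3)[of i]] by (simp add: J_def)
  have T: "uT i - uscale (qpow (symm i * (b - m) i)) 1 \<in> J" for i
  proof -
    have "vproj m (uTinv i * evF p) = evF (vop m (GenTinv i) p)" using vproj_gen_mult[of m "GenTinv i" p] by simp
    also have "\<dots> = uscale (qpow (symm i * (b - m) i)) (evF p)"
      unfolding vop_Tinv[OF assms(1)] by (simp add: minus_apply right_diff_distrib)
    finally have "uTinv i * evF p - uscale (qpow (symm i * (b - m) i)) (evF p) \<in> rad m"
      using rad_vproj[of "uTinv i * evF p" m] by simp
    then show ?thesis by (simp add: J_def left_diff_distrib uscale_mult_left)
  qed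
  show ?thesis
  proof (rule ccontr)
    assume "theta z * evF p \<notin> rad m"
    then obtain x where x: "x * (theta z * evF p) - 1 \<in> rad m" using irreducible by blast
    have "evF p * (x * (theta z * evF p) - 1) \<in> rad m" by (rule rad_closed) (rule x)
    then have xp: "evF p * x * theta z * evF p - evF p \<in> rad m" by (simp add: right_diff_distrib mult.assoc)
    define w where "w = theta (evF p * x) * z"
    have "w \<in> rad (b - m)" unfolding w_def by (rule rad_closed) (rule assms(4))
    obtain r where r: "vproj (b - m) w = evF r" using vproj_range by blast
    have "const r = 0" using rad_vcoeff[OF \<open>w \<in> rad (b - m)\<close>] r by (metis vcoeff_evF vcoeff_vproj)
    have "w - evF r \<in> J" unfolding r[symmetric] by (rule vproj_decomp[OF sub li E T])
    then have wr: "theta w * evF p - theta (evF r) * evF p \<in> rad m" by (simp add: J_def left_diff_distrib)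
    have tw: "theta w * evF p = evF p * x * theta z * evF p" by (simp add: w_def mult.assoc)
    have d: "theta (evF r) * evF p - evF p \<in> rad m" using rad_closed(5)[OF xp[folded tw] wr] by simp
    define S where "S = {c. part c r \<noteq> 0}"
    have "\<exists>s\<in>Tw (b - c). vproj m (theta (evF (part c r)) * evF p) = evF s" for c
      by (rule vproj_theta_Tw[OF part_Tw assms(1)])
    then obtain s where s: "\<And>c. s c \<in> Tw (b - c)" "\<And>c. vproj m (theta (evF (part c r)) * evF p) = evF (s c)"
      by metis
    have "vproj m (theta (evF r) * evF p - evF p) = (\<Sum>c\<in>S. evF (s c)) - evF p"
      by (simp add: evF_parts[of r] lin_sum[OF lin_theta] sum_distrib_right lin_sum[OF lin_vproj] s S_def)
    also have "\<dots> = evF ((\<Sum>c\<in>S. s c) - p)" by (simp add: ev_sum)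
    finally have "evF ((\<Sum>c\<in>S. s c) - p) \<in> rad m"
      using d rad_vproj[of "theta (evF r) * evF p - evF p" m] rad_iff by metis
    then have "evF (part b ((\<Sum>c\<in>S. s c) - p)) \<in> rad m" by (rule rad_part)
    moreover have "part b (s c) = 0" if "c \<in> S" for c
    proof -
      have "c \<noteq> 0" using that \<open>const r = 0\<close> by (auto simp: S_def part_0)
      then show ?thesis using part_of_Tw[OF s(1)[of c], of b] by (simp add: eq_diff_eq)
    qed
    then have "part b (\<Sum>c\<in>S. s c) = 0" by (simp add: lin_sum[OF lin_part])
    ultimately have "evF (- p) \<in> rad m" using part_of_Tw[OF assms(1), of b] by simp
    then show False using assms(2) rad_closed(6)[of "- evF p" m] by simp
  qed
qed

text \<open>Matrix elements twisted by \<open>theta\<close> are matrix elements of the twisted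
  module: the functional is based at the lowest weight vector, from which \<open>a\<close> recovers
  the class of 1.\<close>

lemma functional_twist:
  assumes "dominant_integral m" "lin uscale (*) \<phi>" "\<And>z. z \<in> rad m ==> \<phi> z = 0"
  shows "\<exists>m' \<psi> u'. dominant_integral m' \<and> lin uscale (*) \<psi> \<and> (\<forall>z\<in>rad m'. \<psi> z = 0) \<and>
    (\<forall>x. \<phi> (theta x * u) = \<psi> (x * u'))"
proof -
  obtain n where n: "\<And>k. rpair k m = of_nat (n k) * symm k" using assms(1) unfolding dominant_integral_iff by blast
  obtain b p where p: "p \<in> Tw b" "evF p \<notin> rad m" "\<And>i. uF i * evF p \<in> rad m"
    "dominant_integral (b - m)" using lowest_weight_vector[OF n] by metis
  obtain a where a: "a * evF p - 1 \<in> rad m" using irreducible[OF p(2)] by blast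
  define \<psi> where "\<psi> z = \<phi> (theta z * evF p)" for z
  have "lin uscale (*) \<psi>" unfolding \<psi>_def by (rule linK)
       (simp_all add: distrib_right lin_add[OF assms(2)] uscale_mult_left lin_scale[OF assms(2)])
  moreover have "\<psi> z = 0" if "z \<in> rad (b - m)" for z
    unfolding \<psi>_def by (rule assms(3)) (rule rad_theta_twist[OF p(1-3) that])
  moreover have "\<phi> (theta x * u) = \<psi> (x * theta (u * a))" for x
  proof -
    have "theta x * u * (a * evF p - 1) \<in> rad m" by (rule rad_closed) (rule a)
    then have "\<phi> (theta x * u * (a * evF p - 1)) = 0" by (rule assms(3))
    then show ?thesis by (simp add: \<psi>_def right_diff_distrib lin_diff[OF assms(2)] mult.assoc)
  qed
  ultimately show ?thesis using p(4) by blast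
qed

section \<open>Verma and irreducible modules as quotients of the algebra\<close>

definition presents :: "('i::cartan_datum uq, 'v) umodule => ('i uq => 'v) => bool"
  where "presents V c \<longleftrightarrow> mcarrier V = range c \<and> mzero V = c 0 \<and>
    (\<forall>u v. madd V (c u) (c v) = c (u + v)) \<and> (\<forall>a u. mscale V a (c u) = c (uscale a u)) \<and>
    (\<forall>a u. mact V a (c u) = c (a * u))"

lemma presentsD:
  assumes "presents V c"
  shows "mcarrier V = range c" "mzero V = c 0" "madd V (c u) (c v) = c (u + v)"
    "mscale V d (c u) = c (uscale d u)" "mact V a (c u) = c (a * u)" using assms by (simp_all add: presents_def)

text \<open>Presentations pass to quotients. The carriers consist of cosets, and for irreducible
  modules of cosets of cosets; through \<open>c\<close> all computations with them are carried out
  in the algebra.\<close>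

lemma presents_quotient:
  assumes V: "presents V c" and J: "left_ideal J" and N: "N = c ` J"
  shows "presents (quotient_module V N) (\<lambda>u. mcoset V N (c u))"
    and "(\<And>u. c u \<in> N ==> u \<in> J) ==> mcoset V N (c u) = mcoset V N (c v) \<longleftrightarrow> u - v \<in> J"
proof -
  note J = left_idealD[OF J] and V = presentsD[OF V]
  have coset: "mcoset V N (c u) = (\<lambda>j. c (u + j)) ` J" for u
    unfolding mcoset_def N by (simp add: Setcompr_eq_image image_image V)
  have coset_eq: "mcoset V N (c u) = mcoset V N (c v)" if "u - v \<in> J" for u v
  proof -
    have "c (u + j) \<in> mcoset V N (c v)" "c (v + j) \<in> mcoset V N (c u)" if "j \<in> J" for j
    proof -
      have "u + j = v + (u - v + j)" "v + j = u + (j - (u - v))" by (simp_all add: algebra_simps)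
      then show "c (u + j) \<in> mcoset V N (c v)" "c (v + j) \<in> mcoset V N (c u)"
        unfolding coset using J(2)[OF \<open>u - v \<in> J\<close> that] J(5)[OF that \<open>u - v \<in> J\<close>] by (metis imageI)+
    qed
    then show ?thesis unfolding coset by auto
  qed
  show "mcoset V N (c u) = mcoset V N (c v) \<longleftrightarrow> u - v \<in> J" if *: "\<And>u. c u \<in> N ==> u \<in> J"
  proof
    assume "mcoset V N (c u) = mcoset V N (c v)"
    moreover have "c (u + 0) \<in> mcoset V N (c u)" unfolding coset using J(1) by blast
    ultimately obtain j where j: "c u = c (v + j)" "j \<in> J" unfolding coset by auto
    have "c (u - (v + j)) = madd V (c u) (c (- (v + j)))" by (simp only: V diff_conv_add_uminus)
    also have "\<dots> = c 0" unfolding j(1) by (simp only: V add.right_inverse)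
    finally have "u - (v + j) \<in> J" using J(1) by (intro *) (simp add: N)
    from J(2)[OF this j(2)] show "u - v \<in> J" by (simp add: algebra_simps)
  qed (rule coset_eq)
  have add: "{madd V x y | x y. x \<in> mcoset V N (c u) \<and> y \<in> mcoset V N (c v)} = mcoset V N (c (u + v))" for u v
  proof (rule equalityI; rule subsetI)
    fix z assume "z \<in> {madd V x y | x y. x \<in> mcoset V N (c u) \<and> y \<in> mcoset V N (c v)}"
    then obtain j j' where j: "z = c (u + j + (v + j'))" "j \<in> J" "j' \<in> J" unfolding coset by (auto simp: V)
    have "u + j + (v + j') = u + v + (j + j')" by (simp add: algebra_simps)
    then have "z = c (u + v + (j + j'))" by (simp only: j)
    then show "z \<in> mcoset V N (c (u + v))" unfolding coset using J(2)[OF j(2,3)] by (rule image_eqI)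
  next
    fix z assume "z \<in> mcoset V N (c (u + v))"
    then obtain j where j: "z = c (u + v + j)" "j \<in> J" unfolding coset by auto
    have "u + v + j = (u + j) + (v + 0)" by (simp add: algebra_simps)
    then have "z = madd V (c (u + j)) (c (v + 0))" by (simp only: V j)
    moreover have "c (u + j) \<in> mcoset V N (c u)" "c (v + 0) \<in> mcoset V N (c v)"
      unfolding coset using j(2) J(1) by blast+
    ultimately show "z \<in> {madd V x y | x y. x \<in> mcoset V N (c u) \<and> y \<in> mcoset V N (c v)}" by blast
  qed
  have op: "(\<Union>x\<in>mcoset V N (c u). mcoset V N (g x)) = mcoset V N (c (h u))"
    if g: "\<And>u. g (c u) = c (h u)" and h: "\<And>j. j \<in> J ==> h (u + j) - h u \<in> J" for g h u
  proof -
    have "mcoset V N (g x) = mcoset V N (c (h u))" if "x \<in> mcoset V N (c u)" for x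
    proof -
      obtain j where "x = c (u + j)" "j \<in> J" using \<open>x \<in> mcoset V N (c u)\<close> unfolding coset by blast
      then show ?thesis by (simp only: g) (intro coset_eq h)
    qed
    moreover have "c (u + 0) \<in> mcoset V N (c u)" unfolding coset using J(1) by blast
    ultimately show ?thesis by blast
  qed
  show "presents (quotient_module V N) (\<lambda>u. mcoset V N (c u))"
    unfolding presents_def quotient_module_def umodule.simps
  proof (intro conjI allI)
    show "mcoset V N ` mcarrier V = range (\<lambda>u. mcoset V N (c u))" by (auto simp: V)
    show "N = mcoset V N (c 0)" unfolding coset by (auto simp: N)
    show "{madd V x y |x y. x \<in> mcoset V N (c u) \<and> y \<in> mcoset V N (c v)} = mcoset V N (c (u + v))" for u v
      by (rule add)
    show "(\<Union>x\<in>mcoset V N (c u). mcoset V N (mscale V a x)) = mcoset V N (c (uscale a u))" for a u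
      by (rule op) (simp_all add: V U.scale_right_distrib J(4))
    show "(\<Union>x\<in>mcoset V N (c u). mcoset V N (mact V a x)) = mcoset V N (c (a * u))" for a u
      by (rule op) (simp_all add: V distrib_left J(3))
  qed
qed

lemma presents_regular: "presents regular_module (\<lambda>u. u)" by (simp add: presents_def regular_module_def)

lemma verma_ideal_eq: "verma_ideal l = {u. vproj l u = 0}"
proof
  let ?V = "verma_ideal l"
  have sub: "U.subspace ?V" unfolding verma_ideal_def by (rule U.subspace_span)
  have gen: "u * uE i \<in> ?V" "u * (uT i - uscale (qpow (symm i * l i)) 1) \<in> ?V" for u i
    unfolding verma_ideal_def by (rule U.span_base, force)+
  have li: "u * v \<in> ?V" if "v \<in> ?V" for u v using that unfolding verma_ideal_def[of l]
  proof (induction v rule: U.span_induct_alt)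
    case base
    show ?case by (simp add: U.span_zero)
  next
    case (step c x y)
    then have "u * x \<in> ?V" using gen by (auto simp flip: mult.assoc)
    then show ?case using step.IH unfolding verma_ideal_def
      by (simp add: distrib_left uscale_mult_right U.span_add U.span_scale)
  qed
  show "{u. vproj l u = 0} \<subseteq> ?V"
  proof
    fix u assume "u \<in> {u. vproj l u = 0}"
    moreover have "u - vproj l u \<in> ?V" using gen[of 1] by (intro vproj_decomp[OF sub li]) simp_all
    ultimately show "u \<in> ?V" by simp
  qed
  show "?V \<subseteq> {u. vproj l u = 0}" unfolding verma_ideal_def
  proof (rule U.span_minimal)
    show "U.subspace {u. vproj l u = 0}" by (rule U.subspaceI) simp_all
  qed (auto simp: right_diff_distrib uscale_mult_right)
qed

lemma verma_ideal_left_ideal: "left_ideal (verma_ideal l)" unfolding left_ideal_def verma_ideal_eq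
proof
  show "U.subspace {u. vproj l u = 0}" by (rule U.subspaceI) simp_all
  have "vproj l (u * v) = 0" if "vproj l v = 0" for u v by (subst vproj_mult) (simp add: that)
  then show "\<forall>u. \<forall>v\<in>{u. vproj l u = 0}. u * v \<in> {u. vproj l u = 0}" by blast
qed

definition vcl :: "('i::cartan_datum => rat) => 'i uq => 'i uq set"
  where "vcl l u = mcoset regular_module (verma_ideal l) u"

lemma presents_verma: "presents (verma l) (vcl l)"
  and vcl_eq: "vcl l u = vcl l v \<longleftrightarrow> u - v \<in> verma_ideal l"
  using presents_quotient[OF presents_regular verma_ideal_left_ideal, of "verma_ideal l" l]
  by (simp_all add: verma_def vcl_def[abs_def])

definition cl :: "('i::cartan_datum => rat) => 'i uq => 'i uq set set"
  where "cl l u = mcoset (verma l) (verma_kernel l) (vcl l u)"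

lemma verma_ideal_rad: "verma_ideal l \<subseteq> rad l" using rad_vproj_0 by (auto simp: verma_ideal_eq)

text \<open>The kernel is given by elements of the negative part only; \<open>vproj\<close> moves
  any element of the radical there without changing its class.\<close>

lemma verma_kernel_eq: "verma_kernel l = vcl l ` rad l"
proof -
  have "verma_kernel l = vcl l ` Kminus l" unfolding verma_kernel_def verma_vec_def vcl_def[symmetric]
    using presentsD(5)[OF presents_verma, of l _ 1] by simp
  moreover have "\<exists>v\<in>Kminus l. vcl l u = vcl l v" if "u \<in> rad l" for u
  proof
    show "vproj l u \<in> Kminus l" unfolding Kminus_rad using rad_vproj[of u l] that rad_iff by auto
    show "vcl l u = vcl l (vproj l u)" by (simp add: vcl_eq verma_ideal_eq)
  qed
  then have "vcl l ` rad l \<subseteq> vcl l ` Kminus l" by (intro image_subsetI) (metis imageI)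
  moreover have "vcl l ` Kminus l \<subseteq> vcl l ` rad l" by (intro image_mono) (simp add: Kminus_rad)
  ultimately show ?thesis by (metis subset_antisym)
qed

lemma presents_irr: "presents (irr l) (cl l)"
  and cl_eq: "cl l u = cl l v \<longleftrightarrow> u - v \<in> rad l"
proof -
  have "u \<in> rad l" if "vcl l u \<in> verma_kernel l" for u
  proof -
    obtain v where "vcl l u = vcl l v" "v \<in> rad l" using \<open>vcl l u \<in> verma_kernel l\<close> by (auto simp: verma_kernel_eq)
    then show ?thesis using verma_ideal_rad rad_iff unfolding vcl_eq by blast
  qed
  from presents_quotient(2)[OF presents_verma rad_left_ideal verma_kernel_eq this]
  show "cl l u = cl l v \<longleftrightarrow> u - v \<in> rad l" by (simp add: cl_def)
  show "presents (irr l) (cl l)" using presents_quotient(1)[OF presents_verma rad_left_ideal verma_kernel_eq]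
    by (simp add: irr_def cl_def[abs_def])
qed

lemma irr_vec_cl: "irr_vec l = cl l 1" by (simp add: irr_vec_def cl_def verma_vec_def vcl_def)

lemma irr_act_vec: "mact (irr l) y (irr_vec l) = cl l y" by (simp add: irr_vec_cl presentsD(5)[OF presents_irr])

lemma shapovalov_bar_cl:
  assumes "x \<in> Uminus" "y \<in> Uminus"
  shows "shapovalov_bar l (cl l x) (cl l y) = shap l x y" unfolding shapovalov_bar_def irr_act_vec shapovalov_eq
proof (rule the_equality)
  show "\<exists>x'\<in>Uminus. \<exists>y'\<in>Uminus. cl l x = cl l x' \<and> cl l y = cl l y' \<and> shap l x y = shap l x' y'"
    using assms by blast
next
  have 0: "shap l a b = 0" if "b \<in> rad l" for a b using that by (simp add: rad_def shap_def)
  fix c assume "\<exists>x'\<in>Uminus. \<exists>y'\<in>Uminus. cl l x = cl l x' \<and> cl l y = cl l y' \<and> c = shap l x' y'"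
  then obtain x' y' where c: "x - x' \<in> rad l" "y - y' \<in> rad l" "c = shap l x' y'" by (auto simp: cl_eq)
  have "shap l y (x - x') = 0" "shap l x' (y - y') = 0" using c by (simp_all only: 0)
  then show "c = shap l x y" by (simp add: c shap_commute[of l y])
qed

lemma lincomb_presents:
  assumes "presents V c" "length cs = length ys"
  shows "lincomb V cs (map c ys) = c (\<Sum>i<length ys. uscale (cs ! i) (ys ! i))" using assms(2)
proof (induction cs ys rule: list_induct2)
  case Nil
  show ?case by (simp add: lincomb_def presentsD[OF assms(1)])
next
  case (Cons x xs y ys)
  then show ?case by (simp add: lincomb_def presentsD[OF assms(1)] sum.lessThan_Suc_shift del: sum.lessThan_Suc)
qed

lemma uT_evF: "p \<in> Tw b ==> uT i * evF p = uscale (qpow (- (symm i * b i))) (evF p * uT i)" using qcomm_T_F[of i]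
  by (intro qcomm_evF[where h = "\<lambda>b. - (symm i * b i)"]) (simp_all add: simple_root_def plus_fun_apply distrib_left)

lemma torus_tmon:
  assumes "t \<in> torus"
  obtains n where "t = tmon n"
proof -
  have "t \<in> range tmon" using assms
  proof induction
    case 1
    show ?case by (rule range_eqI[of _ _ "\<lambda>_. 0"]) (simp add: tmon_0)
  next
    case (2 x i)
    then obtain n where "x = tmon n" by blast
    then show ?case
      by (intro range_eqI[of _ _ "\<lambda>j. (if j = i then 1 else 0) + n j"]) (simp add: tmon_add tmon_single ipow_def)
  next
    case (3 x i)
    then obtain n where "x = tmon n" by blast
    then show ?case
      by (intro range_eqI[of _ _ "\<lambda>j. (if j = i then - 1 else 0) + n j"]) (simp only: tmon_add tmon_single, simp add: ipow_def)
  qed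
  then show ?thesis using that by blast
qed

lemma qchar_tmon: "qchar l (tmon n) = qpow (\<Sum>j\<in>UNIV. of_int (n j) * (symm j * l j))"
  by (simp add: qchar_Uzero vcoeff_tmon)

lemma torus_evF:
  assumes "t \<in> torus" "p \<in> Tw b"
  shows "t * evF p = uscale (qchar (- b) t) (evF p * t)"
proof -
  obtain n where "t = tmon n" using assms(1) by (rule torus_tmon)
  then show ?thesis by (simp only: tmon_evF[OF assms(2)] qchar_tmon uminus_apply)
qed

lemma uT_torus: "uT i \<in> torus" "uTinv i \<in> torus"
  using torus.intros(2)[OF torus.intros(1)] torus.intros(3)[OF torus.intros(1)] by simp_all

text \<open>An element of the right torus weight may have a representative with other components,
  provided that they lie in the Serre ideal. This is seen for each \<open>c\<close> by comparing
  eigenvalues of some \<open>uT i\<close> that separates \<open>c\<close> from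
  \<open>b\<close>.\<close>

lemma Uminus_weight_eq: "Uminus_weight b = evF ` Tw b"
proof
  show "evF ` Tw b \<subseteq> Uminus_weight b"
  proof (rule image_subsetI)
    fix p :: "'a tens" assume p: "p \<in> Tw b"
    have "t * evF p * t' = uscale (qchar (- b) t) (evF p)" if "t \<in> torus" "t * t' = 1" for t t'
      using that(2) by (simp only: torus_evF[OF that(1) p] uscale_mult_left mult.assoc mult_1_right)
    then show "evF p \<in> Uminus_weight b" by (simp add: Uminus_weight_def)
  qed
  show "Uminus_weight b \<subseteq> evF ` Tw b"
  proof
    fix y assume y: "y \<in> Uminus_weight b"
    then obtain p where p: "y = evF p" by (auto simp: Uminus_weight_def Uminus_eq)
    have 0: "part c p \<in> serre_ideal" if "c \<noteq> b" for c
    proof -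
      obtain i where i: "c i \<noteq> b i" using \<open>c \<noteq> b\<close> by (metis ext)
      let ?S = "{c. part c p \<noteq> 0}"
      have "uT i * y * uTinv i = uscale (qchar (- b) (uT i)) y"
        using y uT_torus uT_inv(1) unfolding Uminus_weight_def by blast
      also have "uT i * y * uTinv i = (\<Sum>c\<in>?S. uT i * evF (part c p) * uTinv i)"
        unfolding p by (subst evF_parts) (simp only: sum_distrib_left sum_distrib_right)
      also have "\<dots> = (\<Sum>c\<in>?S. evF (psc (qpow (- (symm i * c i))) (part c p)))"
        by (simp add: uT_evF[OF part_Tw] uscale_mult_left mult.assoc)
      also have "uscale (qchar (- b) (uT i)) y = evF (psc (qpow (- (symm i * b i))) p)"
        by (simp add: p uminus_apply[of b i])
      finally have "(\<Sum>c\<in>?S. psc (qpow (- (symm i * c i))) (part c p)) - psc (qpow (- (symm i * b i))) p \<in> serre_ideal"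
        unfolding ev_sum[symmetric] evF_eq_iff .
      then have "part c ((\<Sum>c\<in>?S. psc (qpow (- (symm i * c i))) (part c p)) - psc (qpow (- (symm i * b i))) p) \<in> serre_ideal"
        by (rule part_serre_ideal)
      also have "part c ((\<Sum>c\<in>?S. psc (qpow (- (symm i * c i))) (part c p)) - psc (qpow (- (symm i * b i))) p) =
          (\<Sum>d\<in>?S. if d = c then psc (qpow (- (symm i * c i))) (part c p) else 0) - psc (qpow (- (symm i * b i))) (part c p)"
        by (simp add: lin_sum[OF lin_part] part_part) (intro sum.cong; simp)
      also have "\<dots> = psc (qpow (- (symm i * c i)) - qpow (- (symm i * b i))) (part c p)"
        using finite_parts[of p] by (simp add: P.scale_left_diff_distrib)
      finally show ?thesis using i by (subst (asm) serre_ideal_scale_iff) simp_all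
    qed
    have "p - part b p = (\<Sum>c\<in>{c. part c (p - part b p) \<noteq> 0}. part c (p - part b p))"
      by (simp only: sum_parts[OF finite_parts order_refl])
    also have "\<dots> \<in> serre_ideal"
    proof (rule P.subspace_sum[OF subspace_serre_ideal])
      fix c show "part c (p - part b p) \<in> serre_ideal" using 0[of c] by (cases "c = b") (simp_all add: part_part)
    qed
    finally have "y = evF (part b p)" unfolding p evF_eq_iff .
    then show "y \<in> evF ` Tw b" by simp
  qed
qed

lemma torus_rad:
  assumes "t \<in> torus" "p \<in> Tw b"
  shows "t * evF p - uscale (qchar (l - b) t) (evF p) \<in> rad l"
proof -
  have "qchar (l - b) t = qchar (- b) t * qchar l t"
  proof -
    obtain n where "t = tmon n" using assms(1) by (rule torus_tmon)
    then show ?thesis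
      by (simp add: qchar_tmon minus_apply uminus_apply sum_subtractf right_diff_distrib sum_negf flip: qpow_add)
  qed
  moreover have "vproj l (evF p * t) = uscale (qchar l t) (evF p)"
    using torus_Uzero[OF assms(1)] by (simp add: vproj_Uzero qchar_Uzero)
  ultimately have "vproj l (t * evF p - uscale (qchar (l - b) t) (evF p)) = 0"
    unfolding torus_evF[OF assms] by simp
  then show ?thesis by (rule rad_vproj_0)
qed

lemma ordered_basis_presents:
  assumes V: "presents V c" and B: "ordered_basis V W (map c ys)"
  shows "w \<in> W ==> \<exists>a. w = c (\<Sum>i<length ys. uscale (a i) (ys ! i))"
    and "c (\<Sum>i<length ys. uscale (a i) (ys ! i)) = c 0 ==> c 0 \<in> W ==> k < length ys ==> a k = 0"
proof -
  note lc = lincomb_presents[OF V, where ys = ys]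
  have *: "\<exists>!cs. length cs = length ys \<and> w = lincomb V cs (map c ys)" if "w \<in> W" for w
    using B that by (simp add: ordered_basis_def)
  show "\<exists>a. w = c (\<Sum>i<length ys. uscale (a i) (ys ! i))" if w: "w \<in> W"
  proof -
    obtain cs where "length cs = length ys" "w = lincomb V cs (map c ys)" using *[OF w] by blast
    then show ?thesis by (intro exI[of _ "\<lambda>i. cs ! i"]) (simp add: lc)
  qed
  assume 0: "c (\<Sum>i<length ys. uscale (a i) (ys ! i)) = c 0" "c 0 \<in> W" and k: "k < length ys"
  have "c 0 = lincomb V (map a [0..<length ys]) (map c ys)" "c 0 = lincomb V (replicate (length ys) 0) (map c ys)"
    by (simp_all add: lc 0(1))
  then have "map a [0..<length ys] = replicate (length ys) 0"
    using *[OF 0(2)] by (metis length_map length_replicate length_upt minus_nat.diff_0)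
  then have "map a [0..<length ys] ! k = replicate (length ys) 0 ! k" by simp
  then show "a k = 0" using k by simp
qed

lemma reduced_familyD:
  assumes "reduced_family l Y" "b \<in> Qplus"
  shows "set (Y b) \<subseteq> evF ` Tw b"
    and "p \<in> Tw b ==> \<exists>c. evF p - (\<Sum>i<length (Y b). uscale (c i) (Y b ! i)) \<in> rad l"
    and "(\<Sum>i<length (Y b). uscale (c i) (Y b ! i)) \<in> rad l ==> k < length (Y b) ==> c k = 0"
proof -
  let ?W = "weight_space (irr l) (l - b)"
  have *: "set (Y b) \<subseteq> evF ` Tw b" "ordered_basis (irr l) ?W (map (cl l) (Y b))"
    using assms unfolding reduced_family_def irr_act_vec Uminus_weight_eq by simp_all
  note B = ordered_basis_presents[OF presents_irr *(2)]
  have ws: "cl l (evF p) \<in> ?W" if "p \<in> Tw b" for p unfolding weight_space_def using torus_rad[OF _ that]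
    by (simp add: presentsD[OF presents_irr] cl_eq rangeI)
  show "set (Y b) \<subseteq> evF ` Tw b" by (rule *)
  show "\<exists>c. evF p - (\<Sum>i<length (Y b). uscale (c i) (Y b ! i)) \<in> rad l" if p: "p \<in> Tw b"
    using B(1)[OF ws[OF p]] by (simp add: cl_eq)
  show "c k = 0" if "(\<Sum>i<length (Y b). uscale (c i) (Y b ! i)) \<in> rad l" "k < length (Y b)"
    using B(2)[of c k] ws[of 0] that by (simp add: cl_eq)
qed

lemma basis_familyD:
  assumes "basis_family Y" "b \<in> Qplus"
  shows "set (Y b) \<subseteq> evF ` Tw b"
    and "p \<in> Tw b ==> \<exists>c. evF p = (\<Sum>i<length (Y b). uscale (c i) (Y b ! i))"
    and "(\<Sum>i<length (Y b). uscale (c i) (Y b ! i)) = 0 ==> k < length (Y b) ==> c k = 0"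
proof -
  have *: "ordered_basis regular_module (evF ` Tw b) (Y b)"
    using assms unfolding basis_family_def Uminus_weight_eq by blast
  then show "set (Y b) \<subseteq> evF ` Tw b" by (simp add: ordered_basis_def)
  note B = ordered_basis_presents[OF presents_regular, of _ "Y b", unfolded map_ident, OF *]
  show "\<exists>c. evF p = (\<Sum>i<length (Y b). uscale (c i) (Y b ! i))" if "p \<in> Tw b" using B(1) that by blast
  show "c k = 0" if "(\<Sum>i<length (Y b). uscale (c i) (Y b ! i)) = 0" "k < length (Y b)"
    using that image_eqI[of 0 evF 0 "Tw b"] by (intro B(2)[of c k]) simp_all
qed

section \<open>Regular functions\<close>

lemma vector_space_pscale: "vector_space sc ==> vector_space (pscale sc)"
  unfolding vector_space_def by (simp add: pscale_def fun_eq_iff plus_fun_apply)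

global_interpretation FS: vector_space "fscale :: qfield => ('x => qfield) => _"
  by (rule vector_space_pscale) (rule K.vector_space_axioms)

text \<open>A functional on \<open>L(m)\<close> amounts to a functional on the algebra that kills
  \<open>rad m\<close>, so matrix elements are the functions
  \<open>x \<mapsto> \<phi> (x * u)\<close>.\<close>

lemma Freg_I:
  assumes "dominant_integral m" "lin uscale (*) \<phi>" "\<And>z. z \<in> rad m ==> \<phi> z = 0"
  shows "(\<lambda>x. \<phi> (x * u)) \<in> Freg"
proof -
  define \<xi> where "\<xi> v = \<phi> (SOME u. cl m u = v)" for v
  have \<xi>: "\<xi> (cl m u) = \<phi> u" for u
  proof -
    have "cl m (SOME v. cl m v = cl m u) = cl m u" by (rule someI_ex) blast
    then have "\<phi> ((SOME v. cl m v = cl m u) - u) = 0" unfolding cl_eq by (rule assms(3))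
    then show ?thesis by (simp add: \<xi>_def lin_diff[OF assms(2)])
  qed
  have "linear_functional (irr m) \<xi>" unfolding linear_functional_def presentsD(1)[OF presents_irr]
    by (simp add: presentsD[OF presents_irr] \<xi> lin_add[OF assms(2)] lin_scale[OF assms(2)])
  moreover have "matrix_element (irr m) \<xi> (cl m u) = (\<lambda>x. \<phi> (x * u))"
    by (simp add: matrix_element_def presentsD[OF presents_irr] \<xi>)
  moreover have "cl m u \<in> mcarrier (irr m)" by (simp add: presentsD[OF presents_irr])
  ultimately show ?thesis unfolding Freg_def
    by (intro FS.span_base CollectI exI[of _ m] exI[of _ \<xi>] exI[of _ "cl m u"] conjI assms(1)) simp_all
qed

lemma subspace_Freg: "FS.subspace Freg" by (simp add: Freg_def)

lemmas Freg_closed = FS.subspace_0[OF subspace_Freg] FS.subspace_add[OF subspace_Freg]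
  FS.subspace_scale[OF subspace_Freg]

lemma Freg_induct [consumes 1, case_names zero step]:
  assumes "f \<in> Freg" "P 0"
    and "\<And>c m \<phi> u g. dominant_integral m ==> lin uscale (*) \<phi> ==> (\<And>z. z \<in> rad m ==> \<phi> z = 0) ==>
      P g ==> P (fscale c (\<lambda>x. \<phi> (x * u)) + g)"
  shows "P f" using assms(1) unfolding Freg_def
proof (induction f rule: FS.span_induct_alt)
  case base
  show ?case by (rule assms(2))
next
  case (step c h g)
  then obtain m X v where h: "h = matrix_element (irr m) X v" "dominant_integral m"
    "linear_functional (irr m) X" "v \<in> range (cl m)" by (auto simp: presentsD(1)[OF presents_irr])
  then obtain u where v: "v = cl m u" by blast
  define \<phi> where "\<phi> z = X (cl m z)" for z
  have lf: "X (cl m (a + b)) = X (cl m a) + X (cl m b)" "X (cl m (uscale d a)) = d * X (cl m a)" for a b d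
    using h(3) unfolding linear_functional_def presentsD(1)[OF presents_irr]
    by (auto simp: presentsD[OF presents_irr])
  have lin: "lin uscale (*) \<phi>" unfolding \<phi>_def by (rule linK) (simp_all add: lf)
  have "\<phi> z = 0" if "z \<in> rad m" for z
  proof -
    have "cl m z = cl m (uscale 0 z)" using that by (simp add: cl_eq)
    then have "\<phi> z = \<phi> (uscale 0 z)" unfolding \<phi>_def by (rule arg_cong)
    then show ?thesis by (simp only: lin_scale[OF lin]) simp
  qed
  from assms(3)[OF h(2) lin this step(2), of c u] show ?case
    by (simp add: h(1) v matrix_element_def[abs_def] presentsD[OF presents_irr] \<phi>_def)
qed

lemma Freg_lin: "f \<in> Freg ==> lin uscale (*) f"
proof (induction rule: Freg_induct)
  case zero
  show ?case by (rule linK) (simp_all add: zero_fun_apply)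
next
  case (step c m \<phi> u g)
  show ?case by (rule linK)
       (simp_all add: plus_fun_apply pscale_def distrib_right distrib_left uscale_mult_left lin_add[OF step(2)]
         lin_scale[OF step(2)] lin_add[OF step(4)] lin_scale[OF step(4)] mult.left_commute)
qed

lemma Freg_left_reg: "f \<in> Freg ==> left_reg a f \<in> Freg"
proof (induction rule: Freg_induct)
  case zero
  then show ?case using Freg_closed(1) by (simp add: left_reg_def zero_fun_apply zero_fun_def)
next
  case (step c m \<phi> u g)
  have "left_reg a (fscale c (\<lambda>x. \<phi> (x * u)) + g) = fscale c (\<lambda>x. \<phi> (x * (a * u))) + left_reg a g"
    by (simp add: left_reg_def pscale_def fun_eq_iff plus_fun_apply mult.assoc)
  then show ?case by (simp only:) (intro Freg_closed(2,3) Freg_I[OF step(1,2,3)] step(4))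
qed

lemma Freg_theta: "f \<in> Freg ==> (\<lambda>x. f (theta x)) \<in> Freg"
proof (induction rule: Freg_induct)
  case zero
  then show ?case using Freg_closed(1) by (simp add: zero_fun_apply zero_fun_def)
next
  case (step c m \<phi> u g)
  obtain m' h u' where *: "dominant_integral m'" "lin uscale (*) h" "\<forall>z\<in>rad m'. h z = 0"
    "\<forall>x. \<phi> (theta x * u) = h (x * u')" using functional_twist[OF step(1,2,3)] by blast
  have "(\<lambda>x. (fscale c (\<lambda>x. \<phi> (x * u)) + g) (theta x)) = fscale c (\<lambda>x. h (x * u')) + (\<lambda>x. g (theta x))"
    using *(4) by (simp add: pscale_def fun_eq_iff plus_fun_apply)
  then show ?case using *(3) by (simp only:) (intro Freg_closed(2,3) Freg_I[OF *(1,2)] step(4); blast)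
qed

text \<open>\<open>theta (evF p)\<close> is a raising element, and a given vector is moved by
  raising elements of only finitely many weights. This makes the fusion sums finite.\<close>

lemma Freg_finite:
  fixes f :: "'i::cartan_datum uq => qfield"
  shows "f \<in> Freg ==> finite {d. \<exists>p\<in>Tw d. left_reg (theta (evF p)) f \<noteq> 0}"
proof (induction rule: Freg_induct)
  case zero
  have "left_reg a 0 = 0" for a :: "'i uq" by (simp add: left_reg_def fun_eq_iff zero_fun_apply)
  then show ?case by simp
next
  case (step c m \<phi> u g)
  have 0: "left_reg a (fscale c (\<lambda>x. \<phi> (x * u)) + g) = 0" if "a * u \<in> rad m" "left_reg a g = 0" for a
  proof -
    have "\<phi> (x * a * u) = 0" for x using step(3)[OF rad_closed(3)[OF that(1), of x]] by (simp add: mult.assoc)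
    moreover have "g (x * a) = 0" for x using fun_cong[OF that(2), of x] by (simp add: left_reg_def zero_fun_apply)
    ultimately show ?thesis by (simp add: left_reg_def pscale_def fun_eq_iff plus_fun_apply zero_fun_apply)
  qed
  show ?case by (rule finite_subset[OF _ finite_UnI[OF rad_finite_theta[of u m] step(4)]])
       (use 0 in blast)
qed

lemma F0_D:
  assumes "f \<in> F0 K"
  shows "f \<in> Freg" "f (x * uT i) = f x" "a \<in> K ==> f (x * a) = 0"
proof -
  show f: "f \<in> Freg" and "a \<in> K ==> f (x * a) = 0" for x
    using assms by (auto simp: F0_def weight_space_def Fmodule_def left_reg_def fun_eq_iff zero_fun_apply)
  have "left_reg (uT i) f = fscale (qchar 0 (uT i)) f"
    using assms uT_torus(1)[of i] by (simp add: F0_def weight_space_def Fmodule_def)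
  then show "f (x * uT i) = f x" by (simp add: left_reg_def pscale_def fun_eq_iff zero_fun_apply[of i])
qed

lemma F0_I:
  assumes "f \<in> Freg" "\<And>x i. f (x * uT i) = f x" "\<And>a x. a \<in> K ==> f (x * a) = 0"
  shows "f \<in> F0 K"
proof -
  have inv: "f (x * uTinv i) = f x" for x i using assms(2)[of "x * uTinv i" i] by (simp add: mult.assoc)
  have "left_reg t f = fscale (qchar 0 t) f" if "t \<in> torus" for t
  proof -
    obtain n where n: "t = tmon n" using \<open>t \<in> torus\<close> by (rule torus_tmon)
    have "\<forall>z. f (z * tmon n) = f z" by (rule tmon_rule[of "\<lambda>a _. \<forall>z. f (z * a) = f z" "\<lambda>_. 0"])
        (simp_all add: assms(2) inv flip: mult.assoc)
    then show ?thesis by (simp add: n qchar_tmon left_reg_def pscale_def fun_eq_iff zero_fun_apply)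
  qed
  then show ?thesis
    using assms by (simp add: F0_def weight_space_def Fmodule_def left_reg_def fun_eq_iff zero_fun_apply)
qed

lemma F0_theta:
  assumes "f \<in> F0 (Kminus l)"
  shows "(\<lambda>x. f (theta x)) \<in> F0 (Kplus l)"
proof (rule F0_I)
  show "(\<lambda>x. f (theta x)) \<in> Freg" by (rule Freg_theta) (rule F0_D[OF assms])
  show "f (theta (x * uT i)) = f (theta x)" for x i
    using F0_D(2)[OF assms, of "theta x * uTinv i" i] by (simp add: mult.assoc)
  show "f (theta (x * a)) = 0" if "a \<in> Kplus l" for a x using that F0_D(3)[OF assms] by (auto simp: Kplus_eq)
qed

section \<open>Laurent polynomial families\<close>

text \<open>Laurent polynomials in \<open>q^s\<close>, kept as functions of a rational
  \<open>s\<close> so that specialization to a weight of the line is application.\<close>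

definition lf :: "(rat => qfield) => bool"
  where "lf a \<longleftrightarrow> (\<exists>N p. \<forall>s. a s = qpow (- (of_nat N * s)) * poly p (qpow s))"

lemma lf_const [simp]: "lf (\<lambda>s. c)" unfolding lf_def by (intro exI[of _ 0] exI[of _ "[:c:]"]) simp

lemma lf_add [intro]:
  assumes "lf a" "lf b"
  shows "lf (\<lambda>s. a s + b s)"
proof -
  obtain N p M r where a: "\<And>s. a s = qpow (- (of_nat N * s)) * poly p (qpow s)"
    and b: "\<And>s. b s = qpow (- (of_nat M * s)) * poly r (qpow s)" using assms unfolding lf_def by blast
  have m: "qpow (- (of_nat N * s)) = qpow (- (of_nat (N + M) * s)) * qpow s ^ M" for N M s
    by (simp add: qpow_power distrib_right flip: qpow_add)
  have "a s + b s = qpow (- (of_nat (N + M) * s)) * poly (monom 1 M * p + monom 1 N * r) (qpow s)" for s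
    using m[of N s M] m[of M s N] by (simp add: a b poly_monom distrib_left add.commute)
  then show ?thesis unfolding lf_def by blast
qed

lemma lf_mult [intro]:
  assumes "lf a" "lf b"
  shows "lf (\<lambda>s. a s * b s)"
proof -
  obtain N p M r where a: "\<And>s. a s = qpow (- (of_nat N * s)) * poly p (qpow s)"
    and b: "\<And>s. b s = qpow (- (of_nat M * s)) * poly r (qpow s)" using assms unfolding lf_def by blast
  have "qpow (- (of_nat (N + M) * s)) = qpow (- (of_nat N * s)) * qpow (- (of_nat M * s))" for s
    by (simp add: distrib_right flip: qpow_add)
  then have "a s * b s = qpow (- (of_nat (N + M) * s)) * poly (p * r) (qpow s)" for s by (simp add: a b)
  then show ?thesis unfolding lf_def by blast
qed

lemma lf_qpow: "lf (\<lambda>s. qpow (of_int n * s))"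
proof (cases "n \<ge> 0")
  case True
  then obtain k where "n = int k" using nonneg_int_cases by blast
  then show ?thesis unfolding lf_def by (intro exI[of _ 0] exI[of _ "monom 1 k"]) (simp add: poly_monom qpow_power)
next
  case False
  then obtain k where "n = - int k" by (metis minus_minus nle_le nonneg_int_cases neg_0_le_iff_le)
  then show ?thesis unfolding lf_def by (intro exI[of _ k] exI[of _ 1]) simp
qed

lemma lf_qpow_affine: "lf (\<lambda>s. qpow (a + s * of_int n))"
  unfolding qpow_add using lf_mult[OF lf_const lf_qpow] by (simp add: mult.commute)

lemma lf_minus [intro]: "lf a ==> lf (\<lambda>s. - a s)" using lf_mult[OF lf_const[of "-1"], of a] by simp

lemma lf_diff [intro]: "lf a ==> lf b ==> lf (\<lambda>s. a s - b s)" using lf_add[OF _ lf_minus, of a b] by simp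

lemma lf_sum [intro]: "(\<And>k. k \<in> A ==> lf (a k)) ==> lf (\<lambda>s. \<Sum>k\<in>A. a k s)"
  by (induction A rule: infinite_finite_induct) (auto simp: lf_add)

lemma lf_prod [intro]: "(\<And>k. k \<in> A ==> lf (a k)) ==> lf (\<lambda>s. \<Prod>k\<in>A. a k s)"
  by (induction A rule: infinite_finite_induct) (auto simp: lf_mult)

text \<open>\<open>qpow\<close> is injective, so a ray of parameters provides infinitely many
  roots.\<close>

lemma lf_zero:
  assumes "lf a" "\<And>s. s \<le> s0 ==> a s = 0"
  shows "a s = 0"
proof -
  obtain N p where a: "\<And>s. a s = qpow (- (of_nat N * s)) * poly p (qpow s)"
    using assms(1) unfolding lf_def by blast
  have "qpow ` {..s0} \<subseteq> {x. poly p x = 0}" using assms(2) a by auto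
  moreover have "infinite (qpow ` {..s0})" by (subst finite_image_iff) (auto simp: inj_on_def infinite_Iic)
  ultimately have "p = 0" using poly_roots_finite finite_subset by blast
  then show ?thesis by (simp add: a)
qed

lemma lf_eqI:
  assumes "lf a" "lf b" "\<And>s. s \<le> s0 ==> a s = b s"
  shows "a s = b s" using lf_zero[OF lf_diff[OF assms(1,2)], of s0 s] assms(3) by simp

section \<open>Order of vanishing at the parameter 0\<close>

definition tt :: "rat => qfield"
  where "tt s = qpow s - 1"

lemma tt_0 [simp]: "tt 0 = 0" by (simp add: tt_def)

lemma tt_nonzero [simp]: "tt s = 0 \<longleftrightarrow> s = 0" by (simp add: tt_def)

lemma lf_tt: "lf (\<lambda>s. tt s ^ j)"
  unfolding lf_def by (intro exI[of _ 0] exI[of _ "[:-1, 1:] ^ j"]) (simp add: tt_def)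

lemma lf_order:
  assumes "lf a" "a s1 \<noteq> 0"
  shows "\<exists>i b. lf b \<and> b 0 \<noteq> 0 \<and> (\<forall>s. a s = tt s ^ i * b s)"
proof -
  obtain N p where a: "\<And>s. a s = qpow (- (of_nat N * s)) * poly p (qpow s)"
    using assms(1) unfolding lf_def by blast
  then have "p \<noteq> 0" using assms(2) by auto
  then obtain r where r: "p = [:-1, 1:] ^ order 1 p * r" "\<not> [:-1, 1:] dvd r" using order_decomp by blast
  have "poly r 1 \<noteq> 0" using r(2) by (simp add: poly_eq_0_iff_dvd)
  moreover have "a s = tt s ^ order 1 p * (qpow (- (of_nat N * s)) * poly r (qpow s))" for s
    unfolding a by (subst r(1)) (simp add: tt_def)
  ultimately show ?thesis
    by (intro exI[of _ "order 1 p"] exI[of _ "\<lambda>s. qpow (- (of_nat N * s)) * poly r (qpow s)"])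
       (auto simp: lf_def)
qed

lemma lf_div:
  assumes "lf a" "a 0 = 0"
  shows "\<exists>b. lf b \<and> (\<forall>s. a s = tt s * b s)"
proof (cases "\<exists>s. a s \<noteq> 0")
  case True
  then obtain i b where b: "lf b" "b 0 \<noteq> 0" "\<And>s. a s = tt s ^ i * b s" using lf_order[OF assms(1)] by blast
  then obtain k where "i = Suc k" using b(3)[of 0] assms(2) by (cases i) auto
  then have "a s = tt s * (tt s ^ k * b s)" for s by (simp only: b(3)[of s] \<open>i = Suc k\<close> power_Suc mult.assoc)
  then show ?thesis using lf_mult[OF lf_tt b(1), of k] by blast
qed (auto intro!: exI[of _ "\<lambda>_. 0"])

lemma lf_cancel_tt:
  assumes "lf a" "lf b" "\<And>s. tt s ^ i * a s = tt s ^ i * b s"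
  shows "a s = b s"
proof (rule lf_eqI[OF assms(1,2), of "-1"])
  fix s :: rat assume "s \<le> -1"
  then have "tt s \<noteq> 0" by auto
  then show "a s = b s" using assms(3)[of s] by simp
qed

text \<open>Divisibility by a power of the local parameter \<open>tt\<close>, with a quotient that
  is again a Laurent polynomial.\<close>

definition tdiv :: "nat => (rat => qfield) => bool"
  where "tdiv j a \<longleftrightarrow> (\<exists>b. lf b \<and> (\<forall>s. a s = tt s ^ j * b s))"

lemma tdiv_zero [simp]: "tdiv j (\<lambda>s. 0)" unfolding tdiv_def by (intro exI[of _ "\<lambda>_. 0"]) simp

lemma tdiv_add:
  assumes "tdiv j a" "tdiv j b"
  shows "tdiv j (\<lambda>s. a s + b s)"
proof -
  obtain c d where "lf c" "\<And>s. a s = tt s ^ j * c s" "lf d" "\<And>s. b s = tt s ^ j * d s"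
    using assms unfolding tdiv_def by blast
  then show ?thesis unfolding tdiv_def by (intro exI[of _ "\<lambda>s. c s + d s"]) (auto simp: distrib_left)
qed

lemma tdiv_mult:
  assumes "lf c" "tdiv j a"
  shows "tdiv j (\<lambda>s. c s * a s)"
proof -
  obtain b where "lf b" "\<And>s. a s = tt s ^ j * b s" using assms unfolding tdiv_def by blast
  then show ?thesis unfolding tdiv_def using assms(1) by (intro exI[of _ "\<lambda>s. c s * b s"]) auto
qed

lemma tdiv_diff: "tdiv j a ==> tdiv j b ==> tdiv j (\<lambda>s. a s - b s)"
  using tdiv_add[OF _ tdiv_mult[OF lf_const[of "-1"]], of j a b] by simp

lemma tdiv_sum: "(\<And>k. k \<in> A ==> tdiv j (a k)) ==> tdiv j (\<lambda>s. \<Sum>k\<in>A. a k s)"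
  by (induction A rule: infinite_finite_induct) (auto simp: tdiv_add)

lemma tdiv_0_iff: "tdiv 0 a \<longleftrightarrow> lf a" by (simp add: tdiv_def flip: fun_eq_iff)

lemma tdiv_at_0: "tdiv j a ==> j > 0 ==> a 0 = 0" unfolding tdiv_def by auto

lemma tdiv_power_mult:
  assumes "tdiv j a"
  shows "tdiv (i + j) (\<lambda>s. tt s ^ i * a s)"
proof -
  obtain b where b: "lf b" "\<And>s. a s = tt s ^ j * b s" using assms unfolding tdiv_def by blast
  have "tt s ^ i * a s = tt s ^ (i + j) * b s" for s by (simp only: b(2)[of s] power_add mult.assoc)
  then show ?thesis unfolding tdiv_def using b(1) by blast
qed

lemma tdiv_cancel_power:
  assumes "lf a" "tdiv (i + j) (\<lambda>s. tt s ^ i * a s)"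
  shows "tdiv j a"
proof -
  obtain b where b: "lf b" "\<And>s. tt s ^ i * a s = tt s ^ (i + j) * b s" using assms unfolding tdiv_def by blast
  have "a s = tt s ^ j * b s" for s
    by (rule lf_cancel_tt[OF assms(1) lf_mult[OF lf_tt b(1)], of i]) (simp only: b(2) power_add mult.assoc)
  then show ?thesis using b(1) unfolding tdiv_def by blast
qed

lemma tdiv_cancel_unit:
  assumes "lf d" "d 0 \<noteq> 0" "lf a" "tdiv j (\<lambda>s. d s * a s)"
  shows "tdiv j a" using assms(3,4)
proof (induction j arbitrary: a)
  case 0
  then show ?case by (simp add: tdiv_0_iff)
next
  case (Suc j)
  have "a 0 = 0" using tdiv_at_0[OF Suc.prems(2)] assms(2) by simp
  then obtain b where b: "lf b" "\<And>s. a s = tt s * b s" using lf_div[OF Suc.prems(1)] by blast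
  have "d s * a s = tt s ^ 1 * (d s * b s)" for s by (simp only: b(2)[of s] power_one_right mult.left_commute)
  then have "tdiv (1 + j) (\<lambda>s. tt s ^ 1 * (d s * b s))" using Suc.prems(2) by (simp only: plus_1_eq_Suc)
  then have "tdiv j (\<lambda>s. d s * b s)" by (rule tdiv_cancel_power[OF lf_mult[OF assms(1) b(1)]])
  then have "tdiv j b" by (rule Suc.IH[OF b(1)])
  from tdiv_power_mult[OF this, of 1] show ?case by (simp add: b(2))
qed

section \<open>Families of elements of the free algebra\<close>

inductive lfT :: "(rat => 'i::cartan_datum tens) => bool" where
  single: "lf c ==> lfT (\<lambda>s. psc (c s) v)"
| add: "lfT a ==> lfT b ==> lfT (\<lambda>s. a s + b s)"

lemma lfT_const: "lfT (\<lambda>s. v)" using lfT.single[OF lf_const[of 1], of v] by simp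

lemma lfT_scale: "lfT a ==> lf d ==> lfT (\<lambda>s. psc (d s) (a s))"
proof (induction rule: lfT.induct)
  case (single c v)
  then have "lfT (\<lambda>s. psc (d s * c s) v)" by (intro lfT.single lf_mult)
  then show ?case by simp
next
  case (add a b)
  then show ?case by (simp add: P.scale_right_distrib lfT.add)
qed

lemma lfT_sum: "(\<And>k. k \<in> A ==> lfT (a k)) ==> lfT (\<lambda>s. \<Sum>k\<in>A. a k s)"
  by (induction A rule: infinite_finite_induct) (auto simp: lfT_const intro: lfT.add)

lemma lfT_op:
  assumes "lfT a" "\<And>s. lin psc psc (L s)" "\<And>v. lfT (\<lambda>s. L s v)"
  shows "lfT (\<lambda>s. L s (a s))" using assms(1)
proof (induction rule: lfT.induct)
  case (single c v)
  then show ?case using lfT_scale[OF assms(3)] by (simp add: lin_scale[OF assms(2)])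
next
  case (add a b)
  then show ?case by (simp add: lin_add[OF assms(2)] lfT.add)
qed

lemma lfT_linear: "lfT a ==> lin psc psc L ==> lfT (\<lambda>s. L (a s))"
  by (rule lfT_op[where L = "\<lambda>_. L"]) (auto intro: lfT_const)

lemma lfT_tdiv:
  assumes "lfT a" "\<And>s. lin psc (*) (\<phi> s)" "\<And>v. tdiv j (\<lambda>s. \<phi> s v)"
  shows "tdiv j (\<lambda>s. \<phi> s (a s))" using assms(1)
proof (induction rule: lfT.induct)
  case (single c v)
  then show ?case using tdiv_mult[OF _ assms(3)] by (simp add: lin_scale[OF assms(2)])
next
  case (add a b)
  then show ?case by (simp add: lin_add[OF assms(2)] tdiv_add)
qed

lemma lfT_lf: "lfT a ==> (\<And>s. lin psc (*) (\<phi> s)) ==> (\<And>v. lf (\<lambda>s. \<phi> s v)) ==> lf (\<lambda>s. \<phi> s (a s))"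
  using lfT_tdiv[of a \<phi> 0] by (simp add: tdiv_0_iff)

lemma lf_det:
  assumes "\<And>s. A s \<in> carrier_mat n n" "\<And>i j. i < n ==> j < n ==> lf (\<lambda>s. A s $$ (i, j))"
  shows "lf (\<lambda>s. det (A s))"
proof -
  have "det (A s) = (\<Sum>p\<in>{p. p permutes {0..<n}}. signof p * (\<Prod>i = 0..<n. A s $$ (i, p i)))" for s
    using det_def'[OF assms(1)] .
  moreover have "lf (\<lambda>s. \<Sum>p\<in>{p. p permutes {0..<n}}. signof p * (\<Prod>i = 0..<n. A s $$ (i, p i)))"
    by (intro lf_sum lf_mult lf_const lf_prod assms(2)) (metis atLeastLessThan_iff mem_Collect_eq permutes_in_image zero_le)+
  ultimately show ?thesis by simp
qed

lemma lf_adj_mat: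
  assumes "\<And>s. A s \<in> carrier_mat n n" "\<And>i j. i < n ==> j < n ==> lf (\<lambda>s. A s $$ (i, j))"
    and "i < n" "j < n"
  shows "lf (\<lambda>s. adj_mat (A s) $$ (i, j))"
proof -
  have "mat_delete (A s) j i \<in> carrier_mat (n - 1) (n - 1)" for s using mat_delete_carrier[OF assms(1)] .
  moreover have "lf (\<lambda>s. mat_delete (A s) j i $$ (k, l))" if "k < n - 1" "l < n - 1" for k l
  proof -
    have "mat_delete (A s) j i $$ (k, l) = A s $$ (if k < j then k else Suc k, if l < i then l else Suc l)" for s
      using assms(1)[of s] that unfolding mat_delete_def by (simp add: carrier_matD)
    then show ?thesis using that assms(2) by auto
  qed
  ultimately have "lf (\<lambda>s. det (mat_delete (A s) j i))" by (rule lf_det)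
  then have "lf (\<lambda>s. (- 1) ^ (j + i) * det (mat_delete (A s) j i))" by (rule lf_mult[OF lf_const])
  then show ?thesis using assms carrier_matD[OF assms(1)] by (simp add: adj_mat_def cofactor_def)
qed

section \<open>Deformation along a line\<close>

declare K.scale_scale [simp del]

lemma ip_reflection: "ip (reflection cartan i b) (reflection cartan i b) = ip b b"
proof -
  define c where "c = pairing b (simple_coroot cartan i)"
  have r: "reflection cartan i b = b - (\<lambda>j. c * simple_root i j)"
    by (rule ext) (simp add: reflection_def c_def minus_apply[of b "\<lambda>j. c * simple_root i j" for c])
  have c: "rpair i b = c * symm i"
    by (simp add: c_def rpair_def pairing_def simple_coroot_def sum_distrib_left algebra_simps)
  have "ip b (simple_root i) = rpair i b" "ip (simple_root i) (simple_root i) = 2 * symm i"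
    by (simp_all add: ip_commute[of b] ip_simple rpair_self)
  then show ?thesis
    unfolding r by (simp add: ip_diff_left ip_diff_right ip_scale_left ip_commute[of _ "\<lambda>j. c * simple_root i j"] ip_simple c)
qed

lemma roots_nonzero: "b \<in> roots cartan ==> ip b b > 0"
proof (induction rule: roots.induct)
  case (1 i)
  show ?case by (simp add: ip_simple rpair_self symm_pos)
next
  case (2 b i)
  then show ?case by (simp add: ip_reflection)
qed

text \<open>For a positive root the pairing with its coroot is a non-negative combination of the
  \<open>rpair i (l + \<rho>)\<close>, so it cannot be a positive integer.\<close>

lemma generic_antidominant:
  assumes "\<And>i. rpair i (l + \<rho>) \<le> 0"
  shows "generic l" unfolding generic_def
proof (intro ballI allI impI)
  fix b :: "'a => rat" and n :: nat
  assume b: "b \<in> positive_roots" and n: "1 \<le> n"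
  have "pairing s (coroot b) = 2 * (\<Sum>i\<in>UNIV. b i * rpair i s) / ip b b" for s
  proof -
    have "pairing s (coroot b) = (\<Sum>i\<in>UNIV. s i * (2 * rpair i b / ip b b))"
      by (simp add: pairing_def coroot_def ip_simple)
    also have "\<dots> = 2 * (\<Sum>i\<in>UNIV. s i * rpair i b) / ip b b"
      by (simp add: sum_divide_distrib sum_distrib_left ac_simps)
    also have "(\<Sum>i\<in>UNIV. s i * rpair i b) = (\<Sum>i\<in>UNIV. b i * rpair i s)"
      by (simp only: ip_alt[symmetric] ip_commute)
    finally show ?thesis .
  qed
  then have "pairing (l + \<rho>) (coroot b) = 2 * (\<Sum>i\<in>UNIV. b i * rpair i (l + \<rho>)) / ip b b" .
  also have "\<dots> \<le> 0"
  proof -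
    have "(\<Sum>i\<in>UNIV. b i * rpair i (l + \<rho>)) \<le> 0"
      using b assms by (intro sum_nonpos) (auto simp: positive_roots_def mult_nonneg_nonpos)
    then show ?thesis using roots_nonzero[of b] b by (simp add: positive_roots_def divide_nonpos_pos)
  qed
  finally show "pairing (l + \<rho>) (coroot b) \<noteq> of_nat n" using n by auto
qed

lemma common_denominator:
  assumes "finite A"
  shows "\<exists>N::nat. N > 0 \<and> (\<forall>i\<in>A. \<exists>h. of_nat N * x i = (of_int h :: rat))" using assms
proof (induction rule: finite_induct)
  case (insert a A)
  then obtain N where N: "N > 0" "\<forall>i\<in>A. \<exists>h. of_nat N * x i = of_int h" by blast
  obtain p d where pd: "d > 0" "x a = of_int p / of_int d"
    using quotient_of_div[of "x a"] quotient_of_denom_pos[of "x a"] by (metis surj_pair)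
  have eq: "of_nat (N * nat d) = (of_nat N * of_int d :: rat)" using pd by (simp add: of_nat_nat)
  have "of_nat (N * nat d) * x a = of_int (int N * p)" unfolding eq using pd by simp
  then have 1: "\<exists>h. of_nat (N * nat d) * x a = of_int h" by blast
  have 2: "\<exists>h. of_nat (N * nat d) * x i = of_int h" if "i \<in> A" for i
  proof -
    obtain h where "of_nat N * x i = of_int h" using N(2) \<open>i \<in> A\<close> by blast
    then have "of_int d * (of_nat N * x i) = of_int (d * h)" by simp
    then have "of_nat (N * nat d) * x i = of_int (d * h)"
      unfolding eq by (simp only: mult.left_commute[of "of_int d"] mult.assoc)
    then show ?thesis by blast
  qed
  have "0 < N * nat d" using N(1) pd(1) by simp
  with 1 2 show ?case by blast
qed auto

text \<open>Integrality makes the torus characters Laurent in \<open>q^s\<close> along the line. On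
  the ray \<open>s \<le> s0\<close> the weights are generic and the Shapovalov form is
  nondegenerate, which is where identities are checked before they are extended to
  \<open>s = 0\<close>.\<close>

locale line =
  fixes \<nu>0 \<eta> :: "'i::cartan_datum => rat" and s0 :: rat and Y :: "('i => rat) => 'i uq list"
  assumes integral: "\<And>i. \<exists>h. symm i * \<eta> i = of_int h"
    and antidominant: "\<And>s i. s \<le> s0 ==> rpair i (\<nu>0 + (\<lambda>j. s * \<eta> j)) + symm i \<le> 0"
    and generic_line: "\<And>s. s \<le> s0 ==> generic (\<nu>0 + (\<lambda>j. s * \<eta> j))"
    and basis: "basis_family Y"

text \<open>The direction \<open>\<omega>\<close> has product 1 with all simple roots and is scaled
  by a common denominator; far in the negative direction the weights become antidominant.\<close>

lemma line_exists:
  fixes \<nu>0 :: "'i::cartan_datum => rat"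
  assumes "basis_family Y"
  shows "\<exists>\<eta> s0. line \<nu>0 \<eta> s0 Y"
proof -
  obtain \<omega> :: "'i => rat" where \<omega>: "\<And>k. rpair k \<omega> = 1" using rpair_solvable[of "\<lambda>_. 1"] by blast
  obtain N :: nat where N: "N > 0" "\<And>i. \<exists>h. of_nat N * (symm i * \<omega> i) = of_int h"
    using common_denominator[OF finite_UNIV, of "\<lambda>i. symm i * \<omega> i"] by auto
  define \<eta> where "\<eta> = (\<lambda>j. of_nat N * \<omega> j)"
  have \<eta>: "rpair i \<eta> = of_nat N" for i unfolding \<eta>_def rpair_scale \<omega> by simp
  \<comment> \<open>The maximum with 0 ensures that \<open>s \<le> - M\<close> implies
    \<open>s * of_nat N \<le> s\<close>, hence \<open>s * of_nat N \<le> - M\<close>.\<close>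
  define M where "M = Max (range (\<lambda>i::'i. max 0 (max (rpair i \<nu>0 + symm i) (rpair i (\<nu>0 + \<rho>)))))"
  have M: "0 \<le> M" "rpair i \<nu>0 + symm i \<le> M" "rpair i (\<nu>0 + \<rho>) \<le> M" for i
  proof -
    have "max 0 (max (rpair i \<nu>0 + symm i) (rpair i (\<nu>0 + \<rho>))) \<le> M" unfolding M_def by (rule Max_ge) auto
    then show "0 \<le> M" "rpair i \<nu>0 + symm i \<le> M" "rpair i (\<nu>0 + \<rho>) \<le> M" by simp_all
  qed
  have sN: "s * of_nat N \<le> - M" if "s \<le> - M" for s
  proof -
    have "s * of_nat N \<le> s * 1" using that M(1) N(1) by (intro mult_left_mono_neg) auto
    then show ?thesis using that by simp
  qed
  have "line \<nu>0 \<eta> (- M) Y"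
  proof
    fix i
    obtain h where "of_nat N * (symm i * \<omega> i) = of_int h" using N(2) by blast
    then show "\<exists>h. symm i * \<eta> i = of_int h" by (intro exI[of _ h]) (simp add: \<eta>_def mult.left_commute)
  next
    fix s i assume s: "s \<le> - M"
    show "rpair i (\<nu>0 + (\<lambda>j. s * \<eta> j)) + symm i \<le> 0"
      using sN[OF s] M(2)[of i] unfolding rpair_add rpair_scale \<eta> by linarith
  next
    fix s assume s: "s \<le> - M"
    show "generic (\<nu>0 + (\<lambda>j. s * \<eta> j))"
    proof (rule generic_antidominant)
      fix i
      show "rpair i (\<nu>0 + (\<lambda>j. s * \<eta> j) + \<rho>) \<le> 0"
        using sN[OF s] M(3)[of i] unfolding rpair_add rpair_scale \<eta> by linarith
    qed
  qed (rule assms)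
  then show ?thesis by blast
qed

context line
begin

definition \<nu> :: "rat => 'i => rat"
  where "\<nu> s = \<nu>0 + (\<lambda>j. s * \<eta> j)"

lemma \<nu>_0 [simp]: "\<nu> 0 = \<nu>0" by (rule ext) (simp add: \<nu>_def plus_fun_apply)

lemma rpair_line: "\<exists>h. \<forall>s. rpair i (\<nu> s - b) = rpair i (\<nu>0 - b) + s * of_int h"
proof -
  obtain h where h: "\<And>j. symm j * \<eta> j = of_int (h j)" using integral by metis
  have "rpair i \<eta> = (\<Sum>j\<in>UNIV. of_int (cartan j i) * (symm j * \<eta> j))"
    unfolding rpair_def by (intro sum.cong refl) (subst symm_cartan, simp)
  also have "\<dots> = of_int (\<Sum>j\<in>UNIV. cartan j i * h j)" by (simp add: h)
  finally show ?thesis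
    unfolding \<nu>_def rpair_diff rpair_add rpair_scale by (intro exI[of _ "\<Sum>j\<in>UNIV. cartan j i * h j"]) simp
qed

lemma lf_rpair: "lf (\<lambda>s. qpow (rpair i (\<nu> s - b)))" "lf (\<lambda>s. qpow (- rpair i (\<nu> s - b)))"
proof -
  obtain h where h: "\<And>s. rpair i (\<nu> s - b) = rpair i (\<nu>0 - b) + s * of_int h" using rpair_line by blast
  show "lf (\<lambda>s. qpow (rpair i (\<nu> s - b)))" unfolding h by (rule lf_qpow_affine)
  have "- rpair i (\<nu> s - b) = - rpair i (\<nu>0 - b) + s * of_int (- h)" for s by (simp add: h)
  then show "lf (\<lambda>s. qpow (- rpair i (\<nu> s - b)))" using lf_qpow_affine[of "- rpair i (\<nu>0 - b)" "- h"] by simp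
qed

lemma lf_vcoeff_T: "lf (\<lambda>s. qpow (symm i * \<nu> s i))" "lf (\<lambda>s. qpow (- (symm i * \<nu> s i)))"
proof -
  obtain h where h: "symm i * \<eta> i = of_int h" using integral by blast
  have 1: "symm i * \<nu> s i = symm i * \<nu>0 i + s * of_int h" for s
    by (simp add: \<nu>_def plus_fun_apply distrib_left flip: h)
  have 2: "- (symm i * \<nu> s i) = - (symm i * \<nu>0 i) + s * of_int (- h)" for s by (simp add: 1)
  show "lf (\<lambda>s. qpow (symm i * \<nu> s i))" unfolding 1 by (rule lf_qpow_affine)
  show "lf (\<lambda>s. qpow (- (symm i * \<nu> s i)))" unfolding 2 by (rule lf_qpow_affine)
qed

lemma lf_vcoeff_Uzero: "x \<in> Uzero ==> lf (\<lambda>s. vcoeff (\<nu> s) x)"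
proof (induction rule: Uzero_induct)
  case (mult x y)
  then show ?case by (simp add: vcoeff_Uzero lf_mult)
next
  case (scale c x)
  then show ?case using lf_mult[OF lf_const] by simp
qed (simp_all add: lf_vcoeff_T lf_add)

lemma lf_vcoeff: "lf (\<lambda>s. vcoeff (\<nu> s) u)"
proof -
  obtain z where z: "z \<in> Uzero" "u - z \<in> ker0" using ker0_complement by blast
  have "vcoeff (\<nu> s) u = vcoeff (\<nu> s) z" for s using vcoeff_ker0[OF z(2), of "\<nu> s"] by simp
  then show ?thesis using lf_vcoeff_Uzero[OF z(1)] by simp
qed

lemma lf_qchar: "x \<in> Uzero ==> lf (\<lambda>s. qchar (\<nu> s) x)" using lf_vcoeff by (simp add: qchar_Uzero)

lemma lf_shap: "lf (\<lambda>s. shap (\<nu> s) x y)" unfolding shap_def by (rule lf_vcoeff)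

lemma lfT_vop_E: "lfT (\<lambda>s. vop (\<nu> s) (GenE i) p)"
proof (induction p rule: free_induct)
  case (single w c)
  have "lfT (\<lambda>s. vop (\<nu> s) (GenE i) (mono w))"
  proof (induction w)
    case Nil
    then show ?case using lfT_const[of 0] by (simp add: mono_Nil)
  next
    case (Cons j w)
    have "lf (\<lambda>s. qbracket i (rpair i (\<nu> s - wt w)))"
      using lf_mult[OF lf_const[of "1 / qden i"] lf_diff[OF lf_rpair]] by (simp add: qbracket_def)
    then have "lfT (\<lambda>s. if i = j then psc (qbracket i (rpair i (\<nu> s - wt w))) (mono w) else 0)"
      by (cases "i = j") (simp_all add: lfT.single lfT_const)
    moreover have "lfT (\<lambda>s. mono [j] * vop (\<nu> s) (GenE i) (mono w))"
      using lin_vop[of \<nu>0 "GenF j"] by (intro lfT_linear[OF Cons]) (simp add: vop_F[abs_def])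
    ultimately show ?case unfolding mono_Cons[of j w] vop_E_Cons[OF mono_Tw] by (intro lfT.add)
  qed
  then show ?case using lfT_scale[OF _ lf_const] by simp
next
  case (add p r)
  then show ?case by (simp add: lfT.add)
qed

lemma lfT_E: "lfT m ==> lfT (\<lambda>s. vop (\<nu> s) (GenE i) (m s))" by (rule lfT_op[OF _ lin_vop lfT_vop_E])

lemma lin_shap_evF: "lin psc (*) (\<lambda>p. shap \<mu> x (evF p))" by (rule lin_comp[OF lin_ev lin_shap])

section \<open>Gram matrices along the line\<close>

definition gm :: "('i => rat) => rat => qfield mat"
  where "gm b s = gram (shap (\<nu> s)) (Y b)"

definition gdet :: "('i => rat) => rat => qfield"
  where "gdet b s = det (gm b s)"

text \<open>The adjugate takes the place of the inverse, because its entries are Laurent polynomials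
  also where the Gram determinant vanishes.\<close>

definition gadj :: "('i => rat) => rat => nat => nat => qfield"
  where "gadj b s i j = adj_mat (gm b s) $$ (i, j)"

abbreviation dim :: "('i => rat) => nat"
  where "dim \<beta> \<equiv> length (Y \<beta>)"

lemma gm_carrier: "gm b s \<in> carrier_mat (dim b) (dim b)" by (simp add: gm_def gram_def)

lemma gm_index: "i < dim b ==> j < dim b ==> gm b s $$ (i, j) = shap (\<nu> s) (Y b ! i) (Y b ! j)"
  by (simp add: gm_def gram_def)

lemma lf_gdet: "lf (gdet b)"
  unfolding gdet_def[abs_def] by (rule lf_det[OF gm_carrier]) (simp add: gm_index lf_shap)

lemma lf_gadj: "i < dim b ==> j < dim b ==> lf (\<lambda>s. gadj b s i j)"
  unfolding gadj_def by (rule lf_adj_mat[OF gm_carrier]) (simp_all add: gm_index lf_shap)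

lemma gadj_gm:
  assumes "i < dim b" "k < dim b"
  shows "(\<Sum>j<dim b. gadj b s i j * shap (\<nu> s) (Y b ! j) (Y b ! k)) = (if i = k then gdet b s else 0)"
    and "(\<Sum>j<dim b. shap (\<nu> s) (Y b ! i) (Y b ! j) * gadj b s j k) = (if i = k then gdet b s else 0)"
proof -
  note A = adj_mat[OF gm_carrier[of b s]]
  have "(adj_mat (gm b s) * gm b s) $$ (i, k) = (\<Sum>j<dim b. gadj b s i j * shap (\<nu> s) (Y b ! j) (Y b ! k))"
    using assms A(1) gm_carrier[of b s]
    by (auto simp: scalar_prod_def gadj_def gm_index atLeast0LessThan carrier_matD intro!: sum.cong)
  then show "(\<Sum>j<dim b. gadj b s i j * shap (\<nu> s) (Y b ! j) (Y b ! k)) = (if i = k then gdet b s else 0)"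
    unfolding A(3) using assms by (cases "i = k") (simp_all add: gdet_def)
  have "(gm b s * adj_mat (gm b s)) $$ (i, k) = (\<Sum>j<dim b. shap (\<nu> s) (Y b ! i) (Y b ! j) * gadj b s j k)"
    using assms A(1) gm_carrier[of b s]
    by (auto simp: scalar_prod_def gadj_def gm_index atLeast0LessThan carrier_matD intro!: sum.cong)
  then show "(\<Sum>j<dim b. shap (\<nu> s) (Y b ! i) (Y b ! j) * gadj b s j k) = (if i = k then gdet b s else 0)"
    unfolding A(2) using assms by (cases "i = k") (simp_all add: gdet_def)
qed

lemma singular_weights_line: "s \<le> s0 ==> singular_weights (\<nu> s) = {}"
  using antidominant by (intro singular_weights_antidominant) (simp add: \<nu>_def)

lemma radical_line:
  assumes "s \<le> s0" "\<And>p. shap (\<nu> s) (evF p) (evF r) = 0"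
  shows "evF r = 0"
proof -
  have "part b r \<in> serre_ideal" for b
  proof (rule shap_nondegenerate[OF part_Tw])
    show "shap (\<nu> s) (evF p) (evF (part b r)) = 0" if "p \<in> Tw b" for p
      using assms(2)[of p] shap_part[of "\<nu> s" b p r] part_of_Tw[OF that, of b] by simp
  qed (use singular_weights_line[OF assms(1)] in auto)
  then have "evF (part b r) = 0" for b by (rule evF_serre_ideal)
  then show ?thesis by (subst evF_parts) simp
qed

lemma basis_evF: "b \<in> Qplus ==> i < dim b ==> \<exists>p\<in>Tw b. Y b ! i = evF p"
  using basis_familyD(1)[OF basis, of b] nth_mem by blast

lemma gdet_nonzero:
  assumes "s \<le> s0" "b \<in> Qplus"
  shows "gdet b s \<noteq> 0"
proof
  assume "gdet b s = 0"
  then obtain v where v: "v \<in> carrier_vec (dim b)" "v \<noteq> 0\<^sub>v (dim b)" "gm b s *\<^sub>v v = 0\<^sub>v (dim b)"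
    unfolding gdet_def using det_0_iff_vec_prod_zero[OF gm_carrier] by blast
  have "\<exists>p. \<forall>i<dim b. p i \<in> Tw b \<and> Y b ! i = evF (p i)" using basis_evF[OF assms(2)] by metis
  then obtain p where p: "\<And>i. i < dim b ==> p i \<in> Tw b" "\<And>i. i < dim b ==> Y b ! i = evF (p i)" by blast
  define r where "r = (\<Sum>i<dim b. psc (v $ i) (p i))"
  have r: "evF r = (\<Sum>i<dim b. uscale (v $ i) (Y b ! i))" by (simp add: r_def ev_sum p)
  have rT: "r \<in> Tw b" unfolding r_def by (intro P.subspace_sum[OF subspace_Tw] Tw_closed) (simp add: p)
  have 0: "shap (\<nu> s) (Y b ! j) (evF r) = 0" if "j < dim b" for j
  proof -
    have "(gm b s *\<^sub>v v) $ j = (\<Sum>i<dim b. shap (\<nu> s) (Y b ! j) (Y b ! i) * v $ i)"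
      using that v(1) gm_carrier[of b s]
      by (auto simp: scalar_prod_def gm_index atLeast0LessThan carrier_matD carrier_vecD intro!: sum.cong)
    then show ?thesis using that by (simp add: v(3) r shap_sum mult.commute)
  qed
  have "shap (\<nu> s) (evF x) (evF r) = 0" for x
  proof -
    obtain c where "evF (part b x) = (\<Sum>i<dim b. uscale (c i) (Y b ! i))"
      using basis_familyD(2)[OF basis assms(2) part_Tw] by blast
    then have "shap (\<nu> s) (evF (part b x)) (evF r) = 0" by (simp add: shap_left_sum 0)
    then show ?thesis using shap_part'[of "\<nu> s" x b r] part_of_Tw[OF rT, of b] by simp
  qed
  then have "evF r = 0" by (rule radical_line[OF assms(1)])
  then have "v $ k = 0" if "k < dim b" for k
    using basis_familyD(3)[OF basis assms(2), of "\<lambda>i. v $ i" k] that r by simp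
  then show False using v(1,2) by (auto simp: vec_eq_iff)
qed

text \<open>Cramer's rule for the Shapovalov equations with right-hand side \<open>L\<close>: the
  adjugate produces a solution up to the factor \<open>gdet b s\<close>.\<close>

lemma gadj_solve:
  assumes "b \<in> Qplus" "p \<in> Tw b" "lin uscale (*) L"
  shows "(\<Sum>i<dim b. \<Sum>j<dim b. shap (\<nu> s) (evF p) (Y b ! i) * gadj b s i j * L (Y b ! j)) = gdet b s * L (evF p)"
proof -
  obtain c where c: "evF p = (\<Sum>k<dim b. uscale (c k) (Y b ! k))"
    using basis_familyD(2)[OF basis assms(1,2)] by blast
  have "(\<Sum>i<dim b. \<Sum>j<dim b. shap (\<nu> s) (evF p) (Y b ! i) * gadj b s i j * L (Y b ! j)) =
      (\<Sum>j<dim b. \<Sum>k<dim b. c k * (\<Sum>i<dim b. shap (\<nu> s) (Y b ! k) (Y b ! i) * gadj b s i j) * L (Y b ! j))"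
  proof -
    have "(\<Sum>i<dim b. shap (\<nu> s) (evF p) (Y b ! i) * gadj b s i j) =
        (\<Sum>k<dim b. c k * (\<Sum>i<dim b. shap (\<nu> s) (Y b ! k) (Y b ! i) * gadj b s i j))" for j
      unfolding c shap_left_sum by (simp add: sum_distrib_left sum_distrib_right mult.assoc) (rule sum.swap)
    then show ?thesis by (subst sum.swap) (simp flip: sum_distrib_right)
  qed
  also have "\<dots> = (\<Sum>j<dim b. \<Sum>k<dim b. if k = j then c k * gdet b s * L (Y b ! j) else 0)"
    by (intro sum.cong refl) (simp add: gadj_gm(2))
  also have "\<dots> = (\<Sum>j<dim b. gdet b s * (c j * L (Y b ! j)))" by (intro sum.cong refl) (simp add: ac_simps)
  also have "\<dots> = gdet b s * L (evF p)"
    by (simp only: c lin_sum[OF assms(3)] lin_scale[OF assms(3)] sum_distrib_left)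
  finally show ?thesis .
qed

text \<open>Cramer's rule in the other direction: the coordinates of a vector are recovered from its
  pairings.\<close>

lemma gadj_coords:
  assumes "evF p = (\<Sum>k<dim B. uscale (c k) (Y B ! k))" "a < dim B"
  shows "gdet B s * c a = (\<Sum>b<dim B. gadj B s a b * shap (\<nu> s) (Y B ! b) (evF p))"
proof -
  have "(\<Sum>b<dim B. gadj B s a b * shap (\<nu> s) (Y B ! b) (evF p)) =
      (\<Sum>k<dim B. (\<Sum>b<dim B. gadj B s a b * shap (\<nu> s) (Y B ! b) (Y B ! k)) * c k)"
    unfolding assms(1) shap_sum by (simp add: sum_distrib_left sum_distrib_right ac_simps) (rule sum.swap)
  also have "\<dots> = (\<Sum>k<dim B. if k = a then gdet B s * c k else 0)"
    by (intro sum.cong refl) (auto simp: gadj_gm(1)[OF assms(2)])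
  finally show ?thesis using assms(2) by simp
qed

end

section \<open>Fusion elements as finite sums\<close>

lemma sum_fun_apply: "sum g B x = (\<Sum>b\<in>B. g b x)"
  by (induction B rule: infinite_finite_induct) (simp_all add: plus_fun_apply[of _ _ x] zero_fun_apply[of x])

lemma fusion_apply_finite:
  assumes "finite A" "A \<subseteq> Qplus" "\<And>c. sc c 0 = 0"
    and "\<And>b i j. b \<in> Qplus - A ==> i < length (Y b) ==> j < length (Y b) ==> B (Y b ! i) (theta (Y b ! j)) = 0"
  shows "fusion_apply sc S Y B = (\<Sum>b\<in>A. \<Sum>i<length (Y b). \<Sum>j<length (Y b).
    sc (the (mat_inverse (gram S (Y b))) $$ (i, j)) (B (Y b ! i) (theta (Y b ! j))))"
proof -
  let ?t = "\<lambda>b. \<Sum>i<length (Y b). \<Sum>j<length (Y b).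
    sc (the (mat_inverse (gram S (Y b))) $$ (i, j)) (B (Y b ! i) (theta (Y b ! j)))"
  have "?t b = 0" if "b \<in> Qplus - A" for b using assms(4)[OF that] assms(3) by simp
  then have "{b. (if b \<in> Qplus then ?t b else 0) \<noteq> 0} \<subseteq> A" by auto
  then have "fusion_apply sc S Y B = (\<Sum>b\<in>A. if b \<in> Qplus then ?t b else 0)"
    unfolding fusion_apply_def by (rule Sum_any.expand_superset[OF assms(1)])
  also have "\<dots> = (\<Sum>b\<in>A. ?t b)" using assms(2) by (intro sum.cong) auto
  finally show ?thesis .
qed

text \<open>A finite set of weights outside which the second factors of a fusion element annihilate
  \<open>f\<close>.\<close>

definition support_weights :: "('i::cartan_datum uq => qfield) => ('i => rat) set"
  where "support_weights f = {b \<in> Qplus. \<exists>p\<in>Tw b. left_reg (theta (evF p)) f \<noteq> 0}"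

lemma support_weights:
  assumes "f \<in> Freg"
  shows "finite (support_weights f)" "support_weights f \<subseteq> Qplus"
    "b \<notin> support_weights f ==> p \<in> Tw b ==> f (z * theta (evF p)) = 0"
proof -
  show "finite (support_weights f)"
    unfolding support_weights_def by (rule finite_subset[OF _ Freg_finite[OF assms]]) blast
  show "support_weights f \<subseteq> Qplus" by (auto simp: support_weights_def)
  assume *: "b \<notin> support_weights f" "p \<in> Tw b"
  show "f (z * theta (evF p)) = 0"
  proof (cases "b \<in> Qplus")
    case True
    then have "left_reg (theta (evF p)) f = 0" using * by (auto simp: support_weights_def)
    from fun_cong[OF this, of z] show ?thesis by (simp add: left_reg_def zero_fun_apply[of z])
  next
    case False
    then show ?thesis using Tw_0[OF *(2)] by (simp add: lin_0[OF Freg_lin[OF assms]])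
  qed
qed

lemma fusion_support:
  fixes g :: "'i::cartan_datum uq => qfield" and S Y
  assumes g: "g \<in> Freg" and Y: "\<forall>\<beta>\<in>Qplus. set (Y \<beta>) \<subseteq> evF ` Tw \<beta>"
  defines "Q \<equiv> \<lambda>\<beta> i j. the (mat_inverse (gram S (Y \<beta>))) $$ (i, j)"
  shows "fusion_apply fscale S Y (\<lambda>a b. tensorF (left_reg a f) (left_reg b g)) (x', x) =
      (\<Sum>\<beta>\<in>support_weights g. \<Sum>i<length (Y \<beta>). \<Sum>j<length (Y \<beta>). Q \<beta> i j *
        (f (x' * Y \<beta> ! i) * g (x * theta (Y \<beta> ! j))))" (is ?FF)
    and "fusion_apply (pscale fscale) S Y (\<lambda>a b. tensorM fscale (B a) (left_reg b g)) x =
      (\<Sum>\<beta>\<in>support_weights g. \<Sum>i<length (Y \<beta>). \<Sum>j<length (Y \<beta>).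
        fscale (Q \<beta> i j * g (x * theta (Y \<beta> ! j))) (B (Y \<beta> ! i)))" (is ?MF)
proof -
  note A = support_weights[OF g]
  have 0: "left_reg (theta (Y \<beta> ! j)) g = 0" if \<beta>: "\<beta> \<in> Qplus - support_weights g" "j < length (Y \<beta>)" for \<beta> j
  proof -
    have "Y \<beta> ! j \<in> evF ` Tw \<beta>" using Y \<beta> nth_mem by blast
    then show ?thesis using A(3) \<beta>(1) by (auto simp: left_reg_def fun_eq_iff zero_fun_apply)
  qed
  have FF: "fusion_apply fscale S Y (\<lambda>a b. tensorF (left_reg a f) (left_reg b g)) =
      (\<Sum>\<beta>\<in>support_weights g. \<Sum>i<length (Y \<beta>). \<Sum>j<length (Y \<beta>). fscale (Q \<beta> i j)
        (tensorF (left_reg (Y \<beta> ! i) f) (left_reg (theta (Y \<beta> ! j)) g)))" unfolding Q_def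
    by (rule fusion_apply_finite[OF A(1,2)]) (simp_all add: 0 tensorF_def fun_eq_iff zero_fun_apply)
  show ?FF unfolding FF sum_fun_apply by (simp add: pscale_def tensorF_def left_reg_def)
  have MF: "fusion_apply (pscale fscale) S Y (\<lambda>a b. tensorM fscale (B a) (left_reg b g)) =
      (\<Sum>\<beta>\<in>support_weights g. \<Sum>i<length (Y \<beta>). \<Sum>j<length (Y \<beta>). pscale fscale (Q \<beta> i j)
        (tensorM fscale (B (Y \<beta> ! i)) (left_reg (theta (Y \<beta> ! j)) g)))" unfolding Q_def
    by (rule fusion_apply_finite[OF A(1,2)]) (simp_all add: 0 tensorM_def pscale_def fun_eq_iff zero_fun_apply)
  show ?MF unfolding MF sum_fun_apply by (simp only: pscale_def[of fscale] tensorM_def left_reg_def FS.scale_scale)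
qed

lemma sum_active:
  assumes "lin uscale (*) L" "finite A" "\<And>b p. b \<notin> A ==> p \<in> Tw b ==> L (evF p) = 0"
  shows "(\<Sum>b\<in>A. L (evF (part b r))) = L (evF r)"
proof -
  let ?S = "{b. part b r \<noteq> 0}"
  have "L (evF r) = (\<Sum>b\<in>?S. L (evF (part b r)))" by (subst evF_parts) (rule lin_sum[OF assms(1)])
  also have "\<dots> = (\<Sum>b\<in>?S \<union> A. L (evF (part b r)))"
    using assms(2) finite_parts[of r] by (intro sum.mono_neutral_left) (auto simp: lin_0[OF assms(1)])
  also have "\<dots> = (\<Sum>b\<in>A. L (evF (part b r)))"
    using assms(2,3) finite_parts[of r] by (intro sum.mono_neutral_right) auto
  finally show ?thesis ..
qed

global_interpretation FFS: vector_space "pscale (fscale :: qfield => ('x => qfield) => _) :: _ => ('y => _) => _"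
  by (rule vector_space_pscale) (rule FS.vector_space_axioms)

lemma M_tensor_F_apply:
  assumes "FS.subspace W" "w \<in> M_tensor_F fscale W"
  shows "w x \<in> W" using assms(2) unfolding M_tensor_F_def
proof (induction w rule: FFS.span_induct_alt)
  case base
  show ?case using FS.subspace_0[OF assms(1)] by (simp add: zero_fun_apply[of x])
next
  case (step c h w)
  then obtain m g where "h = tensorM fscale m g" "m \<in> W" by blast
  then show ?case using step.IH FS.subspace_add[OF assms(1)] FS.subspace_scale[OF assms(1)]
    by (simp add: tensorM_def pscale_def[of fscale] plus_fun_apply[of _ w x])
qed

context line
begin

lemma mat_inverse_gadj:
  assumes "s \<le> s0" "b \<in> Qplus" "i < dim b" "j < dim b"
  shows "gdet b s * the (mat_inverse (gm b s)) $$ (i, j) = gadj b s i j"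
proof -
  let ?n = "dim b" and ?A = "gm b s"
  note A = gm_carrier[of b s]
  have "?A \<in> Units (ring_mat TYPE(qfield) ?n undefined)"
    using det_non_zero_imp_unit[OF A] gdet_nonzero[OF assms(1,2)] by (simp add: gdet_def)
  then obtain B where "mat_inverse ?A = Some B" using mat_inverse(1)[OF A] by fastforce
  then have B: "B * ?A = 1\<^sub>m ?n" "B \<in> carrier_mat ?n ?n" "the (mat_inverse ?A) = B"
    using mat_inverse(2)[OF A] by auto
  note adj = adj_mat[OF A]
  have "adj_mat ?A = (B * ?A) * adj_mat ?A" using adj(1) by (simp add: B(1))
  also have "\<dots> = B * (det ?A \<cdot>\<^sub>m 1\<^sub>m ?n)" using assoc_mult_mat[OF B(2) A adj(1)] by (simp add: adj(2))
  also have "\<dots> = det ?A \<cdot>\<^sub>m B" using B(2) by (subst mult_smult_distrib[OF B(2) one_carrier_mat]) simp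
  finally show ?thesis using assms(3,4) B(2) by (simp add: gadj_def gdet_def B(3))
qed

text \<open>On one weight space the inverse Gram matrix contracted with the form is the
  identity.\<close>

lemma fusion_solve:
  assumes "s \<le> s0" "b \<in> Qplus" "p \<in> Tw b" "lin uscale (*) L"
  shows "(\<Sum>i<dim b. \<Sum>j<dim b. the (mat_inverse (gm b s)) $$ (i, j) * (shap (\<nu> s) (evF p) (Y b ! i) * L (Y b ! j))) = L (evF p)"
proof -
  have "gdet b s * (\<Sum>i<dim b. \<Sum>j<dim b. the (mat_inverse (gm b s)) $$ (i, j) * (shap (\<nu> s) (evF p) (Y b ! i) * L (Y b ! j)))
      = (\<Sum>i<dim b. \<Sum>j<dim b. shap (\<nu> s) (evF p) (Y b ! i) * gadj b s i j * L (Y b ! j))" unfolding sum_distrib_left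
  proof (intro sum.cong refl)
    fix i j assume "i \<in> {..<dim b}" "j \<in> {..<dim b}"
    then have "gadj b s i j = gdet b s * the (mat_inverse (gm b s)) $$ (i, j)"
      using mat_inverse_gadj[OF assms(1,2)] by simp
    then show "gdet b s * (the (mat_inverse (gm b s)) $$ (i, j) * (shap (\<nu> s) (evF p) (Y b ! i) * L (Y b ! j))) =
        shap (\<nu> s) (evF p) (Y b ! i) * gadj b s i j * L (Y b ! j)" by (simp only: ac_simps)
  qed
  also have "\<dots> = gdet b s * L (evF p)" by (rule gadj_solve[OF assms(2-4)])
  finally show ?thesis using gdet_nonzero[OF assms(1,2)] by simp
qed

lemma gram_shapovalov: "gram (shapovalov (\<nu> s)) (Y b) = gm b s" unfolding gm_def gram_def shapovalov_eq ..

text \<open>Extracts from regularity a solution of the Shapovalov equations whose denominator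
  \<open>D\<close> is invertible at \<open>s = 0\<close>. The hypothesis is applied to the negative
  part as a module over itself, to its element 1 and to \<open>f\<close> twisted by
  \<open>theta\<close>.\<close>

lemma regular_solution:
  assumes "J_regular Y \<nu>0" "f \<in> F0 (Kminus \<nu>0)"
  shows "\<exists>D. lf D \<and> D 0 \<noteq> 0 \<and>
    (\<forall>z. \<exists>M. lfT M \<and> (\<forall>p s. shap (\<nu> s) (evF p) (evF (M s)) = D s * f (z * evF p)))"
proof -
  have f: "f \<in> Freg" by (rule F0_D) (rule assms(2))
  note flin = Freg_lin[OF f]
  define F where "F = (\<lambda>x. f (theta x))"
  have F: "F \<in> F0 (Kplus \<nu>0)" unfolding F_def by (rule F0_theta) (rule assms(2))
  \<comment> \<open>The modules in \<open>J_regular\<close> consist of functions. The negative part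
    is embedded by the form at the weight \<open>\<nu> s0\<close>, where it is
    nondegenerate.\<close>
  define \<iota> where "\<iota> y = (\<lambda>x. shap (\<nu> s0) x y)" for y
  define W where "W = \<iota> ` Uminus"
  define ac :: "'i uq => ('i uq => qfield) => 'i uq => qfield" where "ac a w = (\<lambda>x. w (omega a * x))" for a w
  have \<iota>_add: "\<iota> (x + y) = \<iota> x + \<iota> y" and \<iota>_scale: "\<iota> (uscale c x) = fscale c (\<iota> x)" for x y c
    by (simp_all add: \<iota>_def fun_eq_iff plus_fun_apply pscale_def)
  have \<iota>_lin: "lin uscale fscale \<iota>"
    by (rule linI[OF U.vector_space_axioms FS.vector_space_axioms]) (simp_all add: \<iota>_add \<iota>_scale)
  have ac: "ac a (\<iota> y) = \<iota> (a * y)" for a y by (simp add: ac_def \<iota>_def shap_mult_right)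
  have "FS.subspace W"
    unfolding W_def using subalgebra_Uminus \<iota>_lin by (intro module_hom.subspace_image) (auto simp: subalgebra_def)
  moreover have "Uminus_module fscale W ac" unfolding Uminus_module_def
    using \<open>FS.subspace W\<close> subalgebraD[OF subalgebra_Uminus]
    by (auto simp: W_def ac distrib_left distrib_right us_mult mult.assoc simp flip: \<iota>_add \<iota>_scale intro!: imageI)
  moreover have "\<iota> 1 \<in> W" unfolding W_def by (intro imageI subalgebraD[OF subalgebra_Uminus])
  ultimately have "regular_at (pscale fscale) (M_tensor_F fscale W) (\<lambda>\<nu>. J_M fscale ac Y \<nu> (\<iota> 1) F) \<nu>0"
    using assms(1) F unfolding J_regular_def by blast
  then obtain n c v D where D: "D \<in> Uzero" "qchar \<nu>0 D \<noteq> 0"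
    and cv: "\<And>k. k < n ==> c k \<in> Uzero \<and> v k \<in> M_tensor_F fscale W"
    and eq: "\<And>\<mu>. generic \<mu> ==> pscale fscale (qchar \<mu> D) (J_M fscale ac Y \<mu> (\<iota> 1) F) =
      (\<Sum>k<(n::nat). pscale fscale (qchar \<mu> (c k)) (v k))" unfolding regular_at_def tends_to_def by blast
  have "\<exists>p. v k x = \<iota> (evF p)" if "k < n" for k x
    using M_tensor_F_apply[OF \<open>FS.subspace W\<close>, of "v k" x] cv[OF that] by (auto simp: W_def Uminus_eq)
  define M0 where "M0 x k = (SOME p. v k x = \<iota> (evF p))" for x k
  have M0: "v k x = \<iota> (evF (M0 x k))" if "k < n" for k x
    unfolding M0_def using someI_ex[OF \<open>\<And>k x. k < n ==> \<exists>p. v k x = \<iota> (evF p)\<close>[OF that, of x]] .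
  let ?M = "\<lambda>z s. \<Sum>k<n. psc (qchar (\<nu> s) (c k)) (M0 (theta z) k)"
  have FR: "F \<in> Freg" by (rule F0_D) (rule F)
  let ?A = "support_weights F"
  have A: "finite ?A" "?A \<subseteq> Qplus" by (rule support_weights[OF FR])+
  have inactive: "f (z * evF p) = 0" if "b \<notin> ?A" "p \<in> Tw b" for b p z
    using support_weights(3)[OF FR that, of "theta z"] by (simp add: F_def)
  let ?M = "\<lambda>z s. \<Sum>k<n. psc (qchar (\<nu> s) (c k)) (M0 (theta z) k)"
  have solution: "shap (\<nu> s) (evF p) (evF (?M z s)) = qchar (\<nu> s) D * f (z * evF p)"
    if s: "s \<le> s0" for s p z
  proof -
    let ?Q = "\<lambda>b i j. the (mat_inverse (gm b s)) $$ (i, j)"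
    \<comment> \<open>This is the value of \<open>J\<close> at \<open>theta z\<close> before the
      embedding: the twist of \<open>f\<close> cancels the \<open>theta\<close> inside the fusion
      element, leaving \<open>f (z * Y b ! j)\<close>.\<close>
    define R where "R = (\<Sum>b\<in>?A. \<Sum>i<dim b. \<Sum>j<dim b. uscale (?Q b i j * f (z * Y b ! j)) (Y b ! i))"
    have "\<forall>b\<in>Qplus. set (Y b) \<subseteq> evF ` Tw b" using basis_familyD(1)[OF basis] by blast
    then have "J_M fscale ac Y (\<nu> s) (\<iota> 1) F (theta z) = \<iota> R"
      unfolding J_M_def by (subst fusion_support(2)[OF FR], assumption, unfold gram_shapovalov)
        (simp add: R_def lin_sum[OF \<iota>_lin] \<iota>_scale ac F_def)
    moreover have "(\<Sum>k<n. pscale fscale (qchar (\<nu> s) (c k)) (v k)) (theta z) = \<iota> (evF (?M z s))"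
      by (simp add: ev_sum lin_sum[OF \<iota>_lin] \<iota>_scale sum_fun_apply pscale_def[of fscale] M0)
    moreover have "generic (\<nu> s)" using generic_line[OF s] by (simp add: \<nu>_def)
    from fun_cong[OF eq[OF this], of "theta z"]
    have "fscale (qchar (\<nu> s) D) (J_M fscale ac Y (\<nu> s) (\<iota> 1) F (theta z)) = (\<Sum>k<n. pscale fscale (qchar (\<nu> s) (c k)) (v k)) (theta z)"
      by (simp add: pscale_def[of fscale])
    ultimately have "\<iota> (uscale (qchar (\<nu> s) D) R) = \<iota> (evF (?M z s))" by (simp only: \<iota>_scale)
    then have z: "\<iota> (uscale (qchar (\<nu> s) D) R - evF (?M z s)) = 0" by (simp add: lin_diff[OF \<iota>_lin])
    have "R \<in> Uminus"
    proof -
      have "Y b ! i \<in> Uminus" if "b \<in> ?A" "i < dim b" for b i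
      proof -
        obtain p where "Y b ! i = evF p" using basis_evF[of b i] \<open>b \<in> ?A\<close> \<open>i < dim b\<close> A(2) by blast
        then show ?thesis by simp
      qed
      then show ?thesis unfolding R_def using subalgebra_Uminus unfolding subalgebra_def
        by (intro U.subspace_sum U.subspace_scale) auto
    qed
    then obtain r where r: "R = evF r" by (auto simp: Uminus_eq)
    define d where "d = psc (qchar (\<nu> s) D) r - (?M z s)"
    have "shap (\<nu> s0) x (evF d) = 0" for x
      using fun_cong[OF z, of x] by (simp add: \<iota>_def d_def r zero_fun_apply[of x])
    then have "evF d = 0" by (intro radical_line[of s0]) simp_all
    then have "evF (?M z s) = uscale (qchar (\<nu> s) D) R" by (simp add: d_def r)
    then have "shap (\<nu> s) (evF p) (evF (?M z s)) = qchar (\<nu> s) D * shap (\<nu> s) (evF p) R" by simp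
    also have "shap (\<nu> s) (evF p) R = (\<Sum>b\<in>?A. f (z * evF (part b p)))"
    proof -
      have "shap (\<nu> s) (evF p) R = (\<Sum>b\<in>?A. \<Sum>i<dim b. \<Sum>j<dim b. ?Q b i j * (shap (\<nu> s) (evF (part b p)) (Y b ! i) * f (z * Y b ! j)))"
        unfolding R_def shap_sum
      proof (intro sum.cong refl)
        fix b i j assume "b \<in> ?A" "i \<in> {..<dim b}" "j \<in> {..<dim b}"
        then obtain x where x: "x \<in> Tw b" "Y b ! i = evF x" using basis_evF[of b i] A(2) by auto
        have *: "shap (\<nu> s) (evF p) (Y b ! i) = shap (\<nu> s) (evF (part b p)) (Y b ! i)"
          using shap_part'[of "\<nu> s" p b x] part_of_Tw[OF x(1), of b] x(2) by simp
        show "shap (\<nu> s) (evF p) (uscale (?Q b i j * f (z * Y b ! j)) (Y b ! i)) =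
            ?Q b i j * (shap (\<nu> s) (evF (part b p)) (Y b ! i) * f (z * Y b ! j))"
          unfolding lin_scale[OF lin_shap] * by (simp only: ac_simps)
      qed
      also have "\<dots> = (\<Sum>b\<in>?A. f (z * evF (part b p)))"
      proof (intro sum.cong refl)
        fix b assume "b \<in> ?A"
        then have "b \<in> Qplus" using A by blast
        have "lin uscale (*) (\<lambda>y. f (z * y))" by (rule lin_left_mult[OF flin])
        from fusion_solve[OF s \<open>b \<in> Qplus\<close> part_Tw this]
        show "(\<Sum>i<dim b. \<Sum>j<dim b. ?Q b i j * (shap (\<nu> s) (evF (part b p)) (Y b ! i) * f (z * Y b ! j))) = f (z * evF (part b p))" .
      qed
      finally show ?thesis .
    qed
    also have "(\<Sum>b\<in>?A. f (z * evF (part b p))) = f (z * evF p)"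
    proof (rule sum_active[OF _ A(1)])
      show "lin uscale (*) (\<lambda>y. f (z * y))" by (rule lin_left_mult[OF flin])
    qed (rule inactive)
    finally show ?thesis .
  qed
  have M: "lfT (?M z)" for z using cv by (intro lfT_sum lfT.single lf_qchar) auto
  show ?thesis
  proof (intro exI[of _ "\<lambda>s. qchar (\<nu> s) D"] conjI allI)
    show "lf (\<lambda>s. qchar (\<nu> s) D)" by (rule lf_qchar) (rule D)
    show "qchar (\<nu> 0) D \<noteq> 0" using D by simp
    fix z
    \<comment> \<open>Both sides are Laurent in \<open>q^s\<close>, so the equality on the generic
      ray extends to all parameters, in particular to 0.\<close>
    have "shap (\<nu> s) (evF p) (evF (?M z s)) = qchar (\<nu> s) D * f (z * evF p)" for s p
    proof (rule lf_eqI[of _ _ s0])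
      show "lf (\<lambda>s. shap (\<nu> s) (evF p) (evF (?M z s)))"
        by (rule lfT_lf[OF M, where \<phi> = "\<lambda>s r. shap (\<nu> s) (evF p) (evF r)", OF lin_shap_evF lf_shap])
      show "lf (\<lambda>s. qchar (\<nu> s) D * f (z * evF p))" by (intro lf_mult lf_const lf_qchar D)
    qed (rule solution)
    with M[of z] show "\<exists>M. lfT M \<and> (\<forall>p s. shap (\<nu> s) (evF p) (evF (M s)) = qchar (\<nu> s) D * f (z * evF p))" by blast
  qed
qed

end

section \<open>The coproduct action on a solution of the twisted equations\<close>

lemma vproj_K_evF: "p \<in> Tw b ==> vproj m (uK i * evF p) = uscale (qpow (rpair i (m - b))) (evF p)"
  by (simp add: evF_word_K rpair_diff add.commute flip: qpow_add)

lemma vproj_Kinv_evF: "p \<in> Tw b ==> vproj m (uKinv i * evF p) = uscale (qpow (- rpair i (m - b))) (evF p)"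
  by (simp add: evF_word_Kinv rpair_diff flip: qpow_add)

lemma theta_evF_K:
  assumes "p \<in> Tw b"
  shows "uK i * theta (evF p) = uscale (qpow (rpair i b)) (theta (evF p) * uK i)"
proof -
  have "theta (uKinv i * evF p) = theta (uscale (qpow (rpair i b)) (evF p * uKinv i))"
    by (simp only: evF_word_Kinv[OF assms])
  then show ?thesis by simp
qed

lemma shap_E:
  assumes "p \<in> Tw b"
  shows "shap m (evF p) (evF (vop m (GenE i) r)) = qpow (rpair i (m - b)) * shap m (evF (mono [i] * p)) (evF r)"
proof -
  have "evF (vop m (GenE i) r) = vproj m (uE i * evF r)" using vproj_gen_mult[of m "GenE i" r] by simp
  then have "shap m (evF p) (evF (vop m (GenE i) r)) = shap m (uF i * (uK i * evF p)) (evF r)"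
    by (simp only: shap_vproj_right shap_mult_right omega_E mult.assoc)
  also have "\<dots> = shap m (vproj m (uF i * (uK i * evF p))) (evF r)" by (simp only: shap_vproj_left)
  also have "vproj m (uF i * (uK i * evF p)) = uscale (qpow (rpair i (m - b))) (evF (mono [i] * p))"
    by (simp add: vproj_K_evF[OF assms] uscale_mult_right ev_mult)
  finally show ?thesis by simp
qed

text \<open>For a solution \<open>R\<close> of the twisted equations this is the pairing of
  \<open>x\<close> with \<open>\<Delta>(w) R\<close> at the argument \<open>z\<close>, written
  without \<open>R\<close>. The recursion is
  \<open>\<Delta>(f_j) = f_j \<otimes> k_j^(-1) + 1 \<otimes> f_j\<close>: the first tensor factor
  moves over to \<open>x\<close> by contravariance, the second acts on the argument of
  \<open>f\<close>.\<close>

primrec zeta :: "('i::cartan_datum uq => qfield) => ('i => rat) => 'i list => 'i uq => 'i uq => qfield" where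
  "zeta f m [] = (\<lambda>x z. f (z * theta (vproj m x)))"
| "zeta f m (j # w) = (\<lambda>x z. zeta f m w (omega (uF j) * x) (z * uKinv j) + zeta f m w x (z * uF j))"

definition zetaT :: "('i::cartan_datum uq => qfield) => ('i => rat) => 'i tens => 'i uq => 'i uq => qfield"
  where "zetaT f u m x z = lx (*) (\<lambda>w. zeta f u w x z) m"

lemma lin_zetaT: "lin psc (*) (\<lambda>m. zetaT f u m x z)" unfolding zetaT_def by (rule KQ.lin_lx)

lemma zetaT_mono [simp]: "zetaT f m (mono w) x z = zeta f m w x z" by (simp add: zetaT_def)

lemma lin_mult_left: "lin psc psc (\<lambda>q. x * q)" by (rule linT) (simp_all add: distrib_left psc_mult_right)

lemma lin_plus: "lin s1 (*) g ==> lin s1 (*) h ==> lin s1 (*) (\<lambda>x. g x + (h x :: qfield))"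
  by (auto simp: module_hom_iff distrib_left)

lemma zetaT_Cons: "zetaT f m (mono [j] * q) x z = zetaT f m q (omega (uF j) * x) (z * uKinv j) + zetaT f m q x (z * uF j)"
proof (rule lin_free_eqI[where p = q])
  show "lin psc (*) (\<lambda>q. zetaT f m (mono [j] * q) x z)" by (rule lin_comp[OF lin_mult_left lin_zetaT])
  show "lin psc (*) (\<lambda>q. zetaT f m q (omega (uF j) * x) (z * uKinv j) + zetaT f m q x (z * uF j))"
    by (intro lin_plus lin_zetaT)
  show "zetaT f m (mono [j] * mono w) x z = zetaT f m (mono w) (omega (uF j) * x) (z * uKinv j) + zetaT f m (mono w) x (z * uF j)" for w
    unfolding mono_Cons[of j w, symmetric] zetaT_mono by simp
qed

context
  fixes f :: "'i::cartan_datum uq => qfield" and \<mu> :: "'i => rat"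
  assumes flin: "lin uscale (*) f" and fT: "\<And>x i. f (x * uT i) = f x"
begin

lemma zero_weight_K: "f (x * uK i) = f x"
proof -
  have "f (x * uTinv i) = f x" for x i using fT[of "x * uTinv i" i] by (simp add: mult.assoc)
  then have "\<forall>z. f (z * kpow uT uTinv i 1) = f z"
    by (intro kpow_rule[of "\<lambda>a _. \<forall>z. f (z * a) = f z" _ 0]) (simp_all add: fT flip: mult.assoc)
  then show ?thesis by (simp add: uK_def)
qed

lemma lin_zeta_left: "lin uscale (*) (\<lambda>x. zeta f \<mu> w x z)"
proof (induction w arbitrary: z)
  case Nil
  have "lin uscale uscale (\<lambda>x. theta (vproj \<mu> x))" by (rule lin_comp[OF lin_vproj lin_theta])
  from lin_comp[OF this lin_left_mult[OF flin]] show ?case by simp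
next
  case (Cons j w)
  have "lin uscale uscale (\<lambda>x. omega (uF j) * x)" by (rule linU) (simp_all add: distrib_left uscale_mult_right)
  from lin_plus[OF lin_comp[OF this Cons] Cons] show ?case by simp
qed

lemma lin_zeta_right: "lin uscale (*) (\<lambda>z. zeta f \<mu> w x z)"
proof (induction w arbitrary: x)
  case Nil
  show ?case by (rule linK)
       (simp_all add: distrib_right uscale_mult_left lin_add[OF flin] lin_scale[OF flin])
next
  case (Cons j w)
  have "lin uscale uscale (\<lambda>z. z * u)" for u :: "'i uq"
    by (rule linU) (simp_all add: distrib_right uscale_mult_left)
  from lin_plus[OF lin_comp[OF this Cons] lin_comp[OF this Cons]] show ?case by simp
qed

lemma zeta_vproj: "zeta f \<mu> w (vproj \<mu> x) z = zeta f \<mu> w x z"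
proof (induction w arbitrary: x z)
  case (Cons j w)
  have "zeta f \<mu> w (omega (uF j) * vproj \<mu> x) z' = zeta f \<mu> w (omega (uF j) * x) z'" for z'
    by (subst (1 2) Cons[symmetric]) (simp only: vproj_mult[symmetric])
  then show ?case by (simp add: Cons)
qed simp

text \<open>Equivariance under \<open>\<Delta>(k_i) = k_i \<otimes> k_i\<close>. Since
  \<open>f\<close> has weight zero, the exponent is given by the weight of \<open>w\<close> in the
  Verma module.\<close>

lemma zeta_K: "zeta f \<mu> w (uK i * x) (z * uK i) = qpow (rpair i (\<mu> - wt w)) * zeta f \<mu> w x z"
proof (induction w arbitrary: x z)
  case Nil
  obtain p where p: "vproj \<mu> x = evF p" using vproj_range by blast
  have "f (z * uK i * theta (vproj \<mu> (uK i * evF p))) = qpow (rpair i \<mu>) * f (z * theta (evF p))"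
  proof (induction p rule: free_induct)
    case (single w c)
    have "f (z * uK i * theta (vproj \<mu> (uK i * evF (mono w)))) = qpow (rpair i (\<mu> - wt w)) * f (z * (uK i * theta (evF (mono w))))"
      by (simp add: vproj_K_evF[OF mono_Tw] uscale_mult_right lin_scale[OF flin] mult.assoc)
    also have "\<dots> = qpow (rpair i \<mu>) * f (z * theta (evF (mono w)) * uK i)"
      by (simp add: theta_evF_K[OF mono_Tw] uscale_mult_right lin_scale[OF flin] rpair_diff mult.assoc flip: qpow_add)
    finally show ?case by (simp add: zero_weight_K uscale_mult_right lin_scale[OF flin] mult.left_commute)
  next
    case (add p r)
    then show ?case by (simp add: distrib_left lin_add[OF flin])
  qed
  moreover have "vproj \<mu> (uK i * x) = vproj \<mu> (uK i * evF p)" by (subst vproj_mult) (simp add: p)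
  ultimately show ?case by (simp add: p rpair_diff)
next
  case (Cons j w)
  let ?q = "qpow (- rpair i (simple_root j))"
  have 1: "omega (uF j) * (uK i * x) = uscale ?q (uK i * (omega (uF j) * x))"
  proof -
    have "omega (uF j) * (uK i * x) = uKinv j * (uE j * uK i) * x" by (simp add: mult.assoc)
    also have "\<dots> = uscale ?q (uKinv j * uK i * uE j * x)" by (simp only: uE_K us_mult mult.assoc)
    also have "\<dots> = uscale ?q (uK i * (omega (uF j) * x))" by (simp only: uK_comm(2)[of j i] omega_F mult.assoc)
    finally show ?thesis .
  qed
  have 2: "z * uK i * uKinv j = z * uKinv j * uK i" using uK_comm(2)[of j i] by (simp add: mult.assoc)
  have 3: "z * uK i * uF j = uscale ?q (z * uF j * uK i)" by (simp add: mult.assoc uK_F uscale_mult_right)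
  have "rpair i (\<mu> - wt (j # w)) = - rpair i (simple_root j) + rpair i (\<mu> - wt w)"
    by (simp add: rpair_diff rpair_wt_Cons)
  then show ?case unfolding zeta.simps 1 2 3 lin_scale[OF lin_zeta_left] lin_scale[OF lin_zeta_right] Cons
    by (simp only: qpow_add distrib_left mult.assoc)
qed

lemma zeta_Kinv: "zeta f \<mu> w (uKinv i * x) (z * uKinv i) = qpow (- rpair i (\<mu> - wt w)) * zeta f \<mu> w x z"
proof -
  have "zeta f \<mu> w (uK i * (uKinv i * x)) (z * uKinv i * uK i) =
      qpow (rpair i (\<mu> - wt w)) * zeta f \<mu> w (uKinv i * x) (z * uKinv i)" by (rule zeta_K)
  then have "zeta f \<mu> w x z = qpow (rpair i (\<mu> - wt w)) * zeta f \<mu> w (uKinv i * x) (z * uKinv i)"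
    by (simp add: mult.assoc)
  then have "qpow (- rpair i (\<mu> - wt w)) * zeta f \<mu> w x z =
      qpow (- rpair i (\<mu> - wt w)) * qpow (rpair i (\<mu> - wt w)) * zeta f \<mu> w (uKinv i * x) (z * uKinv i)"
    by (simp only: mult.assoc)
  then show ?thesis by simp
qed

text \<open>The homomorphism property:
  \<open>\<Delta>(e_i) = e_i \<otimes> 1 + k_i \<otimes> e_i\<close> acts on
  \<open>\<Delta>(w) R\<close> as \<open>e_i\<close> acts on \<open>w\<close> in the Verma module.
  For the empty word it says that \<open>R\<close> is singular.\<close>

lemma zeta_E: "zeta f \<mu> w (omega (uE i) * x) z + zeta f \<mu> w (uK i * x) (z * uE i) = zetaT f \<mu> (vop \<mu> (GenE i) (mono w)) x z"
proof (induction w arbitrary: x z)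
  case Nil
  have "zetaT f \<mu> (vop \<mu> (GenE i) (mono [])) x z = 0" by (simp add: mono_Nil lin_0[OF lin_zetaT])
  then show ?case by (simp add: mult.assoc lin_neg[OF flin])
next
  case (Cons j w)
  let ?d = "of_bool (i = j) / qden i"
  let ?Z = "zeta f \<mu> w"
  have 1: "omega (uF j) * (omega (uE i) * x) = omega (uE i) * (omega (uF j) * x) + uscale ?d (uK i * x - uKinv i * x)"
  proof -
    have "omega (uF j) * omega (uE i) = omega (uE i * uF j)" by (simp only: omega_mult)
    also have "\<dots> = omega (uE i) * omega (uF j) + uscale ?d (uK i - uKinv i)"
      by (simp only: uE_uF omega_simps omega_mult omega_K omega_Kinv)
    finally show ?thesis
      by (simp only: mult.assoc[symmetric]) (simp only: distrib_right uscale_mult_left left_diff_distrib mult.assoc)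
  qed
  have 2: "z * uE i * uF j = z * uF j * uE i + uscale ?d (z * uK i - z * uKinv i)"
    by (simp only: mult.assoc uE_uF[of i j] distrib_left uscale_mult_right right_diff_distrib)
  have 3: "?Z (omega (uF j) * (uK i * x)) (z * uE i * uKinv j) = ?Z (uK i * (omega (uF j) * x)) (z * uKinv j * uE i)"
  proof -
    let ?q = "qpow (- rpair i (simple_root j))" and ?r = "qpow (rpair j (simple_root i))"
    have "omega (uF j) * (uK i * x) = uKinv j * (uE j * uK i) * x" by (simp add: mult.assoc)
    also have "\<dots> = uscale ?q (uKinv j * uK i * uE j * x)" by (simp only: uE_K us_mult mult.assoc)
    also have "\<dots> = uscale ?q (uK i * (omega (uF j) * x))" by (simp only: uK_comm(2)[of j i] omega_F mult.assoc)
    finally have a: "omega (uF j) * (uK i * x) = uscale ?q (uK i * (omega (uF j) * x))" .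
    have b: "z * uE i * uKinv j = uscale ?r (z * uKinv j * uE i)"
      by (simp add: mult.assoc uE_Kinv uscale_mult_right)
    have "?q * ?r = 1" "?r * ?q = 1" by (simp_all add: rpair_simple_commute[of j i])
    then show ?thesis unfolding a b lin_scale[OF lin_zeta_left] lin_scale[OF lin_zeta_right]
      by (simp only: mult.assoc[of ?q ?r, symmetric] mult.assoc[of ?r ?q, symmetric] mult_1_left)
  qed
  \<comment> \<open>The mixed terms with \<open>uK i * x\<close> and \<open>z * uKinv i\<close>
    cancel. What remains has the same torus element in both places and is evaluated by
    \<open>zeta_K\<close> and \<open>zeta_Kinv\<close>.\<close>
  have 4: "?Z (uscale ?d (uK i * x - uKinv i * x)) (z * uKinv j) + ?Z (uK i * x) (uscale ?d (z * uK i - z * uKinv i)) =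
      (if i = j then qbracket i (rpair i (\<mu> - wt w)) * ?Z x z else 0)"
  proof (cases "i = j")
    case True
    have "?Z (uscale ?d (uK i * x - uKinv i * x)) (z * uKinv j) + ?Z (uK i * x) (uscale ?d (z * uK i - z * uKinv i)) =
        1 / qden i * (?Z (uK i * x) (z * uK i) - ?Z (uKinv i * x) (z * uKinv i))"
      using True by (simp add: lin_scale[OF lin_zeta_left] lin_scale[OF lin_zeta_right] lin_diff[OF lin_zeta_left] lin_diff[OF lin_zeta_right] diff_divide_distrib)
    then show ?thesis using True by (simp add: zeta_K zeta_Kinv qbracket_def diff_divide_distrib left_diff_distrib)
  qed (simp add: lin_0[OF lin_zeta_left] lin_0[OF lin_zeta_right])
  have "zeta f \<mu> (j # w) (omega (uE i) * x) z + zeta f \<mu> (j # w) (uK i * x) (z * uE i) =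
      (?Z (omega (uE i) * (omega (uF j) * x)) (z * uKinv j) + ?Z (uK i * (omega (uF j) * x)) (z * uKinv j * uE i)) +
      (?Z (omega (uE i) * x) (z * uF j) + ?Z (uK i * x) (z * uF j * uE i)) +
      (?Z (uscale ?d (uK i * x - uKinv i * x)) (z * uKinv j) + ?Z (uK i * x) (uscale ?d (z * uK i - z * uKinv i)))"
    unfolding zeta.simps 1 2 3 lin_add[OF lin_zeta_left] lin_add[OF lin_zeta_right] by (simp only: ac_simps)
  also have "\<dots> = zetaT f \<mu> (mono [j] * vop \<mu> (GenE i) (mono w)) x z +
      (if i = j then qbracket i (rpair i (\<mu> - wt w)) * ?Z x z else 0)" unfolding 4 Cons zetaT_Cons ..
  also have "\<dots> = zetaT f \<mu> (vop \<mu> (GenE i) (mono [j] * mono w)) x z"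
    unfolding vop_E_Cons[OF mono_Tw] lin_add[OF lin_zetaT]
    by (simp add: lin_scale[OF lin_zetaT] lin_0[OF lin_zetaT])
  finally show ?case unfolding mono_Cons[of j w] .
qed

lemma zetaT_E: "zetaT f \<mu> m (omega (uE i) * x) z + zetaT f \<mu> m (uK i * x) (z * uE i) = zetaT f \<mu> (vop \<mu> (GenE i) m) x z"
  by (rule lin_free_eqI[where p = m, OF lin_plus[OF lin_zetaT lin_zetaT] lin_comp[OF lin_vop lin_zetaT]])
     (simp only: zetaT_mono zeta_E)

text \<open>In the pairing with the highest weight vector the summands with some \<open>f_j\<close>
  in the first tensor factor vanish, and the remaining one acts only on \<open>f\<close>.\<close>

lemma zetaT_one: "zetaT f \<mu> m 1 z = f (z * evF m)"
proof (rule lin_free_eqI[where p = m, OF lin_zetaT lin_comp[OF lin_ev lin_left_mult[OF flin]]])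
  fix w
  have "zeta f \<mu> w 1 z = f (z * evF (mono w))"
  proof (induction w arbitrary: z)
    case (Cons j w)
    have "zeta f \<mu> w (omega (uF j) * 1) z' = 0" for z'
    proof -
      have "vproj \<mu> (omega (uF j) * 1) = 0" using vproj_mult_E[of \<mu> "uKinv j" j] by simp
      then show ?thesis using zeta_vproj[of w "omega (uF j) * 1" z'] lin_0[OF lin_zeta_left[of w z']] by simp
    qed
    then show ?case by (simp add: Cons ev_Cons mult.assoc)
  qed simp
  then show "zetaT f \<mu> (mono w) 1 z = f (z * evF (mono w))" by simp
qed

lemma lin_zetaT_left: "lin uscale (*) (\<lambda>x. zetaT f \<mu> m x z)"
proof (induction m rule: free_induct)
  case (single w c)
  have "lin uscale (*) (\<lambda>x. c * zeta f \<mu> w x z)"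
    by (rule lin_comp[OF lin_zeta_left]) (simp add: linI[OF K.vector_space_axioms K.vector_space_axioms] distrib_left mult.left_commute)
  then show ?case by (simp add: lin_scale[OF lin_zetaT])
next
  case (add p r)
  then show ?case using lin_plus by (simp add: lin_add[OF lin_zetaT])
qed

lemma zetaT_vproj: "zetaT f \<mu> m (vproj \<mu> x) z = zetaT f \<mu> m x z"
  by (rule lin_free_eqI[where p = m, OF lin_zetaT lin_zetaT]) (simp only: zetaT_mono zeta_vproj)

text \<open>Solves \<open>zetaT_E\<close> for the pairing with \<open>uF i * evF p\<close>.
  Iteration reduces every pairing to the one with 1, at the price of raising \<open>m\<close>, which
  does not leave a layer of the Jantzen filtration.\<close>

lemma zetaT_F_evF:
  assumes "p \<in> Tw b"
  shows "zetaT f \<mu> m (uF i * evF p) z =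
    qpow (- rpair i (\<mu> - b)) * zetaT f \<mu> (vop \<mu> (GenE i) m) (evF p) z - zetaT f \<mu> m (evF p) (z * uE i)"
proof -
  have "zetaT f \<mu> m (uF i * evF p) z + zetaT f \<mu> m (evF p) (z * uE i) = zetaT f \<mu> (vop \<mu> (GenE i) m) (uKinv i * evF p) z"
    using zetaT_E[of m i "uKinv i * evF p" z] by (simp add: mult.assoc)
  also have "\<dots> = zetaT f \<mu> (vop \<mu> (GenE i) m) (vproj \<mu> (uKinv i * evF p)) z" by (simp only: zetaT_vproj)
  also have "\<dots> = qpow (- rpair i (\<mu> - b)) * zetaT f \<mu> (vop \<mu> (GenE i) m) (evF p) z"
    unfolding vproj_Kinv_evF[OF assms] lin_scale[OF lin_zetaT_left] ..
  finally show ?thesis by (simp add: eq_diff_eq)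
qed

end

text \<open>\<open>\<Delta>(w)\<close> applied to the family \<open>R\<close>: its values are
  multiplied by the first tensor factor, its argument by the second. The pairings of the result are
  computed by \<open>zeta\<close>.\<close>

primrec Theta :: "('i::cartan_datum uq => 'i tens) => 'i list => 'i uq => 'i tens" where
  "Theta R [] = R"
| "Theta R (j # w) = (\<lambda>z. mono [j] * Theta R w (z * uKinv j) + Theta R w (z * uF j))"

definition ThetaT :: "('i::cartan_datum uq => 'i tens) => 'i tens => 'i uq => 'i tens"
  where "ThetaT R m z = lx psc (\<lambda>w. Theta R w z) m"

lemma lin_ThetaT: "lin psc psc (\<lambda>m. ThetaT R m z)" unfolding ThetaT_def by (rule PQ.lin_lx)

lemma ThetaT_mono [simp]: "ThetaT R (mono w) z = Theta R w z" by (simp add: ThetaT_def)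

lemma Theta_shap:
  assumes "\<And>x z. shap m x (evF (R z)) = C * zeta f m [] x z"
  shows "shap m x (evF (Theta R w z)) = C * zeta f m w x z"
proof (induction w arbitrary: x z)
  case Nil
  then show ?case using assms by simp
next
  case (Cons j w)
  then show ?case by (simp add: ev_mult shap_mult_right distrib_left)
qed

lemma ThetaT_shap:
  assumes "\<And>x z. shap u x (evF (R z)) = C * zeta f u [] x z"
  shows "shap u x (evF (ThetaT R m z)) = C * zetaT f u m x z"
proof (rule lin_free_eqI[where p = m])
  show "lin psc (*) (\<lambda>m. shap u x (evF (ThetaT R m z)))"
    by (rule lin_comp[OF lin_ThetaT lin_comp[OF lin_ev lin_shap]])
  show "lin psc (*) (\<lambda>m. C * zetaT f u m x z)"
    by (rule lin_comp[OF lin_zetaT]) (simp add: linI[OF K.vector_space_axioms K.vector_space_axioms] distrib_left mult.left_commute)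
  show "shap u x (evF (ThetaT R (mono w) z)) = C * zetaT f u (mono w) x z" for w
    using Theta_shap[of u R C f x w z, OF assms] by simp
qed

lemma ThetaT_lfT:
  assumes "\<And>z. lfT (\<lambda>s. R s z)" "lfT m"
  shows "lfT (\<lambda>s. ThetaT (R s) (m s) z)"
proof (rule lfT_op[OF assms(2) lin_ThetaT])
  have w: "lfT (\<lambda>s. Theta (R s) w z)" for w
  proof (induction w arbitrary: z)
    case Nil
    then show ?case using assms(1) by simp
  next
    case (Cons j w)
    show ?case unfolding Theta.simps by (intro lfT.add lfT_linear[OF _ lin_mult_left] Cons)
  qed
  fix v
  show "lfT (\<lambda>s. ThetaT (R s) v z)"
  proof (induction v rule: free_induct)
    case (single w c)
    show ?case using lfT_scale[OF w lf_const] by (simp add: lin_scale[OF lin_ThetaT])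
  next
    case (add p r)
    then show ?case by (simp add: lin_add[OF lin_ThetaT] lfT.add)
  qed
qed

lemma part_Cons: "part d (mono [j] * q) = mono [j] * part (d - simple_root j) q"
proof (rule lin_free_eqI[where p = q, OF lin_comp[OF lin_mult_left lin_part] lin_comp[OF lin_part lin_mult_left]])
  fix w
  have "simple_root j + wt w = d \<longleftrightarrow> wt w = d - simple_root j" by (auto simp: algebra_simps)
  then show "part d (mono [j] * mono w) = mono [j] * part (d - simple_root j) (mono w)"
    unfolding mono_Cons[of j w, symmetric] part_mono wt_Cons by (simp add: mono_Cons[of j w])
qed

lemma height_simple: "height (simple_root i) = 1" by (simp add: height_def simple_root_def)

text \<open>The component of top height arises only when all letters act on the first tensor factor;
  then the second factor contributes just the elements \<open>uKinv j\<close> to the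
  argument.\<close>

lemma Theta_top:
  assumes R: "\<And>z d. height d > h ==> part d (R z) \<in> serre_ideal"
  shows "height d > height (wt w) + h ==> part d (Theta R w z) \<in> serre_ideal"
    and "height d = height (wt w) + h ==>
      part d (Theta R w z) \<approx> mono w * part (d - wt w) (R (fold (\<lambda>j z. z * uKinv j) w z))"
proof (induction w arbitrary: d z)
  case Nil
  {
    case 1
    then show ?case using R by (simp add: height_def zero_fun_apply)
  next
    case 2
    then show ?case by (simp add: mono_Nil)
  }
next
  case (Cons j w)
  have h: "height (d - simple_root j) = height d - 1" for d by (simp add: height_diff height_simple)
  {
    case 1
    then have "part (d - simple_root j) (Theta R w (z * uKinv j)) \<in> serre_ideal" "part d (Theta R w (z * uF j)) \<in> serre_ideal"
      using Cons(1) by (simp_all add: h wt_Cons height_add height_simple)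
    then show ?case by (simp add: part_Cons serre_ideal_mult_left)
  next
    case 2
    let ?z = "z * uKinv j"
    have "part (d - simple_root j) (Theta R w ?z) \<approx> mono w * part (d - simple_root j - wt w) (R (fold (\<lambda>j z. z * uKinv j) w ?z))"
      using 2 by (intro Cons(2)) (simp add: h wt_Cons height_add height_simple)
    then have a: "mono [j] * (part (d - simple_root j) (Theta R w ?z) - mono w * part (d - simple_root j - wt w) (R (fold (\<lambda>j z. z * uKinv j) w ?z))) \<in> serre_ideal"
      by (rule serre_ideal_mult_left)
    have b: "part d (Theta R w (z * uF j)) \<in> serre_ideal"
      using 2 by (intro Cons(1)) (simp add: h wt_Cons height_add height_simple)
    have e: "d - simple_root j - wt w = d - wt (j # w)" by (simp add: wt_Cons algebra_simps)
    have q: "part d (Theta R (j # w) z) - mono (j # w) * part (d - wt (j # w)) (R (fold (\<lambda>j z. z * uKinv j) (j # w) z)) =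
        mono [j] * (part (d - simple_root j) (Theta R w ?z) - mono w * part (d - simple_root j - wt w) (R (fold (\<lambda>j z. z * uKinv j) w ?z))) +
        part d (Theta R w (z * uF j))" unfolding e[symmetric] Theta.simps fold.simps comp_apply
      by (simp only: part_simps part_Cons mono_Cons[of j w] right_diff_distrib mult.assoc diff_add_eq)
    show ?case unfolding q by (rule serre_ideal_closed(2)[OF a b])
  }
qed

lemma fold_Kinv_eq:
  assumes "wt v = wt w"
  shows "fold (\<lambda>j z. z * uKinv j) v = fold (\<lambda>j z. z * uKinv j) w"
proof (rule fold_multiset_equiv)
  show "(\<lambda>z. z * uKinv x) \<circ> (\<lambda>z. z * uKinv y) = (\<lambda>z. z * uKinv y) \<circ> (\<lambda>z. z * uKinv x)" for x y :: 'a
    by (rule ext) (simp add: mult.assoc uK_comm)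
  have "count_list v x = count_list w x" for x using fun_cong[OF assms, of x] by (simp add: wt_def)
  then show "mset v = mset w" by (intro multiset_eqI) (simp add: count_mset count_list_eq_length_filter)
qed

lemma fold_Kinv_surj: "\<exists>z'. fold (\<lambda>j z. z * uKinv j) w z' = z"
proof (induction w)
  case (Cons j w)
  then obtain z' where "fold (\<lambda>j z. z * uKinv j) w z' = z" by blast
  then show ?case by (intro exI[of _ "z' * uK j"]) (simp add: mult.assoc)
qed simp

lemma ThetaT_top:
  assumes "\<And>z d. height d > height b ==> part d (R z) \<in> serre_ideal" "q \<in> Tw g" "wt w0 = g"
  shows "part (g + b) (ThetaT R q z) \<approx> q * part b (R (fold (\<lambda>j z. z * uKinv j) w0 z))" using assms(2)
proof (induction rule: Tw_induct)
  case (word w c)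
  have "fold (\<lambda>j z. z * uKinv j) w z = fold (\<lambda>j z. z * uKinv j) w0 z"
    using fold_Kinv_eq[of w w0] word assms(3) by simp
  then have "part (g + b) (Theta R w z) \<approx> mono w * part b (R (fold (\<lambda>j z. z * uKinv j) w0 z))"
    using Theta_top(2)[of "height b" R "g + b" w z, OF assms(1)] word by (simp add: height_add)
  then have "psc c (part (g + b) (Theta R w z) - mono w * part b (R (fold (\<lambda>j z. z * uKinv j) w0 z))) \<in> serre_ideal"
    by (rule serre_ideal_closed)
  then show ?case by (simp add: lin_scale[OF lin_ThetaT] P.scale_right_diff_distrib psc_mult_left)
next
  case (add p r)
  from serre_ideal_closed(2)[OF add] show ?case by (simp add: lin_add[OF lin_ThetaT] distrib_right algebra_simps)
qed (simp add: lin_0[OF lin_ThetaT])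

section \<open>The Jantzen filtration\<close>

context line
begin

text \<open>The layer \<open>j\<close> for families rather than vectors: the values at
  \<open>s = 0\<close> of its members form the \<open>j\<close>-th term of the Jantzen filtration of
  the Verma module at \<open>\<nu>0\<close>.\<close>

definition jant :: "nat => (rat => 'i tens) => bool"
  where "jant j m \<longleftrightarrow> lfT m \<and> (\<forall>p. tdiv j (\<lambda>s. shap (\<nu> s) (evF p) (evF (m s))))"

lemma tdiv_words:
  assumes "\<And>s. lin psc (*) (\<phi> s)" "\<And>w. tdiv j (\<lambda>s. \<phi> s (mono w))"
  shows "tdiv j (\<lambda>s. \<phi> s p)"
proof (induction p rule: free_induct)
  case (single w c)
  then show ?case using tdiv_mult[OF lf_const assms(2)] by (simp add: lin_scale[OF assms(1)])
next
  case (add p r)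
  then show ?case by (simp add: lin_add[OF assms(1)] tdiv_add)
qed

lemma lin_shap_evF_left: "lin psc (*) (\<lambda>p. shap \<mu> (evF p) y)" by (rule lin_comp[OF lin_ev lin_shap_left])

lemma jant_I:
  assumes "lfT m" "\<And>w. tdiv j (\<lambda>s. shap (\<nu> s) (evF (mono w)) (evF (m s)))"
  shows "jant j m" unfolding jant_def
proof (intro conjI allI)
  show "tdiv j (\<lambda>s. shap (\<nu> s) (evF p) (evF (m s)))" for p
    by (rule tdiv_words[where \<phi> = "\<lambda>s p. shap (\<nu> s) (evF p) (evF (m s))", OF lin_shap_evF_left assms(2)])
qed (rule assms(1))

lemma jant_E: "jant j m ==> jant j (\<lambda>s. vop (\<nu> s) (GenE i) (m s))"
proof (rule jant_I)
  assume m: "jant j m"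
  then show "lfT (\<lambda>s. vop (\<nu> s) (GenE i) (m s))" by (intro lfT_E) (simp add: jant_def)
  show "tdiv j (\<lambda>s. shap (\<nu> s) (evF (mono w)) (evF (vop (\<nu> s) (GenE i) (m s))))" for w
    unfolding shap_E[OF mono_Tw] using m by (intro tdiv_mult lf_rpair) (simp add: jant_def)
qed

lemma jant_part: "jant j m ==> jant j (\<lambda>s. part c (m s))"
proof -
  assume m: "jant j m"
  have "shap (\<nu> s) (evF p) (evF (part c (m s))) = shap (\<nu> s) (evF (part c p)) (evF (m s))" for s p
    using shap_part'[of "\<nu> s" p c "m s"] shap_part[of "\<nu> s" c p "m s"] by simp
  moreover have "lfT (\<lambda>s. part c (m s))" using m by (intro lfT_linear[OF _ lin_part]) (simp add: jant_def)
  ultimately show ?thesis using m by (simp add: jant_def)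
qed

text \<open>The \<open>j\<close>-th term of the Jantzen filtration at \<open>\<nu>0\<close> is not
  zero, witnessed in a single weight.\<close>

definition extends :: "nat => bool"
  where "extends j \<longleftrightarrow> (\<exists>m c. jant j m \<and> (\<forall>s. m s \<in> Tw c) \<and> m 0 \<notin> serre_ideal)"

text \<open>The family is raised until its value at \<open>s = 0\<close> is singular. Weight 0 is
  excluded by \<open>j > 0\<close>, because there the pairing with 1 is the constant term.\<close>

lemma extends_singular:
  assumes "extends j" "j > 0"
  shows "\<exists>m. \<exists>g\<in>singular_weights \<nu>0. jant j m \<and> (\<forall>s. m s \<in> Tw g) \<and> m 0 \<notin> serre_ideal"
proof -
  obtain m g where m: "jant j m" "\<And>s. m s \<in> Tw g" "m 0 \<notin> serre_ideal" using assms(1) unfolding extends_def by blast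
  have "\<forall>m. m 0 = p \<longrightarrow> jant j m \<longrightarrow> (\<forall>s. m s \<in> Tw g) \<longrightarrow>
      (\<exists>m. \<exists>g\<in>singular_weights \<nu>0. jant j m \<and> (\<forall>s. m s \<in> Tw g) \<and> m 0 \<notin> serre_ideal)"
    if "p \<in> Tw g" "p \<notin> serre_ideal" for p g using that
  proof (induction rule: Tw_height_induct)
    case (step p g)
    show ?case
    proof (intro allI impI)
      fix m assume m: "m 0 = p" "jant j m" "\<forall>s. m s \<in> Tw g"
      show "\<exists>m. \<exists>g\<in>singular_weights \<nu>0. jant j m \<and> (\<forall>s. m s \<in> Tw g) \<and> m 0 \<notin> serre_ideal"
      proof (cases "singular \<nu>0 p")
        case True
        have "g \<noteq> 0"
        proof
          assume "g = 0"
          then have "p = psc (const p) 1" using step(1) Tw_zero_scalar by blast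
          moreover have "tdiv j (\<lambda>s. shap (\<nu> s) (evF 1) (evF (m s)))" using m(2) unfolding jant_def by blast
          from tdiv_at_0[OF this assms(2)] have "const p = 0" by (simp add: m(1))
          ultimately show False using step(2) by (metis P.scale_zero_left serre_ideal_closed(1))
        qed
        then have "g \<in> singular_weights \<nu>0"
          using singular_weight[OF step(1) True] Tw_Qplus[OF step(1,2)] by (simp add: singular_weights_def)
        then show ?thesis using m step(2) by blast
      next
        case False
        then obtain i where i: "vop \<nu>0 (GenE i) p \<notin> serre_ideal" using step(2) by (auto simp: singular_def)
        let ?m = "\<lambda>s. vop (\<nu> s) (GenE i) (m s)"
        have a: "?m 0 = vop \<nu>0 (GenE i) p" by (simp add: m(1))
        have b: "jant j ?m" by (rule jant_E) (rule m)
        have c: "\<forall>s. ?m s \<in> Tw (g - simple_root i)" using m(3) vop_E_Tw by blast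
        show ?thesis by (rule step(3)[OF vop_E_Tw[OF step(1)] i, THEN spec, THEN mp, THEN mp, THEN mp, OF a b c])
      qed
    qed
  qed
  then show ?thesis using m by blast
qed

lemma lfT_coords:
  assumes "lfT m" "g \<in> Qplus"
  shows "\<exists>C. (\<forall>a. lf (C a)) \<and> (\<forall>s. evF (part g (m s)) = (\<Sum>a<dim g. uscale (C a s) (Y g ! a)))" using assms(1)
proof (induction rule: lfT.induct)
  case (single c v)
  obtain d where "evF (part g v) = (\<Sum>a<dim g. uscale (d a) (Y g ! a))"
    using basis_familyD(2)[OF basis assms(2) part_Tw] by blast
  then show ?case using single by (intro exI[of _ "\<lambda>a s. c s * d a"]) (auto simp: U.scale_sum_right)
next
  case (add m m')
  then obtain C D where "\<forall>a. lf (C a)" "\<forall>s. evF (part g (m s)) = (\<Sum>a<dim g. uscale (C a s) (Y g ! a))"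
    "\<forall>a. lf (D a)" "\<forall>s. evF (part g (m' s)) = (\<Sum>a<dim g. uscale (D a s) (Y g ! a))" by blast
  then show ?case by (intro exI[of _ "\<lambda>a s. C a s + D a s"]) (auto simp: U.scale_left_distrib sum.distrib)
qed

text \<open>In a fixed weight the order \<open>N\<close> of the Gram determinant bounds the layers:
  by Cramer's rule the coordinates of a family in a layer \<open>j > N\<close> are divisible by the
  power \<open>j - N\<close> of \<open>tt\<close> and vanish at 0.\<close>

lemma jant_bound:
  assumes "c \<in> Qplus"
  shows "\<exists>N. \<forall>j m. jant j m \<longrightarrow> (\<forall>s. m s \<in> Tw c) \<longrightarrow> m 0 \<notin> serre_ideal \<longrightarrow> j \<le> N"
proof -
  obtain N d where d: "lf d" "d 0 \<noteq> 0" "\<And>s. gdet c s = tt s ^ N * d s"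
    using lf_order[OF lf_gdet gdet_nonzero[OF order_refl assms]] by blast
  have "j \<le> N" if m: "jant j m" "\<And>s. m s \<in> Tw c" "m 0 \<notin> serre_ideal" for j m
  proof (rule ccontr)
    assume "\<not> j \<le> N"
    obtain C where C: "\<And>a. lf (C a)" "\<And>s. evF (part c (m s)) = (\<Sum>a<dim c. uscale (C a s) (Y c ! a))"
      using lfT_coords[OF _ assms] m(1) unfolding jant_def by blast
    have Cm: "evF (m s) = (\<Sum>a<dim c. uscale (C a s) (Y c ! a))" for s
      using C(2)[of s] part_of_Tw[OF m(2), of c] by simp
    have "C a 0 = 0" if a: "a < dim c" for a
    proof -
      have "tdiv j (\<lambda>s. \<Sum>b<dim c. gadj c s a b * shap (\<nu> s) (Y c ! b) (evF (m s)))"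
      proof (intro tdiv_sum tdiv_mult lf_gadj a)
        fix b assume b: "b \<in> {..<dim c}"
        then show "b < dim c" by simp
        obtain p where "Y c ! b = evF p" using basis_evF[OF assms, of b] b by auto
        then show "tdiv j (\<lambda>s. shap (\<nu> s) (Y c ! b) (evF (m s)))" using m(1) by (simp add: jant_def)
      qed
      then have "tdiv j (\<lambda>s. gdet c s * C a s)" by (simp only: gadj_coords[OF Cm a])
      then have "tdiv (N + (j - N)) (\<lambda>s. tt s ^ N * (d s * C a s))" using \<open>\<not> j \<le> N\<close> by (simp add: d(3) mult.assoc)
      then have "tdiv (j - N) (\<lambda>s. d s * C a s)" by (rule tdiv_cancel_power[OF lf_mult[OF d(1) C(1)]])
      then have "tdiv (j - N) (C a)" by (rule tdiv_cancel_unit[OF d(1,2) C(1)])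
      then show ?thesis by (rule tdiv_at_0) (use \<open>\<not> j \<le> N\<close> in simp)
    qed
    then have "evF (m 0) = 0" by (simp add: Cm)
    then show False using m(3) by (simp add: evF_eq_0_iff)
  qed
  then show ?thesis by blast
qed

text \<open>The bound of \<open>jant_bound\<close> depends on the weight. Singular vectors confine
  the weights to a finite set, and the sum of the bounds over this set serves for all of
  them.\<close>

lemma extends_bounded: "\<exists>N. \<forall>j. extends j \<longrightarrow> j \<le> N"
proof -
  have "\<exists>N. \<forall>j m. jant j m \<longrightarrow> (\<forall>s. m s \<in> Tw c) \<longrightarrow> m 0 \<notin> serre_ideal \<longrightarrow> j \<le> N"
    if "c \<in> singular_weights \<nu>0" for c using that by (intro jant_bound) (simp add: singular_weights_def)
  then obtain N where N: "\<And>c j m. c \<in> singular_weights \<nu>0 ==> jant j m ==> \<forall>s. m s \<in> Tw c ==> m 0 \<notin> serre_ideal ==> j \<le> N c"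
    by metis
  have "j \<le> sum N (singular_weights \<nu>0)" if j: "extends j" for j
  proof (cases "j > 0")
    case True
    obtain m c where m: "c \<in> singular_weights \<nu>0" "jant j m" "\<forall>s. m s \<in> Tw c" "m 0 \<notin> serre_ideal"
      using extends_singular[OF j True] by blast
    have "j \<le> N c" using N m by blast
    also have "\<dots> \<le> sum N (singular_weights \<nu>0)" using m(1) finite_singular_weights by (intro member_le_sum) auto
    finally show ?thesis .
  qed simp
  then show ?thesis by blast
qed

end

section \<open>Invariance under the twisted kernel\<close>

locale line_regular = line \<nu>0 \<eta> s0 Y
  for \<nu>0 \<eta> :: "'i::cartan_datum => rat" and s0 Y +
  fixes f :: "'i uq => qfield"
  assumes regular: "J_regular Y \<nu>0" and f: "f \<in> F0 (Kminus \<nu>0)"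
begin

lemma f_Freg: "f \<in> Freg" by (rule F0_D) (rule f)

lemmas f_lin = Freg_lin[OF f_Freg]
lemmas f_T = F0_D(2)[OF f]
lemmas f_lin_mult = lin_left_mult[OF f_lin]

text \<open>The family is paired with the solution \<open>M\<close> of
  \<open>regular_solution\<close>; by symmetry of the form this is
  \<open>D s * f (z * evF (m s))\<close>, and \<open>D\<close> is invertible at 0.\<close>

lemma jant_f:
  assumes "jant j m"
  shows "tdiv j (\<lambda>s. f (z * evF (m s)))"
proof -
  obtain D where D: "lf D" "D 0 \<noteq> 0"
    "\<forall>z. \<exists>M. lfT M \<and> (\<forall>p s. shap (\<nu> s) (evF p) (evF (M s)) = D s * f (z * evF p))"
    using regular_solution[OF regular f] by blast
  then obtain M where M: "lfT M" "\<And>p s. shap (\<nu> s) (evF p) (evF (M s)) = D s * f (z * evF p)" by blast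
  have "tdiv j (\<lambda>s. shap (\<nu> s) (evF (M s)) (evF (m s)))"
    using assms by (intro lfT_tdiv[OF M(1), where \<phi> = "\<lambda>s p. shap (\<nu> s) (evF p) (evF (m s))"] lin_shap_evF_left) (simp add: jant_def)
  moreover have "shap (\<nu> s) (evF (M s)) (evF (m s)) = D s * f (z * evF (m s))" for s
    by (subst shap_commute) (rule M(2))
  ultimately have t: "tdiv j (\<lambda>s. D s * f (z * evF (m s)))" by (simp only:)
  have "lf (\<lambda>s. f (z * evF (m s)))"
    by (rule lfT_lf[where \<phi> = "\<lambda>s p. f (z * evF p)", OF _ lin_comp[OF lin_ev f_lin_mult] lf_const])
       (use assms in \<open>simp add: jant_def\<close>)
  then show ?thesis by (rule tdiv_cancel_unit[OF D(1,2) _ t])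
qed

lemma jant_zeta:
  assumes "jant j m"
  shows "tdiv j (\<lambda>s. zetaT f (\<nu> s) (m s) (evF (mono w)) z)" using assms
proof (induction w arbitrary: m z)
  case Nil
  show ?case using jant_f[OF Nil] by (simp add: zetaT_one[OF f_lin f_T])
next
  case (Cons i w)
  show ?case unfolding ev_Cons zetaT_F_evF[OF f_lin f_T mono_Tw]
    by (intro tdiv_diff tdiv_mult lf_rpair Cons.IH jant_E Cons.prems)
qed

abbreviation active :: "('i => rat) set"
  where "active \<equiv> support_weights f"

lemmas finite_active = support_weights(1)[OF f_Freg]
lemmas inactive = support_weights(3)[OF f_Freg]

lemma f_lin_theta: "lin uscale (*) (\<lambda>y. f (z * theta y))" by (rule lin_comp[OF lin_theta f_lin_mult])

text \<open>A solution of the Shapovalov equations for \<open>f\<close> twisted by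
  \<open>theta\<close>, with a pole of order at most \<open>i\<close>, in coordinates
  \<open>w\<close> with respect to the chosen bases; \<open>d\<close> is invertible at the base
  point.\<close>

definition expansion :: "nat => (rat => qfield) => (('i => rat) => nat => rat => 'i uq => qfield) => bool"
  where "expansion i d w \<longleftrightarrow> lf d \<and> d 0 \<noteq> 0 \<and> (\<forall>b\<in>active. \<forall>a<dim b. \<forall>z. lf (\<lambda>s. w b a s z)) \<and>
    (\<forall>s p z. tt s ^ i * d s * f (z * theta (evF p)) =
      (\<Sum>b\<in>active. \<Sum>a<dim b. shap (\<nu> s) (evF p) (Y b ! a) * w b a s z))"

lemma expansion_exists: "\<exists>i d w. expansion i d w"
proof -
  \<comment> \<open>The product of the Gram determinants of all active weights is a common
    denominator of the solution.\<close>
  define G where "G s = (\<Prod>B\<in>active. gdet B s)" for s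
  have "lf G" unfolding G_def by (intro lf_prod lf_gdet)
  moreover have "G s0 \<noteq> 0"
    using finite_active gdet_nonzero[OF order_refl] by (auto simp: G_def support_weights_def)
  ultimately obtain i d where d: "lf d" "d 0 \<noteq> 0" "\<And>s. G s = tt s ^ i * d s" using lf_order by blast
  define w where "w B a s z = (\<Prod>c\<in>active - {B}. gdet c s) * (\<Sum>b<dim B. gadj B s a b * f (z * theta (Y B ! b)))" for B a s z
  have "lf (\<lambda>s. w B a s z)" if "a < dim B" for B a z
    unfolding w_def using that by (intro lf_mult lf_prod lf_sum lf_gdet lf_gadj lf_const) auto
  moreover have "G s * f (z * theta (evF p)) = (\<Sum>B\<in>active. \<Sum>a<dim B. shap (\<nu> s) (evF p) (Y B ! a) * w B a s z)" for s z p
  proof -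
    have "(\<Sum>a<dim B. shap (\<nu> s) (evF p) (Y B ! a) * w B a s z) = G s * f (z * theta (evF (part B p)))"
      if B: "B \<in> active" for B
    proof -
      have Q: "B \<in> Qplus" using B by (simp add: support_weights_def)
      have *: "shap (\<nu> s) (evF p) (Y B ! a) = shap (\<nu> s) (evF (part B p)) (Y B ! a)" if "a < dim B" for a
      proof -
        obtain x where "x \<in> Tw B" "Y B ! a = evF x" using basis_evF[OF Q \<open>a < dim B\<close>] by blast
        then show ?thesis using shap_part'[of "\<nu> s" p B x] part_of_Tw[of x B B] by simp
      qed
      have "(\<Sum>a<dim B. shap (\<nu> s) (evF p) (Y B ! a) * w B a s z) =
          (\<Prod>c\<in>active - {B}. gdet c s) *
          (\<Sum>a<dim B. \<Sum>b<dim B. shap (\<nu> s) (evF (part B p)) (Y B ! a) * gadj B s a b * f (z * theta (Y B ! b)))"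
        unfolding sum_distrib_left w_def by (intro sum.cong refl, subst *) (simp, simp only: ac_simps)
      also have "\<dots> = (\<Prod>c\<in>active - {B}. gdet c s) * (gdet B s * f (z * theta (evF (part B p))))"
        by (simp only: gadj_solve[OF Q part_Tw f_lin_theta])
      also have "\<dots> = G s * f (z * theta (evF (part B p)))"
        unfolding G_def prod.remove[OF finite_active B] by (simp only: ac_simps)
      finally show ?thesis .
    qed
    then have "(\<Sum>B\<in>active. \<Sum>a<dim B. shap (\<nu> s) (evF p) (Y B ! a) * w B a s z) =
        G s * (\<Sum>B\<in>active. f (z * theta (evF (part B p))))" by (simp add: sum_distrib_left)
    also have "(\<Sum>B\<in>active. f (z * theta (evF (part B p)))) = f (z * theta (evF p))"
      by (rule sum_active[OF f_lin_theta finite_active inactive])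
    finally show ?thesis ..
  qed
  ultimately have "expansion i d w" using d by (simp add: expansion_def)
  then show ?thesis by blast
qed

text \<open>When all coordinates vanish at 0 they are divisible by \<open>tt\<close>, and one factor
  cancels on both sides.\<close>

lemma expansion_step:
  assumes "expansion (Suc i) d w" "\<And>B a z. B \<in> active ==> a < dim B ==> w B a 0 z = 0"
  shows "\<exists>w. expansion i d w"
proof -
  have e: "lf d" "d 0 \<noteq> 0" "\<And>B a z. B \<in> active ==> a < dim B ==> lf (\<lambda>s. w B a s z)"
    "\<And>s p z. tt s ^ Suc i * d s * f (z * theta (evF p)) =
      (\<Sum>B\<in>active. \<Sum>a<dim B. shap (\<nu> s) (evF p) (Y B ! a) * w B a s z)"
    using assms(1) by (simp_all add: expansion_def)
  have "\<exists>b. lf b \<and> (\<forall>s. w B a s z = tt s * b s)" if "B \<in> active" "a < dim B" for B a z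
    by (rule lf_div[OF e(3)[OF that] assms(2)[OF that]])
  then obtain v where v: "\<And>B a z. B \<in> active ==> a < dim B ==> lf (v B a z)"
    "\<And>B a z s. B \<in> active ==> a < dim B ==> w B a s z = tt s * v B a z s" by metis
  have "tt s ^ i * d s * f (z * theta (evF p)) =
      (\<Sum>B\<in>active. \<Sum>a<dim B. shap (\<nu> s) (evF p) (Y B ! a) * v B a z s)" for s p z
  proof (rule lf_cancel_tt[where i = 1])
    show "lf (\<lambda>s. tt s ^ i * d s * f (z * theta (evF p)))" by (intro lf_mult lf_tt e lf_const)
    show "lf (\<lambda>s. \<Sum>B\<in>active. \<Sum>a<dim B. shap (\<nu> s) (evF p) (Y B ! a) * v B a z s)"
      using v(1) by (intro lf_sum lf_mult lf_shap) auto
    fix s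
    have "tt s ^ 1 * (tt s ^ i * d s * f (z * theta (evF p))) = tt s ^ Suc i * d s * f (z * theta (evF p))"
      by (simp only: power_one_right power_Suc mult.assoc)
    also have "\<dots> = (\<Sum>B\<in>active. \<Sum>a<dim B. tt s ^ 1 * (shap (\<nu> s) (evF p) (Y B ! a) * v B a z s))"
      unfolding e(4) by (intro sum.cong refl) (simp add: v(2) mult.left_commute)
    finally show "tt s ^ 1 * (tt s ^ i * d s * f (z * theta (evF p))) =
        tt s ^ 1 * (\<Sum>B\<in>active. \<Sum>a<dim B. shap (\<nu> s) (evF p) (Y B ! a) * v B a z s)"
      by (simp only: sum_distrib_left)
  qed
  then have "expansion i d (\<lambda>B a s z. v B a z s)" using e v by (simp add: expansion_def)
  then show ?thesis by blast
qed

text \<open>The pairings of \<open>\<Delta>(m) R\<close> are \<open>tt s ^ i * d s\<close> times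
  values of \<open>zetaT\<close>, which are divisible by the \<open>j\<close>-th power of
  \<open>tt\<close>. At \<open>s = 0\<close> the family is non-zero because its top component is a
  product of two elements outside the Serre ideal.\<close>

lemma extends_step:
  assumes w: "expansion i d w" and nz: "b0 \<in> active" "a0 < dim b0" "w b0 a0 0 z0 \<noteq> 0"
    and j: "extends j"
  shows "extends (i + j)"
proof -
  have e: "lf d" "d 0 \<noteq> 0" "\<And>b a z. b \<in> active ==> a < dim b ==> lf (\<lambda>s. w b a s z)"
    "\<And>s p z. tt s ^ i * d s * f (z * theta (evF p)) =
      (\<Sum>b\<in>active. \<Sum>a<dim b. shap (\<nu> s) (evF p) (Y b ! a) * w b a s z)" using w by (simp_all add: expansion_def)
  have Q: "b \<in> Qplus" if "b \<in> active" for b using that by (simp add: support_weights_def)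
  have "\<exists>p. p \<in> Tw b \<and> Y b ! a = evF p" if "b \<in> active" "a < dim b" for b a using basis_evF[OF Q] that by blast
  then obtain y where y: "\<And>b a. b \<in> active ==> a < dim b ==> y b a \<in> Tw b"
    "\<And>b a. b \<in> active ==> a < dim b ==> Y b ! a = evF (y b a)" by metis
  define R where "R s z = (\<Sum>b\<in>active. \<Sum>a<dim b. psc (w b a s z) (y b a))" for s z
  have R_lf: "lfT (\<lambda>s. R s z)" for z unfolding R_def using e(3) by (intro lfT_sum lfT.single) auto
  have R_shap: "shap (\<nu> s) x (evF (R s z)) = tt s ^ i * d s * zeta f (\<nu> s) [] x z" for s x z
  proof -
    obtain p where p: "vproj (\<nu> s) x = evF p" using vproj_range by blast
    have "shap (\<nu> s) x (evF (R s z)) = shap (\<nu> s) (evF p) (evF (R s z))" unfolding p[symmetric] by simp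
    also have "\<dots> = (\<Sum>b\<in>active. \<Sum>a<dim b. shap (\<nu> s) (evF p) (Y b ! a) * w b a s z)"
      unfolding R_def ev_sum shap_sum by (intro sum.cong refl) (simp add: y(2) mult.commute)
    also have "\<dots> = tt s ^ i * d s * zeta f (\<nu> s) [] x z" unfolding e(4)[symmetric] by (simp add: p)
    finally show ?thesis .
  qed
  have R_part: "part b (R s z) = (if b \<in> active then \<Sum>a<dim b. psc (w b a s z) (y b a) else 0)" for b s z
  proof -
    have "part b (R s z) = (\<Sum>c\<in>active. if c = b then \<Sum>a<dim b. psc (w b a s z) (y b a) else 0)"
      unfolding R_def lin_sum[OF lin_part] by (intro sum.cong refl) (auto simp: part_of_Tw[OF y(1)])
    then show ?thesis using finite_active by simp
  qed
  define S where "S = {b \<in> active. \<exists>z. part b (R 0 z) \<notin> serre_ideal}"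
  have "b0 \<in> S"
  proof -
    have "part b0 (R 0 z0) \<notin> serre_ideal"
    proof
      assume "part b0 (R 0 z0) \<in> serre_ideal"
      then have "evF (part b0 (R 0 z0)) = 0" by (rule evF_serre_ideal)
      then have "(\<Sum>a<dim b0. uscale (w b0 a 0 z0) (Y b0 ! a)) = 0" using nz(1) by (simp add: R_part ev_sum y(2))
      from basis_familyD(3)[OF basis Q[OF nz(1)] this nz(2)] show False using nz(3) by simp
    qed
    then show ?thesis using nz(1) by (auto simp: S_def)
  qed
  moreover have "finite S" unfolding S_def using finite_active by simp
  \<comment> \<open>A weight of maximal height in which \<open>R 0\<close> does not vanish; the
    maximality is what \<open>ThetaT_top\<close> requires.\<close>
  ultimately obtain b where b: "b \<in> S" "\<And>D. D \<in> S ==> height D \<le> height b" using finite_max_height[of S] by blast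
  then obtain z1 where z1: "part b (R 0 z1) \<notin> serre_ideal" by (auto simp: S_def)
  have above: "part D (R 0 z) \<in> serre_ideal" if "height D > height b" for D z
  proof (cases "D \<in> active")
    case True
    then show ?thesis using b(2)[of D] that by (auto simp: S_def)
  qed (simp add: R_part)
  obtain m c where m: "jant j m" "\<And>s. m s \<in> Tw c" "m 0 \<notin> serre_ideal" using j unfolding extends_def by blast
  obtain w0 where w0: "wt w0 = c" using not_serre_word[OF m(2,3)] by blast
  \<comment> \<open>The argument is chosen so that, after collecting the factors
    \<open>uKinv j\<close>, the family \<open>R\<close> is evaluated at \<open>z1\<close>.\<close>
  obtain z' where z': "fold (\<lambda>j z. z * uKinv j) w0 z' = z1" using fold_Kinv_surj by blast
  define \<Psi> where "\<Psi> s = ThetaT (R s) (m s) z'" for s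
  have "jant (i + j) \<Psi>"
  proof (rule jant_I)
    show "lfT \<Psi>" unfolding \<Psi>_def using m(1) by (intro ThetaT_lfT R_lf) (simp add: jant_def)
    fix v
    have "tdiv (i + j) (\<lambda>s. tt s ^ i * (d s * zetaT f (\<nu> s) (m s) (evF (mono v)) z'))"
      by (intro tdiv_power_mult tdiv_mult e jant_zeta m)
    then show "tdiv (i + j) (\<lambda>s. shap (\<nu> s) (evF (mono v)) (evF (\<Psi> s)))"
      unfolding \<Psi>_def by (simp only: ThetaT_shap[of "\<nu> _" "R _", OF R_shap] mult.assoc)
  qed
  then have "jant (i + j) (\<lambda>s. part (c + b) (\<Psi> s))" by (rule jant_part)
  moreover have "part (c + b) (\<Psi> 0) \<notin> serre_ideal"
  proof -
    have "part (c + b) (\<Psi> 0) \<approx> m 0 * part b (R 0 z1)"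
      unfolding \<Psi>_def z'[symmetric] by (rule ThetaT_top[OF above m(2) w0])
    moreover have "m 0 * part b (R 0 z1) \<notin> serre_ideal" by (rule serre_ideal_domain[OF m(2,3) part_Tw z1])
    ultimately show ?thesis
      using serre_ideal_closed(4) by (metis (no_types, lifting) diff_diff_eq2 add_diff_cancel_left')
  qed
  ultimately show ?thesis unfolding extends_def using part_Tw by blast
qed

lemma extends_0: "extends 0" unfolding extends_def
proof (intro exI conjI allI)
  show "jant 0 (\<lambda>_. 1)" by (simp add: jant_def lfT_const tdiv_0_iff lf_shap)
  show "(1 :: 'i tens) \<in> Tw 0" for s :: rat by simp
  show "(1 :: 'i tens) \<notin> serre_ideal" using const_serre_ideal[of "1 :: 'i tens"] by auto
qed

text \<open>A minimal pole order \<open>i > 0\<close> would produce non-zero layers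
  \<open>0, i, 2 i, ...\<close> without end. Hence a pole-free solution exists, and at
  \<open>s = 0\<close> its pairing with an element of the kernel is zero.\<close>

theorem theta_invariant: "f \<in> F0 (Kplus \<nu>0)"
proof (rule F0_I[OF f_Freg f_T])
  obtain i where i: "\<exists>d w. expansion i d w" "\<And>k. k < i ==> \<not> (\<exists>d w. expansion k d w)"
    using expansion_exists exists_least_iff[of "\<lambda>i. \<exists>d w. expansion i d w"] by blast
  then obtain d w where w: "expansion i d w" by blast
  have "i = 0"
  proof (rule ccontr)
    assume "i \<noteq> 0"
    then obtain k where k: "i = Suc k" by (cases i) auto
    have "\<not> (\<exists>w. expansion k d w)" using i(2)[of k] k by blast
    then obtain b0 a0 z0 where nz: "b0 \<in> active" "a0 < dim b0" "w b0 a0 0 z0 \<noteq> 0"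
      using expansion_step[of k d w] w k by blast
    have "\<exists>j\<ge>n. extends j" for n
    proof (induction n)
      case 0
      then show ?case using extends_0 by blast
    next
      case (Suc n)
      then obtain j where "n \<le> j" "extends j" by blast
      then show ?case using extends_step[OF w nz, of j] k by (intro exI[of _ "i + j"]) simp
    qed
    moreover obtain N where "\<And>j. extends j ==> j \<le> N" using extends_bounded by blast
    ultimately show False by (meson Suc_n_not_le_n order_trans)
  qed
  fix a x assume "a \<in> Kplus \<nu>0"
  then obtain y where y: "a = theta y" "y \<in> Uminus" "y \<in> rad \<nu>0" by (auto simp: Kplus_eq Kminus_rad)
  then obtain p where p: "y = evF p" by (auto simp: Uminus_eq)
  have "d 0 * f (x * theta (evF p)) = (\<Sum>b\<in>active. \<Sum>a<dim b. shap \<nu>0 (evF p) (Y b ! a) * w b a 0 x)"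
  proof -
    have "\<forall>s p z. tt s ^ i * d s * f (z * theta (evF p)) = (\<Sum>b\<in>active. \<Sum>a<dim b. shap (\<nu> s) (evF p) (Y b ! a) * w b a s z)"
      using w unfolding expansion_def by (elim conjE)
    from this[rule_format, of 0 x p] show ?thesis by (simp add: \<open>i = 0\<close>)
  qed
  also have "\<dots> = 0"
  proof (intro sum.neutral ballI)
    fix b a assume "b \<in> active" "a \<in> {..<dim b}"
    then obtain q where "Y b ! a = evF q" using basis_evF[of b a] by (auto simp: support_weights_def)
    moreover have "shap \<nu>0 (evF q) (evF p) = 0" using y(3) by (simp add: p rad_shap)
    ultimately show "shap \<nu>0 (evF p) (Y b ! a) * w b a 0 x = 0" by (simp add: shap_commute[of \<nu>0 "evF p"])
  qed
  finally show "f (x * a) = 0" using w by (simp add: expansion_def y(1) p)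
qed

end

section \<open>Evaluation of the limit\<close>

lemma mat_inverse_sum:
  fixes A :: "qfield mat"
  assumes A: "A \<in> carrier_mat n n" and "det A \<noteq> 0" "i < n" "k < n"
  shows "(\<Sum>j<n. A $$ (i, j) * the (mat_inverse A) $$ (j, k)) = (if i = k then 1 else 0)"
proof -
  have "A \<in> Units (ring_mat TYPE(qfield) n undefined)" using det_non_zero_imp_unit[OF A assms(2)] .
  then obtain B where "mat_inverse A = Some B" using mat_inverse(1)[OF A] by fastforce
  then have B: "A * B = 1\<^sub>m n" "B \<in> carrier_mat n n" "the (mat_inverse A) = B" using mat_inverse(2)[OF A] by auto
  have "(A * B) $$ (i, k) = (\<Sum>j<n. A $$ (i, j) * B $$ (j, k))"
    using assms(3,4) A B(2) by (auto simp: scalar_prod_def atLeast0LessThan carrier_matD intro!: sum.cong)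
  then show ?thesis using assms(3,4) by (simp add: B)
qed

text \<open>If \<open>C\<close> are the coordinates of a vector, its pairings with the basis
  contracted with the inverse Gram matrix give back \<open>C\<close>, here inside the linear
  functional with values \<open>L\<close>.\<close>

lemma fusion_coordinates:
  assumes "det (gram S ys) \<noteq> 0" "\<And>x y. S x y = S y x"
  shows "(\<Sum>i<length ys. \<Sum>j<length ys. the (mat_inverse (gram S ys)) $$ (i, j) *
    ((\<Sum>k<length ys. C k * S (ys ! i) (ys ! k)) * L j)) = (\<Sum>k<length ys. C k * L k)"
proof -
  let ?n = "length ys" and ?Q = "\<lambda>i j. the (mat_inverse (gram S ys)) $$ (i, j)"
  have G: "gram S ys \<in> carrier_mat ?n ?n" by (simp add: gram_def)
  have "(\<Sum>i<?n. \<Sum>j<?n. ?Q i j * ((\<Sum>k<?n. C k * S (ys ! i) (ys ! k)) * L j)) =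
      (\<Sum>i<?n. \<Sum>j<?n. \<Sum>k<?n. C k * L j * (gram S ys $$ (k, i) * ?Q i j))"
    unfolding sum_distrib_left sum_distrib_right
  proof (intro sum.cong refl)
    fix i j k assume "i \<in> {..<?n}" "j \<in> {..<?n}" "k \<in> {..<?n}"
    then have "gram S ys $$ (k, i) = S (ys ! i) (ys ! k)"
      using assms(2)[of "ys ! k" "ys ! i"] by (simp add: gram_def)
    then show "?Q i j * (C k * S (ys ! i) (ys ! k) * L j) = C k * L j * (gram S ys $$ (k, i) * ?Q i j)"
      by (simp only: ac_simps)
  qed
  also have "\<dots> = (\<Sum>j<?n. \<Sum>k<?n. \<Sum>i<?n. C k * L j * (gram S ys $$ (k, i) * ?Q i j))"
    by (subst sum.swap) (intro sum.cong refl sum.swap)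
  also have "\<dots> = (\<Sum>j<?n. \<Sum>k<?n. if k = j then C k * L j else 0)" unfolding sum_distrib_left[symmetric]
    by (intro sum.cong refl) (simp add: mat_inverse_sum[OF G assms(1)])
  finally show ?thesis by simp
qed

text \<open>A null vector of the Gram matrix would give a combination in \<open>rad l\<close>,
  contradicting independence in the irreducible module.\<close>

lemma reduced_gram_nonzero:
  assumes "reduced_family l Y" "b \<in> Qplus"
  shows "det (gram (shap l) (Y b)) \<noteq> 0"
proof
  let ?n = "length (Y b)" and ?G = "gram (shap l) (Y b)"
  note Y = reduced_familyD[OF assms]
  have G: "?G \<in> carrier_mat ?n ?n" by (simp add: gram_def)
  assume "det ?G = 0"
  then obtain v where v: "v \<in> carrier_vec ?n" "v \<noteq> 0\<^sub>v ?n" "?G *\<^sub>v v = 0\<^sub>v ?n"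
    using det_0_iff_vec_prod_zero[OF G] by blast
  define y where "y = (\<Sum>i<?n. uscale (v $ i) (Y b ! i))"
  have 0: "shap l (Y b ! j) y = 0" if "j < ?n" for j
  proof -
    have "(?G *\<^sub>v v) $ j = (\<Sum>i<?n. shap l (Y b ! j) (Y b ! i) * v $ i)"
      using that v(1) by (auto simp: gram_def scalar_prod_def atLeast0LessThan carrier_vecD intro!: sum.cong)
    then show ?thesis using that by (simp add: v(3) y_def shap_sum mult.commute)
  qed
  have "\<forall>i<?n. \<exists>p. p \<in> Tw b \<and> Y b ! i = evF p" using Y(1) nth_mem by blast
  then obtain p where p: "\<And>i. i < ?n ==> p i \<in> Tw b" "\<And>i. i < ?n ==> Y b ! i = evF (p i)" by metis
  define r where "r = (\<Sum>i<?n. psc (v $ i) (p i))"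
  have r: "y = evF r" by (simp add: r_def y_def ev_sum p)
  have rT: "r \<in> Tw b" unfolding r_def by (intro P.subspace_sum[OF subspace_Tw] Tw_closed) (simp add: p)
  have "shap l (evF x) y = 0" for x
  proof -
    obtain c where c: "evF (part b x) - (\<Sum>i<?n. uscale (c i) (Y b ! i)) \<in> rad l" using Y(2)[OF part_Tw] by blast
    have "shap l (evF (part b x) - (\<Sum>i<?n. uscale (c i) (Y b ! i))) y = 0"
      using c unfolding r by (subst shap_commute) (simp add: rad_shap)
    then have "shap l (evF (part b x)) y = 0" by (simp add: shap_left_sum 0)
    then show ?thesis unfolding r using shap_part'[of l x b r] part_of_Tw[OF rT, of b] by simp
  qed
  then have "y \<in> rad l" by (simp add: rad_shap)
  then have "v $ k = 0" if "k < ?n" for k using Y(3)[of "\<lambda>i. v $ i" k] that by (simp add: y_def)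
  then show False using v(1,2) by (auto simp: vec_eq_iff)
qed

lemma Freg_module: "Uminus_module fscale Freg (left_reg :: 'i::cartan_datum uq => _)" unfolding Uminus_module_def
proof (intro conjI ballI allI)
  show "FS.subspace Freg" by (rule subspace_Freg)
  fix m :: "'i uq => qfield" and a assume m: "m \<in> Freg"
  note lin = Freg_lin[OF m]
  show "left_reg a m \<in> Freg" using m by (rule Freg_left_reg)
  show "left_reg 1 m = m" by (simp add: left_reg_def)
  show "left_reg a (m + m') = left_reg a m + left_reg a m'" for m'
    by (simp add: left_reg_def fun_eq_iff plus_fun_apply)
  show "left_reg (a + b) m = left_reg a m + left_reg b m" for b
    by (simp add: left_reg_def fun_eq_iff plus_fun_apply distrib_left lin_add[OF lin])
  show "left_reg (a * b) m = left_reg a (left_reg b m)" for b by (simp add: left_reg_def mult.assoc)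
  show "left_reg (uscale c a) m = fscale c (left_reg a m)" "left_reg a (fscale c m) = fscale c (left_reg a m)" for c
    by (simp_all add: left_reg_def pscale_def uscale_mult_right lin_scale[OF lin])
qed

text \<open>The arguments are exchanged: in \<open>M_tensor_F\<close> the outer argument belongs to
  the second tensor factor.\<close>

lemma M_tensor_F_uncurry:
  assumes "w \<in> M_tensor_F fscale Freg"
  shows "(\<lambda>(x', x). w x x') \<in> F_tensor_F" using assms unfolding M_tensor_F_def
proof (induction w rule: FFS.span_induct_alt)
  case base
  have 0: "(\<lambda>(x', x). (0 :: 'b uq => 'a uq => qfield) x x') = 0" by (simp add: fun_eq_iff zero_fun_apply)
  show ?case unfolding F_tensor_F_def 0 by (rule FS.span_zero)
next
  case (step c h w)
  then obtain m g where h: "h = tensorM fscale m g" "m \<in> Freg" "g \<in> Freg" by blast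
  have "(\<lambda>(x', x). (pscale fscale c h + w) x x') = fscale c (tensorF m g) + (\<lambda>(x', x). w x x')"
    by (simp add: h(1) tensorM_def tensorF_def pscale_def fun_eq_iff plus_fun_apply mult.commute)
  moreover have "tensorF m g \<in> FS.span {tensorF f g | f g. f \<in> Freg \<and> g \<in> Freg}"
    using h by (intro FS.span_base) blast
  ultimately show ?case using step.IH unfolding F_tensor_F_def by (simp only: FS.span_add FS.span_scale)
qed

theorem proposition18:
  fixes \<nu>0 :: "'i::cartan_datum \<Rightarrow> rat"
    and Y Y0 :: "('i \<Rightarrow> rat) \<Rightarrow> 'i uq list"
    and f g :: "'i uq \<Rightarrow> qfield"
  assumes "basis_family Y"
    and "reduced_family \<nu>0 Y0"
    and "J_regular Y \<nu>0"
    and "f \<in> F0 (Kminus \<nu>0)" and "g \<in> F0 (Kminus \<nu>0)"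
  shows "tends_to fscale F_tensor_F (\<lambda>\<nu>. J_FF Y \<nu> f g) \<nu>0 (Jred_FF Y0 \<nu>0 f g)"
proof -
  obtain \<eta> s0 where "line \<nu>0 \<eta> s0 Y" using line_exists[OF assms(1)] by blast
  then interpret line \<nu>0 \<eta> s0 Y .
  interpret line_regular \<nu>0 \<eta> s0 Y g by unfold_locales (rule assms(3), rule assms(5))
  have g: "g \<in> F0 (Kplus \<nu>0)" by (rule theta_invariant)
  have fF: "f \<in> Freg" by (rule F0_D) (rule assms(4))
  let ?A = "support_weights g"
  have A: "finite ?A" "?A \<subseteq> Qplus" by (rule support_weights[OF f_Freg])+
  \<comment> \<open>Since \<open>g\<close> is also invariant under \<open>Kplus \<nu>0\<close>,
    regularity applies to \<open>Freg\<close> itself as a module. It provides the rational function,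
    so that only its value at \<open>\<nu>0\<close> remains to be found.\<close>
  have "regular_at (pscale fscale) (M_tensor_F fscale Freg) (\<lambda>\<nu>. J_M fscale left_reg Y \<nu> f g) \<nu>0"
    using assms(3) Freg_module fF g unfolding J_regular_def by blast
  then obtain n c v D where D: "D \<in> Uzero" "qchar \<nu>0 D \<noteq> 0"
    and cv: "\<And>k. k < n ==> c k \<in> Uzero \<and> v k \<in> M_tensor_F fscale Freg"
    and eq: "\<And>\<mu>. generic \<mu> ==> pscale fscale (qchar \<mu> D) (J_M fscale left_reg Y \<mu> f g) =
      (\<Sum>k<(n::nat). pscale fscale (qchar \<mu> (c k)) (v k))" unfolding regular_at_def tends_to_def by blast
  define V where "V k = (\<lambda>(x', x). v k x x')" for k
  have Y: "\<forall>\<beta>\<in>Qplus. set (Y \<beta>) \<subseteq> evF ` Tw \<beta>" "\<forall>\<beta>\<in>Qplus. set (Y0 \<beta>) \<subseteq> evF ` Tw \<beta>"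
    using basis_familyD(1)[OF assms(1)] reduced_familyD(1)[OF assms(2)] by blast+
  have J_FF: "J_FF Y \<mu> f g (x', x) = (\<Sum>\<beta>\<in>?A. \<Sum>i<dim \<beta>. \<Sum>j<dim \<beta>.
      the (mat_inverse (gram (shapovalov \<mu>) (Y \<beta>))) $$ (i, j) * (f (x' * Y \<beta> ! i) * g (x * theta (Y \<beta> ! j))))" for \<mu> x x'
    unfolding J_FF_def by (rule fusion_support(1)[OF f_Freg Y(1)])
  have J: "J_FF Y \<mu> f g (x', x) = J_M fscale left_reg Y \<mu> f g x x'" for \<mu> x x'
    unfolding J_FF J_M_def fusion_support(2)[OF f_Freg Y(1)] sum_fun_apply
    by (intro sum.cong refl) (simp add: pscale_def left_reg_def)
  have eqV: "qchar \<mu> D * J_FF Y \<mu> f g (x', x) = (\<Sum>k<n. qchar \<mu> (c k) * V k (x', x))" if "generic \<mu>" for \<mu> x x'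
    using fun_cong[OF fun_cong[OF eq[OF that], of x], of x'] by (simp add: J V_def sum_fun_apply pscale_def)
  obtain D1 where D1: "lf D1" "D1 0 \<noteq> 0"
    "\<forall>z. \<exists>M. lfT M \<and> (\<forall>p s. shap (\<nu> s) (evF p) (evF (M s)) = D1 s * f (z * evF p))"
    using regular_solution[OF assms(3,4)] by blast
  have limit: "qchar \<nu>0 D * Jred_FF Y0 \<nu>0 f g (x', x) = (\<Sum>k<n. qchar \<nu>0 (c k) * V k (x', x))" for x x'
  proof -
    obtain M where M: "lfT M" "\<And>p s. shap (\<nu> s) (evF p) (evF (M s)) = D1 s * f (x' * evF p)" using D1(3) by blast
    let ?L = "\<lambda>y. g (x * theta y)"
    note L = f_lin_theta[of x]
    \<comment> \<open>By the choice of \<open>M\<close>, the first factors \<open>f (x' * _)\<close>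
      times \<open>D1 s\<close> are pairings with \<open>M s\<close>. Contracting them with the
      inverse Gram matrix leaves \<open>?L\<close> evaluated at \<open>M s\<close>.\<close>
    have generic: "D1 s * J_FF Y (\<nu> s) f g (x', x) = ?L (evF (M s))" if s: "s \<le> s0" for s
    proof -
      let ?Q = "\<lambda>\<beta> i j. the (mat_inverse (gm \<beta> s)) $$ (i, j)"
      have "D1 s * J_FF Y (\<nu> s) f g (x', x) =
          (\<Sum>\<beta>\<in>?A. \<Sum>i<dim \<beta>. \<Sum>j<dim \<beta>. ?Q \<beta> i j * (shap (\<nu> s) (evF (part \<beta> (M s))) (Y \<beta> ! i) * ?L (Y \<beta> ! j)))"
        unfolding J_FF gram_shapovalov sum_distrib_left
      proof (intro sum.cong refl)
        fix \<beta> i j assume "\<beta> \<in> ?A" "i \<in> {..<dim \<beta>}"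
        then obtain p where p: "p \<in> Tw \<beta>" "Y \<beta> ! i = evF p" using basis_evF[of \<beta> i] A(2) by auto
        have "shap (\<nu> s) (evF p) (evF (M s)) = shap (\<nu> s) (evF (part \<beta> (M s))) (evF p)"
          using shap_part[of "\<nu> s" \<beta> p "M s"] part_of_Tw[OF p(1), of \<beta>] by (subst (2) shap_commute) simp
        then have 1: "D1 s * f (x' * Y \<beta> ! i) = shap (\<nu> s) (evF (part \<beta> (M s))) (Y \<beta> ! i)"
          by (simp only: M(2) p(2))
        have "D1 s * (?Q \<beta> i j * (f (x' * Y \<beta> ! i) * ?L (Y \<beta> ! j))) = ?Q \<beta> i j * (D1 s * f (x' * Y \<beta> ! i) * ?L (Y \<beta> ! j))"
          by (simp only: ac_simps)
        then show "D1 s * (?Q \<beta> i j * (f (x' * Y \<beta> ! i) * ?L (Y \<beta> ! j))) =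
            ?Q \<beta> i j * (shap (\<nu> s) (evF (part \<beta> (M s))) (Y \<beta> ! i) * ?L (Y \<beta> ! j))" by (simp only: 1)
      qed
      also have "\<dots> = (\<Sum>\<beta>\<in>?A. ?L (evF (part \<beta> (M s))))"
        using A(2) by (intro sum.cong refl fusion_solve[OF s _ part_Tw L]) auto
      also have "\<dots> = ?L (evF (M s))" by (rule sum_active[OF L A(1) inactive])
      finally show ?thesis .
    qed
    \<comment> \<open>The sum over \<open>V k\<close> stands for \<open>J\<close> with cleared
      denominators, so the identity can be carried from the generic ray to
      \<open>s = 0\<close>.\<close>
    have "D1 s * (\<Sum>k<n. qchar (\<nu> s) (c k) * V k (x', x)) = qchar (\<nu> s) D * ?L (evF (M s))" for s
    proof (rule lf_eqI[of _ _ s0])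
      show "lf (\<lambda>s. D1 s * (\<Sum>k<n. qchar (\<nu> s) (c k) * V k (x', x)))"
        using cv by (intro lf_mult D1(1) lf_sum lf_qchar lf_const) auto
      show "lf (\<lambda>s. qchar (\<nu> s) D * ?L (evF (M s)))"
        by (rule lf_mult[OF lf_qchar[OF D(1)] lfT_lf[OF M(1), where \<phi> = "\<lambda>s p. ?L (evF p)", OF lin_comp[OF lin_ev L] lf_const]])
      fix s assume s: "s \<le> s0"
      have "generic (\<nu> s)" using generic_line[OF s] by (simp add: \<nu>_def)
      then have "D1 s * (\<Sum>k<n. qchar (\<nu> s) (c k) * V k (x', x)) = D1 s * (qchar (\<nu> s) D * J_FF Y (\<nu> s) f g (x', x))"
        by (simp only: eqV)
      also have "\<dots> = qchar (\<nu> s) D * (D1 s * J_FF Y (\<nu> s) f g (x', x))" by (simp only: ac_simps)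
      finally show "D1 s * (\<Sum>k<n. qchar (\<nu> s) (c k) * V k (x', x)) = qchar (\<nu> s) D * ?L (evF (M s))"
        by (simp only: generic[OF s])
    qed
    from this[of 0] have at0: "D1 0 * (\<Sum>k<n. qchar \<nu>0 (c k) * V k (x', x)) = qchar \<nu>0 D * ?L (evF (M 0))" by simp
    have "D1 0 * Jred_FF Y0 \<nu>0 f g (x', x) = ?L (evF (M 0))"
    proof -
      let ?S = "\<lambda>x y. shapovalov_bar \<nu>0 (mact (irr \<nu>0) x (irr_vec \<nu>0)) (mact (irr \<nu>0) y (irr_vec \<nu>0))"
      let ?n = "\<lambda>\<beta>. length (Y0 \<beta>)"
      let ?Q = "\<lambda>\<beta> i j. the (mat_inverse (gram (shap \<nu>0) (Y0 \<beta>))) $$ (i, j)"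
      have Y0: "\<exists>p\<in>Tw \<beta>. Y0 \<beta> ! i = evF p" if "\<beta> \<in> ?A" "i < ?n \<beta>" for \<beta> i
        using reduced_familyD(1)[OF assms(2), of \<beta>] nth_mem[OF that(2)] A(2) that(1) by blast
      have gram: "gram ?S (Y0 \<beta>) = gram (shap \<nu>0) (Y0 \<beta>)" if \<beta>: "\<beta> \<in> ?A" for \<beta>
      proof -
        have "Y0 \<beta> ! i \<in> Uminus" if "i < ?n \<beta>" for i using Y0[OF \<beta> that] by auto
        then show ?thesis unfolding gram_def irr_act_vec by (intro eq_matI) (simp_all add: shapovalov_bar_cl)
      qed
      have "Jred_FF Y0 \<nu>0 f g (x', x) = (\<Sum>\<beta>\<in>?A. \<Sum>i<?n \<beta>. \<Sum>j<?n \<beta>.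
          the (mat_inverse (gram ?S (Y0 \<beta>))) $$ (i, j) * (f (x' * Y0 \<beta> ! i) * ?L (Y0 \<beta> ! j)))"
        unfolding Jred_FF_def by (rule fusion_support(1)[OF f_Freg Y(2)])
      also have "\<dots> = (\<Sum>\<beta>\<in>?A. \<Sum>i<?n \<beta>. \<Sum>j<?n \<beta>. ?Q \<beta> i j * (f (x' * Y0 \<beta> ! i) * ?L (Y0 \<beta> ! j)))"
        by (intro sum.cong refl) (simp only: gram)
      finally have "D1 0 * Jred_FF Y0 \<nu>0 f g (x', x) =
          (\<Sum>\<beta>\<in>?A. \<Sum>i<?n \<beta>. \<Sum>j<?n \<beta>. ?Q \<beta> i j * (D1 0 * f (x' * Y0 \<beta> ! i) * ?L (Y0 \<beta> ! j)))"
        by (simp only: sum_distrib_left ac_simps)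
      also have "\<dots> = (\<Sum>\<beta>\<in>?A. ?L (evF (part \<beta> (M 0))))"
      proof (intro sum.cong refl)
        fix \<beta> assume \<beta>: "\<beta> \<in> ?A"
        then have Q: "\<beta> \<in> Qplus" using A by blast
        \<comment> \<open>Coordinates of the image of \<open>M 0\<close> in the irreducible module;
          they determine this component of \<open>M 0\<close> only modulo
          \<open>rad \<nu>0\<close>.\<close>
        obtain C where C: "evF (part \<beta> (M 0)) - (\<Sum>k<?n \<beta>. uscale (C k) (Y0 \<beta> ! k)) \<in> rad \<nu>0"
          using reduced_familyD(2)[OF assms(2) Q part_Tw] by blast
        have fS: "D1 0 * f (x' * Y0 \<beta> ! i) = (\<Sum>k<?n \<beta>. C k * shap \<nu>0 (Y0 \<beta> ! i) (Y0 \<beta> ! k))" if "i < ?n \<beta>" for i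
        proof -
          obtain p where p: "p \<in> Tw \<beta>" "Y0 \<beta> ! i = evF p" using Y0[OF \<beta> \<open>i < ?n \<beta>\<close>] by blast
          have "D1 0 * f (x' * evF p) = shap \<nu>0 (evF p) (evF (M 0))" using M(2)[of 0 p] by simp
          also have "\<dots> = shap \<nu>0 (evF p) (evF (part \<beta> (M 0)))"
            using shap_part[of \<nu>0 \<beta> p "M 0"] part_of_Tw[OF p(1), of \<beta>] by simp
          also have "\<dots> = shap \<nu>0 (evF p) (\<Sum>k<?n \<beta>. uscale (C k) (Y0 \<beta> ! k))" using C by (simp add: rad_shap)
          finally show ?thesis by (simp add: p(2) shap_sum)
        qed
        have "(\<Sum>i<?n \<beta>. \<Sum>j<?n \<beta>. ?Q \<beta> i j * (D1 0 * f (x' * Y0 \<beta> ! i) * ?L (Y0 \<beta> ! j))) = (\<Sum>k<?n \<beta>. C k * ?L (Y0 \<beta> ! k))"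
          using fusion_coordinates[OF reduced_gram_nonzero[OF assms(2) Q] shap_commute, of C "\<lambda>j. ?L (Y0 \<beta> ! j)"]
          by (simp add: fS)
        also have "\<dots> = ?L (\<Sum>k<?n \<beta>. uscale (C k) (Y0 \<beta> ! k))" by (simp only: lin_sum[OF L] lin_scale[OF L])
        \<comment> \<open>The two arguments differ by an element of the kernel, which
          \<open>?L\<close> cannot see because \<open>g\<close> is invariant under
          \<open>Kplus \<nu>0\<close>.\<close>
        also have "\<dots> = ?L (evF (part \<beta> (M 0)))"
        proof -
          have "Y0 \<beta> ! k \<in> Uminus" if "k < ?n \<beta>" for k using Y0[OF \<beta> that] by auto
          then have "(\<Sum>k<?n \<beta>. uscale (C k) (Y0 \<beta> ! k)) \<in> Uminus" using subalgebra_Uminus unfolding subalgebra_def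
            by (intro U.subspace_sum U.subspace_scale) auto
          then have "theta (evF (part \<beta> (M 0)) - (\<Sum>k<?n \<beta>. uscale (C k) (Y0 \<beta> ! k))) \<in> Kplus \<nu>0"
            unfolding Kplus_eq Kminus_rad using C by (intro imageI IntI subalgebraD(6)[OF subalgebra_Uminus]) simp_all
          from F0_D(3)[OF g this, of x] have "?L (evF (part \<beta> (M 0)) - (\<Sum>k<?n \<beta>. uscale (C k) (Y0 \<beta> ! k))) = 0" .
          then show ?thesis by (simp only: lin_diff[OF L] right_minus_eq)
        qed
        finally show "(\<Sum>i<?n \<beta>. \<Sum>j<?n \<beta>. ?Q \<beta> i j * (D1 0 * f (x' * Y0 \<beta> ! i) * ?L (Y0 \<beta> ! j))) = ?L (evF (part \<beta> (M 0)))" .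
      qed
      also have "\<dots> = ?L (evF (M 0))" by (rule sum_active[OF L A(1) inactive])
      finally show ?thesis .
    qed
    then have "qchar \<nu>0 D * (D1 0 * Jred_FF Y0 \<nu>0 f g (x', x)) = D1 0 * (\<Sum>k<n. qchar \<nu>0 (c k) * V k (x', x))"
      by (simp only: at0)
    then have "D1 0 * (qchar \<nu>0 D * Jred_FF Y0 \<nu>0 f g (x', x)) = D1 0 * (\<Sum>k<n. qchar \<nu>0 (c k) * V k (x', x))"
      by (simp only: mult.left_commute)
    then show ?thesis using D1(2) by (simp only: mult_cancel_left) simp
  qed
  show ?thesis unfolding tends_to_def
  proof (intro exI[of _ n] exI[of _ c] exI[of _ V] bexI[of _ D] conjI allI impI)
    fix k assume "k < n"
    note c = cv[OF this]
    show "c k \<in> Uzero" using c ..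
    show "V k \<in> F_tensor_F" unfolding V_def by (rule M_tensor_F_uncurry) (rule conjunct2[OF c])
  next
    fix \<mu> :: "'i => rat" assume "generic \<mu>"
    then show "fscale (qchar \<mu> D) (J_FF Y \<mu> f g) = (\<Sum>k<n. fscale (qchar \<mu> (c k)) (V k))"
      using eqV by (simp add: fun_eq_iff sum_fun_apply pscale_def)
  next
    show "fscale (qchar \<nu>0 D) (Jred_FF Y0 \<nu>0 f g) = (\<Sum>k<n. fscale (qchar \<nu>0 (c k)) (V k))"
      using limit by (simp add: fun_eq_iff sum_fun_apply pscale_def)
  qed (use D in auto)
qed

end
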